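(* Let $(H,\Delta_H)$ be a regular Hopf algebra with normalized integral $\phi_H$, let $C$ be a unital braided-commutative Yetter–Drinfeld algebra over $H$ with a faithful, normalized, $H$-invariant functional $\mu_C$, and let $(\mathcal A,\mu_B,\mu_C,{}_B\psi_B,{}_C\phi_C)$ be the associated measured regular multiplier Hopf algebroid on $A=C\#H$ described in the context, with total left integral $\phi=\mu_C\circ{}_C\phi_C$ and dual $\hat{\mathcal A}=(\hat A,C,B,t_B^{-1},t_C^{-1},\hat\Delta_C,\hat\Delta_B)$. Then: The algebra $\hat A$ is isomorphic to $B\#\hat H$ via $$(hy\cdot\phi)\mapsto t_C(y)\#(h\cdot\phi_H)\qquad(h\in H,\ y\in C).$$ With respect to this identification, the embeddings of $B$ and $C$ into $M(\hat A)$ are given by $$x(x'\#\upsilon)=xx'\#\upsilon,\qquad y(x\#\upsilon)=xt_C(y_{\langle0\rangle})\#y_{\langle1\rangle}\upsilon$$ for $x,x'\in B$, $y\in C$, $\upsilon\in\hat H$. The map $\hat H\to\hat A\cong B\#\hat H$ given by $\upsilon\mapsto\tilde\upsilon:=1\#\upsilon$ is a morphism of multiplier Hopf algebroids. The counit functional $\hat\varepsilon$ and the dual right integral $\hat\psi$ of $\hat{\mathcal A}$ are given by $$\hat\varepsilon(t_C(z)\#\upsilon)=\mu_C(z)\varepsilon_{\hat H}(\upsilon),\qquad\hat\psi(t_C(z)\#\upsilon)=\mu_C(z)\psi_{\hat H}(\upsilon)$$ for $z\in C$, $\upsilon\in\hat H$.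
   Context: The algebra data. $(H,\Delta_H)$ is a regular Hopf algebra over $\mathbb C$ (bijective antipode $S_H$), with counit $\varepsilon_H$ and a (left and right) integral $\phi_H\colon H\to\mathbb C$ with $\phi_H(1_H)=1$. $C$ is a unital left $H$-module algebra ($(h,y)\mapsto h\triangleright y$) and right $H^{\mathrm{op}}$-comodule algebra ($y\mapsto y_{(0)}\otimes y_{(1)}$) with $(h_{(2)}\triangleright y)_{(0)}\otimes(h_{(2)}\triangleright y)_{(1)}h_{(1)}=h_{(1)}\triangleright y_{(0)}\otimes h_{(2)}y_{(1)}$ and $yy'=y'_{(0)}(y'_{(1)}\triangleright y)=(S_H(y_{(1)})\triangleright y')y_{(0)}$. $\mu_C$ is a functional on $C$ that is faithful ($\mu_C(dC)\ne0\neq\mu_C(Cd)$ for $d\neq0$), normalized ($\mu_C(1_C)=1$) and invariant: $\mu_C(y_{(0)})y_{(1)}=\mu_C(y)1_H$, $\mu_C(h\triangleright y)=\varepsilon_H(h)\mu_C(y)$. $A=C\#H$ is $C\otimes H$ with product $(y\otimes h)(y'\otimes h')=y(h_{(1)}\triangleright y')\otimes h_{(2)}h'$; $C$ and $H$ are identified with subalgebras of $A$. The multiplier Hopf algebroid. $B=\{y_{(0)}\#y_{(1)}:y\in C\}\subseteq A$, $t_C\colon C\to B$, $t_C(y)=y_{(0)}\#y_{(1)}$, $t_B\colon B\to C$, $t_B(y_{(0)}\#y_{(1)})=S_H^{-1}(y_{(1)})\triangleright y_{(0)}$ (anti-isomorphisms; $B$ and $C$ commute). ${}_BA,A_B,{}_CA,A_C$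 denote $A$ with left/right multiplication; $A^C$: $a\cdot y=t_C(y)a$; ${}^BA$: $x\cdot a=at_B(x)$. Comultiplications: $\Delta_C(yh)(a\otimes a')=yh_{(1)}a\otimes h_{(2)}a'$ in $A^C\otimes{}_CA$ (left), $(a\otimes a')\Delta_B(hy)=ah_{(1)}y\otimes a'h_{(2)}$ in $A_B\otimes{}^BA$ (right). Further $\mu_B(t_C(y))=\mu_C(y)$, partial left integral ${}_C\phi_C(yh)=y\phi_H(h)$, partial right integral ${}_B\psi_B(hx)=\phi_H(h)x$, left counit ${}_C\varepsilon(yh)=y\varepsilon_H(h)$, right counit $\varepsilon_B(hx)=\varepsilon_H(h)x$, antipode $S(yh)=S_H(h)S_H^2(y_{(1)})y_{(0)}$. This is a measured regular multiplier Hopf algebroid. Put $\phi=\mu_C\circ{}_C\phi_C$, $\psi=\mu_B\circ{}_B\psi_B$. The dual. Write $(a\cdot\omega)(b)=\omega(ba)$, $(\omega\cdot a)(b)=\omega(ab)$. $\hat A:=A\cdot\phi=\phi\cdot A=A\cdot\psi=\psi\cdot A\subseteq A^\vee$ (linear dual). For $\omega\in\hat A$ there are unique module maps ${}_B\omega\colon{}_BA\to{}_BB$, $\omega_B\colon A_B\to B_B$, ${}_C\omega\colon{}_CA\to{}_CC$, $\omega_C\colon A_C\to C_C$ whose composition with $\mu_B$, respectively $\mu_C$, is $\omega$. For $a\in A$, $\omega\in\hat A$ put $\omega\triangleright a=(\iota\odot{}_C\omega)(\Delta_C(a)(1\otimes 1))$ and $a\triangleleft\omega=(\omega_B\odot\iota)((1\otimes1)\Delta_B(a))$,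 where $(\iota\odot{}_C\omega)(a\otimes b)=t_C({}_C\omega(b))a$, $(\omega_B\odot\iota)(a\otimes b)=bt_B(\omega_B(a))$. The product on $\hat A$ is $\upsilon\omega=\upsilon(\omega\triangleright-)=\omega(-\triangleleft\upsilon)$; it is non-degenerate. $B$ and $C$ embed into the multiplier algebra $M(\hat A)$ by $(x\upsilon)(a)=\upsilon(t_B(x)a)$, $(\upsilon x)(a)=\upsilon(xa)$, $(y\upsilon)(a)=\upsilon(ay)$, $(\upsilon y)(a)=\upsilon(at_C(y))$. With $\hat A^B$: $\omega\cdot x=t_C^{-1}(x)\omega$, and ${}^C\hat A$: $y\cdot\omega=\omega t_B^{-1}(y)$, the left comultiplication $\hat\Delta_B$ and right comultiplication $\hat\Delta_C$ are determined by elements $\hat\Delta_B(\upsilon)(1\otimes\omega)\in\hat A^B\otimes{}_B\hat A$ and $(\upsilon\otimes1)\hat\Delta_C(\omega)\in\hat A_C\otimes{}^C\hat A$ with $(\hat\Delta_B(\upsilon)(1\otimes\omega)\mid a\otimes b)=\upsilon(a(\omega\triangleright b))$, $((\upsilon\otimes1)\hat\Delta_C(\omega)\mid a\otimes b)=\omega((a\triangleleft\upsilon)b)$, where $(\upsilon\otimes\omega\mid a\otimes b)=\upsilon(a\,{}_C\omega(b))$ on $(\hat A^B\otimes{}_B\hat A)\times(A_C\otimes{}_CA)$ and $(\upsilon\otimes\omega\mid a\otimes b)=\upsilon(a\,{}_B\omega(b))$ on $(\hat A_C\otimes{}^C\hat A)\times(A_B\otimes{}_BA)$ (non-degenerate pairings).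 $\hat{\mathcal A}=(\hat A,C,B,t_B^{-1},t_C^{-1},\hat\Delta_C,\hat\Delta_B)$ is a regular multiplier Hopf algebroid. Its counit functional $\hat\varepsilon$ (composition of the left counit with $\mu_B$, equivalently of the right counit with $\mu_C$) is evaluation at $1_A$, and its dual (total) right integral is $\hat\psi(a\cdot\phi)=\mu_C({}_C\varepsilon(a))$. $\hat H$. $\hat H=H\cdot\phi_H\subseteq H^\vee$ is the dual multiplier Hopf algebra of $H$: product $(\upsilon\omega)(h)=\upsilon(h_{(1)})\omega(h_{(2)})$, comultiplication $\Delta_{\hat H}$ dual to the multiplication of $H$, counit $\varepsilon_{\hat H}(\upsilon)=\upsilon(1_H)$, right integral $\psi_{\hat H}(h\cdot\phi_H)=\varepsilon_H(h)$. $B$ is a left $\hat H$-module algebra via $\upsilon\triangleright t_C(y)=t_C(y_{(0)})\upsilon(y_{(1)})$, and $B\#\hat H$ is $B\otimes\hat H$ with product $(x\#\upsilon)(x'\#\upsilon')=x(\upsilon_{(1)}\triangleright x')\#\upsilon_{(2)}\upsilon'$. The coaction $C\to M(C\otimes\hat H)$, $y\mapsto y_{\langle0\rangle}\otimes y_{\langle1\rangle}$, is determined by $h\triangleright y=y_{\langle1\rangle}(h)y_{\langle0\rangle}$ for all $h\in H$; thus $y_{\langle0\rangle}\otimes y_{\langle1\rangle}\upsilon\in C\otimes\hat H$ evaluates at $h$ to $(h_{(1)}\triangleright y)\upsilon(h_{(2)})$. Morphism. $\hat H$ is regarded as a regular multiplier Hopf algebroid with base algebras $\mathbb C$ and both comultiplications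 equal to $\Delta_{\hat H}$. That $\pi\colon\hat H\to M(\hat A)$ is a morphism from $\hat H$ to $\hat{\mathcal A}$ means: $\pi$ is a homomorphism with $\pi(\hat H)\hat A=\hat A=\hat A\pi(\hat H)$ and, for all $d,d',d''\in\hat H$, $\alpha,\beta\in\hat A$, $\hat\Delta_B(\pi(d))(\pi(d')\alpha\otimes\pi(d'')\beta)=(\pi\otimes\pi)(\Delta_{\hat H}(d)(d'\otimes d''))(\alpha\otimes\beta)$ in $\hat A^B\otimes{}_B\hat A$ and $(\alpha\pi(d')\otimes\beta\pi(d''))\hat\Delta_C(\pi(d))=(\alpha\otimes\beta)(\pi\otimes\pi)((d'\otimes d'')\Delta_{\hat H}(d))$ in $\hat A_C\otimes{}^C\hat A$, where $\hat\Delta_B,\hat\Delta_C$ are extended to $M(\hat A)$. *)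

theory Defs
  imports Complex_Main "HOL-Library.Poly_Mapping" "HOL-Library.FuncSet"
begin

section \<open>Complex vector spaces and unital complex algebras\<close>

class complex_vector = ab_group_add +
  fixes scaleC :: "complex \<Rightarrow> 'a \<Rightarrow> 'a"  (infixr \<open>*\<^sub>C\<close> 75)
  assumes scaleC_add_right: "c *\<^sub>C (x + y) = c *\<^sub>C x + c *\<^sub>C y"
    and scaleC_add_left: "(c + d) *\<^sub>C x = c *\<^sub>C x + d *\<^sub>C x"
    and scaleC_scaleC: "c *\<^sub>C d *\<^sub>C x = (c * d) *\<^sub>C x"
    and scaleC_one: "1 *\<^sub>C x = x"

global_interpretation complex_vector: vector_space "scaleC :: complex \<Rightarrow> 'a \<Rightarrow> 'a::complex_vector"
  by unfold_locales (simp_all add: scaleC_add_right scaleC_add_left scaleC_scaleC scaleC_one)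

class complex_algebra_1 = complex_vector + ring_1 +
  assumes mult_scaleC_left: "(c *\<^sub>C x) * y = c *\<^sub>C (x * y)"
    and mult_scaleC_right: "x * (c *\<^sub>C y) = c *\<^sub>C (x * y)"

instantiation complex :: complex_algebra_1
begin
definition scaleC_complex :: "complex \<Rightarrow> complex \<Rightarrow> complex" where
  "scaleC_complex c x = c * x"
instance by standard (simp_all add: scaleC_complex_def algebra_simps)
end

abbreviation clinear :: "('a::complex_vector \<Rightarrow> 'b::complex_vector) \<Rightarrow> bool" where
  "clinear \<equiv> Vector_Spaces.linear scaleC scaleC"

abbreviation cspan :: "'a::complex_vector set \<Rightarrow> 'a set" where
  "cspan \<equiv> complex_vector.span"

definition cbilinear :: "('a::complex_vector \<Rightarrow> 'b::complex_vector \<Rightarrow> 'v::complex_vector) \<Rightarrow> bool" where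
  "cbilinear f \<longleftrightarrow> (\<forall>a. clinear (f a)) \<and> (\<forall>b. clinear (\<lambda>a. f a b))"

definition clinear_on :: "'a::complex_vector set \<Rightarrow> ('a \<Rightarrow> 'b::complex_vector) \<Rightarrow> bool" where
  "clinear_on V f \<longleftrightarrow> (\<forall>u\<in>V. \<forall>v\<in>V. f (u + v) = f u + f v) \<and> (\<forall>c. \<forall>v\<in>V. f (c *\<^sub>C v) = c *\<^sub>C f v)"

lemma clinearI:
  assumes "\<And>x y. f (x + y) = f x + f y" "\<And>c x. f (c *\<^sub>C x) = c *\<^sub>C f x"
  shows "clinear f"
  by unfold_locales (simp_all add: assms)

lemma clinear_add: "clinear f \<Longrightarrow> f (x + y) = f x + f y"
  by (simp add: Vector_Spaces.linear_iff)

lemma clinear_scaleC: "clinear f \<Longrightarrow> f (c *\<^sub>C x) = c *\<^sub>C f x"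
  by (simp add: Vector_Spaces.linear_iff)


subsection \<open>The linear dual\<close>

typedef (overloaded) 'a dual = "{f :: 'a::complex_vector \<Rightarrow> complex. clinear f}"
  morphisms dapp Dual
  by (rule exI[of _ "\<lambda>_. 0"]) (auto intro!: clinearI simp: scaleC_complex_def)

setup_lifting type_definition_dual

instantiation dual :: (complex_vector) complex_vector
begin
lift_definition zero_dual :: "'a dual" is "\<lambda>_. 0"
  by (auto intro!: clinearI simp: scaleC_complex_def)
lift_definition plus_dual :: "'a dual \<Rightarrow> 'a dual \<Rightarrow> 'a dual" is "\<lambda>f g x. f x + g x"
  by (auto intro!: clinearI simp: clinear_add clinear_scaleC scaleC_complex_def algebra_simps)
lift_definition uminus_dual :: "'a dual \<Rightarrow> 'a dual" is "\<lambda>f x. - f x"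
  by (auto intro!: clinearI simp: clinear_add clinear_scaleC scaleC_complex_def algebra_simps)
lift_definition minus_dual :: "'a dual \<Rightarrow> 'a dual \<Rightarrow> 'a dual" is "\<lambda>f g x. f x - g x"
  by (auto intro!: clinearI simp: clinear_add clinear_scaleC scaleC_complex_def algebra_simps)
lift_definition scaleC_dual :: "complex \<Rightarrow> 'a dual \<Rightarrow> 'a dual" is "\<lambda>c f x. c * f x"
  by (auto intro!: clinearI simp: clinear_add clinear_scaleC scaleC_complex_def algebra_simps)
instance
  by standard (transfer; simp add: fun_eq_iff algebra_simps)+
end


subsection \<open>The algebraic tensor product\<close>

instantiation poly_mapping :: (type, complex_vector) complex_vector
begin
lift_definition scaleC_poly_mapping :: "complex \<Rightarrow> ('a \<Rightarrow>\<^sub>0 'b) \<Rightarrow> ('a \<Rightarrow>\<^sub>0 'b)" is "\<lambda>c p k. c *\<^sub>C p k"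
  by (rule finite_subset) auto
instance
  by standard (transfer; simp add: fun_eq_iff scaleC_add_right scaleC_add_left scaleC_scaleC scaleC_one)+
end

inductive_set bilinear_relations :: "(('a::complex_vector \<times> 'b::complex_vector) \<Rightarrow>\<^sub>0 complex) set" where
  "Poly_Mapping.single (a + a', b) 1 - Poly_Mapping.single (a, b) 1 - Poly_Mapping.single (a', b) 1
     \<in> bilinear_relations"
| "Poly_Mapping.single (a, b + b') 1 - Poly_Mapping.single (a, b) 1 - Poly_Mapping.single (a, b') 1
     \<in> bilinear_relations"
| "Poly_Mapping.single (c *\<^sub>C a, b) 1 - c *\<^sub>C Poly_Mapping.single (a, b) 1 \<in> bilinear_relations"
| "Poly_Mapping.single (a, c *\<^sub>C b) 1 - c *\<^sub>C Poly_Mapping.single (a, b) 1 \<in> bilinear_relations"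

definition tensor_rel ::
    "(('a::complex_vector \<times> 'b::complex_vector) \<Rightarrow>\<^sub>0 complex) \<Rightarrow> (('a \<times> 'b) \<Rightarrow>\<^sub>0 complex) \<Rightarrow> bool" where
  "tensor_rel p q \<longleftrightarrow> p - q \<in> cspan bilinear_relations"

quotient_type (overloaded) ('a, 'b) tensor =
    "('a::complex_vector \<times> 'b::complex_vector) \<Rightarrow>\<^sub>0 complex" / tensor_rel
proof (rule equivpI)
  show "reflp tensor_rel"
    by (rule reflpI) (simp add: tensor_rel_def complex_vector.span_zero)
  show "symp tensor_rel"
    by (rule sympI) (metis tensor_rel_def complex_vector.span_neg minus_diff_eq)
  show "transp tensor_rel"
  proof (rule transpI)
    fix x y z
    assume "tensor_rel x y" "tensor_rel y z"
    then show "tensor_rel x z"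
      unfolding tensor_rel_def using complex_vector.span_add[of "x - y" _ "y - z"] by simp
  qed
qed

instantiation tensor :: (complex_vector, complex_vector) complex_vector
begin
lift_definition zero_tensor :: "('a, 'b) tensor" is 0 .
lift_definition plus_tensor :: "('a, 'b) tensor \<Rightarrow> ('a, 'b) tensor \<Rightarrow> ('a, 'b) tensor" is "(+)"
  unfolding tensor_rel_def by (simp only: add_diff_add complex_vector.span_add)
lift_definition uminus_tensor :: "('a, 'b) tensor \<Rightarrow> ('a, 'b) tensor" is uminus
  unfolding tensor_rel_def by (simp only: minus_diff_minus complex_vector.span_neg)
lift_definition minus_tensor :: "('a, 'b) tensor \<Rightarrow> ('a, 'b) tensor \<Rightarrow> ('a, 'b) tensor" is "(-)"
proof -
  fix p p' q q' :: "('a \<times> 'b) \<Rightarrow>\<^sub>0 complex"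
  assume "tensor_rel p p'" "tensor_rel q q'"
  moreover have "p - q - (p' - q') = (p - p') - (q - q')"
    by (simp add: algebra_simps)
  ultimately show "tensor_rel (p - q) (p' - q')"
    unfolding tensor_rel_def by (simp only: complex_vector.span_diff)
qed
lift_definition scaleC_tensor :: "complex \<Rightarrow> ('a, 'b) tensor \<Rightarrow> ('a, 'b) tensor" is scaleC
  unfolding tensor_rel_def
  by (simp only: complex_vector.scale_right_diff_distrib[symmetric] complex_vector.span_scale)
instance
proof
  fix x y z :: "('a, 'b) tensor" and c d :: complex
  have refl: "tensor_rel p q" if "p = q" for p q :: "('a \<times> 'b) \<Rightarrow>\<^sub>0 complex"
    using that by (simp add: tensor_rel_def complex_vector.span_zero)
  show "x + y + z = x + (y + z)" by transfer (rule refl, simp add: algebra_simps)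
  show "x + y = y + x" by transfer (rule refl, simp add: algebra_simps)
  show "0 + x = x" by transfer (rule refl, simp)
  show "- x + x = 0" by transfer (rule refl, simp)
  show "x - y = x + - y" by transfer (rule refl, simp)
  show "c *\<^sub>C (x + y) = c *\<^sub>C x + c *\<^sub>C y" by transfer (rule refl, simp add: scaleC_add_right)
  show "(c + d) *\<^sub>C x = c *\<^sub>C x + d *\<^sub>C x" by transfer (rule refl, simp add: scaleC_add_left)
  show "c *\<^sub>C d *\<^sub>C x = (c * d) *\<^sub>C x" by transfer (rule refl, simp add: scaleC_scaleC)
  show "1 *\<^sub>C x = x" by transfer (rule refl, simp add: scaleC_one)
qed
end

lift_definition tensor_op :: "'a::complex_vector \<Rightarrow> 'b::complex_vector \<Rightarrow> ('a, 'b) tensor"  (infixr \<open>\<otimes>\<close> 68)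
  is "\<lambda>a b. Poly_Mapping.single (a, b) 1" .

text \<open>For subspaces \<^term>\<open>U\<close>, \<^term>\<open>V\<close> the tensor product of \<^term>\<open>U\<close> and \<^term>\<open>V\<close>
  embeds into the tensor product of the ambient spaces; we identify it with its image.\<close>

definition tsub :: "'a::complex_vector set \<Rightarrow> 'b::complex_vector set \<Rightarrow> ('a, 'b) tensor set" where
  "tsub U V = cspan {u \<otimes> v | u v. u \<in> U \<and> v \<in> V}"

text \<open>The linear map on \<^term>\<open>tsub U V\<close> induced by a map that is bilinear on \<^term>\<open>U \<times> V\<close>:
  Sweedler notation such as \<open>f(h\<^sub>1, h\<^sub>2)\<close> is written \<open>tlift f (\<Delta> h)\<close>. The lemmas
  \<open>tlift_on_tensor\<close> and \<open>tlift_on_linear\<close> below show that the chosen representation is irrelevant.\<close>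

definition tlift_on :: "'a::complex_vector set \<Rightarrow> 'b::complex_vector set \<Rightarrow>
    ('a \<Rightarrow> 'b \<Rightarrow> 'v::complex_vector) \<Rightarrow> ('a, 'b) tensor \<Rightarrow> 'v" where
  "tlift_on U V f t =
     (let xs = (SOME xs. set xs \<subseteq> U \<times> V \<and> t = (\<Sum>(u, v)\<leftarrow>xs. u \<otimes> v))
      in \<Sum>(u, v)\<leftarrow>xs. f u v)"

abbreviation tlift :: "('a::complex_vector \<Rightarrow> 'b::complex_vector \<Rightarrow> 'v::complex_vector) \<Rightarrow>
    ('a, 'b) tensor \<Rightarrow> 'v" where
  "tlift \<equiv> tlift_on UNIV UNIV"


lemma tensor_op_add_left: "(a + a') \<otimes> b = a \<otimes> b + a' \<otimes> b"
proof (transfer fixing: a a' b)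
  show "tensor_rel (Poly_Mapping.single (a + a', b) 1)
          (Poly_Mapping.single (a, b) 1 + Poly_Mapping.single (a', b) 1)"
    using complex_vector.span_base[OF bilinear_relations.intros(1)[of a a' b]]
    by (simp add: tensor_rel_def diff_diff_add)
qed

lemma tensor_op_add_right: "a \<otimes> (b + b') = a \<otimes> b + a \<otimes> b'"
proof (transfer fixing: a b b')
  show "tensor_rel (Poly_Mapping.single (a, b + b') 1)
          (Poly_Mapping.single (a, b) 1 + Poly_Mapping.single (a, b') 1)"
    using complex_vector.span_base[OF bilinear_relations.intros(2)[of a b b']]
    by (simp add: tensor_rel_def diff_diff_add)
qed

lemma tensor_op_scaleC_left: "(c *\<^sub>C a) \<otimes> b = c *\<^sub>C (a \<otimes> b)"
proof (transfer fixing: c a b)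
  show "tensor_rel (Poly_Mapping.single (c *\<^sub>C a, b) 1) (c *\<^sub>C Poly_Mapping.single (a, b) 1)"
    using complex_vector.span_base[OF bilinear_relations.intros(3)[of c a b]]
    by (simp add: tensor_rel_def)
qed

lemma tensor_op_scaleC_right: "a \<otimes> (c *\<^sub>C b) = c *\<^sub>C (a \<otimes> b)"
proof (transfer fixing: c a b)
  show "tensor_rel (Poly_Mapping.single (a, c *\<^sub>C b) 1) (c *\<^sub>C Poly_Mapping.single (a, b) 1)"
    using complex_vector.span_base[OF bilinear_relations.intros(4)[of a c b]]
    by (simp add: tensor_rel_def)
qed

lemma cbilinear_tensor_op: "cbilinear (\<otimes>)"
  unfolding cbilinear_def
  by (intro conjI allI clinearI tensor_op_add_left tensor_op_add_right
      tensor_op_scaleC_left tensor_op_scaleC_right)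

lemma tensor_universal:
  fixes f :: "'a::complex_vector \<Rightarrow> 'b::complex_vector \<Rightarrow> 'v::complex_vector"
  assumes f: "cbilinear f"
  shows "\<exists>g. clinear g \<and> (\<forall>a b. g (a \<otimes> b) = f a b)"
proof -
  define F where "F = (\<lambda>k :: 'a \<times> 'b. f (fst k) (snd k))"
  define L where "L = (\<lambda>p. \<Sum>k\<in>Poly_Mapping.keys p. Poly_Mapping.lookup p k *\<^sub>C F k)"
  have lookup_scaleC: "Poly_Mapping.lookup (c *\<^sub>C p) k = c * Poly_Mapping.lookup p k"
    for c and p :: "('a \<times> 'b) \<Rightarrow>\<^sub>0 complex" and k
    by transfer (simp add: scaleC_complex_def)
  have L_sup: "L p = (\<Sum>k\<in>S. Poly_Mapping.lookup p k *\<^sub>C F k)" if "finite S" "Poly_Mapping.keys p \<subseteq> S" for p S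
    unfolding L_def using that
    by (intro sum.mono_neutral_left) (auto simp: in_keys_iff)
  have lin: "clinear L"
  proof (rule clinearI)
    fix p q c
    have "L (p + q) = (\<Sum>k\<in>Poly_Mapping.keys p \<union> Poly_Mapping.keys q. Poly_Mapping.lookup (p + q) k *\<^sub>C F k)"
      by (rule L_sup) (simp_all add: Poly_Mapping.keys_add)
    also have "\<dots> = (\<Sum>k\<in>Poly_Mapping.keys p \<union> Poly_Mapping.keys q. Poly_Mapping.lookup p k *\<^sub>C F k)
                  + (\<Sum>k\<in>Poly_Mapping.keys p \<union> Poly_Mapping.keys q. Poly_Mapping.lookup q k *\<^sub>C F k)"
      by (simp add: lookup_add scaleC_add_left sum.distrib)
    also have "\<dots> = L p + L q"
      by (subst (1 2) L_sup[symmetric]) auto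
    finally show "L (p + q) = L p + L q" .
    have "L (c *\<^sub>C p) = (\<Sum>k\<in>Poly_Mapping.keys p. Poly_Mapping.lookup (c *\<^sub>C p) k *\<^sub>C F k)"
      by (rule L_sup) (auto simp: in_keys_iff lookup_scaleC)
    then show "L (c *\<^sub>C p) = c *\<^sub>C L p"
      by (simp add: L_def lookup_scaleC complex_vector.scale_sum_right scaleC_scaleC)
  qed
  have diff: "L (p - q) = L p - L q" for p q
    using clinear_add[OF lin, of "p - q" q] by simp
  have single: "L (Poly_Mapping.single (a, b) 1) = f a b" for a b
    by (simp add: L_def F_def)
  have bil: "f (a + a') b = f a b + f a' b" "f a (b + b') = f a b + f a b'"
    "f (c *\<^sub>C a) b = c *\<^sub>C f a b" "f a (c *\<^sub>C b) = c *\<^sub>C f a b" for a a' b b' c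
    using f clinear_add[of "f a"] clinear_add[of "\<lambda>a. f a b"] clinear_scaleC[of "f a"]
      clinear_scaleC[of "\<lambda>a. f a b"] unfolding cbilinear_def by blast+
  have "L r = 0" if "r \<in> bilinear_relations" for r
    using that by cases (simp_all add: diff single bil clinear_scaleC[OF lin])
  moreover have "complex_vector.subspace {p. L p = 0}"
    using clinear_scaleC[OF lin, of 0 0]
    by (auto simp: complex_vector.subspace_def clinear_add[OF lin] clinear_scaleC[OF lin])
  ultimately have "L r = 0" if "r \<in> cspan bilinear_relations" for r
    using that complex_vector.span_minimal[of bilinear_relations "{p. L p = 0}"] by blast
  then have rel: "L p = L q" if "tensor_rel p q" for p q
    using that diff[of p q] by (simp add: tensor_rel_def)
  have [simp]: "L (rep_tensor (abs_tensor p)) = L p" for p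
    by (rule rel, rule Quotient_rep_abs[OF Quotient_tensor])
      (simp add: tensor_rel_def complex_vector.span_zero)
  have abs_rep: "abs_tensor (rep_tensor t) = t" for t :: "('a, 'b) tensor"
    by (rule Quotient_abs_rep[OF Quotient_tensor])
  have "clinear (\<lambda>t. L (rep_tensor t))"
  proof (rule clinearI)
    fix x y :: "('a, 'b) tensor" and c
    have "x + y = abs_tensor (rep_tensor x + rep_tensor y)"
      by (simp add: plus_tensor.abs_eq[symmetric] abs_rep)
    then show "L (rep_tensor (x + y)) = L (rep_tensor x) + L (rep_tensor y)"
      by (simp add: clinear_add[OF lin])
    have "c *\<^sub>C x = abs_tensor (c *\<^sub>C rep_tensor x)"
      by (simp add: scaleC_tensor.abs_eq[symmetric] abs_rep)
    then show "L (rep_tensor (c *\<^sub>C x)) = c *\<^sub>C L (rep_tensor x)"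
      by (simp add: clinear_scaleC[OF lin])
  qed
  moreover have "L (rep_tensor (a \<otimes> b)) = f a b" for a b
    by (simp add: tensor_op.abs_eq single)
  ultimately show ?thesis by blast
qed

lemma clinear_sum_list:
  assumes "clinear g"
  shows "g (\<Sum>x\<leftarrow>xs. F x) = (\<Sum>x\<leftarrow>xs. g (F x))"
  using clinear_scaleC[OF assms, of 0 0] by (induction xs) (simp_all add: clinear_add[OF assms])

lemma tsub_repr:
  assumes U: "complex_vector.subspace U" and t: "t \<in> tsub U V"
  shows "\<exists>xs. set xs \<subseteq> U \<times> V \<and> t = (\<Sum>(u, v)\<leftarrow>xs. u \<otimes> v)"
  using t unfolding tsub_def
proof (induction rule: complex_vector.span_induct_alt)
  case base
  show ?case by (rule exI[of _ "[]"]) simp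
next
  case (step c x y)
  then obtain u v xs where *: "u \<in> U" "v \<in> V" "x = u \<otimes> v" "set xs \<subseteq> U \<times> V"
    "y = (\<Sum>(u, v)\<leftarrow>xs. u \<otimes> v)" by blast
  then show ?case
    by (intro exI[of _ "(c *\<^sub>C u, v) # xs"])
      (auto simp: tensor_op_scaleC_left complex_vector.subspace_scale[OF U])
qed

lemma tlift_on_universal:
  fixes f :: "'a::complex_vector \<Rightarrow> 'b::complex_vector \<Rightarrow> 'v::complex_vector"
  assumes U: "complex_vector.subspace U" and V: "complex_vector.subspace V"
    and f1: "\<And>v. v \<in> V \<Longrightarrow> clinear_on U (\<lambda>u. f u v)" and f2: "\<And>u. u \<in> U \<Longrightarrow> clinear_on V (f u)"
  shows "\<exists>g. clinear g \<and> (\<forall>u\<in>U. \<forall>v\<in>V. g (u \<otimes> v) = f u v) \<and> (\<forall>t\<in>tsub U V. tlift_on U V f t = g t)"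
proof -
  interpret pa: vector_space_pair "scaleC :: complex \<Rightarrow> 'a \<Rightarrow> 'a" "scaleC :: complex \<Rightarrow> 'a \<Rightarrow> 'a" ..
  interpret pb: vector_space_pair "scaleC :: complex \<Rightarrow> 'b \<Rightarrow> 'b" "scaleC :: complex \<Rightarrow> 'b \<Rightarrow> 'b" ..
  obtain p where p: "range p \<subseteq> U" "clinear p" "\<And>u. u \<in> U \<Longrightarrow> p u = u"
    using pa.linear_exists_left_inverse_on[of "\<lambda>u. u" U] U complex_vector.linear_ident by auto
  obtain q where q: "range q \<subseteq> V" "clinear q" "\<And>v. v \<in> V \<Longrightarrow> q v = v"
    using pb.linear_exists_left_inverse_on[of "\<lambda>v. v" V] V complex_vector.linear_ident by auto
  have pq: "p a \<in> U" "q b \<in> V" for a b using p q by auto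
  have "cbilinear (\<lambda>a b. f (p a) (q b))"
    unfolding cbilinear_def
    using f1[OF pq(2)] f2[OF pq(1)]
    by (auto intro!: clinearI simp: clinear_on_def clinear_add[OF p(2)] clinear_add[OF q(2)]
        clinear_scaleC[OF p(2)] clinear_scaleC[OF q(2)] pq)
  from tensor_universal[OF this] obtain g where g: "clinear g"
    and g_eq: "\<And>a b. g (a \<otimes> b) = f (p a) (q b)" by blast
  have gf: "g (u \<otimes> v) = f u v" if "u \<in> U" "v \<in> V" for u v
    using that g_eq p q by simp
  have "tlift_on U V f t = g t" if t: "t \<in> tsub U V" for t
  proof -
    define xs where "xs = (SOME xs. set xs \<subseteq> U \<times> V \<and> t = (\<Sum>(u, v)\<leftarrow>xs. u \<otimes> v))"
    have xs: "set xs \<subseteq> U \<times> V" "t = (\<Sum>(u, v)\<leftarrow>xs. u \<otimes> v)"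
      using someI_ex[OF tsub_repr[OF U t]] unfolding xs_def by auto
    have "g t = (\<Sum>x\<leftarrow>xs. g (case x of (u, v) \<Rightarrow> u \<otimes> v))"
      unfolding xs(2) by (rule clinear_sum_list[OF g])
    also have "\<dots> = (\<Sum>(u, v)\<leftarrow>xs. f u v)"
      using xs(1) gf by (intro arg_cong[of _ _ sum_list] map_cong) auto
    finally show ?thesis unfolding tlift_on_def xs_def Let_def by simp
  qed
  then show ?thesis using g gf by blast
qed

lemma tlift_on_tensor:
  assumes "complex_vector.subspace U" "complex_vector.subspace V"
    and "\<And>v. v \<in> V \<Longrightarrow> clinear_on U (\<lambda>u. f u v)" "\<And>u. u \<in> U \<Longrightarrow> clinear_on V (f u)"
    and "u \<in> U" "v \<in> V"
  shows "tlift_on U V f (u \<otimes> v) = f u v"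
proof -
  have "u \<otimes> v \<in> tsub U V"
    unfolding tsub_def using assms(5,6) by (blast intro: complex_vector.span_base)
  then show ?thesis
    using tlift_on_universal[of U V f] assms by metis
qed

lemma tlift_on_linear:
  assumes "complex_vector.subspace U" "complex_vector.subspace V"
    and "\<And>v. v \<in> V \<Longrightarrow> clinear_on U (\<lambda>u. f u v)" "\<And>u. u \<in> U \<Longrightarrow> clinear_on V (f u)"
  shows "clinear_on (tsub U V) (tlift_on U V f)"
proof -
  obtain g where g: "clinear g" "\<And>t. t \<in> tsub U V \<Longrightarrow> tlift_on U V f t = g t"
    using tlift_on_universal[of U V f] assms by metis
  have "complex_vector.subspace (tsub U V)"
    unfolding tsub_def by (rule complex_vector.subspace_span)
  then show ?thesis
    using g by (simp add: clinear_on_def complex_vector.subspace_add complex_vector.subspace_scale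
        clinear_add clinear_scaleC)
qed

lemma tsub_UNIV: "tsub UNIV UNIV = (UNIV :: ('a::complex_vector, 'b::complex_vector) tensor set)"
proof -
  have "abs_tensor p \<in> tsub UNIV UNIV" for p :: "('a \<times> 'b) \<Rightarrow>\<^sub>0 complex"
  proof (induction p rule: Poly_Mapping.update_induct)
    case const
    show ?case
      unfolding tsub_def zero_tensor.abs_eq[symmetric] by (rule complex_vector.span_zero)
  next
    case (update f k c)
    obtain a b where k: "k = (a, b)" by (cases k)
    have "Poly_Mapping.update k c f = f + c *\<^sub>C Poly_Mapping.single k (1::complex)"
      using update(1)
      by (intro poly_mapping_eqI)
        (auto simp: lookup_update lookup_add scaleC_poly_mapping.rep_eq lookup_single
          scaleC_complex_def when_def in_keys_iff)
    then have "abs_tensor (Poly_Mapping.update k c f) = abs_tensor f + c *\<^sub>C (a \<otimes> b)"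
      by (simp add: k scaleC_tensor.abs_eq plus_tensor.abs_eq tensor_op.abs_eq)
    moreover have "a \<otimes> b \<in> tsub UNIV UNIV"
      unfolding tsub_def by (blast intro: complex_vector.span_base)
    ultimately show ?case
      using update(3) unfolding tsub_def
      by (simp add: complex_vector.span_scale complex_vector.span_add)
  qed
  then show ?thesis
    using Quotient_abs_rep[OF Quotient_tensor] by (metis UNIV_eq_I)
qed

lemma tlift_tensor: "cbilinear f \<Longrightarrow> tlift f (a \<otimes> b) = f a b"
  by (rule tlift_on_tensor)
    (auto simp: cbilinear_def clinear_on_def clinear_add clinear_scaleC
      intro: clinear_add[of "\<lambda>a. f a b" for b] clinear_scaleC[of "\<lambda>a. f a b" for b])

lemma clinear_tlift: "cbilinear f \<Longrightarrow> clinear (tlift f)"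
  using tlift_on_linear[of UNIV UNIV f]
  by (intro clinearI)
    (auto simp: tsub_UNIV cbilinear_def clinear_on_def clinear_add clinear_scaleC
      clinear_add[of "\<lambda>a. f a b" for b] clinear_scaleC[of "\<lambda>a. f a b" for b])


subsection \<open>Quotients of tensor products\<close>

text \<open>Elements of the quotient of a subspace \<^term>\<open>T\<close> by a subspace \<^term>\<open>R\<close> are cosets.\<close>

definition coset :: "'a::complex_vector set \<Rightarrow> 'a \<Rightarrow> 'a set" where
  "coset R t = {t + r | r. r \<in> R}"

definition quot :: "'a::complex_vector set \<Rightarrow> 'a set \<Rightarrow> 'a set set" where
  "quot T R = coset R ` T"

definition coset_rep :: "'a set \<Rightarrow> 'a" where
  "coset_rep X = (SOME t. t \<in> X)"

definition quot_endo :: "'a::complex_vector set \<Rightarrow> 'a set \<Rightarrow> ('a set \<Rightarrow> 'a set) set" where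
  "quot_endo T R = {F \<in> quot T R \<rightarrow>\<^sub>E quot T R.
     \<forall>t\<in>T. \<forall>t'\<in>T. \<forall>s\<in>T. \<forall>s'\<in>T. \<forall>c. F (coset R t) = coset R s \<and> F (coset R t') = coset R s' \<longrightarrow>
       F (coset R (t + t')) = coset R (s + s') \<and> F (coset R (c *\<^sub>C t)) = coset R (c *\<^sub>C s)}"

text \<open>The kernel of the projection from the tensor product of \<^term>\<open>U\<close> and \<^term>\<open>V\<close> over the
  complex numbers onto the tensor product over \<^term>\<open>D\<close>, for a right action \<^term>\<open>r\<close> of
  \<^term>\<open>D\<close> on \<^term>\<open>U\<close> and a left action \<^term>\<open>l\<close> on \<^term>\<open>V\<close>.\<close>

definition balancing :: "'u::complex_vector set \<Rightarrow> 'v::complex_vector set \<Rightarrow> 'd set \<Rightarrow>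
    ('u \<Rightarrow> 'd \<Rightarrow> 'u) \<Rightarrow> ('d \<Rightarrow> 'v \<Rightarrow> 'v) \<Rightarrow> ('u, 'v) tensor set" where
  "balancing U V D r l = cspan {r u d \<otimes> v - u \<otimes> l d v | u v d. u \<in> U \<and> v \<in> V \<and> d \<in> D}"


section \<open>The algebraic data\<close>

subsection \<open>Regular Hopf algebras and integrals\<close>

definition coassociative :: "('h::complex_vector \<Rightarrow> ('h, 'h) tensor) \<Rightarrow> bool" where
  "coassociative \<Delta> \<longleftrightarrow> (\<forall>h. tlift (\<lambda>a h3. tlift (\<lambda>h1 h2. h1 \<otimes> h2 \<otimes> h3) (\<Delta> a)) (\<Delta> h)
                          = tlift (\<lambda>h1 b. h1 \<otimes> \<Delta> b) (\<Delta> h))"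

definition is_counit :: "('h::complex_vector \<Rightarrow> ('h, 'h) tensor) \<Rightarrow> ('h \<Rightarrow> complex) \<Rightarrow> bool" where
  "is_counit \<Delta> \<epsilon> \<longleftrightarrow> (\<forall>h. tlift (\<lambda>h1 h2. \<epsilon> h1 *\<^sub>C h2) (\<Delta> h) = h \<and> tlift (\<lambda>h1 h2. \<epsilon> h2 *\<^sub>C h1) (\<Delta> h) = h)"

definition bialgebra :: "('h::complex_algebra_1 \<Rightarrow> ('h, 'h) tensor) \<Rightarrow> ('h \<Rightarrow> complex) \<Rightarrow> bool" where
  "bialgebra \<Delta> \<epsilon> \<longleftrightarrow>
     clinear \<Delta> \<and> clinear \<epsilon> \<and> coassociative \<Delta> \<and> is_counit \<Delta> \<epsilon> \<and>
     (\<forall>h k. \<Delta> (h * k) = tlift (\<lambda>h1 h2. tlift (\<lambda>k1 k2. h1 * k1 \<otimes> h2 * k2) (\<Delta> k)) (\<Delta> h)) \<and>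
     \<Delta> 1 = 1 \<otimes> 1 \<and> (\<forall>h k. \<epsilon> (h * k) = \<epsilon> h * \<epsilon> k) \<and> \<epsilon> 1 = 1"

definition regular_hopf_algebra ::
    "('h::complex_algebra_1 \<Rightarrow> ('h, 'h) tensor) \<Rightarrow> ('h \<Rightarrow> complex) \<Rightarrow> ('h \<Rightarrow> 'h) \<Rightarrow> bool" where
  "regular_hopf_algebra \<Delta> \<epsilon> S \<longleftrightarrow>
     bialgebra \<Delta> \<epsilon> \<and> clinear S \<and> bij S \<and>
     (\<forall>h. tlift (\<lambda>h1 h2. S h1 * h2) (\<Delta> h) = \<epsilon> h *\<^sub>C 1 \<and> tlift (\<lambda>h1 h2. h1 * S h2) (\<Delta> h) = \<epsilon> h *\<^sub>C 1)"

definition normalized_integral ::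
    "('h::complex_algebra_1 \<Rightarrow> ('h, 'h) tensor) \<Rightarrow> ('h \<Rightarrow> complex) \<Rightarrow> bool" where
  "normalized_integral \<Delta> \<phi> \<longleftrightarrow>
     clinear \<phi> \<and> \<phi> 1 = 1 \<and>
     (\<forall>h. tlift (\<lambda>h1 h2. \<phi> h2 *\<^sub>C h1) (\<Delta> h) = \<phi> h *\<^sub>C 1) \<and>
     (\<forall>h. tlift (\<lambda>h1 h2. \<phi> h1 *\<^sub>C h2) (\<Delta> h) = \<phi> h *\<^sub>C 1)"


subsection \<open>Braided-commutative Yetter--Drinfeld algebras\<close>

record (overloaded) ('h, 'c) yd_data =
  Delta  :: "'h::complex_algebra_1 \<Rightarrow> ('h, 'h) tensor"
  eps    :: "'h \<Rightarrow> complex"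
  antip  :: "'h \<Rightarrow> 'h"
  phiH   :: "'h \<Rightarrow> complex"
  act    :: "'h \<Rightarrow> 'c::complex_algebra_1 \<Rightarrow> 'c"
  coact  :: "'c \<Rightarrow> ('c, 'h) tensor"
  muC    :: "'c \<Rightarrow> complex"

definition module_algebra :: "('h::complex_algebra_1, 'c::complex_algebra_1) yd_data \<Rightarrow> bool" where
  "module_algebra G \<longleftrightarrow>
     cbilinear (act G) \<and>
     (\<forall>y. act G 1 y = y) \<and> (\<forall>h k y. act G (h * k) y = act G h (act G k y)) \<and>
     (\<forall>h y y'. act G h (y * y') = tlift (\<lambda>h1 h2. act G h1 y * act G h2 y') (Delta G h)) \<and>
     (\<forall>h. act G h 1 = eps G h *\<^sub>C 1)"

text \<open>The opposite multiplication of \<^term>\<open>H\<close> appears in the second leg of \<open>coact (y * y')\<close>.\<close>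

definition op_comodule_algebra :: "('h::complex_algebra_1, 'c::complex_algebra_1) yd_data \<Rightarrow> bool" where
  "op_comodule_algebra G \<longleftrightarrow>
     clinear (coact G) \<and>
     (\<forall>y. tlift (\<lambda>z h2. tlift (\<lambda>y0 h1. y0 \<otimes> h1 \<otimes> h2) (coact G z)) (coact G y)
        = tlift (\<lambda>y0 h. y0 \<otimes> Delta G h) (coact G y)) \<and>
     (\<forall>y. tlift (\<lambda>y0 y1. eps G y1 *\<^sub>C y0) (coact G y) = y) \<and>
     (\<forall>y y'. coact G (y * y') =
        tlift (\<lambda>y0 y1. tlift (\<lambda>y0' y1'. y0 * y0' \<otimes> y1' * y1) (coact G y')) (coact G y)) \<and>
     coact G 1 = 1 \<otimes> 1"

definition yetter_drinfeld_condition :: "('h::complex_algebra_1, 'c::complex_algebra_1) yd_data \<Rightarrow> bool" where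
  "yetter_drinfeld_condition G \<longleftrightarrow>
     (\<forall>h y. tlift (\<lambda>h1 h2. tlift (\<lambda>z0 z1. z0 \<otimes> z1 * h1) (coact G (act G h2 y))) (Delta G h)
          = tlift (\<lambda>h1 h2. tlift (\<lambda>y0 y1. act G h1 y0 \<otimes> h2 * y1) (coact G y)) (Delta G h))"

definition braided_commutative :: "('h::complex_algebra_1, 'c::complex_algebra_1) yd_data \<Rightarrow> bool" where
  "braided_commutative G \<longleftrightarrow>
     (\<forall>y y'. y * y' = tlift (\<lambda>y0' y1'. y0' * act G y1' y) (coact G y') \<and>
             y * y' = tlift (\<lambda>y0 y1. act G (antip G y1) y' * y0) (coact G y))"

definition braided_commutative_yd_algebra ::
    "('h::complex_algebra_1, 'c::complex_algebra_1) yd_data \<Rightarrow> bool" where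
  "braided_commutative_yd_algebra G \<longleftrightarrow>
     module_algebra G \<and> op_comodule_algebra G \<and> yetter_drinfeld_condition G \<and> braided_commutative G"

definition faithful_functional :: "('c::complex_algebra_1 \<Rightarrow> complex) \<Rightarrow> bool" where
  "faithful_functional \<mu> \<longleftrightarrow> (\<forall>d. d \<noteq> 0 \<longrightarrow> (\<exists>y. \<mu> (d * y) \<noteq> 0) \<and> (\<exists>y. \<mu> (y * d) \<noteq> 0))"

definition invariant_functional :: "('h::complex_algebra_1, 'c::complex_algebra_1) yd_data \<Rightarrow> bool" where
  "invariant_functional G \<longleftrightarrow>
     (\<forall>y. tlift (\<lambda>y0 y1. muC G y0 *\<^sub>C y1) (coact G y) = muC G y *\<^sub>C 1) \<and>
     (\<forall>h y. muC G (act G h y) = eps G h * muC G y)"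


section \<open>The multiplier Hopf algebroid on the smash product\<close>

subsection \<open>The total algebra and the base algebras\<close>

text \<open>The underlying vector space of the smash product \<open>A = C # H\<close> is \<^typ>\<open>('c, 'h) tensor\<close>.\<close>

definition amult :: "('h::complex_algebra_1, 'c::complex_algebra_1) yd_data \<Rightarrow>
    ('c, 'h) tensor \<Rightarrow> ('c, 'h) tensor \<Rightarrow> ('c, 'h) tensor" where
  "amult G a b = tlift (\<lambda>y h. tlift (\<lambda>y' h'.
     tlift (\<lambda>h1 h2. y * act G h1 y' \<otimes> h2 * h') (Delta G h)) b) a"

abbreviation aone :: "('c::complex_algebra_1, 'h::complex_algebra_1) tensor" where
  "aone \<equiv> 1 \<otimes> 1"

abbreviation ofC :: "'c::complex_algebra_1 \<Rightarrow> ('c, 'h::complex_algebra_1) tensor" where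
  "ofC y \<equiv> y \<otimes> 1"

abbreviation ofH :: "'h::complex_algebra_1 \<Rightarrow> ('c::complex_algebra_1, 'h) tensor" where
  "ofH h \<equiv> 1 \<otimes> h"

definition tC :: "('h::complex_algebra_1, 'c::complex_algebra_1) yd_data \<Rightarrow> 'c \<Rightarrow> ('c, 'h) tensor" where
  "tC G y = tlift (\<lambda>y0 y1. y0 \<otimes> y1) (coact G y)"

definition Balg :: "('h::complex_algebra_1, 'c::complex_algebra_1) yd_data \<Rightarrow> ('c, 'h) tensor set" where
  "Balg G = range (tC G)"

definition tC_inv :: "('h::complex_algebra_1, 'c::complex_algebra_1) yd_data \<Rightarrow> ('c, 'h) tensor \<Rightarrow> 'c" where
  "tC_inv G = inv_into UNIV (tC G)"

definition tB :: "('h::complex_algebra_1, 'c::complex_algebra_1) yd_data \<Rightarrow> ('c, 'h) tensor \<Rightarrow> 'c" where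
  "tB G x = tlift (\<lambda>y0 y1. act G (inv (antip G) y1) y0) (coact G (tC_inv G x))"

definition tB_inv :: "('h::complex_algebra_1, 'c::complex_algebra_1) yd_data \<Rightarrow> 'c \<Rightarrow> ('c, 'h) tensor" where
  "tB_inv G = inv_into (Balg G) (tB G)"

definition muB :: "('h::complex_algebra_1, 'c::complex_algebra_1) yd_data \<Rightarrow> ('c, 'h) tensor \<Rightarrow> complex" where
  "muB G x = muC G (tC_inv G x)"


subsection \<open>Comultiplications, counit and integral\<close>

text \<open>\<open>DeltaC G b (a \<otimes> a')\<close> and \<open>DeltaB G (a \<otimes> a') b\<close> are the canonical representatives, in the tensor
  product over the complex numbers, of the elements \<open>\<Delta>\<^sub>C(b)(a \<otimes> a')\<close> and \<open>(a \<otimes> a')\<Delta>\<^sub>B(b)\<close> of the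
  balanced tensor products.\<close>

definition DeltaC :: "('h::complex_algebra_1, 'c::complex_algebra_1) yd_data \<Rightarrow> ('c, 'h) tensor \<Rightarrow>
    (('c, 'h) tensor, ('c, 'h) tensor) tensor \<Rightarrow> (('c, 'h) tensor, ('c, 'h) tensor) tensor" where
  "DeltaC G b t = tlift (\<lambda>y h. tlift (\<lambda>a a'.
     tlift (\<lambda>h1 h2. amult G (y \<otimes> h1) a \<otimes> amult G (ofH h2) a') (Delta G h)) t) b"

definition DeltaB :: "('h::complex_algebra_1, 'c::complex_algebra_1) yd_data \<Rightarrow>
    (('c, 'h) tensor, ('c, 'h) tensor) tensor \<Rightarrow> ('c, 'h) tensor \<Rightarrow>
    (('c, 'h) tensor, ('c, 'h) tensor) tensor" where
  "DeltaB G = (THE D. cbilinear D \<and>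
     (\<forall>a a' h y. D (a \<otimes> a') (amult G (ofH h) (ofC y)) =
        tlift (\<lambda>h1 h2. amult G (amult G a (ofH h1)) (ofC y) \<otimes> amult G a' (ofH h2)) (Delta G h)))"

definition counitC :: "('h::complex_algebra_1, 'c::complex_algebra_1) yd_data \<Rightarrow> ('c, 'h) tensor \<Rightarrow> 'c" where
  "counitC G a = tlift (\<lambda>y h. eps G h *\<^sub>C y) a"

definition phiC :: "('h::complex_algebra_1, 'c::complex_algebra_1) yd_data \<Rightarrow> ('c, 'h) tensor \<Rightarrow> 'c" where
  "phiC G a = tlift (\<lambda>y h. phiH G h *\<^sub>C y) a"

definition phiA :: "('h::complex_algebra_1, 'c::complex_algebra_1) yd_data \<Rightarrow> ('c, 'h) tensor dual" where
  "phiA G = Dual (\<lambda>a. muC G (phiC G a))"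


section \<open>The dual multiplier Hopf algebroid\<close>

subsection \<open>The dual algebra\<close>

definition dotA :: "('h::complex_algebra_1, 'c::complex_algebra_1) yd_data \<Rightarrow>
    ('c, 'h) tensor \<Rightarrow> ('c, 'h) tensor dual \<Rightarrow> ('c, 'h) tensor dual" where
  "dotA G a \<omega> = Dual (\<lambda>b. dapp \<omega> (amult G b a))"

definition Ahat :: "('h::complex_algebra_1, 'c::complex_algebra_1) yd_data \<Rightarrow> ('c, 'h) tensor dual set" where
  "Ahat G = {dotA G a (phiA G) | a. True}"

text \<open>The module maps \<open>\<^sub>C\<omega>\<close>, \<open>\<^sub>B\<omega>\<close> and \<open>\<omega>\<^sub>B\<close>.\<close>

definition left_C_part :: "('h::complex_algebra_1, 'c::complex_algebra_1) yd_data \<Rightarrow>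
    ('c, 'h) tensor dual \<Rightarrow> ('c, 'h) tensor \<Rightarrow> 'c" where
  "left_C_part G \<omega> = (THE f. clinear f \<and>
     (\<forall>y a. f (amult G (ofC y) a) = y * f a) \<and> (\<forall>a. muC G (f a) = dapp \<omega> a))"

definition left_B_part :: "('h::complex_algebra_1, 'c::complex_algebra_1) yd_data \<Rightarrow>
    ('c, 'h) tensor dual \<Rightarrow> ('c, 'h) tensor \<Rightarrow> ('c, 'h) tensor" where
  "left_B_part G \<omega> = (THE f. clinear f \<and> range f \<subseteq> Balg G \<and>
     (\<forall>x\<in>Balg G. \<forall>a. f (amult G x a) = amult G x (f a)) \<and> (\<forall>a. muB G (f a) = dapp \<omega> a))"

definition right_B_part :: "('h::complex_algebra_1, 'c::complex_algebra_1) yd_data \<Rightarrow>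
    ('c, 'h) tensor dual \<Rightarrow> ('c, 'h) tensor \<Rightarrow> ('c, 'h) tensor" where
  "right_B_part G \<omega> = (THE f. clinear f \<and> range f \<subseteq> Balg G \<and>
     (\<forall>x\<in>Balg G. \<forall>a. f (amult G a x) = amult G (f a) x) \<and> (\<forall>a. muB G (f a) = dapp \<omega> a))"

text \<open>\<open>lconv G \<omega> a\<close> is \<open>\<omega> \<triangleright> a\<close> and \<open>rconv G a \<omega>\<close> is \<open>a \<triangleleft> \<omega>\<close>.\<close>

definition lconv :: "('h::complex_algebra_1, 'c::complex_algebra_1) yd_data \<Rightarrow>
    ('c, 'h) tensor dual \<Rightarrow> ('c, 'h) tensor \<Rightarrow> ('c, 'h) tensor" where
  "lconv G \<omega> a = tlift (\<lambda>b b'. amult G (tC G (left_C_part G \<omega> b')) b) (DeltaC G a (aone \<otimes> aone))"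

definition rconv :: "('h::complex_algebra_1, 'c::complex_algebra_1) yd_data \<Rightarrow>
    ('c, 'h) tensor \<Rightarrow> ('c, 'h) tensor dual \<Rightarrow> ('c, 'h) tensor" where
  "rconv G a \<omega> = tlift (\<lambda>b b'. amult G b' (ofC (tB G (right_B_part G \<omega> b)))) (DeltaB G (aone \<otimes> aone) a)"

definition Amult :: "('h::complex_algebra_1, 'c::complex_algebra_1) yd_data \<Rightarrow>
    ('c, 'h) tensor dual \<Rightarrow> ('c, 'h) tensor dual \<Rightarrow> ('c, 'h) tensor dual" where
  "Amult G \<upsilon> \<omega> = Dual (\<lambda>a. dapp \<upsilon> (lconv G \<omega> a))"

definition counitAhat :: "('c::complex_algebra_1, 'h::complex_algebra_1) tensor dual \<Rightarrow> complex" where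
  "counitAhat \<omega> = dapp \<omega> aone"

definition psiAhat :: "('h::complex_algebra_1, 'c::complex_algebra_1) yd_data \<Rightarrow>
    ('c, 'h) tensor dual \<Rightarrow> complex" where
  "psiAhat G \<omega> = muC G (counitC G (THE a. \<omega> = dotA G a (phiA G)))"


subsection \<open>Multipliers\<close>

text \<open>A multiplier is a pair of maps, left and right multiplication by the multiplier.\<close>

type_synonym 'a multiplier = "('a \<Rightarrow> 'a) \<times> ('a \<Rightarrow> 'a)"

abbreviation mleft :: "'a multiplier \<Rightarrow> 'a \<Rightarrow> 'a" where "mleft m \<equiv> fst m"
abbreviation mright :: "'a \<Rightarrow> 'a multiplier \<Rightarrow> 'a" where "mright a m \<equiv> snd m a"

definition MAhat :: "('h::complex_algebra_1, 'c::complex_algebra_1) yd_data \<Rightarrow>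
    ('c, 'h) tensor dual multiplier set" where
  "MAhat G = {m. mleft m \<in> Ahat G \<rightarrow>\<^sub>E Ahat G \<and> snd m \<in> Ahat G \<rightarrow>\<^sub>E Ahat G \<and>
     clinear_on (Ahat G) (mleft m) \<and> clinear_on (Ahat G) (snd m) \<and>
     (\<forall>\<upsilon>\<in>Ahat G. \<forall>\<omega>\<in>Ahat G. Amult G (mright \<upsilon> m) \<omega> = Amult G \<upsilon> (mleft m \<omega>))}"

definition ofAhat :: "('h::complex_algebra_1, 'c::complex_algebra_1) yd_data \<Rightarrow>
    ('c, 'h) tensor dual \<Rightarrow> ('c, 'h) tensor dual multiplier" where
  "ofAhat G \<omega> = (\<lambda>\<upsilon>\<in>Ahat G. Amult G \<omega> \<upsilon>, \<lambda>\<upsilon>\<in>Ahat G. Amult G \<upsilon> \<omega>)"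

definition embB :: "('h::complex_algebra_1, 'c::complex_algebra_1) yd_data \<Rightarrow>
    ('c, 'h) tensor \<Rightarrow> ('c, 'h) tensor dual multiplier" where
  "embB G x = (\<lambda>\<upsilon>\<in>Ahat G. Dual (\<lambda>a. dapp \<upsilon> (amult G (ofC (tB G x)) a)),
               \<lambda>\<upsilon>\<in>Ahat G. Dual (\<lambda>a. dapp \<upsilon> (amult G x a)))"

definition embC :: "('h::complex_algebra_1, 'c::complex_algebra_1) yd_data \<Rightarrow>
    'c \<Rightarrow> ('c, 'h) tensor dual multiplier" where
  "embC G y = (\<lambda>\<upsilon>\<in>Ahat G. Dual (\<lambda>a. dapp \<upsilon> (amult G a (ofC y))),
               \<lambda>\<upsilon>\<in>Ahat G. Dual (\<lambda>a. dapp \<upsilon> (amult G a (tC G y))))"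


subsection \<open>The dual comultiplications\<close>

text \<open>Primes denote the dual objects: \<open>A'\<close> is \<^const>\<open>Ahat\<close>.   \<open>relB\<close> and \<open>relC\<close> are
  the balancing subspaces for the tensor product of \<open>A'\<^sup>B\<close> and \<open>\<^sub>BA'\<close> over \<open>B\<close>, and of \<open>A'\<^sub>C\<close> and \<open>\<^sup>CA'\<close> over \<open>C\<close>.\<close>

abbreviation AA :: "('h::complex_algebra_1, 'c::complex_algebra_1) yd_data \<Rightarrow>
    (('c, 'h) tensor dual, ('c, 'h) tensor dual) tensor set" where
  "AA G \<equiv> tsub (Ahat G) (Ahat G)"

definition relB :: "('h::complex_algebra_1, 'c::complex_algebra_1) yd_data \<Rightarrow>
    (('c, 'h) tensor dual, ('c, 'h) tensor dual) tensor set" where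
  "relB G = balancing (Ahat G) (Ahat G) (Balg G)
     (\<lambda>\<omega> x. mleft (embC G (tC_inv G x)) \<omega>) (\<lambda>x \<omega>. mleft (embB G x) \<omega>)"

definition relC :: "('h::complex_algebra_1, 'c::complex_algebra_1) yd_data \<Rightarrow>
    (('c, 'h) tensor dual, ('c, 'h) tensor dual) tensor set" where
  "relC G = balancing (Ahat G) (Ahat G) UNIV
     (\<lambda>\<omega> y. mright \<omega> (embC G y)) (\<lambda>y \<omega>. mright \<omega> (embB G (tB_inv G y)))"

definition pairB :: "('h::complex_algebra_1, 'c::complex_algebra_1) yd_data \<Rightarrow>
    (('c, 'h) tensor dual, ('c, 'h) tensor dual) tensor set \<Rightarrow>
    ('c, 'h) tensor \<Rightarrow> ('c, 'h) tensor \<Rightarrow> complex" where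
  "pairB G X a b = tlift_on (Ahat G) (Ahat G)
     (\<lambda>\<upsilon> \<omega>. dapp \<upsilon> (amult G a (ofC (left_C_part G \<omega> b)))) (coset_rep X)"

definition pairC :: "('h::complex_algebra_1, 'c::complex_algebra_1) yd_data \<Rightarrow>
    (('c, 'h) tensor dual, ('c, 'h) tensor dual) tensor set \<Rightarrow>
    ('c, 'h) tensor \<Rightarrow> ('c, 'h) tensor \<Rightarrow> complex" where
  "pairC G X a b = tlift_on (Ahat G) (Ahat G)
     (\<lambda>\<upsilon> \<omega>. dapp \<upsilon> (amult G a (left_B_part G \<omega> b))) (coset_rep X)"

text \<open>\<open>DhatB1 G \<upsilon> \<omega>\<close> is \<open>\<Delta>'\<^sub>B(\<upsilon>)(1 \<otimes> \<omega>)\<close> and \<open>DhatC1 G \<upsilon> \<omega>\<close> is \<open>(\<upsilon> \<otimes> 1)\<Delta>'\<^sub>C(\<omega>)\<close>.\<close>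

definition DhatB1 :: "('h::complex_algebra_1, 'c::complex_algebra_1) yd_data \<Rightarrow>
    ('c, 'h) tensor dual \<Rightarrow> ('c, 'h) tensor dual \<Rightarrow>
    (('c, 'h) tensor dual, ('c, 'h) tensor dual) tensor set" where
  "DhatB1 G \<upsilon> \<omega> = (THE X. X \<in> quot (AA G) (relB G) \<and>
     (\<forall>a b. pairB G X a b = dapp \<upsilon> (amult G a (lconv G \<omega> b))))"

definition DhatC1 :: "('h::complex_algebra_1, 'c::complex_algebra_1) yd_data \<Rightarrow>
    ('c, 'h) tensor dual \<Rightarrow> ('c, 'h) tensor dual \<Rightarrow>
    (('c, 'h) tensor dual, ('c, 'h) tensor dual) tensor set" where
  "DhatC1 G \<upsilon> \<omega> = (THE X. X \<in> quot (AA G) (relC G) \<and>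
     (\<forall>a b. pairC G X a b = dapp \<omega> (amult G (rconv G a \<upsilon>) b)))"

text \<open>The operators of multiplication by \<open>\<Delta>'\<^sub>B(\<upsilon>)\<close> from the left and by \<open>\<Delta>'\<^sub>C(\<omega>)\<close> from the right:
  \<open>\<Delta>'\<^sub>B(\<upsilon>)(\<alpha> \<otimes> \<beta>) = (\<Delta>'\<^sub>B(\<upsilon>)(1 \<otimes> \<beta>))(\<alpha> \<otimes> 1)\<close> and
  \<open>(\<alpha> \<otimes> \<beta>)\<Delta>'\<^sub>C(\<omega>) = (1 \<otimes> \<beta>)((\<alpha> \<otimes> 1)\<Delta>'\<^sub>C(\<omega>))\<close>.\<close>

definition DhatB :: "('h::complex_algebra_1, 'c::complex_algebra_1) yd_data \<Rightarrow> ('c, 'h) tensor dual \<Rightarrow>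
    (('c, 'h) tensor dual, ('c, 'h) tensor dual) tensor set \<Rightarrow>
    (('c, 'h) tensor dual, ('c, 'h) tensor dual) tensor set" where
  "DhatB G \<upsilon> = (THE F. F \<in> quot_endo (AA G) (relB G) \<and>
     (\<forall>\<alpha>\<in>Ahat G. \<forall>\<beta>\<in>Ahat G. F (coset (relB G) (\<alpha> \<otimes> \<beta>)) = coset (relB G)
        (tlift_on (Ahat G) (Ahat G) (\<lambda>\<kappa> \<nu>. Amult G \<kappa> \<alpha> \<otimes> \<nu>) (coset_rep (DhatB1 G \<upsilon> \<beta>)))))"

definition DhatC :: "('h::complex_algebra_1, 'c::complex_algebra_1) yd_data \<Rightarrow> ('c, 'h) tensor dual \<Rightarrow>
    (('c, 'h) tensor dual, ('c, 'h) tensor dual) tensor set \<Rightarrow>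
    (('c, 'h) tensor dual, ('c, 'h) tensor dual) tensor set" where
  "DhatC G \<omega> = (THE F. F \<in> quot_endo (AA G) (relC G) \<and>
     (\<forall>\<alpha>\<in>Ahat G. \<forall>\<beta>\<in>Ahat G. F (coset (relC G) (\<alpha> \<otimes> \<beta>)) = coset (relC G)
        (tlift_on (Ahat G) (Ahat G) (\<lambda>\<kappa> \<nu>. \<kappa> \<otimes> Amult G \<beta> \<nu>) (coset_rep (DhatC1 G \<alpha> \<omega>)))))"

text \<open>The extensions to multipliers, determined by \<open>\<Delta>'\<^sub>B(m)\<Delta>'\<^sub>B(\<omega>) = \<Delta>'\<^sub>B(m\<omega>)\<close> and
  \<open>\<Delta>'\<^sub>C(\<omega>)\<Delta>'\<^sub>C(m) = \<Delta>'\<^sub>C(\<omega>m)\<close>.\<close>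

definition DhatB_ext :: "('h::complex_algebra_1, 'c::complex_algebra_1) yd_data \<Rightarrow>
    ('c, 'h) tensor dual multiplier \<Rightarrow>
    (('c, 'h) tensor dual, ('c, 'h) tensor dual) tensor set \<Rightarrow>
    (('c, 'h) tensor dual, ('c, 'h) tensor dual) tensor set" where
  "DhatB_ext G m = (THE F. F \<in> quot_endo (AA G) (relB G) \<and>
     (\<forall>\<omega>\<in>Ahat G. \<forall>X\<in>quot (AA G) (relB G). F (DhatB G \<omega> X) = DhatB G (mleft m \<omega>) X))"

definition DhatC_ext :: "('h::complex_algebra_1, 'c::complex_algebra_1) yd_data \<Rightarrow>
    ('c, 'h) tensor dual multiplier \<Rightarrow>
    (('c, 'h) tensor dual, ('c, 'h) tensor dual) tensor set \<Rightarrow>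
    (('c, 'h) tensor dual, ('c, 'h) tensor dual) tensor set" where
  "DhatC_ext G m = (THE F. F \<in> quot_endo (AA G) (relC G) \<and>
     (\<forall>\<omega>\<in>Ahat G. \<forall>X\<in>quot (AA G) (relC G). F (DhatC G \<omega> X) = DhatC G (mright \<omega> m) X))"


section \<open>The dual multiplier Hopf algebra of \<open>H\<close>\<close>

definition dotH :: "('h::complex_algebra_1, 'c::complex_algebra_1) yd_data \<Rightarrow> 'h \<Rightarrow> 'h dual" where
  "dotH G h = Dual (\<lambda>k. phiH G (k * h))"

definition Hhat :: "('h::complex_algebra_1, 'c::complex_algebra_1) yd_data \<Rightarrow> 'h dual set" where
  "Hhat G = range (dotH G)"

definition Hmult :: "('h::complex_algebra_1, 'c::complex_algebra_1) yd_data \<Rightarrow>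
    'h dual \<Rightarrow> 'h dual \<Rightarrow> 'h dual" where
  "Hmult G \<upsilon> \<omega> = Dual (\<lambda>h. tlift (\<lambda>h1 h2. dapp \<upsilon> h1 * dapp \<omega> h2) (Delta G h))"

definition counitHhat :: "'h::complex_algebra_1 dual \<Rightarrow> complex" where
  "counitHhat \<upsilon> = dapp \<upsilon> 1"

definition psiHhat :: "('h::complex_algebra_1, 'c::complex_algebra_1) yd_data \<Rightarrow> 'h dual \<Rightarrow> complex" where
  "psiHhat G \<upsilon> = eps G (THE h. \<upsilon> = dotH G h)"

definition pairH :: "('h::complex_vector dual, 'h dual) tensor \<Rightarrow> 'h \<Rightarrow> 'h \<Rightarrow> complex" where
  "pairH t h k = tlift (\<lambda>\<upsilon> \<omega>. dapp \<upsilon> h * dapp \<omega> k) t"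

text \<open>The comultiplication \<open>\<Delta>(\<upsilon>)(h \<otimes> k) = \<upsilon>(h k)\<close> takes values in multipliers of the tensor square.
  \<open>DH1 G \<upsilon> \<omega>\<close>, \<open>DH_left G d d' d''\<close> and \<open>DH_right G d' d'' d\<close> are the elements \<open>\<Delta>(\<upsilon>)(1 \<otimes> \<omega>)\<close>,
  \<open>\<Delta>(d)(d' \<otimes> d'')\<close> and \<open>(d' \<otimes> d'')\<Delta>(d)\<close> of the tensor square.\<close>

definition DH1 :: "('h::complex_algebra_1, 'c::complex_algebra_1) yd_data \<Rightarrow>
    'h dual \<Rightarrow> 'h dual \<Rightarrow> ('h dual, 'h dual) tensor" where
  "DH1 G \<upsilon> \<omega> = (THE t. t \<in> tsub (Hhat G) (Hhat G) \<and> (\<forall>h k. pairH t h k =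
     tlift (\<lambda>k1 k2. dapp \<upsilon> (h * k1) * dapp \<omega> k2) (Delta G k)))"

definition DH_left :: "('h::complex_algebra_1, 'c::complex_algebra_1) yd_data \<Rightarrow>
    'h dual \<Rightarrow> 'h dual \<Rightarrow> 'h dual \<Rightarrow> ('h dual, 'h dual) tensor" where
  "DH_left G d d' d'' = (THE t. t \<in> tsub (Hhat G) (Hhat G) \<and> (\<forall>h k. pairH t h k =
     tlift (\<lambda>h1 h2. tlift (\<lambda>k1 k2. dapp d (h1 * k1) * dapp d' h2 * dapp d'' k2) (Delta G k)) (Delta G h)))"

definition DH_right :: "('h::complex_algebra_1, 'c::complex_algebra_1) yd_data \<Rightarrow>
    'h dual \<Rightarrow> 'h dual \<Rightarrow> 'h dual \<Rightarrow> ('h dual, 'h dual) tensor" where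
  "DH_right G d' d'' d = (THE t. t \<in> tsub (Hhat G) (Hhat G) \<and> (\<forall>h k. pairH t h k =
     tlift (\<lambda>h1 h2. tlift (\<lambda>k1 k2. dapp d' h1 * dapp d'' k1 * dapp d (h2 * k2)) (Delta G k)) (Delta G h)))"


subsection \<open>The smash product of \<open>B\<close> with the dual of \<open>H\<close>\<close>

definition actB :: "('h::complex_algebra_1, 'c::complex_algebra_1) yd_data \<Rightarrow>
    'h dual \<Rightarrow> ('c, 'h) tensor \<Rightarrow> ('c, 'h) tensor" where
  "actB G \<upsilon> x = tlift (\<lambda>y0 y1. dapp \<upsilon> y1 *\<^sub>C tC G y0) (coact G (tC_inv G x))"

definition smash :: "('h::complex_algebra_1, 'c::complex_algebra_1) yd_data \<Rightarrow>
    (('c, 'h) tensor, 'h dual) tensor set" where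
  "smash G = tsub (Balg G) (Hhat G)"

text \<open>In the product, \<open>\<upsilon>\<^sub>1 \<otimes> \<upsilon>\<^sub>2 \<upsilon>'\<close> is \<open>\<Delta>(\<upsilon>)(1 \<otimes> \<upsilon>')\<close>.\<close>

definition smash_mult :: "('h::complex_algebra_1, 'c::complex_algebra_1) yd_data \<Rightarrow>
    (('c, 'h) tensor, 'h dual) tensor \<Rightarrow> (('c, 'h) tensor, 'h dual) tensor \<Rightarrow>
    (('c, 'h) tensor, 'h dual) tensor" where
  "smash_mult G s t = tlift_on (Balg G) (Hhat G) (\<lambda>x \<upsilon>. tlift_on (Balg G) (Hhat G) (\<lambda>x' \<upsilon>'.
     tlift_on (Hhat G) (Hhat G) (\<lambda>\<upsilon>1 w. amult G x (actB G \<upsilon>1 x') \<otimes> w) (DH1 G \<upsilon> \<upsilon>')) t) s"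

text \<open>The coaction of the dual of \<open>H\<close> on \<open>C\<close> takes values in multipliers;
  \<open>coactM G y \<upsilon>\<close> is the element \<open>y\<^sub>\<langle>\<^sub>0\<^sub>\<rangle> \<otimes> y\<^sub>\<langle>\<^sub>1\<^sub>\<rangle>\<upsilon>\<close>.\<close>

definition coactM :: "('h::complex_algebra_1, 'c::complex_algebra_1) yd_data \<Rightarrow>
    'c \<Rightarrow> 'h dual \<Rightarrow> ('c, 'h dual) tensor" where
  "coactM G y \<upsilon> = (THE t. t \<in> tsub UNIV (Hhat G) \<and> (\<forall>h. tlift (\<lambda>z w. dapp w h *\<^sub>C z) t =
     tlift (\<lambda>h1 h2. dapp \<upsilon> h2 *\<^sub>C act G h1 y) (Delta G h)))"


subsection \<open>Morphisms from the dual of \<open>H\<close> to the dual multiplier Hopf algebroid\<close>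

definition multiplier_hom :: "('h::complex_algebra_1, 'c::complex_algebra_1) yd_data \<Rightarrow>
    ('h dual \<Rightarrow> ('c, 'h) tensor dual multiplier) \<Rightarrow> bool" where
  "multiplier_hom G \<pi> \<longleftrightarrow> \<pi> ` Hhat G \<subseteq> MAhat G \<and>
     (\<forall>\<alpha>\<in>Ahat G. clinear_on (Hhat G) (\<lambda>d. mleft (\<pi> d) \<alpha>) \<and> clinear_on (Hhat G) (\<lambda>d. mright \<alpha> (\<pi> d)) \<and>
       (\<forall>d\<in>Hhat G. \<forall>e\<in>Hhat G. mleft (\<pi> (Hmult G d e)) \<alpha> = mleft (\<pi> d) (mleft (\<pi> e) \<alpha>) \<and>
          mright \<alpha> (\<pi> (Hmult G d e)) = mright (mright \<alpha> (\<pi> d)) (\<pi> e)))"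

definition hopf_morphism :: "('h::complex_algebra_1, 'c::complex_algebra_1) yd_data \<Rightarrow>
    ('h dual \<Rightarrow> ('c, 'h) tensor dual multiplier) \<Rightarrow> bool" where
  "hopf_morphism G \<pi> \<longleftrightarrow> multiplier_hom G \<pi> \<and>
     cspan {mleft (\<pi> d) \<alpha> | d \<alpha>. d \<in> Hhat G \<and> \<alpha> \<in> Ahat G} = Ahat G \<and>
     cspan {mright \<alpha> (\<pi> d) | d \<alpha>. d \<in> Hhat G \<and> \<alpha> \<in> Ahat G} = Ahat G \<and>
     (\<forall>d\<in>Hhat G. \<forall>d'\<in>Hhat G. \<forall>d''\<in>Hhat G. \<forall>\<alpha>\<in>Ahat G. \<forall>\<beta>\<in>Ahat G.
        DhatB_ext G (\<pi> d) (coset (relB G) (mleft (\<pi> d') \<alpha> \<otimes> mleft (\<pi> d'') \<beta>)) =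
          coset (relB G) (tlift_on (Hhat G) (Hhat G)
            (\<lambda>e e'. mleft (\<pi> e) \<alpha> \<otimes> mleft (\<pi> e') \<beta>) (DH_left G d d' d'')) \<and>
        DhatC_ext G (\<pi> d) (coset (relC G) (mright \<alpha> (\<pi> d') \<otimes> mright \<beta> (\<pi> d''))) =
          coset (relC G) (tlift_on (Hhat G) (Hhat G)
            (\<lambda>e e'. mright \<alpha> (\<pi> e) \<otimes> mright \<beta> (\<pi> e')) (DH_right G d' d'' d)))"

definition algebra_iso_Ahat_smash :: "('h::complex_algebra_1, 'c::complex_algebra_1) yd_data \<Rightarrow>
    (('c, 'h) tensor dual \<Rightarrow> (('c, 'h) tensor, 'h dual) tensor) \<Rightarrow> bool" where
  "algebra_iso_Ahat_smash G \<Theta> \<longleftrightarrow>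
     bij_betw \<Theta> (Ahat G) (smash G) \<and> clinear_on (Ahat G) \<Theta> \<and>
     (\<forall>\<upsilon>\<in>Ahat G. \<forall>\<omega>\<in>Ahat G. \<Theta> (Amult G \<upsilon> \<omega>) = smash_mult G (\<Theta> \<upsilon>) (\<Theta> \<omega>))"

end

theory Submission
  imports Defs
begin

text \<open>Write \<open>\<phi>\<^sub>h\<close> for the functional \<open>\<phi>(_ h)\<close> on \<open>H\<close> and \<open>y \<boxtimes> u\<close> for the functional
  \<open>z # k \<mapsto> \<mu>(z y) u(k)\<close> on \<open>A = C # H\<close>. Invariance of \<open>\<phi>\<close> gives \<open>(h y) \<cdot> \<phi> = y \<boxtimes> \<phi>\<^sub>h\<close>: the action of
  \<open>H\<close> on \<open>y\<close> that arises when \<open>h\<close> is moved past \<open>y\<close> is integrated out. The dual algebra therefore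
  consists of the sums of functionals \<open>y \<boxtimes> u\<close> with \<open>u\<close> in the dual of \<open>H\<close>, and \<open>t\<^sub>C(y) # u \<mapsto> y \<boxtimes> u\<close>
  is a linear map onto it, injective because \<open>\<mu>\<close> is faithful. This is the inverse of the
  isomorphism.

  The multiplication is computed with representing maps: every element of the dual algebra has the
  form \<open>z # k \<mapsto> \<mu>(z F(k))\<close> for a unique linear \<open>F : H \<rightarrow> C\<close>, and the product of the dual algebra
  becomes \<open>(F \<star> K)(k) = K(k\<^sub>2)\<^sub>0 F(K(k\<^sub>2)\<^sub>1 k\<^sub>1)\<close>. This formula defines an associative product on
  all linear maps \<open>H \<rightarrow> C\<close>. The algebra \<open>C\<close> sits in it as the maps \<open>k \<mapsto> k \<rhd> y\<close>; braided commutativity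
  describes left multiplication by these maps and the Yetter--Drinfeld condition describes right
  multiplication. Functionals on \<open>H\<close> sit in it as scalar valued maps. Strong invariance of \<open>\<phi>\<close> turns
  all convolution formulas back into finite sums of generators \<open>y \<boxtimes> \<phi>\<^sub>h\<close>; in this way the algebra
  isomorphism, the embeddings of \<open>B\<close> and \<open>C\<close>, the counit functional and the dual integral are read
  off.

  For the left comultiplication, an element \<open>\<alpha> \<otimes> \<beta>\<close> of the balanced tensor product is described by
  the function \<open>(k, l) \<mapsto> (G(l) \<star> F)(k)\<close> of two variables, where \<open>F\<close> and \<open>G\<close> represent \<open>\<alpha>\<close> and \<open>\<beta>\<close>
  and \<open>G(l)\<close> is regarded as an element of the convolution algebra. The balancing relations are
  exactly the tensors whose function vanishes (lemma \<open>evB_kernel\<close>). In this model the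
  comultiplication of an element represented by \<open>F\<close> is the operator \<open>coprod_op F\<close>, which convolves
  with translates of \<open>F\<close>; since \<open>H\<close> is a bialgebra, these operators are multiplicative in \<open>F\<close> (lemma
  \<open>coprod_op_conv\<close>), and this determines the extension to multipliers. That \<open>\<upsilon> \<mapsto> 1 # \<upsilon>\<close> respects the
  comultiplications is then the identity \<open>coprod_op_sc\<close>, which rests on the exchange of a functional
  on \<open>H\<close> with an element of \<open>C\<close> inside the convolution algebra.

  The right comultiplication needs no second computation. The anti-automorphism
  \<open>\<theta>(z k) = S\<^sup>-\<^sup>1(k) t\<^sub>C(z)\<close> of \<open>A\<close> exchanges \<open>C\<close> and \<open>B\<close>, and its transpose is an
  anti-multiplicative bijection of the dual algebra. It preserves the dual algebra because
  \<open>\<phi> \<circ> S = \<phi>\<close> and because \<open>\<phi>\<close> has a modular automorphism. It carries the tensor product balanced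
  over \<open>C\<close> to the one balanced over \<open>B\<close> and the right comultiplication to the left one.\<close>

section \<open>Multilinear bookkeeping for tensor products\<close>

text \<open>The rewriting rules for Sweedler sums below have multilinearity as side conditions. The rules
  collected here follow the structure of a term, so that \<open>intro lin\<close> discharges these conditions.\<close>

named_theorems lin

(* Nested scalars are the shape in which the Sweedler rules below match a sum. *)
declare complex_vector.scale_scale [simp del]

lemma clinear_ident [lin]: "clinear (\<lambda>x. x)"
  by (rule clinearI) simp_all

lemma clinear_zero [lin]: "clinear (\<lambda>x. 0)"
  by (rule clinearI) simp_all

lemma clinear_plus [lin]: "clinear f \<Longrightarrow> clinear g \<Longrightarrow> clinear (\<lambda>x. f x + g x)"
  by (rule clinearI) (simp_all add: clinear_add clinear_scaleC scaleC_add_right algebra_simps)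

lemma clinear_comp: "clinear g \<Longrightarrow> clinear f \<Longrightarrow> clinear (\<lambda>x. g (f x))"
  by (rule clinearI) (simp_all add: clinear_add clinear_scaleC)

lemma clinear_scale [lin]: "clinear f \<Longrightarrow> clinear (\<lambda>x. c *\<^sub>C f x)"
  by (rule clinearI) (simp_all add: clinear_add clinear_scaleC scaleC_add_right scaleC_scaleC mult.commute)

lemma clinear_scale_left [lin]: "clinear f \<Longrightarrow> clinear (\<lambda>x. f x *\<^sub>C v)" for f :: "_ \<Rightarrow> complex"
  by (rule clinearI) (simp_all add: clinear_add clinear_scaleC scaleC_add_left scaleC_scaleC scaleC_complex_def)

lemma clinear_mult_left [lin]: "clinear f \<Longrightarrow> clinear (\<lambda>x. f x * b)" for b :: "'a::complex_algebra_1"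
  by (rule clinearI) (simp_all add: clinear_add clinear_scaleC algebra_simps mult_scaleC_left)

lemma clinear_mult_right [lin]: "clinear f \<Longrightarrow> clinear (\<lambda>x. b * f x)" for b :: "'a::complex_algebra_1"
  by (rule clinearI) (simp_all add: clinear_add clinear_scaleC algebra_simps mult_scaleC_right)

lemma clinear_tensor_left [lin]: "clinear f \<Longrightarrow> clinear (\<lambda>x. f x \<otimes> b)"
  by (rule clinearI) (simp_all add: clinear_add clinear_scaleC tensor_op_add_left tensor_op_scaleC_left)

lemma clinear_tensor_right [lin]: "clinear f \<Longrightarrow> clinear (\<lambda>x. b \<otimes> f x)"
  by (rule clinearI) (simp_all add: clinear_add clinear_scaleC tensor_op_add_right tensor_op_scaleC_right)

lemma cbilinearI [lin]:
  "(\<And>a. clinear (\<lambda>b. f a b)) \<Longrightarrow> (\<And>b. clinear (\<lambda>a. f a b)) \<Longrightarrow> cbilinear f"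
  by (simp add: cbilinear_def)

lemma cbilinearD: "cbilinear f \<Longrightarrow> clinear (f a)" "cbilinear f \<Longrightarrow> clinear (\<lambda>a. f a b)"
  by (simp_all add: cbilinear_def)

lemma clinear_0: "clinear f \<Longrightarrow> f 0 = 0"
  using clinear_scaleC[of f 0 0] by simp

lemma clinear_minus: "clinear f \<Longrightarrow> f (x - y) = f x - f y"
  using clinear_add[of f "x - y" y] by simp

lemma linear_subspace_image:
  assumes "clinear f" "complex_vector.subspace W"
  shows "complex_vector.subspace (f ` W)"
  unfolding complex_vector.subspace_def
proof (intro conjI allI ballI)
  show "0 \<in> f ` W"
    using complex_vector.subspace_0[OF assms(2)] clinear_0[OF assms(1)] by (metis imageI)
  fix x assume "x \<in> f ` W"
  then obtain a where a: "x = f a" "a \<in> W" by blast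
  show "c *\<^sub>C x \<in> f ` W" for c
    using complex_vector.subspace_scale[OF assms(2) a(2), of c] by (simp add: a clinear_scaleC[OF assms(1), symmetric])
  fix y assume "y \<in> f ` W"
  then obtain b where b: "y = f b" "b \<in> W" by blast
  show "x + y \<in> f ` W"
    using complex_vector.subspace_add[OF assms(2) a(2) b(2)] by (simp add: a b clinear_add[OF assms(1), symmetric])
qed

lemma subspace_range: "clinear f \<Longrightarrow> complex_vector.subspace (range f)"
  by (rule linear_subspace_image) (simp_all add: complex_vector.subspace_def)

lemma clinear_dapp [lin]: "clinear (dapp u)"
  using dapp[of u] by simp

lemma dapp_comp [lin]: "clinear f \<Longrightarrow> clinear (\<lambda>x. dapp u (f x))"
  by (rule clinear_comp[OF clinear_dapp])

lemma dapp_comp_left [lin]: "clinear f \<Longrightarrow> clinear (\<lambda>x. dapp (f x) k)"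
  by (rule clinearI)
    (simp_all add: clinear_add clinear_scaleC plus_dual.rep_eq scaleC_dual.rep_eq scaleC_complex_def)

lemma dapp_Dual: "clinear f \<Longrightarrow> dapp (Dual f) = f"
  by (simp add: Dual_inverse)

lemma dual_eqI: "(\<And>k. dapp u k = dapp v k) \<Longrightarrow> u = v"
  by (metis dapp_inject ext)

text \<open>The list chosen in the definition of \<^const>\<open>tlift_on\<close> depends on the tensor only; hence
  \<^const>\<open>tlift_on\<close> is additive in the map and satisfies Fubini without any linearity assumption.\<close>

definition tensor_terms :: "'a::complex_vector set \<Rightarrow> 'b::complex_vector set \<Rightarrow> ('a, 'b) tensor \<Rightarrow> ('a \<times> 'b) list" where
  "tensor_terms U V t = (SOME xs. set xs \<subseteq> U \<times> V \<and> t = (\<Sum>(u, v)\<leftarrow>xs. u \<otimes> v))"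

lemma tlift_on_terms: "tlift_on U V f t = (\<Sum>(u, v)\<leftarrow>tensor_terms U V t. f u v)"
  by (simp add: tlift_on_def tensor_terms_def)

lemma tensor_terms:
  assumes "complex_vector.subspace U" "t \<in> tsub U V"
  shows "set (tensor_terms U V t) \<subseteq> U \<times> V" "(\<Sum>(u, v)\<leftarrow>tensor_terms U V t. u \<otimes> v) = t"
  using someI_ex[OF tsub_repr[OF assms]] unfolding tensor_terms_def by auto

lemma tensor_terms_UNIV: "(\<Sum>(u, v)\<leftarrow>tensor_terms UNIV UNIV t. u \<otimes> v) = t"
  by (rule tensor_terms) (simp_all add: tsub_UNIV)

lemma tlift_on_push: "clinear g \<Longrightarrow> g (tlift_on U V f t) = tlift_on U V (\<lambda>a b. g (f a b)) t"
  unfolding tlift_on_terms by (simp add: clinear_sum_list case_prod_unfold)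

lemma tlift_on_zero [simp]: "tlift_on U V (\<lambda>a b. 0) t = 0"
  unfolding tlift_on_terms by (simp add: case_prod_unfold)

lemma tlift_on_add: "tlift_on U V (\<lambda>a b. f a b + g a b) t = tlift_on U V f t + tlift_on U V g t"
  unfolding tlift_on_terms by (simp add: case_prod_unfold sum_list_addf)

lemma tlift_on_scale: "tlift_on U V (\<lambda>a b. c *\<^sub>C f a b) t = c *\<^sub>C tlift_on U V f t"
  by (rule tlift_on_push[symmetric]) (intro lin)

lemma tlift_on_swap:
  "tlift_on U V (\<lambda>a b. tlift_on U' V' (\<lambda>c d. f a b c d) s) t
   = tlift_on U' V' (\<lambda>c d. tlift_on U V (\<lambda>a b. f a b c d) t) s"
proof -
  have "(\<Sum>(a, b)\<leftarrow>xs. \<Sum>(c, d)\<leftarrow>ys. f a b c d) = (\<Sum>(c, d)\<leftarrow>ys. \<Sum>(a, b)\<leftarrow>xs. f a b c d)" for xs ys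
    by (induction xs) (simp_all add: case_prod_unfold sum_list_addf)
  then show ?thesis unfolding tlift_on_terms .
qed

lemma clinear_tlift_on_fun [lin]:
  "(\<And>a b. clinear (\<lambda>x. F x a b)) \<Longrightarrow> clinear (\<lambda>x. tlift_on U V (F x) t)"
proof (rule clinearI)
  assume "\<And>a b. clinear (\<lambda>x. F x a b)"
  note F = clinear_add[OF this] clinear_scaleC[OF this]
  show "tlift_on U V (F (x + y)) t = tlift_on U V (F x) t + tlift_on U V (F y) t" for x y
    using F(1)[of x y] by (simp add: tlift_on_terms case_prod_unfold sum_list_addf)
  show "tlift_on U V (F (c *\<^sub>C x)) t = c *\<^sub>C tlift_on U V (F x) t" for c x
    using F(2)[of c x] tlift_on_scale[of U V c "F x" t] by (simp add: tlift_on_terms case_prod_unfold)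
qed

lemma clinear_tlift_arg [lin]: "cbilinear F \<Longrightarrow> clinear g \<Longrightarrow> clinear (\<lambda>x. tlift F (g x))"
  by (rule clinear_comp[OF clinear_tlift])

lemma tlift_on_cong:
  assumes "complex_vector.subspace U" "t \<in> tsub U V" "\<And>a b. a \<in> U \<Longrightarrow> b \<in> V \<Longrightarrow> f a b = g a b"
  shows "tlift_on U V f t = tlift_on U V g t"
  unfolding tlift_on_terms
  using tensor_terms(1)[OF assms(1,2)] assms(3) by (intro arg_cong[of _ _ sum_list] map_cong) auto

text \<open>A map given on subspaces only may be replaced by any bilinear map on the ambient spaces that
  extends it.\<close>

lemma tlift_on_eq_tlift:
  assumes "complex_vector.subspace U" "t \<in> tsub U V" "cbilinear g"
    and "\<And>a b. a \<in> U \<Longrightarrow> b \<in> V \<Longrightarrow> f a b = g a b"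
  shows "tlift_on U V f t = tlift g t"
proof -
  have "tlift g t = tlift g (tlift_on U V (\<lambda>a b. a \<otimes> b) t)"
    using tensor_terms(2)[OF assms(1,2)] by (simp add: tlift_on_terms)
  also have "\<dots> = tlift_on U V (\<lambda>a b. tlift g (a \<otimes> b)) t"
    by (rule tlift_on_push[OF clinear_tlift[OF assms(3)]])
  also have "\<dots> = tlift_on U V f t"
    using assms by (intro tlift_on_cong) (simp_all add: tlift_tensor)
  finally show ?thesis ..
qed

lemma tlift_tensor_id: "tlift (\<lambda>a b. a \<otimes> b) t = t"
  using tensor_terms_UNIV[of t] by (simp add: tlift_on_terms)

lemma tlift_on_tensor_id:
  "complex_vector.subspace U \<Longrightarrow> t \<in> tsub U V \<Longrightarrow> tlift_on U V (\<lambda>a b. a \<otimes> b) t = t"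
  using tensor_terms(2)[of U t V] by (simp add: tlift_on_terms)

lemma tensor_ext:
  assumes "clinear f" "clinear g" "\<And>a b. f (a \<otimes> b) = g (a \<otimes> b)"
  shows "f t = g t"
  using tlift_on_push[OF assms(1), of UNIV UNIV "(\<otimes>)" t] tlift_on_push[OF assms(2), of UNIV UNIV "(\<otimes>)" t]
  by (simp add: tlift_tensor_id assms(3))

lemma tensor_in_tsub: "u \<in> U \<Longrightarrow> v \<in> V \<Longrightarrow> u \<otimes> v \<in> tsub U V"
  unfolding tsub_def by (blast intro: complex_vector.span_base)

lemma subspace_tsub [simp]: "complex_vector.subspace (tsub U V)"
  unfolding tsub_def by (rule complex_vector.subspace_span)

lemma tlift_on_in_subspace:
  assumes "complex_vector.subspace W" "complex_vector.subspace U" "t \<in> tsub U V"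
    and "\<And>a b. a \<in> U \<Longrightarrow> b \<in> V \<Longrightarrow> f a b \<in> W"
  shows "tlift_on U V f t \<in> W"
proof -
  have "(\<Sum>(u, v)\<leftarrow>xs. f u v) \<in> W" if "set xs \<subseteq> U \<times> V" for xs
    using that assms(1,4) by (induction xs) (auto simp: complex_vector.subspace_add complex_vector.subspace_0)
  then show ?thesis unfolding tlift_on_terms using tensor_terms(1)[OF assms(2,3)] by blast
qed

lemma tlift_in_subspace:
  "complex_vector.subspace W \<Longrightarrow> (\<And>a b. f a b \<in> W) \<Longrightarrow> tlift f t \<in> W"
  by (rule tlift_on_in_subspace) (simp_all add: tsub_UNIV)

lemma tlift_on_same: "(\<And>a b. f a b = g a b) \<Longrightarrow> tlift_on U V f t = tlift_on U V g t"
  by (simp add: tlift_on_terms)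

text \<open>Expand the first leg of the tensor in a basis: the coefficients are killed by every functional
  of the family, hence by the second argument of \<open>F\<close>.\<close>

lemma tlift_vanishes_if_slices_vanish:
  fixes t :: "('a::complex_vector, 'b::complex_vector) tensor" and f :: "'k \<Rightarrow> 'b \<Rightarrow> complex"
  assumes f: "\<And>k. clinear (f k)"
    and slices: "\<And>k. tlift (\<lambda>a b. f k b *\<^sub>C a) t = 0"
    and F: "cbilinear F" and kill: "\<And>a b. (\<And>k. f k b = 0) \<Longrightarrow> F a b = 0"
  shows "tlift F t = 0"
proof -
  define E :: "'a set" where "E = complex_vector.extend_basis {}"
  have E: "complex_vector.independent E" "complex_vector.span E = UNIV"
    unfolding E_def
    by (simp_all add: complex_vector.independent_extend_basis complex_vector.independent_empty
        complex_vector.span_extend_basis)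
  define r where "r = complex_vector.representation E"
  have r_lin: "clinear (\<lambda>a. r a e)" for e
    unfolding r_def using E
    by (intro clinearI) (simp_all add: complex_vector.representation_add
        complex_vector.representation_scale scaleC_complex_def)
  have r_fin: "finite {e. r a e \<noteq> 0}" for a
    unfolding r_def by (rule complex_vector.finite_representation)
  have r_sum: "(\<Sum>e | r a e \<noteq> 0. r a e *\<^sub>C e) = a" for a
    using complex_vector.sum_nonzero_representation_eq[OF E(1), of a] E(2) by (simp add: r_def)
  define xs where "xs = tensor_terms UNIV UNIV t"
  define S where "S = (\<Union>(a, b)\<in>set xs. {e. r a e \<noteq> 0})"
  have S: "finite S" unfolding S_def using r_fin by auto
  have a_eq: "a = (\<Sum>e\<in>S. r a e *\<^sub>C e)" if "(a, b) \<in> set xs" for a b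
    using that r_sum[of a] S sum.mono_neutral_right[of S "{e. r a e \<noteq> 0}" "\<lambda>e. r a e *\<^sub>C e"]
    unfolding S_def by force
  note lin2 = cbilinearD[OF F]
  \<comment> \<open>the coefficient of the basis vector \<open>e\<close>\<close>
  define y where "y e = (\<Sum>(a, b)\<leftarrow>xs. r a e *\<^sub>C b)" for e
  have fy: "f k (y e) = 0" for k e
  proof -
    have "f k (y e) = (\<Sum>(a, b)\<leftarrow>xs. r a e *\<^sub>C f k b)"
      unfolding y_def by (simp add: clinear_sum_list[OF f] clinear_scaleC[OF f] case_prod_unfold)
    also have "\<dots> = r (\<Sum>(a, b)\<leftarrow>xs. f k b *\<^sub>C a) e"
      by (simp add: clinear_sum_list[OF r_lin] clinear_scaleC[OF r_lin] case_prod_unfold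
          scaleC_complex_def mult.commute)
    also have "\<dots> = 0"
      using slices[of k] clinear_0[OF r_lin] by (simp add: tlift_on_terms xs_def)
    finally show ?thesis .
  qed
  have "tlift F t = (\<Sum>(a, b)\<leftarrow>xs. F a b)"
    by (simp add: tlift_on_terms xs_def)
  also have "\<dots> = (\<Sum>(a, b)\<leftarrow>xs. \<Sum>e\<in>S. F e (r a e *\<^sub>C b))"
  proof (intro arg_cong[of _ _ sum_list] map_cong refl)
    fix x assume x: "x \<in> set xs"
    obtain a b where ab: "x = (a, b)" by (cases x)
    have "F a b = F (\<Sum>e\<in>S. r a e *\<^sub>C e) b"
      using a_eq x ab by simp
    also have "\<dots> = (\<Sum>e\<in>S. F e (r a e *\<^sub>C b))"
      using S by (induction S) (simp_all add: clinear_add[OF lin2(2)] clinear_0[OF lin2(2)]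
          clinear_scaleC[OF lin2(2)] clinear_scaleC[OF lin2(1)])
    finally show "(case x of (a, b) \<Rightarrow> F a b) = (case x of (a, b) \<Rightarrow> \<Sum>e\<in>S. F e (r a e *\<^sub>C b))"
      by (simp add: ab)
  qed
  also have "\<dots> = (\<Sum>e\<in>S. F e (y e))"
    unfolding y_def
    by (induction xs) (auto simp: case_prod_unfold clinear_0[OF lin2(1)] clinear_add[OF lin2(1)] sum.distrib)
  also have "\<dots> = 0"
    using kill[OF fy] by simp
  finally show ?thesis .
qed

lemma tsub_induct [consumes 2, case_names zero tensor add]:
  assumes "t \<in> tsub U V" "complex_vector.subspace U"
    and "P 0" "\<And>u v. u \<in> U \<Longrightarrow> v \<in> V \<Longrightarrow> P (u \<otimes> v)"
    and "\<And>s t. s \<in> tsub U V \<Longrightarrow> t \<in> tsub U V \<Longrightarrow> P s \<Longrightarrow> P t \<Longrightarrow> P (s + t)"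
  shows "P t"
proof -
  have "(\<Sum>(u, v)\<leftarrow>xs. u \<otimes> v) \<in> tsub U V \<and> P (\<Sum>(u, v)\<leftarrow>xs. u \<otimes> v)" if "set xs \<subseteq> U \<times> V" for xs
    using that
    by (induction xs) (auto simp: assms(3,4) tensor_in_tsub complex_vector.subspace_0
        complex_vector.subspace_add intro!: assms(5))
  then show ?thesis
    using tensor_terms[OF assms(2,1)] by metis
qed

lemma clinear_onI:
  "(\<And>u v. u \<in> V \<Longrightarrow> v \<in> V \<Longrightarrow> f (u + v) = f u + f v) \<Longrightarrow>
   (\<And>c v. v \<in> V \<Longrightarrow> f (c *\<^sub>C v) = c *\<^sub>C f v) \<Longrightarrow> clinear_on V f"
  by (simp add: clinear_on_def)

lemma clinear_on_add: "clinear_on V f \<Longrightarrow> u \<in> V \<Longrightarrow> v \<in> V \<Longrightarrow> f (u + v) = f u + f v"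
  and clinear_on_scale: "clinear_on V f \<Longrightarrow> v \<in> V \<Longrightarrow> f (c *\<^sub>C v) = c *\<^sub>C f v"
  by (simp_all add: clinear_on_def)

lemma clinear_on_zero: "clinear_on V f \<Longrightarrow> complex_vector.subspace V \<Longrightarrow> f 0 = 0"
  using clinear_on_scale[of V f 0 0] by (simp add: complex_vector.subspace_0)

lemma clinear_on_diff:
  assumes "clinear_on V f" "complex_vector.subspace V" "u \<in> V" "v \<in> V"
  shows "f (u - v) = f u - f v"
  using clinear_on_add[OF assms(1), of "u - v" v] assms(2-4)
  by (simp add: complex_vector.subspace_diff)

lemma tlift_on_push_on:
  assumes g: "clinear_on W g" and W: "complex_vector.subspace W"
    and U: "complex_vector.subspace U" and t: "t \<in> tsub U V"
    and f: "\<And>a b. a \<in> U \<Longrightarrow> b \<in> V \<Longrightarrow> f a b \<in> W"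
  shows "g (tlift_on U V f t) = tlift_on U V (\<lambda>a b. g (f a b)) t"
proof -
  have "(\<Sum>(a, b)\<leftarrow>xs. f a b) \<in> W \<and> g (\<Sum>(a, b)\<leftarrow>xs. f a b) = (\<Sum>(a, b)\<leftarrow>xs. g (f a b))"
    if "set xs \<subseteq> U \<times> V" for xs
    using that by (induction xs)
      (auto simp: clinear_on_zero[OF g W] complex_vector.subspace_0[OF W] f
        complex_vector.subspace_add[OF W] clinear_on_add[OF g])
  then show ?thesis unfolding tlift_on_terms using tensor_terms(1)[OF U t] by blast
qed

section \<open>Endomorphisms of quotients described by evaluation maps\<close>

lemma coset_eq_iff:
  assumes "complex_vector.subspace R"
  shows "coset R s = coset R t \<longleftrightarrow> s - t \<in> R"
proof
  assume "coset R s = coset R t"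
  moreover have "s \<in> coset R s"
    using complex_vector.subspace_0[OF assms] by (force simp: coset_def)
  ultimately obtain r where "s = t + r" "r \<in> R" by (auto simp: coset_def)
  then show "s - t \<in> R" by simp
next
  assume st: "s - t \<in> R"
  have "coset R s \<subseteq> coset R t" if "s - t \<in> R" for s t
  proof
    fix x assume "x \<in> coset R s"
    then obtain r where "x = s + r" "r \<in> R" by (auto simp: coset_def)
    then have "x = t + ((s - t) + r)" "(s - t) + r \<in> R"
      using that complex_vector.subspace_add[OF assms] by auto
    then show "x \<in> coset R t" unfolding coset_def by blast
  qed
  from this[OF st] this[of t s] show "coset R s = coset R t"
    using st complex_vector.subspace_neg[OF assms, of "s - t"] by auto
qed

lemma coset_rep_diff:
  assumes "complex_vector.subspace R"
  shows "coset_rep (coset R t) - t \<in> R"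
proof -
  have "t \<in> coset R t"
    using complex_vector.subspace_0[OF assms] by (force simp: coset_def)
  then have "coset_rep (coset R t) \<in> coset R t" unfolding coset_rep_def by (rule someI)
  then show ?thesis by (auto simp: coset_def)
qed

text \<open>The quotient of \<open>T\<close> by \<open>R\<close> is identified with a space of functions by a family of linear maps
  on \<open>T\<close> whose common kernel is \<open>R\<close>. Endomorphisms of the quotient can then be described by
  operators on functions, which replaces calculations with cosets and representatives by
  calculations with values.\<close>

locale evaluated_quotient =
  fixes T R :: "'t::complex_vector set" and ev :: "'t \<Rightarrow> 'i \<Rightarrow> 'v::complex_vector"
  assumes T: "complex_vector.subspace T" and R_sub: "R \<subseteq> T"
    and ev_lin: "\<And>i. clinear_on T (\<lambda>t. ev t i)"
    and ev_kernel: "\<And>t. t \<in> T \<Longrightarrow> (\<And>i. ev t i = 0) \<Longrightarrow> t \<in> R"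
    and ev_R: "\<And>t i. t \<in> R \<Longrightarrow> ev t i = 0"
begin

lemma ev_add: "s \<in> T \<Longrightarrow> t \<in> T \<Longrightarrow> ev (s + t) = (\<lambda>i. ev s i + ev t i)"
  and ev_scale: "t \<in> T \<Longrightarrow> ev (c *\<^sub>C t) = (\<lambda>i. c *\<^sub>C ev t i)"
  and ev_diff: "s \<in> T \<Longrightarrow> t \<in> T \<Longrightarrow> ev (s - t) = (\<lambda>i. ev s i - ev t i)"
  by (simp_all add: fun_eq_iff clinear_on_add[OF ev_lin] clinear_on_scale[OF ev_lin]
      clinear_on_diff[OF ev_lin T])

lemma R: "complex_vector.subspace R"
  unfolding complex_vector.subspace_def
proof (intro conjI allI ballI)
  have T0: "0 \<in> T" by (rule complex_vector.subspace_0[OF T])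
  show "0 \<in> R" by (rule ev_kernel[OF T0]) (rule clinear_on_zero[OF ev_lin T])
  show "x + y \<in> R" if "x \<in> R" "y \<in> R" for x y
    using that R_sub by (intro ev_kernel complex_vector.subspace_add[OF T]) (auto simp: ev_add ev_R subset_iff)
  show "c *\<^sub>C x \<in> R" if "x \<in> R" for c x
    using that R_sub by (intro ev_kernel complex_vector.subspace_scale[OF T]) (auto simp: ev_scale ev_R subset_iff)
qed

lemma coset_eq_iff_ev: "s \<in> T \<Longrightarrow> t \<in> T \<Longrightarrow> coset R s = coset R t \<longleftrightarrow> ev s = ev t"
proof -
  assume st: "s \<in> T" "t \<in> T"
  have "s - t \<in> R \<longleftrightarrow> (\<forall>i. ev (s - t) i = 0)"
    using ev_kernel[of "s - t"] ev_R complex_vector.subspace_diff[OF T st] by blast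
  then show ?thesis by (simp add: coset_eq_iff[OF R] ev_diff[OF st] fun_eq_iff)
qed

lemma coset_rep: "t \<in> T \<Longrightarrow> coset_rep (coset R t) \<in> T" "t \<in> T \<Longrightarrow> ev (coset_rep (coset R t)) = ev t"
proof -
  assume t: "t \<in> T"
  have "coset_rep (coset R t) - t \<in> R" by (rule coset_rep_diff[OF R])
  then show 1: "coset_rep (coset R t) \<in> T"
    using R_sub complex_vector.subspace_add[OF T _ t, of "coset_rep (coset R t) - t"] by auto
  show "ev (coset_rep (coset R t)) = ev t"
    using \<open>coset_rep (coset R t) - t \<in> R\<close> coset_eq_iff_ev[OF 1 t] by (simp add: coset_eq_iff[OF R])
qed

definition realizes :: "('t set \<Rightarrow> 't set) \<Rightarrow> (('i \<Rightarrow> 'v) \<Rightarrow> ('i \<Rightarrow> 'v)) \<Rightarrow> bool" where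
  "realizes F L \<longleftrightarrow> F \<in> quot_endo T R \<and> (\<forall>t\<in>T. \<forall>s\<in>T. ev s = L (ev t) \<longrightarrow> F (coset R t) = coset R s)"

lemma realizes_endo: "realizes F L \<Longrightarrow> F \<in> quot_endo T R"
  and realizes_eq: "realizes F L \<Longrightarrow> t \<in> T \<Longrightarrow> s \<in> T \<Longrightarrow> ev s = L (ev t) \<Longrightarrow> F (coset R t) = coset R s"
  by (auto simp: realizes_def)

text \<open>Choose representatives; linearity of the resulting map on cosets can be read off from the
  evaluations.\<close>

lemma realizes_exists:
  assumes ex: "\<And>t. t \<in> T \<Longrightarrow> \<exists>s\<in>T. ev s = L (ev t)"
    and add: "\<And>s t. s \<in> T \<Longrightarrow> t \<in> T \<Longrightarrow> L (\<lambda>i. ev s i + ev t i) = (\<lambda>i. L (ev s) i + L (ev t) i)"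
    and scale: "\<And>c t. t \<in> T \<Longrightarrow> L (\<lambda>i. c *\<^sub>C ev t i) = (\<lambda>i. c *\<^sub>C L (ev t) i)"
  shows "\<exists>F. realizes F L"
proof -
  define pick where "pick t = (SOME s. s \<in> T \<and> ev s = L (ev t))" for t
  have pick: "pick t \<in> T" "ev (pick t) = L (ev t)" if "t \<in> T" for t
    using someI_ex[of "\<lambda>s. s \<in> T \<and> ev s = L (ev t)"] ex[OF that] unfolding pick_def by auto
  define F where "F = (\<lambda>X\<in>quot T R. coset R (pick (coset_rep X)))"
  have F: "F (coset R t) = coset R s" if "t \<in> T" "s \<in> T" "ev s = L (ev t)" for t s
  proof -
    have "coset R t \<in> quot T R" using that by (simp add: quot_def)
    then have "F (coset R t) = coset R (pick (coset_rep (coset R t)))" by (simp add: F_def)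
    also have "\<dots> = coset R s"
      using that coset_rep[OF that(1)] pick[OF coset_rep(1)[OF that(1)]] by (simp add: coset_eq_iff_ev)
    finally show ?thesis .
  qed
  have F_img: "F (coset R t) = coset R (pick t)" if "t \<in> T" for t
    using F[OF that pick[OF that]] .
  have "F \<in> quot T R \<rightarrow>\<^sub>E quot T R"
  proof (rule PiE_I)
    show "F X \<in> quot T R" if "X \<in> quot T R" for X
    proof -
      from that obtain t where "t \<in> T" "X = coset R t" by (auto simp: quot_def)
      then show ?thesis using F_img pick by (auto simp: quot_def)
    qed
  qed (simp add: F_def)
  moreover have "F (coset R (t + t')) = coset R (s + s') \<and> F (coset R (c *\<^sub>C t)) = coset R (c *\<^sub>C s)"
    if "t \<in> T" "t' \<in> T" "s \<in> T" "s' \<in> T" "F (coset R t) = coset R s" "F (coset R t') = coset R s'" for t t' s s' c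
  proof -
    have "ev s = L (ev t)" "ev s' = L (ev t')"
      using that pick[of t] pick[of t'] by (simp_all add: F_img coset_eq_iff_ev)
    then show ?thesis
      using that T by (intro conjI F)
        (simp_all add: complex_vector.subspace_add complex_vector.subspace_scale ev_add ev_scale add scale)
  qed
  ultimately have "F \<in> quot_endo T R" by (simp add: quot_endo_def)
  then show ?thesis using F by (auto simp: realizes_def)
qed

text \<open>The two endomorphisms agree on a subspace of representatives.\<close>

lemma quot_endo_unique:
  assumes F: "F \<in> quot_endo T R" and F': "F' \<in> quot_endo T R"
    and E: "E \<subseteq> T" "T \<subseteq> complex_vector.span E" and eq: "\<And>t. t \<in> E \<Longrightarrow> F (coset R t) = F' (coset R t)"
  shows "F = F'"
proof -
  have img: "\<exists>s\<in>T. K (coset R t) = coset R s" if "K \<in> quot_endo T R" "t \<in> T" for K t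
  proof -
    have "coset R t \<in> quot T R" using that by (simp add: quot_def)
    then have "K (coset R t) \<in> quot T R" using that(1) by (auto simp: quot_endo_def)
    then show ?thesis by (auto simp: quot_def)
  qed
  have lin: "K (coset R (t + t')) = coset R (s + s')" "K (coset R (c *\<^sub>C t)) = coset R (c *\<^sub>C s)"
    if "K \<in> quot_endo T R" "t \<in> T" "t' \<in> T" "s \<in> T" "s' \<in> T" "K (coset R t) = coset R s"
      "K (coset R t') = coset R s'" for K t t' s s' c
    using that unfolding quot_endo_def by auto
  define W where "W = {t \<in> T. F (coset R t) = F' (coset R t)}"
  have "complex_vector.subspace W"
    unfolding complex_vector.subspace_def
  proof (intro conjI allI ballI)
    have T0: "0 \<in> T" by (rule complex_vector.subspace_0[OF T])
    from img[OF F T0] obtain s where s: "s \<in> T" "F (coset R 0) = coset R s" by blast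
    from img[OF F' T0] obtain s' where s': "s' \<in> T" "F' (coset R 0) = coset R s'" by blast
    show "0 \<in> W"
      using lin(2)[OF F T0 T0 s(1) s(1) s(2) s(2), of 0] lin(2)[OF F' T0 T0 s'(1) s'(1) s'(2) s'(2), of 0] T0
      by (simp add: W_def)
    fix t assume t: "t \<in> W"
    then obtain s where s: "s \<in> T" "F (coset R t) = coset R s" "F' (coset R t) = coset R s"
      using img[OF F, of t] by (auto simp: W_def)
    show "c *\<^sub>C t \<in> W" for c
      using t lin(2)[OF F _ _ s(1) s(1) s(2) s(2), of c] lin(2)[OF F' _ _ s(1) s(1) s(3) s(3), of c]
      by (simp add: W_def complex_vector.subspace_scale[OF T])
    fix t' assume t': "t' \<in> W"
    then obtain s' where s': "s' \<in> T" "F (coset R t') = coset R s'" "F' (coset R t') = coset R s'"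
      using img[OF F, of t'] by (auto simp: W_def)
    show "t + t' \<in> W"
      using t t' lin(1)[OF F _ _ s(1) s'(1) s(2) s'(2)] lin(1)[OF F' _ _ s(1) s'(1) s(3) s'(3)]
      by (simp add: W_def complex_vector.subspace_add[OF T])
  qed
  moreover have "E \<subseteq> W" using E(1) eq by (auto simp: W_def)
  ultimately have "T \<subseteq> W" using E(2) complex_vector.span_minimal by blast
  show "F = F'"
  proof
    fix X
    show "F X = F' X"
    proof (cases "X \<in> quot T R")
      case True
      then show ?thesis using \<open>T \<subseteq> W\<close> by (auto simp: quot_def W_def)
    next
      case False
      then show ?thesis using F F' by (auto simp: quot_endo_def PiE_def extensional_def)
    qed
  qed
qed

text \<open>The dual comultiplications are specified as the unique endomorphism of a quotient with
  prescribed values on a spanning set. An operator with these values identifies that endomorphism.\<close>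

lemma the_quot_endo_realizes:
  assumes F: "realizes F L" and E: "E \<subseteq> T" "T \<subseteq> complex_vector.span E"
    and P: "P F" "\<And>F'. P F' \<Longrightarrow> F' \<in> quot_endo T R" "\<And>F' t. P F' \<Longrightarrow> t \<in> E \<Longrightarrow> F' (coset R t) = F (coset R t)"
  shows "realizes (THE F'. P F') L"
proof -
  have "(THE F'. P F') = F"
  proof (rule the_equality)
    show "P F" by (rule P(1))
    fix F' assume "P F'"
    then show "F' = F" by (intro quot_endo_unique[OF P(2) realizes_endo[OF F] E] P(3))
  qed
  then show ?thesis using F by simp
qed

end

section \<open>Sweedler calculus\<close>

locale yd_setting =
  fixes G :: "('h::complex_algebra_1, 'c::complex_algebra_1) yd_data"
  assumes hopf: "regular_hopf_algebra (Delta G) (eps G) (antip G)"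
    and integral: "normalized_integral (Delta G) (phiH G)"
    and yd_algebra: "braided_commutative_yd_algebra G"
    and mu_linear: "clinear (muC G)" and mu_faithful: "faithful_functional (muC G)"
    and mu_one: "muC G 1 = 1"
    and mu_invariant: "invariant_functional G"
begin

abbreviation sw :: "'h \<Rightarrow> ('h \<Rightarrow> 'h \<Rightarrow> 'v::complex_vector) \<Rightarrow> 'v" where
  "sw h f \<equiv> tlift f (Delta G h)"

abbreviation cw :: "'c \<Rightarrow> ('c \<Rightarrow> 'h \<Rightarrow> 'v::complex_vector) \<Rightarrow> 'v" where
  "cw y f \<equiv> tlift f (coact G y)"

abbreviation counit :: "'h \<Rightarrow> complex" (\<open>\<epsilon>\<close>) where "\<epsilon> \<equiv> eps G"
abbreviation antipode :: "'h \<Rightarrow> 'h" (\<open>S\<close>) where "S \<equiv> antip G"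
abbreviation antipode_inv :: "'h \<Rightarrow> 'h" (\<open>S''\<close>) where "S' \<equiv> inv (antip G)"
abbreviation integral_functional :: "'h \<Rightarrow> complex" (\<open>\<phi>\<close>) where "\<phi> \<equiv> phiH G"
abbreviation invariant_mu :: "'c \<Rightarrow> complex" (\<open>\<mu>\<close>) where "\<mu> \<equiv> muC G"
abbreviation action :: "'h \<Rightarrow> 'c \<Rightarrow> 'c" (infixr \<open>\<rhd>\<close> 75) where "h \<rhd> y \<equiv> act G h y"

subsection \<open>Linearity of the structure maps\<close>

lemma bialg: "bialgebra (Delta G) (eps G)" and S_linear: "clinear S" and S_bij: "bij S"
  using hopf by (auto simp: regular_hopf_algebra_def)

lemma Delta_linear: "clinear (Delta G)" and eps_linear: "clinear \<epsilon>" and phi_linear: "clinear \<phi>"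
  and coact_linear: "clinear (coact G)" and act_bilinear: "cbilinear (act G)"
  using bialg integral yd_algebra
  by (auto simp: bialgebra_def normalized_integral_def braided_commutative_yd_algebra_def
      op_comodule_algebra_def module_algebra_def)

lemma S_S' [simp]: "S (S' h) = h" and S'_S [simp]: "S' (S h) = h"
  using S_bij by (simp_all add: bij_is_surj surj_f_inv_f bij_is_inj)

lemma S'_linear: "clinear S'"
  using S_bij by (intro clinearI; intro inv_f_eq)
    (simp_all add: bij_is_inj clinear_add[OF S_linear] clinear_scaleC[OF S_linear])

lemmas structure_lin [lin] =
  clinear_comp[OF Delta_linear] clinear_comp[OF eps_linear] clinear_comp[OF phi_linear]
  clinear_comp[OF coact_linear] clinear_comp[OF S_linear] clinear_comp[OF S'_linear]
  clinear_comp[OF mu_linear]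
  clinear_comp[OF cbilinearD(1)[OF act_bilinear]] clinear_comp[OF cbilinearD(2)[OF act_bilinear]]

subsection \<open>Axioms as rewriting rules for Sweedler sums\<close>

lemma sw_assoc:
  assumes "\<And>b c. clinear (\<lambda>a. F a b c)" "\<And>a c. clinear (\<lambda>b. F a b c)" "\<And>a b. clinear (\<lambda>c. F a b c)"
  shows "sw h (\<lambda>x c. sw x (\<lambda>a b. F a b c)) = sw h (\<lambda>a x. sw x (\<lambda>b c. F a b c))"
proof -
  let ?g = "tlift (\<lambda>a t. tlift (\<lambda>b c. F a b c) t)"
  have in1: "cbilinear (\<lambda>b c. F a b c)" for a by (intro lin assms)
  have in2: "cbilinear (\<lambda>a t. tlift (\<lambda>b c. F a b c) t)" by (intro lin in1 assms)
  have g: "clinear ?g" by (intro clinear_tlift in2)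
  have g_eq: "?g (a \<otimes> t) = tlift (\<lambda>b c. F a b c) t" for a t
    by (rule tlift_tensor[OF in2])
  have "?g (sw h (\<lambda>x c. sw x (\<lambda>a b. a \<otimes> b \<otimes> c))) = ?g (sw h (\<lambda>a x. a \<otimes> Delta G x))"
    using bialg by (simp add: bialgebra_def coassociative_def)
  then show ?thesis
    by (simp add: tlift_on_push[OF g] g_eq tlift_tensor[OF in1])
qed

lemma sw_counit:
  assumes "clinear F"
  shows "sw h (\<lambda>a b. \<epsilon> a *\<^sub>C F b) = F h" "sw h (\<lambda>a b. \<epsilon> b *\<^sub>C F a) = F h"
proof -
  have "sw h (\<lambda>a b. \<epsilon> a *\<^sub>C b) = h" "sw h (\<lambda>a b. \<epsilon> b *\<^sub>C a) = h"
    using bialg by (auto simp: bialgebra_def is_counit_def)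
  from this[THEN arg_cong[of _ _ F]] show "sw h (\<lambda>a b. \<epsilon> a *\<^sub>C F b) = F h" "sw h (\<lambda>a b. \<epsilon> b *\<^sub>C F a) = F h"
    by (simp_all add: tlift_on_push[OF assms] clinear_scaleC[OF assms])
qed

lemma sw_antipode:
  assumes "clinear F"
  shows "sw h (\<lambda>a b. F (S a * b)) = \<epsilon> h *\<^sub>C F 1" "sw h (\<lambda>a b. F (a * S b)) = \<epsilon> h *\<^sub>C F 1"
proof -
  have "sw h (\<lambda>a b. S a * b) = \<epsilon> h *\<^sub>C 1" "sw h (\<lambda>a b. a * S b) = \<epsilon> h *\<^sub>C 1"
    using hopf by (auto simp: regular_hopf_algebra_def)
  from this[THEN arg_cong[of _ _ F]] show "sw h (\<lambda>a b. F (S a * b)) = \<epsilon> h *\<^sub>C F 1"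
    "sw h (\<lambda>a b. F (a * S b)) = \<epsilon> h *\<^sub>C F 1"
    by (simp_all add: tlift_on_push[OF assms] clinear_scaleC[OF assms])
qed

lemma sw_mult:
  assumes "cbilinear F"
  shows "sw (h * k) F = sw h (\<lambda>a b. sw k (\<lambda>c d. F (a * c) (b * d)))"
proof -
  have "Delta G (h * k) = sw h (\<lambda>a b. sw k (\<lambda>c d. a * c \<otimes> b * d))"
    using bialg by (auto simp: bialgebra_def)
  then show ?thesis
    by (simp add: tlift_on_push[OF clinear_tlift[OF assms]] tlift_tensor[OF assms])
qed

lemma sw_one: "cbilinear F \<Longrightarrow> sw 1 F = F 1 1"
  using bialg by (simp add: bialgebra_def tlift_tensor)

lemma eps_mult: "\<epsilon> (h * k) = \<epsilon> h * \<epsilon> k" and eps_one [simp]: "\<epsilon> 1 = 1"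
  using bialg by (auto simp: bialgebra_def)

lemma phi_one [simp]: "\<phi> 1 = 1"
  using integral by (simp add: normalized_integral_def)

lemma sw_integral:
  assumes "clinear F"
  shows "sw h (\<lambda>a b. \<phi> b *\<^sub>C F a) = \<phi> h *\<^sub>C F 1" "sw h (\<lambda>a b. \<phi> a *\<^sub>C F b) = \<phi> h *\<^sub>C F 1"
proof -
  have "sw h (\<lambda>a b. \<phi> b *\<^sub>C a) = \<phi> h *\<^sub>C 1" "sw h (\<lambda>a b. \<phi> a *\<^sub>C b) = \<phi> h *\<^sub>C 1"
    using integral by (auto simp: normalized_integral_def)
  from this[THEN arg_cong[of _ _ F]] show "sw h (\<lambda>a b. \<phi> b *\<^sub>C F a) = \<phi> h *\<^sub>C F 1"
    "sw h (\<lambda>a b. \<phi> a *\<^sub>C F b) = \<phi> h *\<^sub>C F 1"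
    by (simp_all add: tlift_on_push[OF assms] clinear_scaleC[OF assms])
qed

lemma mod_alg: "module_algebra G" and comod_alg: "op_comodule_algebra G"
  and yd_cond: "yetter_drinfeld_condition G" and braided: "braided_commutative G"
  using yd_algebra by (auto simp: braided_commutative_yd_algebra_def)

lemma act_one [simp]: "1 \<rhd> y = y" and act_mult: "(h * k) \<rhd> y = h \<rhd> k \<rhd> y"
  and act_prod: "h \<rhd> (y * y') = sw h (\<lambda>a b. (a \<rhd> y) * (b \<rhd> y'))" and act_unit [simp]: "h \<rhd> 1 = \<epsilon> h *\<^sub>C 1"
  using mod_alg by (auto simp: module_algebra_def)

lemma cw_coassoc:
  assumes "\<And>b c. clinear (\<lambda>a. F a b c)" "\<And>a c. clinear (\<lambda>b. F a b c)" "\<And>a b. clinear (\<lambda>c. F a b c)"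
  shows "cw y (\<lambda>z c. cw z (\<lambda>a b. F a b c)) = cw y (\<lambda>a x. sw x (\<lambda>b c. F a b c))"
proof -
  let ?g = "tlift (\<lambda>a t. tlift (\<lambda>b c. F a b c) t)"
  have in1: "cbilinear (\<lambda>b c. F a b c)" for a by (intro lin assms)
  have in2: "cbilinear (\<lambda>a t. tlift (\<lambda>b c. F a b c) t)" by (intro lin in1 assms)
  have g: "clinear ?g" by (intro clinear_tlift in2)
  have g_eq: "?g (a \<otimes> t) = tlift (\<lambda>b c. F a b c) t" for a t
    by (rule tlift_tensor[OF in2])
  have "?g (cw y (\<lambda>z c. cw z (\<lambda>a b. a \<otimes> b \<otimes> c))) = ?g (cw y (\<lambda>a x. a \<otimes> Delta G x))"
    using comod_alg by (simp add: op_comodule_algebra_def)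
  then show ?thesis
    by (simp add: tlift_on_push[OF g] g_eq tlift_tensor[OF in1])
qed

lemma cw_counit:
  assumes "clinear F"
  shows "cw y (\<lambda>a b. \<epsilon> b *\<^sub>C F a) = F y"
proof -
  have "cw y (\<lambda>a b. \<epsilon> b *\<^sub>C a) = y"
    using comod_alg by (simp add: op_comodule_algebra_def)
  from this[THEN arg_cong[of _ _ F]] show ?thesis
    by (simp add: tlift_on_push[OF assms] clinear_scaleC[OF assms])
qed

lemma cw_mult:
  assumes "cbilinear F"
  shows "cw (y * y') F = cw y (\<lambda>a b. cw y' (\<lambda>c d. F (a * c) (d * b)))"
proof -
  have "coact G (y * y') = cw y (\<lambda>a b. cw y' (\<lambda>c d. a * c \<otimes> d * b))"
    using comod_alg by (simp add: op_comodule_algebra_def)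
  then show ?thesis
    by (simp add: tlift_on_push[OF clinear_tlift[OF assms]] tlift_tensor[OF assms])
qed

lemma cw_one: "cbilinear F \<Longrightarrow> cw 1 F = F 1 1"
  using comod_alg by (simp add: op_comodule_algebra_def tlift_tensor)

lemma yetter_drinfeld:
  assumes "cbilinear F"
  shows "sw h (\<lambda>a b. cw (b \<rhd> y) (\<lambda>z w. F z (w * a))) = sw h (\<lambda>a b. cw y (\<lambda>z w. F (a \<rhd> z) (b * w)))"
proof -
  have "sw h (\<lambda>a b. cw (b \<rhd> y) (\<lambda>z w. z \<otimes> w * a)) = sw h (\<lambda>a b. cw y (\<lambda>z w. (a \<rhd> z) \<otimes> b * w))"
    using yd_cond by (simp add: yetter_drinfeld_condition_def)
  from this[THEN arg_cong[of _ _ "tlift F"]] show ?thesis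
    by (simp add: tlift_on_push[OF clinear_tlift[OF assms]] tlift_tensor[OF assms])
qed

lemma braided_right: "y * y' = cw y' (\<lambda>a b. a * (b \<rhd> y))"
  and braided_left: "y * y' = cw y (\<lambda>a b. (S b \<rhd> y') * a)"
  using braided unfolding braided_commutative_def by blast+

lemma mu_coact:
  assumes "clinear F"
  shows "cw y (\<lambda>a b. \<mu> a *\<^sub>C F b) = \<mu> y *\<^sub>C F 1"
proof -
  have "cw y (\<lambda>a b. \<mu> a *\<^sub>C b) = \<mu> y *\<^sub>C 1"
    using mu_invariant by (simp add: invariant_functional_def)
  from this[THEN arg_cong[of _ _ F]] show ?thesis
    by (simp add: tlift_on_push[OF assms] clinear_scaleC[OF assms])
qed

lemma mu_act [simp]: "\<mu> (h \<rhd> y) = \<epsilon> h * \<mu> y"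
  using mu_invariant by (simp add: invariant_functional_def)

lemma mu_separates_right:
  assumes "\<And>z. \<mu> (z * c) = \<mu> (z * d)"
  shows "c = d"
proof -
  have "\<mu> (z * (c - d)) = 0" for z
    using assms by (simp add: right_diff_distrib clinear_minus[OF mu_linear])
  then show ?thesis using mu_faithful unfolding faithful_functional_def by (meson right_minus_eq)
qed

lemma mu_separates_left:
  assumes "\<And>z. \<mu> (c * z) = \<mu> (d * z)"
  shows "c = d"
proof -
  have "\<mu> ((c - d) * z) = 0" for z
    using assms by (simp add: left_diff_distrib clinear_minus[OF mu_linear])
  then show ?thesis using mu_faithful unfolding faithful_functional_def by (meson right_minus_eq)
qed

subsection \<open>The integral and the antipode\<close>

text \<open>Strong left invariance: insert \<open>S(k\<^sub>1) k\<^sub>2 = \<epsilon>(k)\<close> and apply invariance to the product.\<close>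

lemma strong_left_invariance:
  assumes "clinear F"
  shows "sw h (\<lambda>a b. \<phi> (k * b) *\<^sub>C F a) = sw k (\<lambda>a b. \<phi> (b * h) *\<^sub>C F (S a))"
proof -
  note F = assms clinear_comp[OF assms]
  have "sw k (\<lambda>a b. \<phi> (b * h) *\<^sub>C F (S a)) = sw k (\<lambda>a b. sw (b * h) (\<lambda>u v. \<phi> v *\<^sub>C F (S a * u)))"
    by (simp add: sw_integral[where F = "\<lambda>x. F (_ * x)"] lin F)
  also have "\<dots> = sw k (\<lambda>a b. sw b (\<lambda>b1 b2. sw h (\<lambda>p q. \<phi> (b2 * q) *\<^sub>C F (S a * (b1 * p)))))"
    by (subst sw_mult) (intro lin F refl)+
  also have "\<dots> = sw k (\<lambda>x b2. sw x (\<lambda>a b1. sw h (\<lambda>p q. \<phi> (b2 * q) *\<^sub>C F (S a * (b1 * p)))))"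
    by (rule sw_assoc[symmetric]; intro lin F)
  also have "\<dots> = sw h (\<lambda>p q. sw k (\<lambda>x b2. sw x (\<lambda>a b1. \<phi> (b2 * q) *\<^sub>C F (S a * b1 * p))))"
    by (simp add: tlift_on_swap[of _ _ _ _ _ _ "Delta G h"] mult.assoc)
  also have "\<dots> = sw h (\<lambda>p q. sw k (\<lambda>x b2. \<epsilon> x *\<^sub>C \<phi> (b2 * q) *\<^sub>C F p))"
    by (simp add: sw_antipode[where F = "\<lambda>x. \<phi> _ *\<^sub>C F (x * _)"] lin F)
  also have "\<dots> = sw h (\<lambda>p q. \<phi> (k * q) *\<^sub>C F p)"
    by (simp add: sw_counit[where F = "\<lambda>x. \<phi> (x * _) *\<^sub>C F _"] lin F)
  finally show ?thesis ..
qed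

lemma strong_right_invariance:
  assumes "clinear F"
  shows "sw h (\<lambda>p q. \<phi> (p * a) *\<^sub>C F q) = sw a (\<lambda>x y. \<phi> (h * x) *\<^sub>C F (S y))"
proof -
  note F = assms clinear_comp[OF assms]
  have "sw a (\<lambda>x y. \<phi> (h * x) *\<^sub>C F (S y)) = sw a (\<lambda>x y. sw (h * x) (\<lambda>u v. \<phi> u *\<^sub>C F (v * S y)))"
    by (simp add: sw_integral(2)[where F = "\<lambda>x. F (x * _)"] lin F)
  also have "\<dots> = sw a (\<lambda>x y. sw h (\<lambda>p q. sw x (\<lambda>x1 x2. \<phi> (p * x1) *\<^sub>C F (q * x2 * S y))))"
    by (subst sw_mult) (intro lin F refl)+
  also have "\<dots> = sw h (\<lambda>p q. sw a (\<lambda>x y. sw x (\<lambda>x1 x2. \<phi> (p * x1) *\<^sub>C F (q * (x2 * S y)))))"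
    by (simp add: tlift_on_swap[of _ _ _ _ _ _ "Delta G h"] mult.assoc)
  also have "\<dots> = sw h (\<lambda>p q. sw a (\<lambda>x1 z. sw z (\<lambda>x2 y. \<phi> (p * x1) *\<^sub>C F (q * (x2 * S y)))))"
    by (subst sw_assoc) (intro lin F refl)+
  also have "\<dots> = sw h (\<lambda>p q. sw a (\<lambda>x1 z. \<epsilon> z *\<^sub>C \<phi> (p * x1) *\<^sub>C F q))"
    by (simp add: sw_antipode(2)[where F = "\<lambda>x. \<phi> _ *\<^sub>C F (_ * x)"] lin F)
  also have "\<dots> = sw h (\<lambda>p q. \<phi> (p * a) *\<^sub>C F q)"
    by (simp add: sw_counit(2)[where F = "\<lambda>x. \<phi> (_ * x) *\<^sub>C F _"] lin F)
  finally show ?thesis ..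
qed

text \<open>By strong invariance the left kernel \<open>{h. \<phi>(k h) = 0 for all k}\<close> is a left coideal, so that
  \<open>h = h\<^sub>1 \<phi>(S(h\<^sub>2) h\<^sub>3)\<close> vanishes for \<open>h\<close> in it.\<close>

lemma phi_faithful:
  assumes "\<And>k. \<phi> (k * h) = 0"
  shows "h = 0"
proof -
  \<comment> \<open>This kills \<open>y\<close> in the left kernel and recovers \<open>h\<close> from its coproduct.\<close>
  define F where "F a y = sw a (\<lambda>b1 b2. \<phi> (S b2 * y) *\<^sub>C b1)" for a y
  have F: "cbilinear F" unfolding F_def by (intro lin)
  have "tlift F (Delta G h) = 0"
  proof (rule tlift_vanishes_if_slices_vanish[where f = "\<lambda>k x. \<phi> (k * x)"])
    show "clinear (\<lambda>x. \<phi> (k * x))" for k by (intro lin)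
    show "sw h (\<lambda>a b. \<phi> (k * b) *\<^sub>C a) = 0" for k
      using strong_left_invariance[OF clinear_ident] by (simp add: assms)
    show "F a b = 0" if "\<And>k. \<phi> (k * b) = 0" for a b
      by (simp add: F_def that)
  qed (rule F)
  moreover have "tlift F (Delta G h) = sw h (\<lambda>b1 z. sw z (\<lambda>b2 y. \<phi> (S b2 * y) *\<^sub>C b1))"
    unfolding F_def by (rule sw_assoc; intro lin)
  moreover have "\<dots> = h"
    by (simp add: sw_antipode(1)[where F = "\<lambda>x. \<phi> x *\<^sub>C _"] sw_counit(2)[where F = "\<lambda>x. x"]
        scaleC_one lin)
  ultimately show ?thesis by simp
qed

lemma phi_separates: "(\<And>k. \<phi> (k * h) = \<phi> (k * h')) \<Longrightarrow> h = h'"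
  using phi_faithful[of "h - h'"] by (simp add: right_diff_distrib clinear_minus[OF phi_linear])

text \<open>The elements \<open>k\<^sub>1 \<phi>(k\<^sub>2 h)\<close> span \<open>H\<close>, since \<open>k = k\<^sub>1 \<phi>(k\<^sub>2 S(k\<^sub>3))\<close>; hence a linear map is
  determined by its values on them.\<close>

lemma eq_if_eq_on_integrals:
  assumes F: "clinear F" and F': "clinear F'"
    and eq: "\<And>k h. sw k (\<lambda>a b. \<phi> (b * h) *\<^sub>C F a) = sw k (\<lambda>a b. \<phi> (b * h) *\<^sub>C F' a)"
  shows "F k = F' k"
proof -
  have *: "sw k (\<lambda>x c. sw x (\<lambda>a b. \<phi> (b * S c) *\<^sub>C E a)) = E k" if "clinear E" for E :: "'h \<Rightarrow> 'a"
  proof -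
    note E = that clinear_comp[OF that]
    have "sw k (\<lambda>x c. sw x (\<lambda>a b. \<phi> (b * S c) *\<^sub>C E a)) = sw k (\<lambda>a z. sw z (\<lambda>b c. \<phi> (b * S c) *\<^sub>C E a))"
      by (rule sw_assoc; intro lin E)
    also have "\<dots> = E k"
      by (simp add: sw_antipode(2)[where F = "\<lambda>x. \<phi> x *\<^sub>C _"] sw_counit(2)[OF that] scaleC_one lin)
    finally show ?thesis .
  qed
  show ?thesis using *[OF F] *[OF F'] by (simp add: eq)
qed

text \<open>Both sides are convolution inverse to the multiplication of \<open>H\<close>.\<close>

lemma S_mult: "S (h * k) = S k * S h"
proof -
  have "S (h * k) = sw h (\<lambda>a b. sw k (\<lambda>c d. \<epsilon> b *\<^sub>C \<epsilon> d *\<^sub>C S (a * c)))"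
    by (subst tlift_on_scale) (simp add: sw_counit(2)[where F = "\<lambda>x. S (_ * x)"] sw_counit(2)[where F = "\<lambda>x. S (x * _)"] lin)
  also have "\<dots> = sw h (\<lambda>a b. sw k (\<lambda>c d. sw b (\<lambda>b1 b2. sw d (\<lambda>d1 d2. S (a * c) * (b1 * (d1 * S d2) * S b2)))))"
    by (simp add: sw_antipode(2)[where F = "\<lambda>x. S _ * (_ * x * S _)"]
        sw_antipode(2)[where F = "\<lambda>x. _ *\<^sub>C (S _ * x)"] sw_antipode(2)[where F = "\<lambda>x. S _ * x"]
          complex_vector.scale_left_commute lin)
  also have "\<dots> = sw h (\<lambda>a b. sw b (\<lambda>b1 b2. sw k (\<lambda>c d. sw d (\<lambda>d1 d2. S (a * c) * (b1 * (d1 * S d2) * S b2)))))"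
    by (simp add: tlift_on_swap[of _ _ _ _ _ _ "Delta G k"])
  also have "\<dots> = sw h (\<lambda>a b. sw b (\<lambda>b1 b2. sw k (\<lambda>y d2. sw y (\<lambda>c d1. S (a * c) * (b1 * (d1 * S d2) * S b2)))))"
    by (subst sw_assoc) (intro lin refl)+
  also have "\<dots> = sw h (\<lambda>x b2. sw x (\<lambda>a b1. sw k (\<lambda>y d2. sw y (\<lambda>c d1. S (a * c) * (b1 * (d1 * S d2) * S b2)))))"
    by (rule sw_assoc[symmetric]; intro lin)
  also have "\<dots> = sw h (\<lambda>x b2. sw k (\<lambda>y d2. sw x (\<lambda>a b1. sw y (\<lambda>c d1. S (a * c) * (b1 * d1) * (S d2 * S b2)))))"
    by (simp add: tlift_on_swap[of _ _ _ _ _ _ "Delta G k"] mult.assoc)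
  also have "\<dots> = sw h (\<lambda>x b2. sw k (\<lambda>y d2. sw (x * y) (\<lambda>u v. S u * v * (S d2 * S b2))))"
    by (subst sw_mult) (intro lin refl)+
  also have "\<dots> = sw h (\<lambda>x b2. sw k (\<lambda>y d2. \<epsilon> x *\<^sub>C \<epsilon> y *\<^sub>C (S d2 * S b2)))"
    by (simp add: sw_antipode(1)[where F = "\<lambda>x. x * _"] eps_mult scaleC_scaleC lin)
  also have "\<dots> = S k * S h"
    by (simp add: tlift_on_scale sw_counit(1)[where F = "\<lambda>x. S x * _"] sw_counit(1)[where F = "\<lambda>x. _ * S x"] lin)
  finally show ?thesis .
qed

lemma S_one [simp]: "S 1 = 1"
proof -
  have "sw 1 (\<lambda>a b. S a * b) = 1"
    using sw_antipode(1)[OF clinear_ident, of 1] by (simp add: scaleC_one)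
  then show ?thesis by (subst (asm) sw_one) (simp_all add: lin)
qed

lemma S'_one [simp]: "S' 1 = 1"
  by (metis S'_S S_one)

lemma S'_mult: "S' (h * k) = S' k * S' h"
  by (metis S'_S S_S' S_mult)

lemma eps_S [simp]: "\<epsilon> (S h) = \<epsilon> h"
proof -
  have "\<epsilon> h = sw h (\<lambda>a b. \<epsilon> (S a * b))"
    by (simp add: sw_antipode(1)[where F = \<epsilon>] eps_linear scaleC_complex_def)
  also have "\<dots> = sw h (\<lambda>a b. \<epsilon> b *\<^sub>C \<epsilon> (S a))"
    by (simp add: eps_mult scaleC_complex_def mult.commute)
  also have "\<dots> = \<epsilon> (S h)"
    by (rule sw_counit(2)[where F = "\<lambda>x. \<epsilon> (S x)"]) (intro lin)
  finally show ?thesis ..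
qed

lemma eps_S' [simp]: "\<epsilon> (S' h) = \<epsilon> h"
  by (metis S_S' eps_S)

text \<open>The antipode reverses the comultiplication. After integration both sides become an iterated
  application of strong invariance, and a linear map is determined by its integrals.\<close>

lemma sw_S:
  assumes "cbilinear F"
  shows "sw (S h) F = sw h (\<lambda>a b. F (S b) (S a))"
proof (rule eq_if_eq_on_integrals[where F = "\<lambda>x. sw (S x) F"])
  note F = cbilinearD[OF assms] cbilinearD[OF assms, THEN clinear_comp]
  show "clinear (\<lambda>x. sw (S x) F)" "clinear (\<lambda>h. sw h (\<lambda>a b. F (S b) (S a)))"
    by (intro lin F assms)+
  fix k h
  have "sw k (\<lambda>a b. \<phi> (b * h) *\<^sub>C sw (S a) F) = sw h (\<lambda>x v. \<phi> (k * v) *\<^sub>C sw x F)"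
    by (rule strong_left_invariance[symmetric]) (intro lin F)
  also have "\<dots> = sw h (\<lambda>x v. sw x (\<lambda>p u. \<phi> (k * v) *\<^sub>C F p u))"
    by (simp add: tlift_on_scale)
  also have "\<dots> = sw h (\<lambda>p q. sw q (\<lambda>u v. \<phi> (k * v) *\<^sub>C F p u))"
    by (rule sw_assoc; intro lin F)
  also have "\<dots> = sw h (\<lambda>p q. sw k (\<lambda>x z. \<phi> (z * q) *\<^sub>C F p (S x)))"
    by (simp add: strong_left_invariance F)
  also have "\<dots> = sw k (\<lambda>x z. sw h (\<lambda>p q. \<phi> (z * q) *\<^sub>C F p (S x)))"
    by (rule tlift_on_swap)
  also have "\<dots> = sw k (\<lambda>x z. sw z (\<lambda>y b. \<phi> (b * h) *\<^sub>C F (S y) (S x)))"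
    by (simp add: strong_left_invariance[where F = "\<lambda>p. F p _"] F)
  also have "\<dots> = sw k (\<lambda>a b. sw a (\<lambda>x y. \<phi> (b * h) *\<^sub>C F (S y) (S x)))"
    by (rule sw_assoc[symmetric]; intro lin F)
  also have "\<dots> = sw k (\<lambda>a b. \<phi> (b * h) *\<^sub>C sw a (\<lambda>x y. F (S y) (S x)))"
    by (simp add: tlift_on_scale)
  finally show "sw k (\<lambda>a b. \<phi> (b * h) *\<^sub>C sw (S a) F) = \<dots>" .
qed

lemma sw_S':
  assumes "cbilinear F"
  shows "sw (S' h) F = sw h (\<lambda>a b. F (S' b) (S' a))"
proof -
  note F = cbilinearD[OF assms] cbilinearD[OF assms, THEN clinear_comp]
  have "sw (S (S' h)) (\<lambda>a b. F (S' b) (S' a)) = sw (S' h) (\<lambda>a b. F (S' (S a)) (S' (S b)))"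
    by (rule sw_S) (intro lin F)
  then show ?thesis by simp
qed

lemma sw_antipode_inv:
  assumes "clinear F"
  shows "sw h (\<lambda>a b. F (b * S' a)) = \<epsilon> h *\<^sub>C F 1" "sw h (\<lambda>a b. F (S' b * a)) = \<epsilon> h *\<^sub>C F 1"
proof -
  note F = assms clinear_comp[OF assms]
  have "sw (S (S' h)) (\<lambda>a b. F (b * S' a)) = sw (S' h) (\<lambda>a b. F (S a * S' (S b)))"
    by (rule sw_S) (intro lin F)
  then show "sw h (\<lambda>a b. F (b * S' a)) = \<epsilon> h *\<^sub>C F 1"
    by (simp add: sw_antipode F)
  have "sw (S (S' h)) (\<lambda>a b. F (S' b * a)) = sw (S' h) (\<lambda>a b. F (S' (S a) * S b))"
    by (rule sw_S) (intro lin F)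
  then show "sw h (\<lambda>a b. F (S' b * a)) = \<epsilon> h *\<^sub>C F 1"
    by (simp add: sw_antipode F)
qed

text \<open>This form turns \<open>\<phi>(_ h)\<close>, evaluated on the second leg of an argument, into elements of the
  dual of \<open>H\<close> again. It keeps all products and coproducts of dual elements inside algebraic tensor
  products.\<close>

lemma strong_left_invariance':
  assumes "clinear F"
  shows "sw k (\<lambda>a b. \<phi> (b * h) *\<^sub>C F a) = sw h (\<lambda>a b. \<phi> (k * b) *\<^sub>C F (S' a))"
  using strong_left_invariance[of "\<lambda>x. F (S' x)" k h] clinear_comp[OF assms S'_linear] by simp

text \<open>Apply \<open>\<phi>\<close> to \<open>\<phi>(S(h\<^sub>2)) h\<^sub>1\<close>: invariance of \<open>\<phi> \<circ> S\<close> evaluates it to \<open>\<phi>(S(h))\<close>, and invariance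
  of \<open>\<phi>\<close> evaluates it to \<open>\<phi>(h)\<close>.\<close>

lemma phi_S [simp]: "\<phi> (S h) = \<phi> h"
proof -
  have "S (sw h (\<lambda>a b. \<phi> (S b) *\<^sub>C a)) = sw (S h) (\<lambda>a b. \<phi> a *\<^sub>C b)"
    by (subst sw_S) (simp_all add: lin tlift_on_push[OF S_linear] clinear_scaleC[OF S_linear])
  also have "\<dots> = S (\<phi> (S h) *\<^sub>C 1)"
    by (simp add: sw_integral(2)[OF clinear_ident] clinear_scaleC[OF S_linear])
  finally have *: "sw h (\<lambda>a b. \<phi> (S b) *\<^sub>C a) = \<phi> (S h) *\<^sub>C 1"
    by (metis S'_S)
  have "\<phi> (S h) = \<phi> (sw h (\<lambda>a b. \<phi> (S b) *\<^sub>C a))"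
    by (simp add: * clinear_scaleC[OF phi_linear] scaleC_complex_def)
  also have "\<dots> = sw h (\<lambda>a b. \<phi> a *\<^sub>C \<phi> (S b))"
    by (simp add: tlift_on_push[OF phi_linear] clinear_scaleC[OF phi_linear] scaleC_complex_def mult.commute)
  also have "\<dots> = \<phi> h"
    by (subst sw_integral(2)[where F = "\<lambda>x. \<phi> (S x)"]) (simp_all add: lin scaleC_complex_def)
  finally show ?thesis .
qed

lemma phi_S' [simp]: "\<phi> (S' h) = \<phi> h"
  by (metis S_S' phi_S)

text \<open>This element solves \<open>\<phi>(p k) = \<phi>(k m)\<close> for \<open>m\<close>: the two strong invariance formulas evaluate
  \<open>\<phi>(k\<^sub>1 q) \<phi>(p k\<^sub>2)\<close> in two ways, and \<open>q = S\<^sup>2(p\<^sub>1)\<close> makes the antipodes cancel.\<close>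

definition modular :: "'h \<Rightarrow> 'h" where
  "modular p = sw p (\<lambda>p1 p2. sw (S (S p1)) (\<lambda>q1 q2. \<phi> (p2 * S q2) *\<^sub>C q1))"

lemma phi_modular: "\<phi> (p * k) = \<phi> (k * modular p)"
proof -
  have "\<phi> (k * modular p)
      = sw p (\<lambda>p1 p2. sw (S (S p1)) (\<lambda>q1 q2. \<phi> (k * q1) *\<^sub>C \<phi> (p2 * S q2)))"
    unfolding modular_def
    by (simp add: tlift_on_push[where g = "\<lambda>x. \<phi> (k * x)"] lin mult_scaleC_right
        clinear_scaleC[OF phi_linear] scaleC_complex_def mult.commute)
  also have "\<dots> = sw p (\<lambda>p1 p2. sw k (\<lambda>u v. \<phi> (u * S (S p1)) *\<^sub>C \<phi> (p2 * v)))"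
    by (simp add: strong_right_invariance[where F = "\<lambda>x. \<phi> (_ * x)"] lin)
  also have "\<dots> = sw p (\<lambda>p1 p2. sw k (\<lambda>u v. \<phi> (p2 * v) *\<^sub>C \<phi> (u * S (S p1))))"
    by (simp add: scaleC_complex_def mult.commute)
  also have "\<dots> = sw p (\<lambda>p1 p2. sw p2 (\<lambda>a b. \<phi> (b * k) *\<^sub>C \<phi> (S a * S (S p1))))"
    by (simp add: strong_left_invariance[where F = "\<lambda>x. \<phi> (x * _)"] lin)
  also have "\<dots> = sw p (\<lambda>x b. sw x (\<lambda>p1 a. \<phi> (b * k) *\<^sub>C \<phi> (S a * S (S p1))))"
    by (rule sw_assoc[symmetric]; intro lin)
  also have "\<dots> = sw p (\<lambda>x b. sw x (\<lambda>p1 a. \<phi> (b * k) *\<^sub>C \<phi> (S p1 * a)))"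
    by (simp add: S_mult[symmetric])
  also have "\<dots> = sw p (\<lambda>x b. \<epsilon> x *\<^sub>C \<phi> (b * k))"
    by (simp add: sw_antipode(1)[where F = "\<lambda>x. _ *\<^sub>C \<phi> x"] lin) (simp add: scaleC_complex_def)
  also have "\<dots> = \<phi> (p * k)"
    by (rule sw_counit(1)[where F = "\<lambda>x. \<phi> (x * k)"]) (intro lin)
  finally show ?thesis ..
qed

section \<open>The smash product and its base algebras\<close>

abbreviation amul (infixl \<open>\<odot>\<close> 70) where "a \<odot> b \<equiv> amult G a b"

lemma amult_bilinear: "cbilinear (amult G)"
  unfolding amult_def by (intro lin)

lemmas amult_lin [lin] = clinear_comp[OF cbilinearD(1)[OF amult_bilinear]]
  clinear_comp[OF cbilinearD(2)[OF amult_bilinear]]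

lemma amult_tensor: "(y \<otimes> h) \<odot> (y' \<otimes> h') = sw h (\<lambda>a b. y * (a \<rhd> y') \<otimes> b * h')"
  unfolding amult_def
  by (simp add: tlift_tensor lin)

lemma amult_ofC_left: "ofC y \<odot> (z \<otimes> h) = y * z \<otimes> h"
  by (simp add: amult_tensor sw_one lin)

lemma amult_ofH_right: "(z \<otimes> h) \<odot> ofH k = z \<otimes> h * k"
proof -
  have "(z \<otimes> h) \<odot> ofH k = sw h (\<lambda>a b. \<epsilon> a *\<^sub>C (z \<otimes> b * k))"
    by (simp add: amult_tensor mult_scaleC_right tensor_op_scaleC_left)
  then show ?thesis
    by (simp add: sw_counit(1)[where F = "\<lambda>x. z \<otimes> x * k"] lin)
qed

lemma amult_one_left [simp]: "aone \<odot> a = a"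
  by (rule tensor_ext[where f = "\<lambda>a. aone \<odot> a" and g = "\<lambda>a. a"]) ((intro lin)+, simp add: amult_ofC_left)

lemma amult_one_right [simp]: "a \<odot> aone = a"
  by (rule tensor_ext[where f = "\<lambda>a. a \<odot> aone" and g = "\<lambda>a. a"]) ((intro lin)+, simp add: amult_ofH_right)

lemma amult_assoc: "(a \<odot> b) \<odot> c = a \<odot> (b \<odot> c)"
proof -
  have "((y \<otimes> h) \<odot> (y' \<otimes> h')) \<odot> (y'' \<otimes> h'') = (y \<otimes> h) \<odot> ((y' \<otimes> h') \<odot> (y'' \<otimes> h''))" for y h y' h' y'' h''
  proof -
    have "((y \<otimes> h) \<odot> (y' \<otimes> h')) \<odot> (y'' \<otimes> h'')
        = sw h (\<lambda>a b. sw (b * h') (\<lambda>u v. y * (a \<rhd> y') * (u \<rhd> y'') \<otimes> v * h''))"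
      by (simp add: amult_tensor tlift_on_push[where g = "\<lambda>x. x \<odot> _"] lin)
    also have "\<dots> = sw h (\<lambda>a b. sw b (\<lambda>u v. sw h' (\<lambda>c d. y * (a \<rhd> y') * ((u * c) \<rhd> y'') \<otimes> v * d * h'')))"
      by (subst sw_mult) (intro lin refl)+
    also have "\<dots> = sw h (\<lambda>x v. sw x (\<lambda>a u. sw h' (\<lambda>c d. y * (a \<rhd> y') * ((u * c) \<rhd> y'') \<otimes> v * d * h'')))"
      by (rule sw_assoc[symmetric]; intro lin)
    also have "\<dots> = sw h' (\<lambda>c d. sw h (\<lambda>x v. sw x (\<lambda>a u. y * ((a \<rhd> y') * (u \<rhd> c \<rhd> y'')) \<otimes> v * d * h'')))"
      by (simp add: tlift_on_swap[of _ _ _ _ _ _ "Delta G h'"] mult.assoc act_mult)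
    also have "\<dots> = sw h' (\<lambda>c d. sw h (\<lambda>x v. y * (x \<rhd> (y' * (c \<rhd> y''))) \<otimes> v * (d * h'')))"
      by (simp add: act_prod tlift_on_push[where g = "\<lambda>x. y * x \<otimes> _"] lin mult.assoc)
    also have "\<dots> = (y \<otimes> h) \<odot> ((y' \<otimes> h') \<odot> (y'' \<otimes> h''))"
      by (simp add: amult_tensor tlift_on_push[where g = "\<lambda>x. (y \<otimes> h) \<odot> x"] lin)
    finally show ?thesis .
  qed
  then have "((y \<otimes> h) \<odot> (y' \<otimes> h')) \<odot> c = (y \<otimes> h) \<odot> ((y' \<otimes> h') \<odot> c)" for y h y' h'
    by (intro tensor_ext[where t = c and f = "\<lambda>c. ((y \<otimes> h) \<odot> (y' \<otimes> h')) \<odot> c"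
          and g = "\<lambda>c. (y \<otimes> h) \<odot> ((y' \<otimes> h') \<odot> c)"] lin)
  then have "((y \<otimes> h) \<odot> b) \<odot> c = (y \<otimes> h) \<odot> (b \<odot> c)" for y h
    by (intro tensor_ext[where t = b and f = "\<lambda>b. ((y \<otimes> h) \<odot> b) \<odot> c"
          and g = "\<lambda>b. (y \<otimes> h) \<odot> (b \<odot> c)"] lin)
  then show ?thesis
    by (intro tensor_ext[where t = a and f = "\<lambda>a. (a \<odot> b) \<odot> c" and g = "\<lambda>a. a \<odot> (b \<odot> c)"] lin)
qed

lemma tensor_eq_amult: "y \<otimes> h = ofC y \<odot> ofH h"
  by (simp add: amult_ofC_left)

lemma ofC_mult: "ofC y \<odot> ofC z = ofC (y * z)" and ofH_mult: "ofH h \<odot> ofH k = ofH (h * k)"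
  by (simp_all add: amult_ofC_left amult_ofH_right)

lemma ofH_ofC: "ofH h \<odot> ofC y = sw h (\<lambda>a b. (a \<rhd> y) \<otimes> b)"
  by (simp add: amult_tensor)

lemma amult_ofC_right: "(z \<otimes> k) \<odot> ofC y = sw k (\<lambda>a b. z * (a \<rhd> y) \<otimes> b)"
  by (simp add: amult_tensor)

text \<open>Moving \<open>H\<close> to the left of \<open>C\<close> undoes the action by \<open>S\<^sup>-\<^sup>1\<close>. Since \<open>\<Delta>\<^sub>B\<close> and the products
  \<open>a \<cdot> \<phi>\<close> take their simple form on products \<open>h y\<close>, linear maps on \<open>A\<close> are compared on these.\<close>

lemma tensor_eq_HC: "z \<otimes> k = sw k (\<lambda>a b. ofH b \<odot> ofC (S' a \<rhd> z))"
proof -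
  have "sw k (\<lambda>a b. ofH b \<odot> ofC (S' a \<rhd> z)) = sw k (\<lambda>a b. sw b (\<lambda>p q. ((p * S' a) \<rhd> z) \<otimes> q))"
    by (simp add: ofH_ofC act_mult)
  also have "\<dots> = sw k (\<lambda>x q. sw x (\<lambda>a p. ((p * S' a) \<rhd> z) \<otimes> q))"
    by (rule sw_assoc[symmetric]; intro lin)
  also have "\<dots> = z \<otimes> k"
    by (simp add: sw_antipode_inv(1)[where F = "\<lambda>x. (x \<rhd> z) \<otimes> _"] sw_counit(1)[where F = "\<lambda>x. z \<otimes> x"] lin)
  finally show ?thesis ..
qed

lemma tensor_ext_HC:
  assumes "clinear f" "clinear g" "\<And>h y. f (ofH h \<odot> ofC y) = g (ofH h \<odot> ofC y)"
  shows "f a = g a"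
proof (rule tensor_ext[OF assms(1,2)])
  show "f (z \<otimes> k) = g (z \<otimes> k)" for z k
    unfolding tensor_eq_HC[of z k] by (simp only: tlift_on_push assms)
qed

lemma tC_linear: "clinear (tC G)"
  unfolding tC_def by (intro lin)

lemmas tC_lin [lin] = clinear_comp[OF tC_linear]

lemma ofC_tC: "ofC z \<odot> tC G y = cw y (\<lambda>a b. z * a \<otimes> b)"
  unfolding tC_def by (simp add: tlift_on_push[where g = "\<lambda>x. ofC z \<odot> x"] lin amult_ofC_left)

lemma tC_ofH: "tC G y \<odot> ofH k = cw y (\<lambda>a b. a \<otimes> b * k)"
  unfolding tC_def by (simp add: tlift_on_push[where g = "\<lambda>x. x \<odot> ofH k"] lin amult_ofH_right)

text \<open>The smash product acts on \<open>z\<close> by \<open>y\<^sub>1\<close>; braided commutativity absorbs this action into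
  \<open>z y\<^sub>0\<close>.\<close>

lemma tC_commute_ofC: "tC G y \<odot> ofC z = ofC z \<odot> tC G y"
proof -
  have "tC G y \<odot> ofC z = cw y (\<lambda>a x. sw x (\<lambda>b c. a * (b \<rhd> z) \<otimes> c))"
    unfolding tC_def by (simp add: tlift_on_push[where g = "\<lambda>x. x \<odot> ofC z"] lin amult_ofC_right)
  also have "\<dots> = cw y (\<lambda>x c. cw x (\<lambda>a b. a * (b \<rhd> z) \<otimes> c))"
    by (rule cw_coassoc[symmetric]; intro lin)
  also have "\<dots> = cw y (\<lambda>x c. z * x \<otimes> c)"
    by (simp only: tlift_on_push[where g = "\<lambda>x. x \<otimes> _", symmetric] lin braided_right[symmetric])
  finally show ?thesis by (simp add: ofC_tC)
qed

lemma tC_tensor: "tC G y \<odot> (z \<otimes> k) = cw y (\<lambda>a b. z * a \<otimes> b * k)"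
proof -
  have "tC G y \<odot> (z \<otimes> k) = ofC z \<odot> (tC G y \<odot> ofH k)"
    by (simp only: tensor_eq_amult[of z k] amult_assoc[symmetric] tC_commute_ofC)
  then show ?thesis
    by (simp add: tC_ofH tlift_on_push[where g = "\<lambda>x. ofC z \<odot> x"] lin amult_ofC_left)
qed

lemma tC_mult: "tC G y \<odot> tC G z = tC G (z * y)"
proof -
  have "tC G y \<odot> tC G z = cw z (\<lambda>c d. cw y (\<lambda>a b. c * a \<otimes> b * d))"
    unfolding tC_def[of G z] by (simp add: tlift_on_push[where g = "\<lambda>x. tC G y \<odot> x"] lin tC_tensor)
  also have "\<dots> = tC G (z * y)"
    by (simp add: tC_def cw_mult lin)
  finally show ?thesis .
qed

lemma tC_one: "tC G 1 = aone"
  by (simp add: tC_def cw_one lin)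

text \<open>Expanding the left side in \<open>C # H\<close> gives the right side of the Yetter--Drinfeld condition.\<close>

lemma ofH_tC: "ofH h \<odot> tC G y = sw h (\<lambda>a b. tC G (b \<rhd> y) \<odot> ofH a)"
proof -
  have "ofH h \<odot> tC G y = cw y (\<lambda>z w. sw h (\<lambda>a b. (a \<rhd> z) \<otimes> b * w))"
    unfolding tC_def by (simp add: tlift_on_push[where g = "\<lambda>x. ofH h \<odot> x"] lin amult_tensor)
  also have "\<dots> = sw h (\<lambda>a b. cw y (\<lambda>z w. (a \<rhd> z) \<otimes> b * w))"
    by (rule tlift_on_swap)
  also have "\<dots> = sw h (\<lambda>a b. cw (b \<rhd> y) (\<lambda>z w. z \<otimes> w * a))"
    by (rule yetter_drinfeld[symmetric]) (intro lin)
  finally show ?thesis by (simp add: tC_ofH)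
qed

lemma counitC_linear: "clinear (counitC G)"
  unfolding counitC_def by (intro lin)

lemmas counitC_lin [lin] = clinear_comp[OF counitC_linear]

lemma counitC_tensor [simp]: "counitC G (y \<otimes> h) = \<epsilon> h *\<^sub>C y"
  unfolding counitC_def by (simp add: tlift_tensor lin)

lemma counitC_tC [simp]: "counitC G (tC G y) = y"
  unfolding tC_def by (simp add: tlift_on_push[OF counitC_linear] cw_counit lin)

lemma tC_inj: "tC G y = tC G z \<Longrightarrow> y = z"
  by (metis counitC_tC)

lemma tC_inv_tC [simp]: "tC_inv G (tC G y) = y"
  unfolding tC_inv_def by (rule inv_into_f_f) (simp_all add: inj_def tC_inj)

lemma tC_in_Balg [simp]: "tC G y \<in> Balg G"
  by (simp add: Balg_def)

lemma BalgE: assumes "x \<in> Balg G" obtains y where "x = tC G y"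
  using assms by (auto simp: Balg_def)

lemma muB_tC [simp]: "muB G (tC G y) = \<mu> y"
  by (simp add: muB_def)

lemma subspace_Balg [simp]: "complex_vector.subspace (Balg G)"
  unfolding Balg_def by (rule subspace_range[OF tC_linear])

subsection \<open>The modular automorphism of the functional on the base\<close>

text \<open>The map \<open>\<tau>\<close> is \<open>t\<^sub>B \<circ> t\<^sub>C\<close> and turns out to be the modular automorphism of \<open>\<mu>\<close>; its inverse
  \<open>\<rho>\<close> comes from the second form of braided commutativity.\<close>

definition base_modular :: "'c \<Rightarrow> 'c" (\<open>\<tau>\<close>) where "\<tau> y = cw y (\<lambda>a b. S' b \<rhd> a)"
definition base_modular_inv :: "'c \<Rightarrow> 'c" (\<open>\<rho>\<close>) where "\<rho> y = cw y (\<lambda>a b. S (S b) \<rhd> a)"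

lemma tau_linear: "clinear \<tau>" and rho_linear: "clinear \<rho>"
  unfolding base_modular_def base_modular_inv_def by (intro lin)+

lemmas tau_rho_lin [lin] = clinear_comp[OF tau_linear] clinear_comp[OF rho_linear]

lemma tB_tC [simp]: "tB G (tC G y) = \<tau> y"
  by (simp add: tB_def base_modular_def)

text \<open>Apply invariance to \<open>h\<^sub>1 \<rhd> (y (S(h\<^sub>2) \<rhd> z))\<close>.\<close>

lemma mu_act_left: "\<mu> ((h \<rhd> y) * z) = \<mu> (y * (S h \<rhd> z))"
proof -
  have "\<mu> (y * (S h \<rhd> z)) = sw h (\<lambda>a b. \<epsilon> a *\<^sub>C \<mu> (y * (S b \<rhd> z)))"
    by (rule sw_counit(1)[symmetric]) (intro lin)
  also have "\<dots> = sw h (\<lambda>a b. \<mu> (a \<rhd> (y * (S b \<rhd> z))))"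
    by (simp add: scaleC_complex_def)
  also have "\<dots> = sw h (\<lambda>a b. sw a (\<lambda>p q. \<mu> ((p \<rhd> y) * ((q * S b) \<rhd> z))))"
    by (simp add: act_prod tlift_on_push[OF mu_linear] act_mult del: mu_act)
  also have "\<dots> = sw h (\<lambda>p x. sw x (\<lambda>q b. \<mu> ((p \<rhd> y) * ((q * S b) \<rhd> z))))"
    by (rule sw_assoc; intro lin)
  also have "\<dots> = \<mu> ((h \<rhd> y) * z)"
    by (simp add: sw_antipode(2)[where F = "\<lambda>x. \<mu> (_ * (x \<rhd> z))"] sw_counit(2)[where F = "\<lambda>x. \<mu> ((x \<rhd> y) * z)"] lin)
  finally show ?thesis ..
qed

text \<open>Apply \<open>\<mu>\<close> to the first form of braided commutativity and move the action to the other factor.\<close>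

lemma mu_tau: "\<mu> (\<tau> y * w) = \<mu> (w * y)"
proof -
  have "\<mu> (w * y) = cw y (\<lambda>a b. \<mu> (a * (S (S' b) \<rhd> w)))"
    unfolding braided_right[of w y] by (simp add: tlift_on_push[OF mu_linear])
  also have "\<dots> = cw y (\<lambda>a b. \<mu> ((S' b \<rhd> a) * w))"
    by (simp only: mu_act_left)
  also have "\<dots> = \<mu> (\<tau> y * w)"
    unfolding base_modular_def by (simp add: tlift_on_push[where g = "\<lambda>x. \<mu> (x * w)"] lin)
  finally show ?thesis ..
qed

text \<open>Apply \<open>\<mu>\<close> to the second form of braided commutativity and move the action to the other factor.\<close>

lemma mu_rho: "\<mu> (w * \<rho> y) = \<mu> (y * w)"
proof -
  have "\<mu> (y * w) = cw y (\<lambda>a b. \<mu> ((S b \<rhd> w) * a))"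
    unfolding braided_left[of y w] by (simp add: tlift_on_push[OF mu_linear])
  also have "\<dots> = cw y (\<lambda>a b. \<mu> (w * (S (S b) \<rhd> a)))"
    by (simp only: mu_act_left)
  also have "\<dots> = \<mu> (w * \<rho> y)"
    unfolding base_modular_inv_def by (simp add: tlift_on_push[where g = "\<lambda>x. \<mu> (w * x)"] lin)
  finally show ?thesis ..
qed

lemma tau_rho [simp]: "\<tau> (\<rho> y) = y" and rho_tau [simp]: "\<rho> (\<tau> y) = y"
  by (rule mu_separates_left, simp add: mu_tau mu_rho) (rule mu_separates_right, simp add: mu_tau mu_rho)

lemma tau_mult: "\<tau> (y * z) = \<tau> y * \<tau> z"
proof (rule mu_separates_left)
  fix w
  have "\<mu> (\<tau> y * (\<tau> z * w)) = \<mu> (\<tau> z * (w * y))" by (simp add: mu_tau mult.assoc)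
  then show "\<mu> (\<tau> (y * z) * w) = \<mu> (\<tau> y * \<tau> z * w)" by (simp add: mu_tau mult.assoc)
qed

lemma tB_inv [simp]: "tB_inv G y = tC G (\<rho> y)"
proof -
  have "inj_on (tB G) (Balg G)"
    by (rule inj_onI) (metis BalgE rho_tau tB_tC)
  then show ?thesis
    unfolding tB_inv_def by (intro inv_into_f_eq) simp_all
qed

section \<open>The convolution algebra of maps from H to C\<close>

text \<open>This is the product of the dual algebra, transported to representing maps (see
  \<open>represents_Amult\<close>).\<close>

definition conv :: "('h \<Rightarrow> 'c) \<Rightarrow> ('h \<Rightarrow> 'c) \<Rightarrow> 'h \<Rightarrow> 'c" (infixl \<open>\<star>\<close> 70) where
  "(F \<star> K) k = sw k (\<lambda>a b. cw (K b) (\<lambda>c d. c * F (d * a)))"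

lemma conv_linear:
  assumes "clinear F" "clinear K" shows "clinear (F \<star> K)"
proof -
  note FK = clinear_comp[OF assms(1)] clinear_comp[OF assms(2)]
  show ?thesis unfolding conv_def by (intro lin FK)
qed

text \<open>Coassociativity of \<open>H\<close> splits the argument, and the comodule axioms of \<open>C\<close> split the coaction
  of the values.\<close>

lemma conv_assoc:
  assumes "clinear F" "clinear K" "clinear L"
  shows "(F \<star> K) \<star> L = F \<star> (K \<star> L)"
proof
  fix k
  note FK = clinear_comp[OF assms(1)] clinear_comp[OF assms(2)] clinear_comp[OF assms(3)]
  have "((F \<star> K) \<star> L) k = sw k (\<lambda>x k2. cw (L k2) (\<lambda>c d. sw (d * x) (\<lambda>u v. cw (K v) (\<lambda>p q. c * (p * F (q * u))))))"
    unfolding conv_def by (simp add: tlift_on_push[where g = "\<lambda>x. _ * x"] lin)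
  also have "\<dots> = sw k (\<lambda>x k2. cw (L k2) (\<lambda>c d. sw d (\<lambda>d1 d2. sw x (\<lambda>m1 m2. cw (K (d2 * m2)) (\<lambda>p q. c * (p * F (q * (d1 * m1))))))))"
    by (subst sw_mult) (intro lin FK refl)+
  also have "\<dots> = sw k (\<lambda>x k2. sw x (\<lambda>m1 m2. cw (L k2) (\<lambda>c d. sw d (\<lambda>d1 d2. cw (K (d2 * m2)) (\<lambda>p q. c * (p * F (q * (d1 * m1))))))))"
  proof (rule arg_cong[where f = "\<lambda>f. sw k f"], intro ext)
    fix x k2
    show "cw (L k2) (\<lambda>c d. sw d (\<lambda>d1 d2. sw x (\<lambda>m1 m2. cw (K (d2 * m2)) (\<lambda>p q. c * (p * F (q * (d1 * m1)))))))
        = sw x (\<lambda>m1 m2. cw (L k2) (\<lambda>c d. sw d (\<lambda>d1 d2. cw (K (d2 * m2)) (\<lambda>p q. c * (p * F (q * (d1 * m1)))))))"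
      by (simp add: tlift_on_swap[of _ _ _ _ _ _ "Delta G x"])
  qed
  also have "\<dots> = sw k (\<lambda>m1 x. sw x (\<lambda>m2 k2. cw (L k2) (\<lambda>c d. sw d (\<lambda>d1 d2. cw (K (d2 * m2)) (\<lambda>p q. c * (p * F (q * (d1 * m1))))))))"
    by (rule sw_assoc; intro lin FK)
  also have "\<dots> = sw k (\<lambda>m1 x. sw x (\<lambda>m2 k2. cw (L k2) (\<lambda>z d2. cw z (\<lambda>c d1. cw (K (d2 * m2)) (\<lambda>p q. c * (p * F (q * (d1 * m1))))))))"
    by (subst cw_coassoc) (intro lin FK refl)+
  also have "\<dots> = sw k (\<lambda>m1 x. sw x (\<lambda>m2 k2. cw (L k2) (\<lambda>z d2. cw (z * K (d2 * m2)) (\<lambda>p q. p * F (q * m1)))))"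
    by (simp add: cw_mult lin FK mult.assoc)
  also have "\<dots> = sw k (\<lambda>m1 x. cw ((K \<star> L) x) (\<lambda>p q. p * F (q * m1)))"
    unfolding conv_def by (simp add: tlift_on_push[where g = "\<lambda>x. cw x _"] lin FK)
  finally show "((F \<star> K) \<star> L) k = (F \<star> (K \<star> L)) k"
    by (simp add: conv_def)
qed

text \<open>The copy of \<open>C\<close> in the convolution algebra.\<close>

definition act_map :: "'c \<Rightarrow> 'h \<Rightarrow> 'c" where "act_map y k = k \<rhd> y"

lemma act_map_linear [lin]: "clinear (act_map y)"
  unfolding act_map_def by (intro lin)

text \<open>Braided commutativity removes the coaction on the values of \<open>F\<close>.\<close>

lemma act_map_conv: "(act_map y \<star> F) k = sw k (\<lambda>a b. (a \<rhd> y) * F b)"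
  unfolding conv_def act_map_def act_mult by (subst braided_right) simp

text \<open>The Yetter--Drinfeld condition replaces the coaction of \<open>k\<^sub>2 \<rhd> y\<close> by that of \<open>y\<close>.\<close>

lemma conv_act_map:
  assumes "clinear F"
  shows "(F \<star> act_map y) k = sw k (\<lambda>a b. cw y (\<lambda>z w. (a \<rhd> z) * F (b * w)))"
  unfolding conv_def act_map_def
  by (rule yetter_drinfeld) (intro lin clinear_comp[OF assms])

lemma act_map_mult: "act_map y \<star> act_map z = act_map (y * z)"
  by (simp add: fun_eq_iff act_map_conv) (simp add: act_map_def act_prod)

text \<open>Multiplicativity of the comultiplication of \<open>H\<close>.\<close>

lemma conv_shift:
  assumes "clinear F" "clinear K"
  shows "(F \<star> K) (k * l) = sw l (\<lambda>a b. ((\<lambda>m. F (m * a)) \<star> (\<lambda>m. K (m * b))) k)"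
proof -
  note FK = clinear_comp[OF assms(1)] clinear_comp[OF assms(2)]
  have "(F \<star> K) (k * l) = sw k (\<lambda>c d. sw l (\<lambda>a b. cw (K (d * b)) (\<lambda>p q. p * F (q * (c * a)))))"
    unfolding conv_def by (subst sw_mult) (intro lin FK refl)+
  then show ?thesis
    by (subst (asm) tlift_on_swap) (simp add: conv_def mult.assoc)
qed

lemma conv_sum_left:
  "((\<lambda>k. tlift_on U V (\<lambda>a b. F a b k) t) \<star> K) k = tlift_on U V (\<lambda>a b. (F a b \<star> K) k) t"
  unfolding conv_def
  by (simp add: tlift_on_push[where g = "\<lambda>x. _ * x"] lin tlift_on_swap[of _ _ _ _ _ _ t])

lemma conv_sum_right:
  assumes "clinear F"
  shows "(F \<star> (\<lambda>k. tlift_on U V (\<lambda>a b. K a b k) t)) k = tlift_on U V (\<lambda>a b. (F \<star> K a b) k) t"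
proof -
  note FK = clinear_comp[OF assms(1)]
  show ?thesis
    unfolding conv_def
    by (simp add: tlift_on_push[where g = "\<lambda>x. cw x _"] lin FK tlift_on_swap[of _ _ _ _ _ _ t])
qed

section \<open>The dual algebra as a convolution algebra\<close>

lemma dapp_dotH [simp]: "dapp (dotH G h) k = \<phi> (k * h)"
  unfolding dotH_def by (subst dapp_Dual) (intro lin refl)+

lemma dotH_linear: "clinear (dotH G)"
  by (rule clinearI; rule dual_eqI)
    (simp_all add: plus_dual.rep_eq scaleC_dual.rep_eq distrib_left clinear_add[OF phi_linear]
      mult_scaleC_right clinear_scaleC[OF phi_linear] scaleC_complex_def)

lemmas dotH_lin [lin] = clinear_comp[OF dotH_linear]

lemma dotH_in_Hhat [simp]: "dotH G h \<in> Hhat G"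
  by (simp add: Hhat_def)

lemma HhatE: assumes "u \<in> Hhat G" obtains h where "u = dotH G h"
  using assms by (auto simp: Hhat_def)

lemma subspace_Hhat [simp]: "complex_vector.subspace (Hhat G)"
  unfolding Hhat_def by (rule subspace_range[OF dotH_linear])

lemma dual_tensor_eqI: "(\<And>z k. dapp \<alpha> (z \<otimes> k) = dapp \<beta> (z \<otimes> k)) \<Longrightarrow> \<alpha> = \<beta>"
  by (rule dual_eqI, rule tensor_ext) (simp_all add: clinear_dapp)

text \<open>The generators of the dual algebra; \<open>y \<boxtimes> u\<close> is to become \<open>t\<^sub>C(y) # u\<close>.\<close>

definition mu_tensor :: "'c \<Rightarrow> 'h dual \<Rightarrow> ('c, 'h) tensor dual" (infixr \<open>\<boxtimes>\<close> 69) where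
  "y \<boxtimes> u = Dual (tlift (\<lambda>z k. dapp u k *\<^sub>C \<mu> (z * y)))"

lemma dapp_mu_tensor [simp]: "dapp (y \<boxtimes> u) (z \<otimes> k) = \<mu> (z * y) * dapp u k"
proof -
  have "dapp (y \<boxtimes> u) = tlift (\<lambda>z k. dapp u k *\<^sub>C \<mu> (z * y))"
    unfolding mu_tensor_def by (intro dapp_Dual clinear_tlift lin)
  then show ?thesis by (simp add: tlift_tensor lin scaleC_complex_def mult.commute)
qed

lemma mu_tensor_lin [lin]:
  "clinear f \<Longrightarrow> clinear (\<lambda>x. f x \<boxtimes> u)" "clinear g \<Longrightarrow> clinear (\<lambda>x. y \<boxtimes> g x)"
  by (rule clinearI; rule dual_tensor_eqI;
      simp add: plus_dual.rep_eq scaleC_dual.rep_eq clinear_add clinear_scaleC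
        clinear_add[OF mu_linear] clinear_scaleC[OF mu_linear] distrib_left mult_scaleC_right
        scaleC_complex_def algebra_simps)+

lemma dapp_phiA: "dapp (phiA G) (z \<otimes> k) = \<phi> k *\<^sub>C \<mu> z"
proof -
  have "dapp (phiA G) = (\<lambda>a. tlift (\<lambda>y h. \<phi> h *\<^sub>C \<mu> y) a)"
    unfolding phiA_def phiC_def
    by (subst dapp_Dual) (simp_all add: lin tlift_on_push[OF mu_linear] clinear_scaleC[OF mu_linear])
  then show ?thesis by (simp add: tlift_tensor lin)
qed

lemma dapp_dotA [simp]: "dapp (dotA G a \<omega>) b = dapp \<omega> (b \<odot> a)"
  unfolding dotA_def by (subst dapp_Dual) (intro lin refl)+

lemma dotA_linear [lin]: "clinear f \<Longrightarrow> clinear (\<lambda>x. dotA G (f x) \<omega>)"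
  by (rule clinearI; rule dual_eqI)
    (simp_all add: plus_dual.rep_eq scaleC_dual.rep_eq clinear_add clinear_scaleC
      clinear_add[OF amult_lin(1)[OF clinear_ident]] clinear_scaleC[OF amult_lin(1)[OF clinear_ident]]
      clinear_add[OF clinear_dapp] clinear_scaleC[OF clinear_dapp] scaleC_complex_def)

text \<open>Moving \<open>h\<close> past \<open>y\<close> makes the first leg of \<open>k h\<close> act on \<open>y\<close>; invariance of \<open>\<phi>\<close> removes it.\<close>

lemma dotA_HC: "dotA G (ofH h \<odot> ofC y) (phiA G) = y \<boxtimes> dotH G h"
proof (rule dual_tensor_eqI)
  fix z k
  have "(z \<otimes> k) \<odot> (ofH h \<odot> ofC y) = sw (k * h) (\<lambda>a b. z * (a \<rhd> y) \<otimes> b)"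
    by (subst amult_assoc[symmetric]) (simp only: amult_ofH_right amult_ofC_right)
  then show "dapp (dotA G (ofH h \<odot> ofC y) (phiA G)) (z \<otimes> k) = dapp (y \<boxtimes> dotH G h) (z \<otimes> k)"
    by (simp add: tlift_on_push[OF clinear_dapp] dapp_phiA sw_integral(1)[where F = "\<lambda>x. \<mu> (z * (x \<rhd> y))"] lin)
      (simp add: scaleC_complex_def)
qed

lemma Ahat_eq: "Ahat G = range (tlift (\<lambda>y h. y \<boxtimes> dotH G h))"
proof (intro set_eqI iffI)
  fix \<alpha>
  assume "\<alpha> \<in> Ahat G"
  then obtain a where a: "\<alpha> = dotA G a (phiA G)" by (auto simp: Ahat_def)
  \<comment> \<open>the element \<open>a\<close> sorted into products \<open>h y\<close>\<close>
  let ?t = "tlift (\<lambda>z k. sw k (\<lambda>p q. (S' p \<rhd> z) \<otimes> q)) a"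
  have "dotA G a (phiA G) = tlift (\<lambda>y h. y \<boxtimes> dotH G h) ?t"
  proof (rule tensor_ext[where t = a])
    show "dotA G (z \<otimes> k) (phiA G) =
        tlift (\<lambda>y h. y \<boxtimes> dotH G h) (tlift (\<lambda>z k. sw k (\<lambda>p q. (S' p \<rhd> z) \<otimes> q)) (z \<otimes> k))" for z k
      unfolding tensor_eq_HC[of z k]
      by (simp add: tlift_on_push[where g = "\<lambda>a. dotA G a (phiA G)"] lin dotA_HC)
        (simp add: tensor_eq_HC[of z k, symmetric] tlift_tensor lin
          tlift_on_push[where g = "tlift (\<lambda>y h. y \<boxtimes> dotH G h)"])
  qed (intro lin)+
  then show "\<alpha> \<in> range (tlift (\<lambda>y h. y \<boxtimes> dotH G h))" using a by blast
next
  fix \<alpha>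
  assume "\<alpha> \<in> range (tlift (\<lambda>y h. y \<boxtimes> dotH G h))"
  then obtain t where "\<alpha> = tlift (\<lambda>y h. y \<boxtimes> dotH G h) t" by auto
  also have "\<dots> = dotA G (tlift (\<lambda>y h. ofH h \<odot> ofC y) t) (phiA G)"
    by (simp add: tlift_on_push[where g = "\<lambda>a. dotA G a (phiA G)"] lin dotA_HC)
  finally show "\<alpha> \<in> Ahat G" by (auto simp: Ahat_def)
qed

lemma subspace_Ahat [simp]: "complex_vector.subspace (Ahat G)"
  unfolding Ahat_eq by (intro subspace_range clinear_tlift lin)

lemma mu_tensor_in_Ahat [simp]: "u \<in> Hhat G \<Longrightarrow> y \<boxtimes> u \<in> Ahat G"
proof -
  have "y \<boxtimes> dotH G h \<in> Ahat G" for h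
    unfolding dotA_HC[symmetric] by (auto simp: Ahat_def)
  then show "u \<in> Hhat G \<Longrightarrow> y \<boxtimes> u \<in> Ahat G" by (metis HhatE)
qed

lemma Ahat_induct [consumes 1, case_names gen add]:
  assumes "\<alpha> \<in> Ahat G"
    and gen: "\<And>y h. P (y \<boxtimes> dotH G h)"
    and add: "\<And>\<alpha> \<beta>. \<alpha> \<in> Ahat G \<Longrightarrow> \<beta> \<in> Ahat G \<Longrightarrow> P \<alpha> \<Longrightarrow> P \<beta> \<Longrightarrow> P (\<alpha> + \<beta>)"
  shows "P \<alpha>"
proof -
  obtain t where t: "\<alpha> = tlift (\<lambda>y h. y \<boxtimes> dotH G h) t"
    using assms(1) by (auto simp: Ahat_eq)
  have P0: "P 0"
    using gen[of 0] clinear_0[OF mu_tensor_lin(1)[OF clinear_ident]] by simp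
  have "(\<Sum>(y, h)\<leftarrow>xs. y \<boxtimes> dotH G h) \<in> Ahat G \<and> P (\<Sum>(y, h)\<leftarrow>xs. y \<boxtimes> dotH G h)" for xs
    by (induction xs) (auto simp: P0 complex_vector.subspace_0 complex_vector.subspace_add intro!: add gen)
  then show ?thesis unfolding t tlift_on_terms by blast
qed

text \<open>The functional is \<open>\<mu>\<close> after the \<open>C\<close>-module map \<open>z # k \<mapsto> z F(k)\<close>; faithfulness of \<open>\<mu>\<close>
  determines \<open>F\<close>.\<close>

definition represents :: "('c, 'h) tensor dual \<Rightarrow> ('h \<Rightarrow> 'c) \<Rightarrow> bool" where
  "represents \<alpha> F \<longleftrightarrow> clinear F \<and> (\<forall>z k. dapp \<alpha> (z \<otimes> k) = \<mu> (z * F k))"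

lemma represents_linear: "represents \<alpha> F \<Longrightarrow> clinear F"
  and represents_dapp: "represents \<alpha> F \<Longrightarrow> dapp \<alpha> (z \<otimes> k) = \<mu> (z * F k)"
  by (auto simp: represents_def)

lemma represents_inject: "represents \<alpha> F \<Longrightarrow> represents \<beta> F \<Longrightarrow> \<alpha> = \<beta>"
  by (rule dual_tensor_eqI) (simp add: represents_dapp)

lemma represents_mu_tensor: "represents (y \<boxtimes> u) (\<lambda>k. dapp u k *\<^sub>C y)"
  unfolding represents_def
  by (simp add: lin mult_scaleC_right clinear_scaleC[OF mu_linear]) (simp add: scaleC_complex_def)

lemma represents_add: "represents \<alpha> F \<Longrightarrow> represents \<beta> K \<Longrightarrow> represents (\<alpha> + \<beta>) (\<lambda>k. F k + K k)"
  by (simp add: represents_def lin plus_dual.rep_eq distrib_left clinear_add[OF mu_linear])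

lemma represents_scale: "represents \<alpha> F \<Longrightarrow> represents (c *\<^sub>C \<alpha>) (\<lambda>k. c *\<^sub>C F k)"
  by (simp add: represents_def lin scaleC_dual.rep_eq mult_scaleC_right clinear_scaleC[OF mu_linear])
    (simp add: scaleC_complex_def)

lemma represents_sum:
  assumes "\<And>a b. represents (A a b) (F a b)"
  shows "represents (tlift_on U V A t) (\<lambda>k. tlift_on U V (\<lambda>a b. F a b k) t)"
  unfolding represents_def
proof (intro conjI allI)
  have F: "clinear (F a b)" for a b using assms by (rule represents_linear)
  show "clinear (\<lambda>k. tlift_on U V (\<lambda>a b. F a b k) t)" by (intro lin F)
  show "dapp (tlift_on U V A t) (z \<otimes> k) = \<mu> (z * tlift_on U V (\<lambda>a b. F a b k) t)" for z k
    by (simp add: tlift_on_push[where g = "\<lambda>x. \<mu> (z * x)"] tlift_on_push[where g = "\<lambda>x. dapp x (z \<otimes> k)"]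
        lin represents_dapp[OF assms])
qed

definition part :: "('c, 'h) tensor dual \<Rightarrow> 'h \<Rightarrow> 'c" where
  "part \<alpha> k = (THE c. \<forall>z. dapp \<alpha> (z \<otimes> k) = \<mu> (z * c))"

lemma part_eq: "represents \<alpha> F \<Longrightarrow> part \<alpha> = F"
  unfolding part_def by (intro ext the_equality) (auto simp: represents_dapp intro: mu_separates_right)

lemma Ahat_represents: "\<alpha> \<in> Ahat G \<Longrightarrow> represents \<alpha> (part \<alpha>)"
proof (induction \<alpha> rule: Ahat_induct)
  case (gen y h)
  show ?case using represents_mu_tensor[of y "dotH G h"] by (simp add: part_eq)
next
  case (add \<alpha> \<beta>)
  then have "represents (\<alpha> + \<beta>) (\<lambda>k. part \<alpha> k + part \<beta> k)" by (intro represents_add)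
  then show ?case by (simp add: part_eq)
qed

lemma part_linear: "\<alpha> \<in> Ahat G \<Longrightarrow> clinear (part \<alpha>)"
  by (rule represents_linear[OF Ahat_represents])

lemma left_C_part_eq:
  assumes "represents \<alpha> F"
  shows "left_C_part G \<alpha> = tlift (\<lambda>z k. z * F k)"
  unfolding left_C_part_def
proof (rule the_equality)
  note F = clinear_comp[OF represents_linear[OF assms]]
  have bil: "cbilinear (\<lambda>z k. z * F k)" by (intro lin F)
  let ?f = "tlift (\<lambda>z k. z * F k)"
  have f: "clinear ?f" "?f (z \<otimes> k) = z * F k" for z k
    using bil by (simp_all add: clinear_tlift tlift_tensor)
  show "clinear ?f \<and> (\<forall>y a. ?f (ofC y \<odot> a) = y * ?f a) \<and> (\<forall>a. \<mu> (?f a) = dapp \<alpha> a)"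
  proof (intro conjI allI f(1))
    show "?f (ofC y \<odot> a) = y * ?f a" for y a
      by (rule tensor_ext[where t = a])
        (intro lin bil | simp add: amult_ofC_left f(2) mult.assoc)+
    show "\<mu> (?f a) = dapp \<alpha> a" for a
      by (rule tensor_ext[where t = a]) (intro lin bil | simp add: f(2) represents_dapp[OF assms])+
  qed
  fix g
  assume g: "clinear g \<and> (\<forall>y a. g (ofC y \<odot> a) = y * g a) \<and> (\<forall>a. \<mu> (g a) = dapp \<alpha> a)"
  show "g = ?f"
  proof (rule ext, rule tensor_ext)
    show "g (z \<otimes> k) = ?f (z \<otimes> k)" for z k
    proof (rule mu_separates_right)
      show "\<mu> (w * g (z \<otimes> k)) = \<mu> (w * ?f (z \<otimes> k))" for w
        using g[THEN conjunct2, THEN conjunct1, rule_format, of w "z \<otimes> k", symmetric] g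
        by (simp add: amult_ofC_left f(2) represents_dapp[OF assms] mult.assoc)
    qed
  qed (use g f in auto)
qed

lemma left_C_part_tensor: "represents \<alpha> F \<Longrightarrow> left_C_part G \<alpha> (z \<otimes> k) = z * F k"
  by (simp add: left_C_part_eq tlift_tensor lin clinear_comp represents_linear)

lemma left_C_part_linear: "represents \<alpha> F \<Longrightarrow> clinear (left_C_part G \<alpha>)"
  by (simp add: left_C_part_eq lin clinear_comp represents_linear clinear_tlift)

lemma DeltaC_linear: "clinear (\<lambda>a. DeltaC G a (aone \<otimes> aone))"
  unfolding DeltaC_def by (intro lin)

lemma DeltaC_tensor: "DeltaC G (z \<otimes> k) (aone \<otimes> aone) = sw k (\<lambda>a b. (z \<otimes> a) \<otimes> ofH b)"
  unfolding DeltaC_def by (simp add: tlift_tensor lin)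

lemma lconv_linear: "represents \<omega> F \<Longrightarrow> clinear (lconv G \<omega>)"
  unfolding lconv_def
  by (intro lin DeltaC_linear clinear_comp[OF left_C_part_linear[of \<omega> F]])

lemma lconv_tensor:
  assumes "represents \<omega> F"
  shows "lconv G \<omega> (z \<otimes> k) = sw k (\<lambda>a b. tC G (F b) \<odot> (z \<otimes> a))"
proof -
  have "cbilinear (\<lambda>b b'. tC G (left_C_part G \<omega> b') \<odot> b)"
    by (intro lin clinear_comp[OF left_C_part_linear[OF assms]])
  then show ?thesis
    unfolding lconv_def DeltaC_tensor
    by (simp add: tlift_on_push[OF clinear_tlift] tlift_tensor left_C_part_tensor[OF assms])
qed

lemma dapp_Amult: "represents \<omega> F \<Longrightarrow> dapp (Amult G \<upsilon> \<omega>) a = dapp \<upsilon> (lconv G \<omega> a)"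
  unfolding Amult_def by (subst dapp_Dual) (simp_all add: dapp_comp lconv_linear)

text \<open>The product evaluates \<open>\<alpha>\<close> on \<open>\<beta> \<triangleright> (z # k) = t\<^sub>C(K(k\<^sub>2)) (z # k\<^sub>1)\<close>; as \<open>B\<close> commutes with \<open>C\<close>,
  this is \<open>z K(k\<^sub>2)\<^sub>0 # K(k\<^sub>2)\<^sub>1 k\<^sub>1\<close>.\<close>

lemma represents_Amult:
  assumes "represents \<alpha> F" "represents \<beta> K"
  shows "represents (Amult G \<alpha> \<beta>) (F \<star> K)"
  unfolding represents_def
proof (intro conjI allI)
  show "clinear (F \<star> K)" using assms by (intro conv_linear represents_linear)
  show "dapp (Amult G \<alpha> \<beta>) (z \<otimes> k) = \<mu> (z * (F \<star> K) k)" for z k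
    by (simp add: dapp_Amult[OF assms(2)] lconv_tensor[OF assms(2)] tC_tensor
        tlift_on_push[OF clinear_dapp] represents_dapp[OF assms(1)] conv_def
        tlift_on_push[where g = "\<lambda>x. \<mu> (z * x)"] lin mult.assoc)
qed

text \<open>Strong invariance brings the convolution product of two generators back to a sum of
  generators. In particular the dual algebra is closed under its product.\<close>

lemma Amult_gen:
  "Amult G (x \<boxtimes> dotH G g) (y \<boxtimes> dotH G h)
   = sw h (\<lambda>p q. cw y (\<lambda>c d. (\<phi> (d * S' p * g) *\<^sub>C (c * x)) \<boxtimes> dotH G q))"
proof (rule represents_inject)
  let ?F = "\<lambda>k. \<phi> (k * g) *\<^sub>C x" and ?K = "\<lambda>k. \<phi> (k * h) *\<^sub>C y"
  show "represents (Amult G (x \<boxtimes> dotH G g) (y \<boxtimes> dotH G h)) (?F \<star> ?K)"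
    using represents_Amult[OF represents_mu_tensor[of x "dotH G g"] represents_mu_tensor[of y "dotH G h"]]
    by simp
  have "?F \<star> ?K = (\<lambda>k. sw h (\<lambda>p q. cw y (\<lambda>c d. \<phi> (k * q) *\<^sub>C \<phi> (d * S' p * g) *\<^sub>C (c * x))))"
  proof
    fix k
    have "(?F \<star> ?K) k = sw k (\<lambda>a b. \<phi> (b * h) *\<^sub>C cw y (\<lambda>c d. \<phi> (d * a * g) *\<^sub>C (c * x)))"
      unfolding conv_def
      by (simp add: clinear_scaleC[OF coact_linear] clinear_scaleC[OF clinear_tlift] lin mult_scaleC_right)
    also have "\<dots> = sw h (\<lambda>p q. \<phi> (k * q) *\<^sub>C cw y (\<lambda>c d. \<phi> (d * S' p * g) *\<^sub>C (c * x)))"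
      by (rule strong_left_invariance') (intro lin)
    finally show "(?F \<star> ?K) k = sw h (\<lambda>p q. cw y (\<lambda>c d. \<phi> (k * q) *\<^sub>C \<phi> (d * S' p * g) *\<^sub>C (c * x)))"
      by (simp add: tlift_on_scale)
  qed
  moreover have "represents (sw h (\<lambda>p q. cw y (\<lambda>c d. (\<phi> (d * S' p * g) *\<^sub>C (c * x)) \<boxtimes> dotH G q)))
    (\<lambda>k. sw h (\<lambda>p q. cw y (\<lambda>c d. dapp (dotH G q) k *\<^sub>C \<phi> (d * S' p * g) *\<^sub>C (c * x))))"
    by (intro represents_sum represents_mu_tensor)
  ultimately show "represents (sw h (\<lambda>p q. cw y (\<lambda>c d. (\<phi> (d * S' p * g) *\<^sub>C (c * x)) \<boxtimes> dotH G q))) (?F \<star> ?K)"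
    by simp
qed

lemma Amult_add:
  assumes "\<alpha> \<in> Ahat G" "\<alpha>' \<in> Ahat G" "\<beta> \<in> Ahat G"
  shows "Amult G (\<alpha> + \<alpha>') \<beta> = Amult G \<alpha> \<beta> + Amult G \<alpha>' \<beta>"
    "Amult G \<beta> (\<alpha> + \<alpha>') = Amult G \<beta> \<alpha> + Amult G \<beta> \<alpha>'"
proof -
  note r = assms[THEN Ahat_represents]
  show "Amult G (\<alpha> + \<alpha>') \<beta> = Amult G \<alpha> \<beta> + Amult G \<alpha>' \<beta>"
    by (rule dual_eqI) (simp add: dapp_Amult[OF r(3)] plus_dual.rep_eq)
  have "clinear (\<lambda>x. cw x (\<lambda>c d. c * part \<beta> (d * a)))" for a
    by (intro lin clinear_comp[OF represents_linear[OF r(3)]])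
  note cw_lin = clinear_add[OF this]
  have "part \<beta> \<star> (\<lambda>k. part \<alpha> k + part \<alpha>' k) = (\<lambda>k. (part \<beta> \<star> part \<alpha>) k + (part \<beta> \<star> part \<alpha>') k)"
    unfolding conv_def fun_eq_iff
    by (simp add: cw_lin tlift_on_add)
  then show "Amult G \<beta> (\<alpha> + \<alpha>') = Amult G \<beta> \<alpha> + Amult G \<beta> \<alpha>'"
    using represents_Amult[OF r(3) represents_add[OF r(1,2)]]
      represents_add[OF represents_Amult[OF r(3) r(1)] represents_Amult[OF r(3) r(2)]]
    by (simp add: represents_inject)
qed

lemma Amult_scale:
  assumes "\<alpha> \<in> Ahat G" "\<beta> \<in> Ahat G"
  shows "Amult G (c *\<^sub>C \<alpha>) \<beta> = c *\<^sub>C Amult G \<alpha> \<beta>" "Amult G \<beta> (c *\<^sub>C \<alpha>) = c *\<^sub>C Amult G \<beta> \<alpha>"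
proof -
  note r = assms[THEN Ahat_represents]
  show "Amult G (c *\<^sub>C \<alpha>) \<beta> = c *\<^sub>C Amult G \<alpha> \<beta>"
    by (rule dual_eqI) (simp add: dapp_Amult[OF r(2)] scaleC_dual.rep_eq)
  have "clinear (\<lambda>x. cw x (\<lambda>c d. c * part \<beta> (d * a)))" for a
    by (intro lin clinear_comp[OF represents_linear[OF r(2)]])
  note cw_lin = clinear_scaleC[OF this]
  have "part \<beta> \<star> (\<lambda>k. c *\<^sub>C part \<alpha> k) = (\<lambda>k. c *\<^sub>C (part \<beta> \<star> part \<alpha>) k)"
    unfolding conv_def fun_eq_iff
    by (simp add: cw_lin tlift_on_scale)
  then show "Amult G \<beta> (c *\<^sub>C \<alpha>) = c *\<^sub>C Amult G \<beta> \<alpha>"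
    using represents_Amult[OF r(2) represents_scale[OF r(1), of c]]
      represents_scale[OF represents_Amult[OF r(2) r(1)], of c]
    by (simp add: represents_inject)
qed

lemma Amult_in_Ahat [simp]:
  assumes "\<alpha> \<in> Ahat G" "\<beta> \<in> Ahat G"
  shows "Amult G \<alpha> \<beta> \<in> Ahat G"
  using assms
proof (induction \<alpha> rule: Ahat_induct)
  case (gen x g)
  from gen show ?case
  proof (induction \<beta> rule: Ahat_induct)
    case (gen y h)
    show ?case unfolding Amult_gen by (intro tlift_in_subspace) simp_all
  next
    case (add \<alpha> \<beta>)
    then show ?case by (simp add: Amult_add complex_vector.subspace_add)
  qed
next
  case (add \<alpha> \<beta>)
  then show ?case by (simp add: Amult_add complex_vector.subspace_add)
qed

lemma part_Amult: "\<alpha> \<in> Ahat G \<Longrightarrow> \<beta> \<in> Ahat G \<Longrightarrow> part (Amult G \<alpha> \<beta>) = part \<alpha> \<star> part \<beta>"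
  by (intro part_eq represents_Amult Ahat_represents)

lemma part_inject: "\<alpha> \<in> Ahat G \<Longrightarrow> \<beta> \<in> Ahat G \<Longrightarrow> part \<alpha> = part \<beta> \<Longrightarrow> \<alpha> = \<beta>"
  by (metis Ahat_represents represents_inject)

lemma part_mu_tensor [simp]: "part (y \<boxtimes> u) = (\<lambda>k. dapp u k *\<^sub>C y)"
  by (intro part_eq represents_mu_tensor)

lemma part_add: "\<alpha> \<in> Ahat G \<Longrightarrow> \<beta> \<in> Ahat G \<Longrightarrow> part (\<alpha> + \<beta>) = (\<lambda>k. part \<alpha> k + part \<beta> k)"
  and part_scale: "\<alpha> \<in> Ahat G \<Longrightarrow> part (c *\<^sub>C \<alpha>) = (\<lambda>k. c *\<^sub>C part \<alpha> k)"
  by (intro part_eq represents_add represents_scale Ahat_represents; assumption)+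

lemma Amult_assoc:
  assumes "\<alpha> \<in> Ahat G" "\<beta> \<in> Ahat G" "\<gamma> \<in> Ahat G"
  shows "Amult G (Amult G \<alpha> \<beta>) \<gamma> = Amult G \<alpha> (Amult G \<beta> \<gamma>)"
  using assms by (intro part_inject) (simp_all add: part_Amult conv_assoc part_linear)

subsection \<open>The embeddings of the base algebras\<close>

text \<open>Left multiplication by \<open>\<tau>(y)\<close> under \<open>\<mu>\<close> is right multiplication by \<open>y\<close>.\<close>

lemma embB_left:
  assumes "\<alpha> \<in> Ahat G"
  shows "represents (mleft (embB G (tC G y)) \<alpha>) (\<lambda>k. part \<alpha> k * y)"
  unfolding represents_def
proof (intro conjI allI)
  have "mleft (embB G (tC G y)) \<alpha> = Dual (\<lambda>a. dapp \<alpha> (ofC (\<tau> y) \<odot> a))"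
    using assms by (simp add: embB_def)
  moreover have "clinear (\<lambda>a. dapp \<alpha> (ofC (\<tau> y) \<odot> a))" by (intro lin)
  ultimately show "dapp (mleft (embB G (tC G y)) \<alpha>) (z \<otimes> k) = \<mu> (z * (part \<alpha> k * y))" for z k
    by (simp add: dapp_Dual amult_ofC_left represents_dapp[OF Ahat_represents[OF assms]] mult.assoc mu_tau)
  show "clinear (\<lambda>k. part \<alpha> k * y)" by (intro lin part_linear assms)
qed

lemma embC_left:
  assumes "\<alpha> \<in> Ahat G"
  shows "represents (mleft (embC G y) \<alpha>) (act_map y \<star> part \<alpha>)"
  unfolding represents_def
proof (intro conjI allI)
  have "mleft (embC G y) \<alpha> = Dual (\<lambda>a. dapp \<alpha> (a \<odot> ofC y))"
    using assms by (simp add: embC_def)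
  moreover have "clinear (\<lambda>a. dapp \<alpha> (a \<odot> ofC y))" by (intro lin)
  ultimately show "dapp (mleft (embC G y) \<alpha>) (z \<otimes> k) = \<mu> (z * (act_map y \<star> part \<alpha>) k)" for z k
    by (simp add: dapp_Dual amult_ofC_right represents_dapp[OF Ahat_represents[OF assms]] mult.assoc
        act_map_conv tlift_on_push[OF clinear_dapp] tlift_on_push[where g = "\<lambda>x. \<mu> (z * x)"] lin)
  show "clinear (act_map y \<star> part \<alpha>)" by (intro conv_linear lin part_linear assms)
qed

lemma embB_left_mu_tensor:
  assumes "u \<in> Hhat G"
  shows "mleft (embB G (tC G y)) (c \<boxtimes> u) = (c * y) \<boxtimes> u"
  using embB_left[of "c \<boxtimes> u" y] represents_mu_tensor[of "c * y" u] assms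
  by (intro represents_inject) (simp_all add: mult_scaleC_left)

lemma act_map_conv_dotH:
  "(act_map y \<star> (\<lambda>k. \<phi> (k * h) *\<^sub>C c)) k = sw h (\<lambda>p q. \<phi> (k * q) *\<^sub>C ((S' p \<rhd> y) * c))"
  unfolding act_map_conv
  using strong_left_invariance'[of "\<lambda>a. (a \<rhd> y) * c" h k] by (simp add: lin mult_scaleC_right)

lemma embC_left_mu_tensor:
  "mleft (embC G y) (c \<boxtimes> dotH G h) = sw h (\<lambda>p q. ((S' p \<rhd> y) * c) \<boxtimes> dotH G q)"
proof (rule represents_inject)
  show "represents (mleft (embC G y) (c \<boxtimes> dotH G h)) (act_map y \<star> (\<lambda>k. \<phi> (k * h) *\<^sub>C c))"
    using embC_left[of "c \<boxtimes> dotH G h" y] by simp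
  have "represents (sw h (\<lambda>p q. ((S' p \<rhd> y) * c) \<boxtimes> dotH G q))
    (\<lambda>k. sw h (\<lambda>p q. dapp (dotH G q) k *\<^sub>C ((S' p \<rhd> y) * c)))"
    by (intro represents_sum represents_mu_tensor)
  then show "represents (sw h (\<lambda>p q. ((S' p \<rhd> y) * c) \<boxtimes> dotH G q)) (act_map y \<star> (\<lambda>k. \<phi> (k * h) *\<^sub>C c))"
    by (simp add: act_map_conv_dotH[abs_def])
qed

lemma embB_left_in_Ahat [simp]:
  assumes "\<alpha> \<in> Ahat G"
  shows "mleft (embB G (tC G y)) \<alpha> \<in> Ahat G"
  using assms
proof (induction \<alpha> rule: Ahat_induct)
  case (gen c h)
  show ?case by (simp add: embB_left_mu_tensor)
next
  case (add \<alpha> \<beta>)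
  have "mleft (embB G (tC G y)) (\<alpha> + \<beta>) = mleft (embB G (tC G y)) \<alpha> + mleft (embB G (tC G y)) \<beta>"
    using represents_add[OF embB_left embB_left, of \<alpha> \<beta> y y] embB_left[of "\<alpha> + \<beta>" y] add
    by (intro represents_inject) (simp_all add: complex_vector.subspace_add part_add distrib_right)
  then show ?case using add by (simp add: complex_vector.subspace_add)
qed

lemma embC_left_in_Ahat [simp]:
  assumes "\<alpha> \<in> Ahat G"
  shows "mleft (embC G y) \<alpha> \<in> Ahat G"
  using assms
proof (induction \<alpha> rule: Ahat_induct)
  case (gen c h)
  show ?case unfolding embC_left_mu_tensor by (intro tlift_in_subspace) simp_all
next
  case (add \<alpha> \<beta>)
  have "mleft (embC G y) (\<alpha> + \<beta>) = mleft (embC G y) \<alpha> + mleft (embC G y) \<beta>"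
    using represents_add[OF embC_left embC_left, of \<alpha> \<beta> y y] embC_left[of "\<alpha> + \<beta>" y] add
    by (intro represents_inject[where F = "act_map y \<star> part (\<alpha> + \<beta>)"])
      (simp_all add: complex_vector.subspace_add part_add act_map_conv[abs_def] distrib_left tlift_on_add)
  then show ?case using add by (simp add: complex_vector.subspace_add)
qed

section \<open>The dual algebra as a smash product\<close>

text \<open>The inverse of the isomorphism. The counit \<open>counitC\<close> inverts \<open>t\<^sub>C\<close> on \<open>B\<close> and has the
  advantage of being linear on all of \<open>A\<close>.\<close>

definition of_smash :: "(('c, 'h) tensor, 'h dual) tensor \<Rightarrow> ('c, 'h) tensor dual" where
  "of_smash = tlift (\<lambda>x u. counitC G x \<boxtimes> u)"

lemma of_smash_linear: "clinear of_smash"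
  unfolding of_smash_def by (intro clinear_tlift lin)

lemma of_smash_tensor [simp]: "of_smash (x \<otimes> u) = counitC G x \<boxtimes> u"
  unfolding of_smash_def by (simp add: tlift_tensor lin)

lemma tensor_eq_if_slices_eq:
  fixes t t' :: "('v::complex_vector, 'w::complex_vector dual) tensor"
  assumes "\<And>k. tlift (\<lambda>z w. dapp w k *\<^sub>C z) t = tlift (\<lambda>z w. dapp w k *\<^sub>C z) t'"
  shows "t = t'"
proof -
  have *: "clinear (\<lambda>t. tlift (\<lambda>z w. dapp w k *\<^sub>C z) t)" for k :: 'w
    by (intro lin)
  have "tlift (\<lambda>a b. a \<otimes> b) (t - t') = 0"
  proof (rule tlift_vanishes_if_slices_vanish[where f = "\<lambda>k w. dapp w k"])
    show "tlift (\<lambda>z w. dapp w k *\<^sub>C z) (t - t') = 0" for k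
      using assms by (simp add: clinear_minus[OF *])
    show "a \<otimes> b = 0" if "\<And>k. dapp b k = 0" for a :: 'v and b :: "'w dual"
    proof -
      have "b = 0" by (rule dual_eqI) (simp add: that zero_dual.rep_eq)
      then show ?thesis using clinear_0[OF clinear_tensor_right[OF clinear_ident], of a] by simp
    qed
  qed (intro lin)+
  then show ?thesis by (simp add: tlift_tensor_id)
qed

lemma of_smash_in_Ahat: "t \<in> smash G \<Longrightarrow> of_smash t \<in> Ahat G"
proof -
  assume t: "t \<in> smash G"
  then have "of_smash t = tlift_on (Balg G) (Hhat G) (\<lambda>x u. counitC G x \<boxtimes> u) t"
    unfolding of_smash_def smash_def by (intro tlift_on_eq_tlift[symmetric] lin) simp_all
  also have "\<dots> \<in> Ahat G"
    using t unfolding smash_def by (intro tlift_on_in_subspace[of "Ahat G"]) simp_all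
  finally show ?thesis .
qed

text \<open>Faithfulness of \<open>\<mu>\<close> recovers the slices of the tensor from the functional.\<close>

lemma of_smash_inj: "inj_on of_smash (smash G)"
proof (rule inj_onI)
  fix s t assume s: "s \<in> smash G" and t: "t \<in> smash G" and eq: "of_smash s = of_smash t"
  \<comment> \<open>With the first leg in \<open>C\<close>, the slices become visible to \<open>\<mu>\<close>.\<close>
  define f :: "(('c, 'h) tensor, 'h dual) tensor \<Rightarrow> ('c, 'h dual) tensor"
    where "f = tlift (\<lambda>x u. counitC G x \<otimes> u)"
  have slices: "\<mu> (z * tlift (\<lambda>y u. dapp u k *\<^sub>C y) (f s)) = dapp (of_smash s) (z \<otimes> k)" for z k s
    by (simp add: f_def tlift_on_push[where g = "tlift (\<lambda>y u. dapp u k *\<^sub>C y)"] clinear_tlift tlift_tensor lin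
        of_smash_def tlift_on_push[where g = "\<lambda>x. \<mu> (z * x)"] tlift_on_push[where g = "\<lambda>x. dapp x (z \<otimes> k)"]
        mult_scaleC_right clinear_scaleC[OF mu_linear])
      (simp add: scaleC_complex_def mult.commute)
  have "f s = f t"
    by (rule tensor_eq_if_slices_eq, rule mu_separates_right) (simp add: slices eq)
  moreover have "tlift (\<lambda>y u. tC G y \<otimes> u) (f s) = s" if "s \<in> smash G" for s
  proof -
    have "tlift (\<lambda>y u. tC G y \<otimes> u) (f s) = tlift (\<lambda>x u. tC G (counitC G x) \<otimes> u) s"
      by (simp add: f_def tlift_on_push[where g = "tlift (\<lambda>y u. tC G y \<otimes> u)"] clinear_tlift tlift_tensor lin)
    also have "\<dots> = tlift_on (Balg G) (Hhat G) (\<lambda>x u. x \<otimes> u) s"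
      using that unfolding smash_def
      by (intro tlift_on_eq_tlift[symmetric] lin) (auto elim: BalgE)
    also have "\<dots> = s"
      using that unfolding smash_def by (intro tlift_on_tensor_id) simp_all
    finally show ?thesis .
  qed
  ultimately show "s = t" using s t by metis
qed

lemma of_smash_bij: "bij_betw of_smash (smash G) (Ahat G)"
  unfolding bij_betw_def
proof (intro conjI of_smash_inj subset_antisym subsetI)
  show "\<alpha> \<in> Ahat G" if "\<alpha> \<in> of_smash ` smash G" for \<alpha>
    using that of_smash_in_Ahat by blast
  show "\<alpha> \<in> of_smash ` smash G" if "\<alpha> \<in> Ahat G" for \<alpha>
    using that
  proof (induction \<alpha> rule: Ahat_induct)
    case (gen y h)
    have "tC G y \<otimes> dotH G h \<in> smash G" unfolding smash_def by (intro tensor_in_tsub) simp_all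
    then show ?case by (metis counitC_tC image_eqI of_smash_tensor)
  next
    case (add \<alpha> \<beta>)
    then obtain s t where "s \<in> smash G" "t \<in> smash G" "\<alpha> = of_smash s" "\<beta> = of_smash t" by blast
    then show ?case
      unfolding smash_def
      by (metis clinear_add[OF of_smash_linear] complex_vector.subspace_add image_eqI subspace_tsub)
  qed
qed

lemma pairH_linear: "clinear (\<lambda>t. pairH t h k)"
  unfolding pairH_def by (intro lin)

lemma pairH_tensor [simp]: "pairH (u \<otimes> w) h k = dapp u h * dapp w k"
  unfolding pairH_def by (simp add: tlift_tensor lin)

lemma pairH_ext:
  assumes "\<And>h k. pairH t h k = pairH t' h k"
  shows "t = t'"
proof (rule tensor_eq_if_slices_eq, rule dual_eqI)
  show "dapp (tlift (\<lambda>z w. dapp w k *\<^sub>C z) t) h = dapp (tlift (\<lambda>z w. dapp w k *\<^sub>C z) t') h" for h k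
    using assms[of h k] unfolding pairH_def
    by (simp add: tlift_on_push[where g = "\<lambda>x. dapp x h"] lin scaleC_dual.rep_eq mult.commute)
qed

text \<open>Strong invariance exhibits the multiplier \<open>\<Delta>(\<upsilon>)(1 \<otimes> \<omega>)\<close> as an element of the tensor square.\<close>

lemma DH1_dotH:
  "DH1 G (dotH G g) (dotH G h) = sw h (\<lambda>p q. dotH G (S' p * g) \<otimes> dotH G q)" (is "_ = ?t")
  and pairH_DH1: "pairH (DH1 G (dotH G g) (dotH G h)) b k = sw k (\<lambda>k1 k2. \<phi> (b * k1 * g) * \<phi> (k2 * h))"
proof -
  have pair: "pairH ?t b k = sw k (\<lambda>k1 k2. \<phi> (b * k1 * g) * \<phi> (k2 * h))" for b k
    using strong_left_invariance'[of "\<lambda>x. \<phi> (b * x * g)" h k]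
    by (simp add: tlift_on_push[OF pairH_linear] lin scaleC_complex_def mult.commute mult.assoc)
  have "?t \<in> tsub (Hhat G) (Hhat G)"
    by (intro tlift_in_subspace tensor_in_tsub) simp_all
  then show 1: "DH1 G (dotH G g) (dotH G h) = ?t"
    unfolding DH1_def by (intro the_equality) (auto simp: pair intro!: pairH_ext)
  show "pairH (DH1 G (dotH G g) (dotH G h)) b k = sw k (\<lambda>k1 k2. \<phi> (b * k1 * g) * \<phi> (k2 * h))"
    by (simp add: 1 pair)
qed

lemma actB_tC: "actB G u (tC G y) = cw y (\<lambda>a b. dapp u b *\<^sub>C tC G a)"
  by (simp add: actB_def)

text \<open>Both sides are represented by the same convolution product: applying the coaction of \<open>y\<close> to
  the first leg of \<open>\<Delta>(\<upsilon>)(1 \<otimes> \<omega>)\<close> produces the factor \<open>y\<^sub>1\<close> in front of \<open>k\<^sub>1\<close>.\<close>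

lemma of_smash_mult_gen:
  "tlift_on (Hhat G) (Hhat G) (\<lambda>u w. of_smash (amult G (tC G x) (actB G u (tC G y)) \<otimes> w))
     (DH1 G (dotH G g) (dotH G h))
   = Amult G (x \<boxtimes> dotH G g) (y \<boxtimes> dotH G h)"
proof (rule represents_inject)
  let ?D = "DH1 G (dotH G g) (dotH G h)"
  have D: "?D \<in> tsub (Hhat G) (Hhat G)"
    unfolding DH1_dotH by (intro tlift_in_subspace tensor_in_tsub) simp_all
  have "of_smash (amult G (tC G x) (actB G u (tC G y)) \<otimes> w) = cw y (\<lambda>a b. dapp u b *\<^sub>C (a * x) \<boxtimes> w)" for u w
    by (simp add: actB_tC tlift_on_push[where g = "\<lambda>v. counitC G (tC G x \<odot> v) \<boxtimes> w"] lin
        clinear_scaleC[OF cbilinearD(1)[OF amult_bilinear]] tC_mult clinear_scaleC[OF counitC_linear]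
        clinear_scaleC[OF mu_tensor_lin(1)[OF clinear_ident]])
  then have "tlift_on (Hhat G) (Hhat G) (\<lambda>u w. of_smash (amult G (tC G x) (actB G u (tC G y)) \<otimes> w)) ?D
      = tlift_on (Hhat G) (Hhat G) (\<lambda>u w. cw y (\<lambda>a b. dapp u b *\<^sub>C (a * x) \<boxtimes> w)) ?D"
    by simp
  also have "\<dots> = tlift (\<lambda>u w. cw y (\<lambda>a b. dapp u b *\<^sub>C (a * x) \<boxtimes> w)) ?D"
    by (rule tlift_on_eq_tlift[OF subspace_Hhat D]) ((intro lin)+, simp)
  also have "represents \<dots> (\<lambda>k. tlift (\<lambda>u w. cw y (\<lambda>a b. dapp w k *\<^sub>C dapp u b *\<^sub>C (a * x))) ?D)"
    by (intro represents_sum represents_mu_tensor)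
  also have "(\<lambda>k. tlift (\<lambda>u w. cw y (\<lambda>a b. dapp w k *\<^sub>C dapp u b *\<^sub>C (a * x))) ?D)
    = (\<lambda>k. \<phi> (k * g) *\<^sub>C x) \<star> (\<lambda>k. \<phi> (k * h) *\<^sub>C y)"
  proof
    fix k
    have cw_scale: "cw (c *\<^sub>C y) (\<lambda>p q. p * (\<phi> (q * a * g) *\<^sub>C x)) = c *\<^sub>C cw y (\<lambda>p q. p * (\<phi> (q * a * g) *\<^sub>C x))" for c a
      by (rule clinear_scaleC) (intro lin)
    have "tlift (\<lambda>u w. cw y (\<lambda>a b. dapp w k *\<^sub>C dapp u b *\<^sub>C (a * x))) ?D
        = cw y (\<lambda>a b. pairH ?D b k *\<^sub>C (a * x))"
      unfolding pairH_def
      by (subst tlift_on_swap) (simp add: tlift_on_push[where g = "\<lambda>c. c *\<^sub>C _"] lin scaleC_scaleC mult.commute)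
    also have "\<dots> = sw k (\<lambda>a b. \<phi> (b * h) *\<^sub>C cw y (\<lambda>p q. p * (\<phi> (q * a * g) *\<^sub>C x)))"
      unfolding pairH_DH1
      by (simp add: tlift_on_push[where g = "\<lambda>c. c *\<^sub>C _"] lin tlift_on_swap[of _ _ _ _ _ _ "coact G y"]
          tlift_on_scale[symmetric] scaleC_scaleC mult_scaleC_right mult.commute)
    finally show "tlift (\<lambda>u w. cw y (\<lambda>a b. dapp w k *\<^sub>C dapp u b *\<^sub>C (a * x))) ?D
        = ((\<lambda>k. \<phi> (k * g) *\<^sub>C x) \<star> (\<lambda>k. \<phi> (k * h) *\<^sub>C y)) k"
      by (simp add: conv_def cw_scale)
  qed
  finally show "represents (tlift_on (Hhat G) (Hhat G) (\<lambda>u w. of_smash (amult G (tC G x) (actB G u (tC G y)) \<otimes> w)) ?D)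
      ((\<lambda>k. \<phi> (k * g) *\<^sub>C x) \<star> (\<lambda>k. \<phi> (k * h) *\<^sub>C y))" .
  show "represents (Amult G (x \<boxtimes> dotH G g) (y \<boxtimes> dotH G h)) ((\<lambda>k. \<phi> (k * g) *\<^sub>C x) \<star> (\<lambda>k. \<phi> (k * h) *\<^sub>C y))"
    using represents_Amult[OF represents_mu_tensor[of x "dotH G g"] represents_mu_tensor[of y "dotH G h"]]
    by simp
qed

lemma Amult_sum_on:
  assumes \<beta>: "\<beta> \<in> Ahat G" and "complex_vector.subspace U" "t \<in> tsub U V"
    and "\<And>a b. a \<in> U \<Longrightarrow> b \<in> V \<Longrightarrow> A a b \<in> Ahat G"
  shows "Amult G (tlift_on U V A t) \<beta> = tlift_on U V (\<lambda>a b. Amult G (A a b) \<beta>) t"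
    "Amult G \<beta> (tlift_on U V A t) = tlift_on U V (\<lambda>a b. Amult G \<beta> (A a b)) t"
proof -
  have "clinear_on (Ahat G) (\<lambda>\<alpha>. Amult G \<alpha> \<beta>)" "clinear_on (Ahat G) (Amult G \<beta>)"
    by (rule clinear_onI; simp add: Amult_add Amult_scale \<beta>)+
  note push = this[THEN tlift_on_push_on, OF subspace_Ahat assms(2-4)]
  show "Amult G (tlift_on U V A t) \<beta> = tlift_on U V (\<lambda>a b. Amult G (A a b) \<beta>) t"
    "Amult G \<beta> (tlift_on U V A t) = tlift_on U V (\<lambda>a b. Amult G \<beta> (A a b)) t"
    by (rule push; assumption)+
qed

lemma of_smash_mult:
  assumes s: "s \<in> smash G" and t: "t \<in> smash G"
  shows "of_smash (smash_mult G s t) = Amult G (of_smash s) (of_smash t)"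
proof -
  note s' = s[unfolded smash_def] and t' = t[unfolded smash_def]
  let ?c = "\<lambda>x u. counitC G x \<boxtimes> u"
  have in_Ahat: "?c x u \<in> Ahat G" if "x \<in> Balg G" "u \<in> Hhat G" for x u
    using that by simp
  have os: "of_smash r = tlift_on (Balg G) (Hhat G) ?c r" if "r \<in> tsub (Balg G) (Hhat G)" for r
    unfolding of_smash_def using that by (intro tlift_on_eq_tlift[symmetric] lin) simp_all
  have "of_smash (smash_mult G s t) = tlift_on (Balg G) (Hhat G) (\<lambda>x u. tlift_on (Balg G) (Hhat G)
      (\<lambda>x' u'. tlift_on (Hhat G) (Hhat G) (\<lambda>u1 w. of_smash (amult G x (actB G u1 x') \<otimes> w)) (DH1 G u u')) t) s"
    unfolding smash_mult_def by (simp only: tlift_on_push[OF of_smash_linear])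
  also have "\<dots> = tlift_on (Balg G) (Hhat G) (\<lambda>x u. tlift_on (Balg G) (Hhat G)
      (\<lambda>x' u'. Amult G (?c x u) (?c x' u')) t) s"
    by (intro tlift_on_cong[OF _ s'] tlift_on_cong[OF _ t'] subspace_Balg)
      (auto elim!: BalgE HhatE simp: of_smash_mult_gen simp del: of_smash_tensor)
  also have "\<dots> = tlift_on (Balg G) (Hhat G) (\<lambda>x u. Amult G (?c x u) (of_smash t)) s"
    by (rule tlift_on_cong[OF _ s'])
      (simp_all add: os[OF t'] Amult_sum_on[OF in_Ahat _ t' in_Ahat])
  also have "\<dots> = Amult G (of_smash s) (of_smash t)"
    using of_smash_in_Ahat[OF t] by (simp add: os[OF s'] Amult_sum_on[OF _ _ s' in_Ahat])
  finally show ?thesis .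
qed

lemma smash_mult_in_smash:
  assumes s: "s \<in> smash G" and t: "t \<in> smash G"
  shows "smash_mult G s t \<in> smash G"
proof -
  note s' = s[unfolded smash_def] and t' = t[unfolded smash_def]
  have "tC G x \<odot> actB G u (tC G y) \<in> Balg G" for x u y
  proof -
    have "tC G x \<odot> actB G u (tC G y) = cw y (\<lambda>a b. dapp u b *\<^sub>C tC G (a * x))"
      by (simp add: actB_tC tlift_on_push[where g = "\<lambda>v. tC G x \<odot> v"] lin
          clinear_scaleC[OF cbilinearD(1)[OF amult_bilinear]] tC_mult)
    also have "\<dots> \<in> Balg G"
      by (intro tlift_in_subspace) (simp_all add: complex_vector.subspace_scale)
    finally show ?thesis .
  qed
  then have *: "x \<odot> actB G u x' \<in> Balg G" if "x \<in> Balg G" "x' \<in> Balg G" for x x' u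
    using that by (metis BalgE)
  have DH: "DH1 G u u' \<in> tsub (Hhat G) (Hhat G)" if u: "u \<in> Hhat G" "u' \<in> Hhat G" for u u'
  proof -
    from u obtain g h where "u = dotH G g" "u' = dotH G h" by (metis HhatE)
    then show ?thesis unfolding DH1_dotH
      by (simp only: DH1_dotH) (intro tlift_in_subspace tensor_in_tsub; simp)
  qed
  show ?thesis
    unfolding smash_def smash_mult_def
    by (intro tlift_on_in_subspace[OF _ _ s'] tlift_on_in_subspace[OF _ _ t'] tlift_on_in_subspace[OF _ _ DH]
        tensor_in_tsub *) simp_all
qed

subsection \<open>The coaction, the counit functional and the dual integral\<close>

lemma coactM_dotH: "coactM G y (dotH G h) = sw h (\<lambda>p q. (S' p \<rhd> y) \<otimes> dotH G q)" (is "_ = ?t")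
proof -
  have slice: "tlift (\<lambda>z w. dapp w k *\<^sub>C z) ?t = sw k (\<lambda>a b. dapp (dotH G h) b *\<^sub>C (a \<rhd> y))" for k
    using strong_left_invariance'[of "\<lambda>a. a \<rhd> y" h k]
    by (simp add: tlift_on_push[where g = "tlift (\<lambda>z w. dapp w k *\<^sub>C z)"] clinear_tlift tlift_tensor lin)
  have "?t \<in> tsub UNIV (Hhat G)"
    by (intro tlift_in_subspace tensor_in_tsub) simp_all
  then show ?thesis
    unfolding coactM_def by (intro the_equality) (auto simp: slice intro!: tensor_eq_if_slices_eq)
qed

text \<open>The element \<open>a\<close> is recovered in two stages. Faithfulness of \<open>\<mu>\<close> determines the elements
  \<open>\<phi>(l\<^sub>2 k) (l\<^sub>1 \<rhd> z)\<close> of \<open>C\<close>; translating them by an antipode removes the action, and then \<open>\<phi>\<close> is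
  faithful.\<close>

lemma dotA_inject:
  assumes "dotA G a (phiA G) = dotA G b (phiA G)"
  shows "a = b"
proof -
  define d where "d = a - b"
  have d0: "dotA G d (phiA G) = 0"
    using assms clinear_minus[OF dotA_linear[OF clinear_ident], of a b "phiA G"] by (simp add: d_def)
  define c where "c l = tlift (\<lambda>z k. sw l (\<lambda>p q. \<phi> (q * k) *\<^sub>C (p \<rhd> z))) d" for l
  have c_lin: "clinear (\<lambda>l. c (f l))" if "clinear f" for f :: "'h \<Rightarrow> 'h"
    unfolding c_def by (intro lin that)
  have "c l = 0" for l
  proof (rule mu_separates_right)
    fix w
    have "dapp (phiA G) ((w \<otimes> l) \<odot> d) = \<mu> (w * c l)"
      unfolding c_def
    proof (rule tensor_ext[where t = d])
      show "dapp (phiA G) ((w \<otimes> l) \<odot> (z \<otimes> k))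
          = \<mu> (w * tlift (\<lambda>z k. sw l (\<lambda>p q. \<phi> (q * k) *\<^sub>C (p \<rhd> z))) (z \<otimes> k))" for z k
        by (simp add: amult_tensor tlift_on_push[OF clinear_dapp] dapp_phiA tlift_tensor lin
            tlift_on_push[where g = "\<lambda>x. \<mu> (w * x)"] mult_scaleC_right clinear_scaleC[OF mu_linear])
    qed (intro lin)+
    then show "\<mu> (w * c l) = \<mu> (w * 0)"
      using d0 clinear_0[OF mu_linear] by (metis dapp_dotA mult_zero_right zero_dual.rep_eq)
  qed
  then have 0: "sw l (\<lambda>p q. S p \<rhd> c q) = 0" for l
    using clinear_0[OF cbilinearD(1)[OF act_bilinear]] by simp
  have "tlift (\<lambda>z k. \<phi> (l * k) *\<^sub>C z) d = 0" for l
  proof -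
    have "sw l (\<lambda>p q. S p \<rhd> c q) = tlift (\<lambda>z k. sw l (\<lambda>p q. sw q (\<lambda>q1 q2. \<phi> (q2 * k) *\<^sub>C ((S p * q1) \<rhd> z)))) d"
      unfolding c_def
      by (simp add: tlift_on_push[where g = "\<lambda>x. S _ \<rhd> x"] lin tlift_on_swap[of _ _ _ _ _ _ "Delta G l"]
          clinear_scaleC[OF cbilinearD(1)[OF act_bilinear]] act_mult)
    also have "\<dots> = tlift (\<lambda>z k. sw l (\<lambda>x q2. sw x (\<lambda>p q1. \<phi> (q2 * k) *\<^sub>C ((S p * q1) \<rhd> z)))) d"
      by (subst sw_assoc) (intro lin refl)+
    also have "\<dots> = tlift (\<lambda>z k. \<phi> (l * k) *\<^sub>C z) d"
      by (simp add: sw_antipode(1)[where F = "\<lambda>x. _ *\<^sub>C (x \<rhd> _)"] sw_counit(1)[where F = "\<lambda>x. \<phi> (x * _) *\<^sub>C _"] lin)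
    finally show ?thesis by (simp add: 0)
  qed
  note slices = this
  have "tlift (\<lambda>z k. z \<otimes> k) d = 0"
  proof (rule tlift_vanishes_if_slices_vanish[where f = "\<lambda>l k. \<phi> (l * k)"])
    show "clinear (\<lambda>k. \<phi> (l * k))" for l by (intro lin)
    show "tlift (\<lambda>a b. \<phi> (l * b) *\<^sub>C a) d = 0" for l by (rule slices)
    show "a \<otimes> b = 0" if "\<And>k. \<phi> (k * b) = 0" for a :: 'c and b
      using phi_faithful[OF that] clinear_0[OF clinear_tensor_right[OF clinear_ident], of a] by simp
  qed (intro lin)+
  then show ?thesis by (simp add: tlift_tensor_id d_def)
qed

lemma psiAhat_mu_tensor: "psiAhat G (z \<boxtimes> dotH G h) = \<mu> z * psiHhat G (dotH G h)"
proof -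
  have "(THE a. z \<boxtimes> dotH G h = dotA G a (phiA G)) = ofH h \<odot> ofC z"
    by (rule the_equality) (simp_all add: dotA_HC[symmetric] dotA_inject)
  moreover have "counitC G (ofH h \<odot> ofC z) = h \<rhd> z"
    by (simp only: ofH_ofC tlift_on_push[OF counitC_linear] counitC_tensor)
      (rule sw_counit(2)[where F = "\<lambda>x. x \<rhd> z"]; intro lin)
  moreover have "(THE g. dotH G h = dotH G g) = h"
  proof (rule the_equality)
    fix g assume "dotH G h = dotH G g"
    then have "\<phi> (k * h) = \<phi> (k * g)" for k by (metis dapp_dotH)
    then show "g = h" by (metis phi_separates)
  qed simp
  ultimately show ?thesis by (simp add: psiAhat_def psiHhat_def)
qed

lemma counitAhat_mu_tensor: "counitAhat (z \<boxtimes> u) = \<mu> z * counitHhat u"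
  by (simp add: counitAhat_def counitHhat_def)

section \<open>The dual comultiplications as operators on functions of two variables\<close>

text \<open>For fixed \<open>l\<close> this convolves \<open>M\<close> with translates of \<open>F\<close>. The argument \<open>l\<close> enters diagonally
  because the comultiplication of the dual of \<open>H\<close> is dual to the product of \<open>H\<close>.\<close>

definition coprod_op :: "('h \<Rightarrow> 'c) \<Rightarrow> ('h \<times> 'h \<Rightarrow> 'c) \<Rightarrow> 'h \<times> 'h \<Rightarrow> 'c" where
  "coprod_op F M = (\<lambda>(k, l). sw l (\<lambda>a b. ((\<lambda>m. F (m * a)) \<star> (\<lambda>m. M (m, b))) k))"

lemma coprod_op_add:
  assumes "clinear F"
  shows "coprod_op F (\<lambda>i. M i + N i) = (\<lambda>i. coprod_op F M i + coprod_op F N i)"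
proof -
  have "clinear (\<lambda>x. cw x (\<lambda>c d. c * F (d * a * b)))" for a b
    by (intro lin clinear_comp[OF assms])
  then show ?thesis
    by (simp add: coprod_op_def conv_def fun_eq_iff clinear_add[where f = "\<lambda>x. cw x (\<lambda>c d. c * F (d * _ * _))"]
        tlift_on_add)
qed

lemma coprod_op_scale:
  assumes "clinear F"
  shows "coprod_op F (\<lambda>i. c *\<^sub>C M i) = (\<lambda>i. c *\<^sub>C coprod_op F M i)"
proof -
  have "clinear (\<lambda>x. cw x (\<lambda>c d. c * F (d * a * b)))" for a b
    by (intro lin clinear_comp[OF assms])
  then show ?thesis
    by (simp add: coprod_op_def conv_def fun_eq_iff clinear_scaleC[where f = "\<lambda>x. cw x (\<lambda>c d. c * F (d * _ * _))"]
        tlift_on_scale)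
qed

lemma coprod_op_add_left:
  "coprod_op (\<lambda>k. F k + K k) M = (\<lambda>i. coprod_op F M i + coprod_op K M i)"
  by (simp add: coprod_op_def conv_def fun_eq_iff distrib_left tlift_on_add)

text \<open>Multiplicativity of the comultiplication. It holds by associativity of the convolution and
  because translation is compatible with it (\<open>conv_shift\<close>).\<close>

lemma coprod_op_conv:
  assumes F: "clinear F" and K: "clinear K"
    and M: "\<And>b. clinear (\<lambda>m. M (m, b))" "\<And>m. clinear (\<lambda>b. M (m, b))"
  shows "coprod_op F (coprod_op K M) = coprod_op (F \<star> K) M"
proof (rule ext, clarify)
  fix k l
  note c = clinear_comp[OF F] clinear_comp[OF K] clinear_comp[OF M(1)] clinear_comp[OF M(2)]
  have lF: "clinear (\<lambda>m. F (m * a))" and lK: "clinear (\<lambda>m. K (m * a))" for a by (intro lin c)+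
  have "coprod_op F (coprod_op K M) (k, l)
      = sw l (\<lambda>a b. sw b (\<lambda>b1 b2. ((\<lambda>m. F (m * a)) \<star> ((\<lambda>m. K (m * b1)) \<star> (\<lambda>m. M (m, b2)))) k))"
    by (simp add: coprod_op_def conv_sum_right lF)
  also have "\<dots> = sw l (\<lambda>x b2. sw x (\<lambda>a b1. ((\<lambda>m. F (m * a)) \<star> ((\<lambda>m. K (m * b1)) \<star> (\<lambda>m. M (m, b2)))) k))"
    by (rule sw_assoc[symmetric]; unfold conv_def; intro lin c)
  also have "\<dots> = sw l (\<lambda>x b2. ((\<lambda>m. sw x (\<lambda>a b1. ((\<lambda>m. F (m * a)) \<star> (\<lambda>m. K (m * b1))) m)) \<star> (\<lambda>m. M (m, b2))) k)"
    by (simp add: conv_sum_left conv_assoc lF lK M)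
  also have "\<dots> = coprod_op (F \<star> K) M (k, l)"
    by (simp add: coprod_op_def conv_shift[OF F K])
  finally show "coprod_op F (coprod_op K M) (k, l) = coprod_op (F \<star> K) M (k, l)" .
qed

text \<open>The Yetter--Drinfeld condition moves an element of \<open>C\<close> to the left past a translate of \<open>F\<close>.\<close>

lemma conv_act_map_exchange:
  assumes F: "clinear F" and K: "clinear K"
  shows "((\<lambda>m. F (m * a)) \<star> (act_map y \<star> K)) k = cw y (\<lambda>c d. (act_map c \<star> ((\<lambda>m. F (m * (d * a))) \<star> K)) k)"
proof -
  note c = clinear_comp[OF F] clinear_comp[OF K]
  have lF: "clinear (\<lambda>m. F (m * a))" for a by (intro lin c)
  have "((\<lambda>m. F (m * a)) \<star> act_map y) m = cw y (\<lambda>c d. (act_map c \<star> (\<lambda>m. F (m * (d * a)))) m)" for m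
    by (simp add: conv_act_map lF act_map_conv mult.assoc)
      (rule tlift_on_swap)
  then have "((\<lambda>m. F (m * a)) \<star> act_map y) = (\<lambda>m. cw y (\<lambda>c d. (act_map c \<star> (\<lambda>m. F (m * (d * a)))) m))"
    by (rule ext)
  then show ?thesis
    by (simp add: conv_assoc[symmetric] lF lin K conv_sum_left)
qed

end

text \<open>The situation common to the left and the right comultiplication of the dual algebra: the
  balanced tensor product is modelled by functions on \<open>H \<times> H\<close>, and the comultiplication of \<open>\<upsilon>\<close> acts
  on them as the operator of its representing map \<open>pr \<upsilon>\<close>. The assumption \<open>coprod_span\<close> makes the
  extension to multipliers unique.\<close>

locale dual_comultiplication = yd_setting G + evaluated_quotient "AA G" R ev
  for G :: "('h::complex_algebra_1, 'c::complex_algebra_1) yd_data" and R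
    and ev :: "(('c, 'h) tensor dual, ('c, 'h) tensor dual) tensor \<Rightarrow> 'h \<times> 'h \<Rightarrow> 'c" +
  fixes pr :: "('c, 'h) tensor dual \<Rightarrow> 'h \<Rightarrow> 'c"
  assumes pr_linear: "\<upsilon> \<in> Ahat G \<Longrightarrow> clinear (pr \<upsilon>)"
    and ev_bilinear: "t \<in> AA G \<Longrightarrow> clinear (\<lambda>m. ev t (m, b))" "t \<in> AA G \<Longrightarrow> clinear (\<lambda>b. ev t (m, b))"
    and coprod_exists: "\<upsilon> \<in> Ahat G \<Longrightarrow> t \<in> AA G \<Longrightarrow> \<exists>s\<in>AA G. ev s = coprod_op (pr \<upsilon>) (ev t)"
    and coprod_span: "AA G \<subseteq> cspan {s \<in> AA G. \<exists>\<omega>\<in>Ahat G. \<exists>t\<in>AA G. ev s = coprod_op (pr \<omega>) (ev t)}"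
begin

lemma coprod_realized: "\<upsilon> \<in> Ahat G \<Longrightarrow> \<exists>F. realizes F (coprod_op (pr \<upsilon>))"
  by (rule realizes_exists) (simp_all add: coprod_exists coprod_op_add coprod_op_scale pr_linear)

lemma comultiplication_realizes:
  assumes \<upsilon>: "\<upsilon> \<in> Ahat G"
    and op: "\<And>\<alpha> \<beta>. \<alpha> \<in> Ahat G \<Longrightarrow> \<beta> \<in> Ahat G \<Longrightarrow> op \<alpha> \<beta> \<in> AA G"
      "\<And>\<alpha> \<beta>. \<alpha> \<in> Ahat G \<Longrightarrow> \<beta> \<in> Ahat G \<Longrightarrow> ev (op \<alpha> \<beta>) = coprod_op (pr \<upsilon>) (ev (\<alpha> \<otimes> \<beta>))"
  shows "realizes (THE F. F \<in> quot_endo (AA G) R \<and>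
    (\<forall>\<alpha>\<in>Ahat G. \<forall>\<beta>\<in>Ahat G. F (coset R (\<alpha> \<otimes> \<beta>)) = coset R (op \<alpha> \<beta>))) (coprod_op (pr \<upsilon>))"
proof -
  obtain F where F: "realizes F (coprod_op (pr \<upsilon>))"
    using coprod_realized[OF \<upsilon>] by blast
  have F_eq: "F (coset R (\<alpha> \<otimes> \<beta>)) = coset R (op \<alpha> \<beta>)" if "\<alpha> \<in> Ahat G" "\<beta> \<in> Ahat G" for \<alpha> \<beta>
    using that by (intro realizes_eq[OF F] op tensor_in_tsub)
  show ?thesis
  proof (rule the_quot_endo_realizes[OF F, where E = "{\<alpha> \<otimes> \<beta> | \<alpha> \<beta>. \<alpha> \<in> Ahat G \<and> \<beta> \<in> Ahat G}"])
    show "{\<alpha> \<otimes> \<beta> | \<alpha> \<beta>. \<alpha> \<in> Ahat G \<and> \<beta> \<in> Ahat G} \<subseteq> AA G" by (auto intro: tensor_in_tsub)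
    show "AA G \<subseteq> cspan {\<alpha> \<otimes> \<beta> | \<alpha> \<beta>. \<alpha> \<in> Ahat G \<and> \<beta> \<in> Ahat G}" by (simp add: tsub_def)
  qed (use F_eq realizes_endo[OF F] in auto)
qed

text \<open>For a multiplier that comes from an element \<open>\<delta>\<close> of the dual algebra, multiplicativity of
  \<open>coprod_op\<close> shows that the operator of \<open>\<delta>\<close> has the property that defines the extension.\<close>

lemma extension_realizes:
  assumes D: "\<And>\<omega>. \<omega> \<in> Ahat G \<Longrightarrow> realizes (D \<omega>) (coprod_op (pr \<omega>))"
    and \<delta>: "\<delta> \<in> Ahat G"
    and m: "\<And>\<omega>. \<omega> \<in> Ahat G \<Longrightarrow> m \<omega> \<in> Ahat G" "\<And>\<omega>. \<omega> \<in> Ahat G \<Longrightarrow> pr (m \<omega>) = pr \<delta> \<star> pr \<omega>"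
  shows "realizes (THE F. F \<in> quot_endo (AA G) R \<and>
    (\<forall>\<omega>\<in>Ahat G. \<forall>X\<in>quot (AA G) R. F (D \<omega> X) = D (m \<omega>) X)) (coprod_op (pr \<delta>))"
proof -
  let ?E = "{s \<in> AA G. \<exists>\<omega>\<in>Ahat G. \<exists>t\<in>AA G. ev s = coprod_op (pr \<omega>) (ev t)}"
  obtain F where F: "realizes F (coprod_op (pr \<delta>))"
    using coprod_realized[OF \<delta>] by blast
  have F_eq: "F (D \<omega> X) = D (m \<omega>) X" if \<omega>: "\<omega> \<in> Ahat G" and X: "X \<in> quot (AA G) R" for \<omega> X
  proof -
    from X obtain t where t: "t \<in> AA G" "X = coset R t" by (auto simp: quot_def)
    obtain s where s: "s \<in> AA G" "ev s = coprod_op (pr \<omega>) (ev t)"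
      using coprod_exists[OF \<omega> t(1)] by blast
    obtain r where r: "r \<in> AA G" "ev r = coprod_op (pr \<delta>) (ev s)"
      using coprod_exists[OF \<delta> s(1)] by blast
    have "ev r = coprod_op (pr (m \<omega>)) (ev t)"
      by (simp add: r(2) s(2) m(2)[OF \<omega>] coprod_op_conv pr_linear \<delta> \<omega> ev_bilinear t(1))
    then have "D (m \<omega>) X = coset R r"
      unfolding t(2) by (intro realizes_eq[OF D] m(1) \<omega> t(1) r(1))
    moreover have "F (D \<omega> X) = coset R r"
      unfolding t(2) realizes_eq[OF D[OF \<omega>] t(1) s] by (rule realizes_eq[OF F s(1) r])
    ultimately show ?thesis by simp
  qed
  show ?thesis
  proof (rule the_quot_endo_realizes[OF F _ coprod_span])
    show "?E \<subseteq> AA G" by auto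
    show "F \<in> quot_endo (AA G) R \<and> (\<forall>\<omega>\<in>Ahat G. \<forall>X\<in>quot (AA G) R. F (D \<omega> X) = D (m \<omega>) X)"
      using F_eq realizes_endo[OF F] by auto
    fix F' s
    assume F': "F' \<in> quot_endo (AA G) R \<and> (\<forall>\<omega>\<in>Ahat G. \<forall>X\<in>quot (AA G) R. F' (D \<omega> X) = D (m \<omega>) X)"
      and "s \<in> ?E"
    then obtain \<omega> t where s: "s \<in> AA G" "ev s = coprod_op (pr \<omega>) (ev t)" and \<omega>: "\<omega> \<in> Ahat G"
      and t: "t \<in> AA G" by blast
    have "D \<omega> (coset R t) = coset R s" by (rule realizes_eq[OF D[OF \<omega>] t s])
    moreover have "coset R t \<in> quot (AA G) R" using t by (simp add: quot_def)
    ultimately show "F' (coset R s) = F (coset R s)"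
      using F' F_eq[OF \<omega>] \<omega> by metis
  qed simp
qed

end

context yd_setting
begin

section \<open>The left comultiplication of the dual\<close>

text \<open>Balancing identifies \<open>\<alpha> \<otimes> (y \<boxtimes> u)\<close> with \<open>(y \<alpha>) \<otimes> (1 \<boxtimes> u)\<close>. The function evaluates the two legs
  of the latter at \<open>k\<close> and \<open>l\<close>; multiplication by \<open>y\<close> is convolution with \<open>act_map y\<close>.\<close>

definition evB :: "(('c, 'h) tensor dual, ('c, 'h) tensor dual) tensor \<Rightarrow> 'h \<times> 'h \<Rightarrow> 'c" where
  "evB t = (\<lambda>(k, l). tlift_on (Ahat G) (Ahat G) (\<lambda>\<alpha> \<beta>. (act_map (part \<beta> l) \<star> part \<alpha>) k) t)"

lemma evB_bilinear:
  "clinear_on (Ahat G) (\<lambda>\<alpha>. (act_map (part \<beta> l) \<star> part \<alpha>) k)"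
  "clinear_on (Ahat G) (\<lambda>\<beta>. (act_map (part \<beta> l) \<star> part \<alpha>) k)"
  by (rule clinear_onI; simp add: act_map_conv part_add part_scale distrib_left distrib_right tlift_on_add
      mult_scaleC_right mult_scaleC_left tlift_on_scale clinear_add[OF cbilinearD(1)[OF act_bilinear]]
      clinear_scaleC[OF cbilinearD(1)[OF act_bilinear]])+

lemma evB_tensor: "\<alpha> \<in> Ahat G \<Longrightarrow> \<beta> \<in> Ahat G \<Longrightarrow> evB (\<alpha> \<otimes> \<beta>) (k, l) = (act_map (part \<beta> l) \<star> part \<alpha>) k"
  unfolding evB_def by (simp add: tlift_on_tensor evB_bilinear)

lemma evB_linear: "clinear_on (AA G) (\<lambda>t. evB t i)"
  unfolding evB_def by (cases i) (simp add: tlift_on_linear evB_bilinear)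

lemma evB_sum: "(\<And>a b. A a b \<in> AA G) \<Longrightarrow> evB (tlift A t) i = tlift (\<lambda>a b. evB (A a b) i) t"
  by (rule tlift_on_push_on[OF evB_linear]) (simp_all add: tsub_UNIV)

lemma one_mu_tensor_linear: "clinear (\<lambda>u. 1 \<boxtimes> u)"
  by (intro lin)

lemma act_map_scalar: "(act_map (c *\<^sub>C 1) \<star> F) k = c *\<^sub>C F k" if "clinear F"
proof -
  have "(act_map (c *\<^sub>C 1) \<star> F) k = sw k (\<lambda>a b. \<epsilon> a *\<^sub>C c *\<^sub>C F b)"
    by (simp add: act_map_conv clinear_scaleC[OF cbilinearD(1)[OF act_bilinear]] mult_scaleC_left
        complex_vector.scale_left_commute)
  then show ?thesis by (simp add: sw_counit(1)[where F = "\<lambda>x. c *\<^sub>C F x"] lin that)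
qed

lemma evB_one: "\<alpha> \<in> Ahat G \<Longrightarrow> u \<in> Hhat G \<Longrightarrow> evB (\<alpha> \<otimes> 1 \<boxtimes> u) (k, l) = dapp u l *\<^sub>C part \<alpha> k"
  by (simp add: evB_tensor act_map_scalar part_linear)

lemma AA_tensor [simp]: "\<alpha> \<in> Ahat G \<Longrightarrow> \<beta> \<in> Ahat G \<Longrightarrow> \<alpha> \<otimes> \<beta> \<in> AA G"
  by (rule tensor_in_tsub)

lemma evB_bilinear':
  assumes "t \<in> AA G"
  shows "clinear (\<lambda>m. evB t (m, b)) \<and> clinear (\<lambda>b. evB t (m, b))"
  using assms subspace_Ahat
proof (induction t rule: tsub_induct)
  case zero
  show ?case by (simp add: clinear_on_zero[OF evB_linear] lin)
next
  case (tensor \<alpha> \<beta>)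
  have "clinear (\<lambda>m. (act_map (part \<beta> b) \<star> part \<alpha>) m)"
    by (intro conv_linear lin part_linear tensor)
  moreover have "clinear (\<lambda>b. (act_map (part \<beta> b) \<star> part \<alpha>) m)"
    unfolding act_map_conv by (intro lin part_linear[OF tensor(2)])
  ultimately show ?case by (simp add: evB_tensor tensor)
next
  case (add s t)
  then show ?case by (simp add: clinear_on_add[OF evB_linear] lin)
qed

text \<open>\<open>C\<close> is multiplicative in the convolution algebra, so both sides of a balancing relation have
  the same function.\<close>

lemma relB_subset: "relB G \<subseteq> {t \<in> AA G. \<forall>i. evB t i = 0}"
  unfolding relB_def balancing_def
proof (rule complex_vector.span_minimal)
  show "complex_vector.subspace {t \<in> AA G. \<forall>i. evB t i = 0}"
    unfolding complex_vector.subspace_def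
    by (auto simp: complex_vector.subspace_0 complex_vector.subspace_add complex_vector.subspace_scale
        clinear_on_zero[OF evB_linear] clinear_on_add[OF evB_linear] clinear_on_scale[OF evB_linear])
  show "{mleft (embC G (tC_inv G d)) u \<otimes> v - u \<otimes> mleft (embB G d) v |u v d. u \<in> Ahat G \<and> v \<in> Ahat G \<and> d \<in> Balg G}
      \<subseteq> {t \<in> AA G. \<forall>i. evB t i = 0}"
  proof (clarify, intro conjI allI)
    fix u v d and i :: "'h \<times> 'h" assume u: "u \<in> Ahat G" and v: "v \<in> Ahat G" and d: "d \<in> Balg G"
    obtain y where y: "d = tC G y" using d by (rule BalgE)
    obtain k l where i: "i = (k, l)" by (cases i)
    have in_AA: "mleft (embC G y) u \<otimes> v \<in> AA G" "u \<otimes> mleft (embB G (tC G y)) v \<in> AA G"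
      using u v by simp_all
    then show "mleft (embC G (tC_inv G d)) u \<otimes> v - u \<otimes> mleft (embB G d) v \<in> AA G"
      by (simp add: y complex_vector.subspace_diff)
    show "evB (mleft (embC G (tC_inv G d)) u \<otimes> v - u \<otimes> mleft (embB G d) v) i = 0"
      using in_AA u v
      by (simp add: y i clinear_on_diff[OF evB_linear] evB_tensor part_eq[OF embC_left] part_eq[OF embB_left]
          conv_assoc[symmetric] lin part_linear act_map_mult)
  qed
qed

lemma relB_reduce:
  assumes "\<alpha> \<in> Ahat G" "u \<in> Hhat G"
  shows "mleft (embC G y) \<alpha> \<otimes> 1 \<boxtimes> u - \<alpha> \<otimes> y \<boxtimes> u \<in> relB G"
proof -
  have "mleft (embC G (tC_inv G (tC G y))) \<alpha> \<otimes> 1 \<boxtimes> u - \<alpha> \<otimes> mleft (embB G (tC G y)) (1 \<boxtimes> u) \<in> relB G"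
    unfolding relB_def balancing_def
    by (rule complex_vector.span_base) (use assms tC_in_Balg mu_tensor_in_Ahat in blast)
  then show ?thesis by (simp add: embB_left_mu_tensor assms)
qed

lemma subspace_relB: "complex_vector.subspace (relB G)"
  unfolding relB_def balancing_def by (rule complex_vector.subspace_span)

text \<open>Every element of the balanced tensor product has a representative with second leg in \<open>1 # H'\<close>,
  where \<open>H'\<close> is the dual of \<open>H\<close>: the factor from \<open>B\<close> is moved to the first leg. On such
  representatives the function is a family of slices (\<open>evB_normal_form\<close>).\<close>

lemma relB_normal_form:
  assumes "t \<in> AA G"
  shows "\<exists>s\<in>tsub (Ahat G) (Hhat G). t - tlift (\<lambda>\<alpha> u. \<alpha> \<otimes> 1 \<boxtimes> u) s \<in> relB G"
proof -
  let ?n = "tlift (\<lambda>\<alpha> u. \<alpha> \<otimes> 1 \<boxtimes> u)"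
  have n: "clinear ?n" by (intro clinear_tlift lin)
  have n_tensor: "?n (\<alpha> \<otimes> u) = \<alpha> \<otimes> 1 \<boxtimes> u" for \<alpha> u by (simp add: tlift_tensor lin)
  have normal_add: "\<exists>s\<in>tsub (Ahat G) (Hhat G). (t + t') - ?n s \<in> relB G"
    if ex: "\<exists>s\<in>tsub (Ahat G) (Hhat G). t - ?n s \<in> relB G" "\<exists>s\<in>tsub (Ahat G) (Hhat G). t' - ?n s \<in> relB G" for t t'
  proof -
    obtain s s' where s: "s \<in> tsub (Ahat G) (Hhat G)" "t - ?n s \<in> relB G"
      "s' \<in> tsub (Ahat G) (Hhat G)" "t' - ?n s' \<in> relB G" using ex by blast
    have "(t + t') - ?n (s + s') = (t - ?n s) + (t' - ?n s')"
      by (simp add: clinear_add[OF n])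
    then show ?thesis
      using s complex_vector.subspace_add[OF subspace_relB] complex_vector.subspace_add[OF subspace_tsub] by metis
  qed
  show ?thesis using assms subspace_Ahat
  proof (induction t rule: tsub_induct)
    case zero
    show ?case
      by (rule bexI[of _ 0]) (simp_all add: clinear_0[OF n] complex_vector.subspace_0 subspace_relB)
  next
    case (tensor \<alpha> \<beta>)
    show ?case using tensor(2)
    proof (induction \<beta> rule: Ahat_induct)
      case (gen y h)
      have "\<alpha> \<otimes> y \<boxtimes> dotH G h - ?n (mleft (embC G y) \<alpha> \<otimes> dotH G h) \<in> relB G"
        using complex_vector.subspace_neg[OF subspace_relB relB_reduce[OF tensor(1), of "dotH G h" y]]
        by (simp add: n_tensor)
      moreover have "mleft (embC G y) \<alpha> \<otimes> dotH G h \<in> tsub (Ahat G) (Hhat G)"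
        using tensor(1) by (intro tensor_in_tsub) simp_all
      ultimately show ?case by blast
    next
      case (add \<beta> \<gamma>)
      then show ?case unfolding tensor_op_add_right by (intro normal_add)
    qed
  next
    case (add s t)
    then show ?case by (intro normal_add)
  qed
qed

lemma evB_normal_form:
  assumes "s \<in> tsub (Ahat G) (Hhat G)"
  shows "tlift (\<lambda>\<alpha> u. \<alpha> \<otimes> 1 \<boxtimes> u) s \<in> AA G \<and>
    represents (tlift (\<lambda>\<alpha> u. dapp u l *\<^sub>C \<alpha>) s) (\<lambda>k. evB (tlift (\<lambda>\<alpha> u. \<alpha> \<otimes> 1 \<boxtimes> u) s) (k, l))"
proof -
  let ?n = "tlift (\<lambda>\<alpha> u. \<alpha> \<otimes> 1 \<boxtimes> u)" and ?sl = "tlift (\<lambda>\<alpha> u. dapp u l *\<^sub>C \<alpha>)"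
  have n: "clinear ?n" by (intro clinear_tlift lin)
  have sl: "clinear ?sl" by (intro clinear_tlift lin)
  show ?thesis using assms subspace_Ahat
  proof (induction s rule: tsub_induct)
    case zero
    show ?case
      by (simp add: clinear_0[OF n] clinear_0[OF sl] complex_vector.subspace_0 clinear_on_zero[OF evB_linear]
          represents_def lin zero_dual.rep_eq clinear_0[OF mu_linear])
  next
    case (tensor \<alpha> u)
    have "represents (dapp u l *\<^sub>C \<alpha>) (\<lambda>k. dapp u l *\<^sub>C part \<alpha> k)"
      by (intro represents_scale Ahat_represents tensor)
    then show ?case using tensor by (simp add: tlift_tensor lin evB_one)
  next
    case (add s t)
    then show ?case
      by (simp add: clinear_add[OF n] clinear_add[OF sl] complex_vector.subspace_add
          clinear_on_add[OF evB_linear] represents_add)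
  qed
qed

text \<open>A normal form with vanishing function has vanishing slices, hence is zero.\<close>

lemma evB_kernel:
  assumes t: "t \<in> AA G" and 0: "\<And>i. evB t i = 0"
  shows "t \<in> relB G"
proof -
  let ?n = "tlift (\<lambda>(\<alpha> :: ('c, 'h) tensor dual) u. \<alpha> \<otimes> 1 \<boxtimes> u)"
  obtain s where s: "s \<in> tsub (Ahat G) (Hhat G)" and ts: "t - ?n s \<in> relB G"
    using relB_normal_form[OF t] by blast
  note ns = evB_normal_form[OF s]
  have "evB (t - ?n s) i = 0" for i using relB_subset ts by blast
  then have "evB (?n s) i = 0" for i
    using 0 clinear_on_diff[OF evB_linear subspace_tsub t conjunct1[OF ns]] by simp
  then have "represents (tlift (\<lambda>\<alpha> u. dapp u l *\<^sub>C \<alpha>) s) (\<lambda>k. 0)" for l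
    using ns by simp
  then have "tlift (\<lambda>\<alpha> u. dapp u l *\<^sub>C \<alpha>) s = 0" for l
    by (rule represents_inject) (simp add: represents_def lin zero_dual.rep_eq clinear_0[OF mu_linear])
  moreover have "tlift (\<lambda>(\<alpha> :: ('c, 'h) tensor dual) u. dapp u l *\<^sub>C \<alpha>) 0 = 0" for l :: 'h
    by (rule clinear_0[OF clinear_tlift]) (intro lin)
  ultimately have "s = 0" by (intro tensor_eq_if_slices_eq) simp
  moreover have "?n 0 = 0" by (rule clinear_0[OF clinear_tlift]) (intro lin)
  ultimately show ?thesis using ts by simp
qed

text \<open>Strong invariance, applied in both variables, realizes the operator on generators by an
  explicit tensor.\<close>

lemma coprod_op_gen:
  fixes x y :: 'c and g a b :: 'h
  defines "st \<equiv> sw a (\<lambda>a1 a2. sw b (\<lambda>b1 b2. cw y (\<lambda>c d.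
      (\<phi> (d * S' a1 * S' b1 * g) *\<^sub>C (c * x)) \<boxtimes> dotH G a2 \<otimes> 1 \<boxtimes> dotH G b2)))"
  shows "st \<in> AA G" "evB st = coprod_op (part (x \<boxtimes> dotH G g)) (evB (y \<boxtimes> dotH G a \<otimes> 1 \<boxtimes> dotH G b))"
proof -
  show "st \<in> AA G" unfolding st_def by (intro tlift_in_subspace) simp_all
  show "evB st = coprod_op (part (x \<boxtimes> dotH G g)) (evB (y \<boxtimes> dotH G a \<otimes> 1 \<boxtimes> dotH G b))"
  proof (rule ext, clarify)
    fix k l
    have in_AA: "(c * x) \<boxtimes> dotH G a2 \<otimes> 1 \<boxtimes> dotH G b2 \<in> AA G" for c a2 b2 by simp
    have cw_scale: "cw (r *\<^sub>C s *\<^sub>C y) (\<lambda>c d. c * (\<phi> (d * p * q * g) *\<^sub>C x))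
        = r *\<^sub>C s *\<^sub>C cw y (\<lambda>c d. c * (\<phi> (d * p * q * g) *\<^sub>C x))" for r s p q
    proof -
      have "clinear (\<lambda>y. cw y (\<lambda>c d. c * (\<phi> (d * p * q * g) *\<^sub>C x)))" by (intro lin)
      from clinear_scaleC[OF this] show ?thesis by simp
    qed
    have "coprod_op (part (x \<boxtimes> dotH G g)) (evB (y \<boxtimes> dotH G a \<otimes> 1 \<boxtimes> dotH G b)) (k, l)
        = sw l (\<lambda>l1 l2. sw k (\<lambda>k1 k2. \<phi> (l2 * b) *\<^sub>C \<phi> (k2 * a) *\<^sub>C
            cw y (\<lambda>c d. c * (\<phi> (d * k1 * l1 * g) *\<^sub>C x))))"
      by (simp add: coprod_op_def evB_one conv_def cw_scale)
    also have "\<dots> = sw l (\<lambda>l1 l2. \<phi> (l2 * b) *\<^sub>C sw a (\<lambda>a1 a2. \<phi> (k * a2) *\<^sub>C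
            cw y (\<lambda>c d. c * (\<phi> (d * S' a1 * l1 * g) *\<^sub>C x))))"
      by (subst tlift_on_scale, subst strong_left_invariance') (intro lin refl)+
    also have "\<dots> = sw b (\<lambda>b1 b2. \<phi> (l * b2) *\<^sub>C sw a (\<lambda>a1 a2. \<phi> (k * a2) *\<^sub>C
            cw y (\<lambda>c d. c * (\<phi> (d * S' a1 * S' b1 * g) *\<^sub>C x))))"
      by (rule strong_left_invariance') (intro lin)
    also have "\<dots> = sw a (\<lambda>a1 a2. sw b (\<lambda>b1 b2. cw y (\<lambda>c d. \<phi> (l * b2) *\<^sub>C \<phi> (k * a2) *\<^sub>C
            \<phi> (d * S' a1 * S' b1 * g) *\<^sub>C (c * x))))"
      by (simp add: tlift_on_scale[symmetric] mult_scaleC_right tlift_on_swap[of _ _ _ _ _ _ "Delta G a"])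
    also have "\<dots> = evB st (k, l)"
      unfolding st_def
      by (simp add: evB_sum tlift_in_subspace evB_one)
    finally show "evB st (k, l) = coprod_op (part (x \<boxtimes> dotH G g)) (evB (y \<boxtimes> dotH G a \<otimes> 1 \<boxtimes> dotH G b)) (k, l)" ..
  qed
qed

lemma evB_reduce:
  assumes "\<alpha> \<in> Ahat G" "u \<in> Hhat G"
  shows "evB (\<alpha> \<otimes> y \<boxtimes> u) = evB (mleft (embC G y) \<alpha> \<otimes> 1 \<boxtimes> u)"
proof
  fix i
  have "evB (mleft (embC G y) \<alpha> \<otimes> 1 \<boxtimes> u - \<alpha> \<otimes> y \<boxtimes> u) i = 0"
    using relB_reduce[OF assms] relB_subset by blast
  then show "evB (\<alpha> \<otimes> y \<boxtimes> u) i = evB (mleft (embC G y) \<alpha> \<otimes> 1 \<boxtimes> u) i"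
    using assms by (simp add: clinear_on_diff[OF evB_linear])
qed

lemma evB_add: "s \<in> AA G \<Longrightarrow> t \<in> AA G \<Longrightarrow> evB (s + t) = (\<lambda>i. evB s i + evB t i)"
  by (rule ext) (rule clinear_on_add[OF evB_linear])

lemma evB_coprod_exists:
  assumes "\<upsilon> \<in> Ahat G" "t \<in> AA G"
  shows "\<exists>s\<in>AA G. evB s = coprod_op (part \<upsilon>) (evB t)"
proof -
  define ok where "ok \<upsilon> t \<longleftrightarrow> (\<exists>s\<in>AA G. evB s = coprod_op (part \<upsilon>) (evB t))" for \<upsilon> t
  have ok_add_left: "ok (\<upsilon> + \<omega>) t" if oks: "ok \<upsilon> t" "ok \<omega> t" "\<upsilon> \<in> Ahat G" "\<omega> \<in> Ahat G" for \<upsilon> \<omega> t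
  proof -
    obtain s s' where "s \<in> AA G" "s' \<in> AA G" "evB s = coprod_op (part \<upsilon>) (evB t)"
      "evB s' = coprod_op (part \<omega>) (evB t)" using oks unfolding ok_def by blast
    then show ?thesis unfolding ok_def
      by (intro bexI[of _ "s + s'"]) (simp_all add: evB_add part_add oks coprod_op_add_left complex_vector.subspace_add)
  qed
  have ok_add_right: "ok \<upsilon> (t + t')" if oks: "ok \<upsilon> t" "ok \<upsilon> t'" "\<upsilon> \<in> Ahat G" "t \<in> AA G" "t' \<in> AA G" for \<upsilon> t t'
  proof -
    obtain s s' where "s \<in> AA G" "s' \<in> AA G" "evB s = coprod_op (part \<upsilon>) (evB t)"
      "evB s' = coprod_op (part \<upsilon>) (evB t')" using oks unfolding ok_def by blast
    then show ?thesis unfolding ok_def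
      by (intro bexI[of _ "s + s'"])
        (simp_all add: evB_add coprod_op_add part_linear oks complex_vector.subspace_add)
  qed
  have gen: "ok \<upsilon> (y \<boxtimes> dotH G a \<otimes> 1 \<boxtimes> dotH G b)" if "\<upsilon> \<in> Ahat G" for \<upsilon> y a b
    using that
  proof (induction \<upsilon> rule: Ahat_induct)
    case (gen x g)
    then show ?case using coprod_op_gen unfolding ok_def by blast
  qed (intro ok_add_left)
  have one: "ok \<upsilon> (\<alpha> \<otimes> 1 \<boxtimes> dotH G b)" if "\<alpha> \<in> Ahat G" for \<alpha> b
    using that
  proof (induction \<alpha> rule: Ahat_induct)
    case (add \<alpha> \<beta>)
    then show ?case unfolding tensor_op_add_left by (intro ok_add_right assms) simp_all
  qed (rule gen[OF assms(1)])
  have tensor: "ok \<upsilon> (\<alpha> \<otimes> \<beta>)" if \<alpha>: "\<alpha> \<in> Ahat G" and "\<beta> \<in> Ahat G" for \<alpha> \<beta>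
    using that(2)
  proof (induction \<beta> rule: Ahat_induct)
    case (gen y h)
    show ?case using one[OF embC_left_in_Ahat[OF \<alpha>], of y h] by (simp add: ok_def evB_reduce \<alpha>)
  next
    case (add \<beta> \<gamma>)
    then show ?case unfolding tensor_op_add_right by (intro ok_add_right assms) (simp_all add: \<alpha>)
  qed
  have "ok \<upsilon> t" using assms(2) subspace_Ahat
  proof (induction t rule: tsub_induct)
    case zero
    have "coprod_op (part \<upsilon>) (\<lambda>i. 0) = (\<lambda>i. 0)"
      using coprod_op_scale[OF part_linear[OF assms(1)], of 0 "\<lambda>i. 0"] by simp
    moreover have "evB 0 = (\<lambda>i. 0)"
      by (rule ext) (rule clinear_on_zero[OF evB_linear subspace_tsub])
    ultimately show ?case unfolding ok_def
      by (intro bexI[of _ 0]) (simp_all add: complex_vector.subspace_0)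
  qed (use tensor ok_add_right[OF _ _ assms(1)] in auto)
  then show ?thesis by (simp add: ok_def)
qed

text \<open>The tensors of \<open>coprod_op_gen\<close> span: the factors \<open>S\<^sup>-\<^sup>1(a\<^sub>1) S\<^sup>-\<^sup>1(b\<^sub>1)\<close> that appear there are
  undone by choosing \<open>\<omega> = 1 \<boxtimes> \<phi>\<^sub>g\<close> with \<open>g = b\<^sub>1 a\<^sub>1 S(y\<^sub>1)\<close>.\<close>

lemma coprod_op_gen_span:
  "y \<boxtimes> dotH G a \<otimes> 1 \<boxtimes> dotH G b
   = cw y (\<lambda>y0 y1. sw a (\<lambda>a1 a2. sw b (\<lambda>b1 b2. sw a2 (\<lambda>p q. sw b2 (\<lambda>r s. cw y0 (\<lambda>c d.
      (\<phi> (d * S' p * S' r * (b1 * a1 * S y1)) *\<^sub>C (c * 1)) \<boxtimes> dotH G q \<otimes> 1 \<boxtimes> dotH G s))))))"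
proof -
  define X where "X c d y1 z q s = (\<phi> (d * z * S y1) *\<^sub>C c) \<boxtimes> dotH G q \<otimes> 1 \<boxtimes> dotH G s" for c :: 'c and d y1 z q s :: 'h
  have X: "clinear (\<lambda>c. X (f c) d y1 z q s)" if "clinear f" for f :: "'c \<Rightarrow> 'c" and d y1 z q s unfolding X_def by (intro lin that)
  have X1: "clinear (\<lambda>c. X c' (f c) y1 z q s)" "clinear (\<lambda>c. X c' y1 (f c) z q s)" "clinear (\<lambda>c. X c' y1 z (f c) q s)"
    "clinear (\<lambda>c. X c' y1 z q (f c) s)" "clinear (\<lambda>c. X c' y1 z q s (f c))"
    if "clinear f" for f :: "'h \<Rightarrow> 'h" and c' y1 z q s unfolding X_def by (intro lin that)+
  have "cw y (\<lambda>y0 y1. sw a (\<lambda>a1 a2. sw b (\<lambda>b1 b2. sw a2 (\<lambda>p q. sw b2 (\<lambda>r s. cw y0 (\<lambda>c d.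
      (\<phi> (d * S' p * S' r * (b1 * a1 * S y1)) *\<^sub>C (c * 1)) \<boxtimes> dotH G q \<otimes> 1 \<boxtimes> dotH G s))))))
    = cw y (\<lambda>y0 y1. sw a (\<lambda>a1 a2. sw b (\<lambda>b1 b2. sw a2 (\<lambda>p q. sw b2 (\<lambda>r s. cw y0 (\<lambda>c d.
      X c d y1 (S' p * (S' r * b1) * a1) q s))))))"
    by (simp add: X_def mult.assoc)
  also have "\<dots> = cw y (\<lambda>y0 y1. sw a (\<lambda>a1 a2. sw a2 (\<lambda>p q. sw b (\<lambda>b1 b2. sw b2 (\<lambda>r s. cw y0 (\<lambda>c d.
      X c d y1 (S' p * (S' r * b1) * a1) q s))))))"
    by (simp add: tlift_on_swap[of _ _ _ _ _ _ "Delta G b"])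
  also have "\<dots> = cw y (\<lambda>y0 y1. sw a (\<lambda>a1 a2. sw a2 (\<lambda>p q. sw b (\<lambda>x s. sw x (\<lambda>b1 r. cw y0 (\<lambda>c d.
      X c d y1 (S' p * (S' r * b1) * a1) q s))))))"
    by (subst sw_assoc[of _ b]) (intro lin X X1 refl)+
  also have "\<dots> = cw y (\<lambda>y0 y1. sw a (\<lambda>a1 a2. sw a2 (\<lambda>p q. cw y0 (\<lambda>c d. X c d y1 (S' p * a1) q b))))"
    by (simp add: sw_antipode_inv(2)[where F = "\<lambda>x. cw _ (\<lambda>c d. X c d _ (_ * x * _) _ _)"] lin X X1
        sw_counit(1)[where F = "\<lambda>x. cw _ (\<lambda>c d. X c d _ _ _ x)"])
  also have "\<dots> = cw y (\<lambda>y0 y1. sw a (\<lambda>x q. sw x (\<lambda>a1 p. cw y0 (\<lambda>c d. X c d y1 (S' p * a1) q b))))"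
    by (subst sw_assoc[of _ a]) (intro lin X X1 refl)+
  also have "\<dots> = cw y (\<lambda>y0 y1. cw y0 (\<lambda>c d. X c d y1 1 a b))"
    by (simp add: sw_antipode_inv(2)[where F = "\<lambda>x. cw _ (\<lambda>c d. X c d _ x _ _)"] lin X X1
        sw_counit(1)[where F = "\<lambda>x. cw _ (\<lambda>c d. X c d _ _ x _)"])
  also have "\<dots> = cw y (\<lambda>c x. sw x (\<lambda>d y1. X c d y1 1 a b))"
    by (rule cw_coassoc; intro X X1 lin)
  also have "\<dots> = cw y (\<lambda>c x. sw x (\<lambda>d y1. (\<phi> (d * S y1) *\<^sub>C c) \<boxtimes> dotH G a \<otimes> 1 \<boxtimes> dotH G b))"
    by (simp add: X_def)
  also have "\<dots> = cw y (\<lambda>c x. \<epsilon> x *\<^sub>C (c \<boxtimes> dotH G a \<otimes> 1 \<boxtimes> dotH G b))"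
    by (simp add: sw_antipode(2)[where F = "\<lambda>x. (\<phi> x *\<^sub>C _) \<boxtimes> _ \<otimes> _"] lin scaleC_one)
  also have "\<dots> = y \<boxtimes> dotH G a \<otimes> 1 \<boxtimes> dotH G b"
    by (rule cw_counit) (intro lin)
  finally show ?thesis ..
qed

lemma evB_coprod_span:
  "AA G \<subseteq> cspan {s \<in> AA G. \<exists>\<omega>\<in>Ahat G. \<exists>t\<in>AA G. evB s = coprod_op (part \<omega>) (evB t)}" (is "_ \<subseteq> cspan ?E")
proof
  fix t assume "t \<in> AA G"
  have sub: "complex_vector.subspace (cspan ?E)" by (rule complex_vector.subspace_span)
  \<comment> \<open>A balancing relation has the function zero and so lies in the set itself, with \<open>\<omega> = 0\<close>.\<close>
  have rel: "r \<in> cspan ?E" if "r \<in> relB G" for r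
  proof (rule complex_vector.span_base)
    have r: "r \<in> AA G" "evB r = (\<lambda>i. 0)" using that relB_subset by (auto intro!: ext)
    have in_A: "0 \<in> Ahat G" by (simp add: complex_vector.subspace_0)
    moreover have "coprod_op (part 0) (\<lambda>i. 0) = (\<lambda>i. 0)"
      using coprod_op_scale[OF part_linear[OF in_A], of 0 "\<lambda>i. 0"] by simp
    ultimately show "r \<in> ?E" using r by (intro CollectI conjI bexI[of _ 0] bexI[of _ r]) simp_all
  qed
  have gen: "y \<boxtimes> dotH G a \<otimes> 1 \<boxtimes> dotH G b \<in> cspan ?E" for y a b
  proof -
    have 1: "sw a2 (\<lambda>p q. sw b2 (\<lambda>r s. cw y0 (\<lambda>c d.
      (\<phi> (d * S' p * S' r * g) *\<^sub>C (c * 1)) \<boxtimes> dotH G q \<otimes> 1 \<boxtimes> dotH G s))) \<in> ?E" for a2 b2 y0 g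
      using coprod_op_gen[where a = a2 and b = b2 and y = y0 and g = g and x = 1]
      by (intro CollectI conjI bexI[of _ "1 \<boxtimes> dotH G g"] bexI[of _ "y0 \<boxtimes> dotH G a2 \<otimes> 1 \<boxtimes> dotH G b2"]) simp_all
    show ?thesis
      by (subst coprod_op_gen_span) (intro tlift_in_subspace sub complex_vector.span_base[OF 1])
  qed
  have one: "\<alpha> \<otimes> 1 \<boxtimes> dotH G b \<in> cspan ?E" if "\<alpha> \<in> Ahat G" for \<alpha> b
    using that
  proof (induction \<alpha> rule: Ahat_induct)
    case (add \<alpha> \<beta>)
    then show ?case unfolding tensor_op_add_left by (intro complex_vector.subspace_add[OF sub])
  qed (rule gen)
  have tensor: "\<alpha> \<otimes> \<beta> \<in> cspan ?E" if \<alpha>: "\<alpha> \<in> Ahat G" and "\<beta> \<in> Ahat G" for \<alpha> \<beta>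
    using that(2)
  proof (induction \<beta> rule: Ahat_induct)
    case (gen y h)
    have "mleft (embC G y) \<alpha> \<otimes> 1 \<boxtimes> dotH G h - (mleft (embC G y) \<alpha> \<otimes> 1 \<boxtimes> dotH G h - \<alpha> \<otimes> y \<boxtimes> dotH G h) \<in> cspan ?E"
      by (intro complex_vector.subspace_diff[OF sub] one rel relB_reduce embC_left_in_Ahat \<alpha>) simp
    then show ?case by simp
  next
    case (add \<beta> \<gamma>)
    then show ?case unfolding tensor_op_add_right by (intro complex_vector.subspace_add[OF sub])
  qed
  show "t \<in> cspan ?E" using \<open>t \<in> AA G\<close> subspace_Ahat
    by (induction t rule: tsub_induct)
      (use tensor complex_vector.subspace_add[OF sub] complex_vector.subspace_0[OF sub] in auto)
qed

lemma evB_model: "dual_comultiplication G (relB G) evB part"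
proof (intro dual_comultiplication.intro[OF yd_setting_axioms] evaluated_quotient.intro
    dual_comultiplication_axioms.intro)
  show "complex_vector.subspace (AA G)" by simp
  show "relB G \<subseteq> AA G" using relB_subset by blast
  show "clinear_on (AA G) (\<lambda>t. evB t i)" for i by (rule evB_linear)
  show "t \<in> relB G" if "t \<in> AA G" "\<And>i. evB t i = 0" for t using that by (rule evB_kernel)
  show "evB t i = 0" if "t \<in> relB G" for t i using that relB_subset by blast
  show "clinear (\<lambda>m. evB t (m, b))" if "t \<in> AA G" for t b
    using evB_bilinear'[OF that] by simp
  show "clinear (\<lambda>b. evB t (m, b))" if "t \<in> AA G" for t m
    using evB_bilinear'[OF that] by simp
  show "clinear (part \<upsilon>)" if "\<upsilon> \<in> Ahat G" for \<upsilon> using that by (rule part_linear)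
  show "\<exists>s\<in>AA G. evB s = coprod_op (part \<upsilon>) (evB t)" if "\<upsilon> \<in> Ahat G" "t \<in> AA G" for \<upsilon> t
    using that by (rule evB_coprod_exists)
  show "AA G \<subseteq> cspan {s \<in> AA G. \<exists>\<omega>\<in>Ahat G. \<exists>t\<in>AA G. evB s = coprod_op (part \<omega>) (evB t)}"
    by (rule evB_coprod_span)
qed

interpretation B: dual_comultiplication G "relB G" evB part
  by (rule evB_model)

lemma left_C_part_Ahat: "\<alpha> \<in> Ahat G \<Longrightarrow> left_C_part G \<alpha> = tlift (\<lambda>z k. z * part \<alpha> k)"
  by (rule left_C_part_eq[OF Ahat_represents])

lemma pairB_bilinear:
  "clinear_on (Ahat G) (\<lambda>\<upsilon>. dapp \<upsilon> a)"
  "clinear_on (Ahat G) (\<lambda>\<omega>. dapp \<upsilon> (a \<odot> ofC (left_C_part G \<omega> b)))"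
proof -
  show "clinear_on (Ahat G) (\<lambda>\<upsilon>. dapp \<upsilon> a)"
    by (rule clinear_onI) (simp_all add: plus_dual.rep_eq scaleC_dual.rep_eq scaleC_complex_def)
  have "clinear (\<lambda>y. dapp \<upsilon> (a \<odot> ofC y))" by (intro lin)
  then show "clinear_on (Ahat G) (\<lambda>\<omega>. dapp \<upsilon> (a \<odot> ofC (left_C_part G \<omega> b)))"
    by (intro clinear_onI)
      (simp_all add: left_C_part_Ahat complex_vector.subspace_add complex_vector.subspace_scale part_add
        part_scale distrib_left tlift_on_add mult_scaleC_right tlift_on_scale
        clinear_add[where f = "\<lambda>y. dapp \<upsilon> (a \<odot> ofC y)"] clinear_scaleC[where f = "\<lambda>y. dapp \<upsilon> (a \<odot> ofC y)"])
qed

text \<open>The pairing that specifies the left comultiplication depends on the function of a tensor only.\<close>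

lemma pairB_evB:
  assumes "t \<in> AA G"
  shows "tlift_on (Ahat G) (Ahat G) (\<lambda>\<upsilon> \<omega>. dapp \<upsilon> ((z \<otimes> k) \<odot> ofC (left_C_part G \<omega> (w \<otimes> l)))) t
    = \<mu> (z * (act_map w \<star> (\<lambda>m. evB t (m, l))) k)" (is "?p t = ?q t")
proof -
  have p: "clinear_on (AA G) ?p"
    by (intro tlift_on_linear subspace_Ahat pairB_bilinear)
  show ?thesis
    using assms subspace_Ahat
  proof (induction t rule: tsub_induct)
    case zero
    show ?case
      by (simp add: clinear_on_zero[OF p] clinear_on_zero[OF evB_linear] act_map_conv clinear_0[OF mu_linear])
  next
    case (tensor \<alpha> \<beta>)
    have "?p (\<alpha> \<otimes> \<beta>) = dapp \<alpha> ((z \<otimes> k) \<odot> ofC (w * part \<beta> l))"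
      using tensor by (subst tlift_on_tensor)
        (simp_all add: pairB_bilinear left_C_part_tensor[OF Ahat_represents])
    also have "\<dots> = \<mu> (z * (act_map (w * part \<beta> l) \<star> part \<alpha>) k)"
      by (simp add: amult_ofC_right tlift_on_push[OF clinear_dapp] act_map_conv lin
          represents_dapp[OF Ahat_represents[OF tensor(1)]] mult.assoc tlift_on_push[where g = "\<lambda>x. \<mu> (z * x)"])
    also have "\<dots> = ?q (\<alpha> \<otimes> \<beta>)"
      by (simp add: act_map_mult[symmetric] conv_assoc lin part_linear tensor evB_tensor[OF tensor])
    finally show ?case .
  next
    case (add s t)
    have "(act_map w \<star> (\<lambda>m. evB (s + t) (m, l))) k
        = (act_map w \<star> (\<lambda>m. evB s (m, l))) k + (act_map w \<star> (\<lambda>m. evB t (m, l))) k"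
      by (simp add: act_map_conv clinear_on_add[OF evB_linear add(1,2)] distrib_left tlift_on_add)
    then show ?case
      using add by (simp add: clinear_on_add[OF p] distrib_left clinear_add[OF mu_linear])
  qed
qed

text \<open>The function of \<open>\<Delta>'(\<upsilon>)(1 \<otimes> \<omega>)\<close>. It is the operator of \<open>F\<close> applied to the function
  \<open>(m, l) \<mapsto> m \<rhd> K(l)\<close> that \<open>1 \<otimes> \<omega>\<close> would have; \<open>1 \<otimes> \<omega>\<close> itself may lie outside the tensor square
  because the dual algebra need not have a unit.\<close>

definition one_coprod :: "('h \<Rightarrow> 'c) \<Rightarrow> ('h \<Rightarrow> 'c) \<Rightarrow> 'h \<times> 'h \<Rightarrow> 'c" where
  "one_coprod F K = (\<lambda>(m, l). sw l (\<lambda>a b. ((\<lambda>m. F (m * a)) \<star> act_map (K b)) m))"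

lemma pair_lconv:
  assumes "\<upsilon> \<in> Ahat G" "\<omega> \<in> Ahat G"
  shows "dapp \<upsilon> ((z \<otimes> k) \<odot> lconv G \<omega> (w \<otimes> l)) = \<mu> (z * (act_map w \<star> (\<lambda>m. one_coprod (part \<upsilon>) (part \<omega>) (m, l))) k)"
proof -
  note F = clinear_comp[OF part_linear[OF assms(1)]]
  have lF: "clinear (\<lambda>m. part \<upsilon> (m * a))" for a by (intro lin F)
  have "dapp \<upsilon> ((z \<otimes> k) \<odot> lconv G \<omega> (w \<otimes> l)) = \<mu> (z * sw l (\<lambda>a b. cw (part \<omega> b) (\<lambda>c d. sw k (\<lambda>p q.
      (p \<rhd> (w * c)) * part \<upsilon> (q * (d * a))))))"
    by (simp add: lconv_tensor[OF Ahat_represents[OF assms(2)]] tC_tensor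
        tlift_on_push[where g = "\<lambda>x. (z \<otimes> k) \<odot> x"] tlift_on_push[OF clinear_dapp]
        tlift_on_push[where g = "\<lambda>x. \<mu> (z * x)"] lin amult_tensor mult.assoc
        represents_dapp[OF Ahat_represents[OF assms(1)]])
  also have "sw l (\<lambda>a b. cw (part \<omega> b) (\<lambda>c d. sw k (\<lambda>p q. (p \<rhd> (w * c)) * part \<upsilon> (q * (d * a)))))
      = sw l (\<lambda>a b. cw (part \<omega> b) (\<lambda>c d. sw k (\<lambda>x q. sw x (\<lambda>p r. (p \<rhd> w) * ((r \<rhd> c) * part \<upsilon> (q * (d * a)))))))"
    by (simp add: act_prod tlift_on_push[where g = "\<lambda>x. x * _"] lin mult.assoc)
  also have "\<dots> = sw l (\<lambda>a b. cw (part \<omega> b) (\<lambda>c d. sw k (\<lambda>p x. sw x (\<lambda>r q. (p \<rhd> w) * ((r \<rhd> c) * part \<upsilon> (q * (d * a)))))))"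
    by (subst sw_assoc) (intro lin F refl)+
  also have "\<dots> = sw k (\<lambda>p x. (p \<rhd> w) * sw l (\<lambda>a b. sw x (\<lambda>r q. cw (part \<omega> b) (\<lambda>c d. (r \<rhd> c) * part \<upsilon> (q * (d * a))))))"
    by (simp add: tlift_on_push[where g = "\<lambda>x. _ * x"] lin tlift_on_swap[of _ _ _ _ _ _ "Delta G k"])
      (simp add: tlift_on_swap[of _ _ _ _ _ "Delta G r" "coact G (part \<omega> s)" for r s])
  also have "\<dots> = (act_map w \<star> (\<lambda>m. one_coprod (part \<upsilon>) (part \<omega>) (m, l))) k"
    by (simp add: act_map_conv one_coprod_def conv_act_map lF mult.assoc)
  finally show ?thesis .
qed

text \<open>A tensor with function \<open>one_coprod\<close> satisfies the equation by which \<open>\<Delta>'(\<upsilon>)(1 \<otimes> \<omega>)\<close> is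
  specified.\<close>

lemma pairing_value:
  assumes v: "\<upsilon> \<in> Ahat G" "\<omega> \<in> Ahat G" and t: "t \<in> AA G" and ev: "evB t = one_coprod (part \<upsilon>) (part \<omega>)"
  shows "tlift_on (Ahat G) (Ahat G) (\<lambda>\<alpha> \<beta>. dapp \<alpha> (a \<odot> ofC (left_C_part G \<beta> b))) t = dapp \<upsilon> (a \<odot> lconv G \<omega> b)"
    (is "?p a b = _")
proof (rule tensor_ext[where t = a])
  have lin2: "clinear (?p a)" for a
  proof (rule clinearI)
    note eq = tlift_on_cong[OF subspace_Ahat t]
    have l: "left_C_part G \<omega> (b + b') = left_C_part G \<omega> b + left_C_part G \<omega> b'"
      "left_C_part G \<omega> (c *\<^sub>C b) = c *\<^sub>C left_C_part G \<omega> b" if "\<omega> \<in> Ahat G" for \<omega> b b' c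
      using left_C_part_linear[OF Ahat_represents[OF that]] by (simp_all add: clinear_add clinear_scaleC)
    have m: "clinear (\<lambda>y. dapp \<upsilon> (a \<odot> ofC y))" for \<upsilon> by (intro lin)
    show "?p a (b + b') = ?p a b + ?p a b'" for b b'
      unfolding tlift_on_add[symmetric] by (rule eq) (simp add: l clinear_add[OF m])
    show "?p a (c *\<^sub>C b) = c *\<^sub>C ?p a b" for b c
      unfolding tlift_on_scale[symmetric] by (rule eq) (simp add: l clinear_scaleC[OF m])
  qed
  show "?p (z \<otimes> k) b = dapp \<upsilon> ((z \<otimes> k) \<odot> lconv G \<omega> b)" for z k
    by (rule tensor_ext[where t = b, OF lin2])
      (simp_all add: pairB_evB[OF t] ev pair_lconv[OF v] lin clinear_comp[OF lconv_linear[OF Ahat_represents[OF v(2)]]]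
        lconv_linear[OF Ahat_represents[OF v(2)]])
qed (intro lin)+

lemma act_map_one_conv: "clinear F \<Longrightarrow> (act_map 1 \<star> F) k = F k"
  using act_map_scalar[of F 1 k] by (simp add: scaleC_one)

lemma pairing_separates:
  assumes s: "s \<in> AA G" and t: "t \<in> AA G"
    and eq: "\<And>a b. tlift_on (Ahat G) (Ahat G) (\<lambda>\<alpha> \<beta>. dapp \<alpha> (a \<odot> ofC (left_C_part G \<beta> b))) s
      = tlift_on (Ahat G) (Ahat G) (\<lambda>\<alpha> \<beta>. dapp \<alpha> (a \<odot> ofC (left_C_part G \<beta> b))) t"
  shows "evB s = evB t"
proof (rule ext, clarify)
  fix k l
  have "\<mu> (z * evB s (k, l)) = \<mu> (z * evB t (k, l))" for z
    using eq[of "z \<otimes> k" "1 \<otimes> l"]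
    by (simp add: pairB_evB s t act_map_one_conv B.ev_bilinear)
  then show "evB s (k, l) = evB t (k, l)" by (rule mu_separates_right)
qed

lemma DhatB1_eq:
  assumes v: "\<upsilon> \<in> Ahat G" "\<omega> \<in> Ahat G" and t: "t \<in> AA G" and ev: "evB t = one_coprod (part \<upsilon>) (part \<omega>)"
  shows "DhatB1 G \<upsilon> \<omega> = coset (relB G) t"
  unfolding DhatB1_def
proof (rule the_equality)
  note rep = B.coset_rep[OF t]
  show "coset (relB G) t \<in> quot (AA G) (relB G) \<and>
      (\<forall>a b. pairB G (coset (relB G) t) a b = dapp \<upsilon> (a \<odot> lconv G \<omega> b))"
    using t by (simp add: quot_def pairB_def pairing_value[OF v rep(1)] rep(2) ev)
  fix X
  assume X: "X \<in> quot (AA G) (relB G) \<and> (\<forall>a b. pairB G X a b = dapp \<upsilon> (a \<odot> lconv G \<omega> b))"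
  then obtain s where s: "s \<in> AA G" "X = coset (relB G) s" by (auto simp: quot_def)
  have "evB (coset_rep X) = evB (coset_rep (coset (relB G) t))"
    using X by (intro pairing_separates) (simp_all add: s rep(1) B.coset_rep[OF s(1)] pairB_def pairing_value[OF v rep(1)] rep(2) ev)
  then show "X = coset (relB G) t"
    using s t by (simp add: B.coset_eq_iff_ev B.coset_rep)
qed

lemma one_coprod_exists:
  assumes "\<upsilon> \<in> Ahat G" "\<omega> \<in> Ahat G"
  shows "\<exists>t\<in>AA G. evB t = one_coprod (part \<upsilon>) (part \<omega>)"
  using assms(1)
proof (induction \<upsilon> rule: Ahat_induct)
  case (gen x g)
  show ?case using assms(2)
  proof (induction \<omega> rule: Ahat_induct)
    case (gen y h)
    \<comment> \<open>The two inverse antipodes come from strong invariance in \<open>l\<close> and in \<open>m\<close>.\<close>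
    let ?t = "sw h (\<lambda>h1 h2. cw y (\<lambda>c d. sw (d * S' h1 * g) (\<lambda>m1 m2.
        ((S' m1 \<rhd> c) * x) \<boxtimes> dotH G m2 \<otimes> 1 \<boxtimes> dotH G h2)))"
    show ?case
    proof (rule bexI[of _ ?t], rule ext, clarify)
      show "?t \<in> AA G" by (intro tlift_in_subspace) simp_all
      fix m l
      have *: "((\<lambda>m. \<phi> (m * a * g) *\<^sub>C x) \<star> act_map (s *\<^sub>C y)) m
          = s *\<^sub>C cw y (\<lambda>c d. sw (d * a * g) (\<lambda>m1 m2. \<phi> (m * m2) *\<^sub>C ((S' m1 \<rhd> c) * x)))" for a s
      proof -
        have "clinear (\<lambda>y. sw m (\<lambda>p q. cw y (\<lambda>c d. (p \<rhd> c) * (\<phi> (q * d * a * g) *\<^sub>C x))))" by (intro lin)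
        from clinear_scaleC[OF this, of s y]
        have "((\<lambda>m. \<phi> (m * a * g) *\<^sub>C x) \<star> act_map (s *\<^sub>C y)) m
            = s *\<^sub>C sw m (\<lambda>p q. cw y (\<lambda>c d. \<phi> (q * (d * a * g)) *\<^sub>C ((p \<rhd> c) * x)))"
          by (simp add: conv_act_map lin mult.assoc mult_scaleC_right)
        also have "\<dots> = s *\<^sub>C cw y (\<lambda>c d. sw m (\<lambda>p q. \<phi> (q * (d * a * g)) *\<^sub>C ((p \<rhd> c) * x)))"
          by (subst tlift_on_swap) simp
        also have "\<dots> = s *\<^sub>C cw y (\<lambda>c d. sw (d * a * g) (\<lambda>m1 m2. \<phi> (m * m2) *\<^sub>C ((S' m1 \<rhd> c) * x)))"
          by (subst strong_left_invariance') (intro lin refl)+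
        finally show ?thesis .
      qed
      have "one_coprod (part (x \<boxtimes> dotH G g)) (part (y \<boxtimes> dotH G h)) (m, l)
          = sw l (\<lambda>a b. \<phi> (b * h) *\<^sub>C cw y (\<lambda>c d. sw (d * a * g) (\<lambda>m1 m2. \<phi> (m * m2) *\<^sub>C ((S' m1 \<rhd> c) * x))))"
        by (simp add: one_coprod_def *)
      also have "\<dots> = sw h (\<lambda>h1 h2. \<phi> (l * h2) *\<^sub>C
            cw y (\<lambda>c d. sw (d * S' h1 * g) (\<lambda>m1 m2. \<phi> (m * m2) *\<^sub>C ((S' m1 \<rhd> c) * x))))"
        by (rule strong_left_invariance') (intro lin)
      also have "\<dots> = evB ?t (m, l)"
        by (simp add: evB_sum tlift_in_subspace evB_one tlift_on_scale)
      finally show "evB ?t (m, l) = one_coprod (part (x \<boxtimes> dotH G g)) (part (y \<boxtimes> dotH G h)) (m, l)" ..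
    qed
  next
    case (add \<omega> \<omega>')
    then obtain s s' where s: "s \<in> AA G" "s' \<in> AA G" "evB s = one_coprod (part (x \<boxtimes> dotH G g)) (part \<omega>)"
      "evB s' = one_coprod (part (x \<boxtimes> dotH G g)) (part \<omega>')" by blast
    have "one_coprod F (\<lambda>k. K k + K' k) = (\<lambda>i. one_coprod F K i + one_coprod F K' i)" if "clinear F" for F K K'
    proof -
      have "clinear (\<lambda>y. ((\<lambda>m. F (m * a)) \<star> act_map y) m)" for a m
        unfolding conv_def act_map_def by (intro lin clinear_comp[OF that])
      then show ?thesis by (simp add: one_coprod_def fun_eq_iff clinear_add[where f = "\<lambda>y. (_ \<star> act_map y) _"] tlift_on_add)
    qed
    then show ?case using s add
      by (intro bexI[of _ "s + s'"]) (simp_all add: evB_add part_add part_linear lin complex_vector.subspace_add del: part_mu_tensor)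
  qed
next
  case (add \<upsilon> \<upsilon>')
  then obtain s s' where s: "s \<in> AA G" "s' \<in> AA G" "evB s = one_coprod (part \<upsilon>) (part \<omega>)"
    "evB s' = one_coprod (part \<upsilon>') (part \<omega>)" by blast
  have "one_coprod (\<lambda>k. K k + K' k) F = (\<lambda>i. one_coprod K F i + one_coprod K' F i)" for F K K'
    by (simp add: one_coprod_def fun_eq_iff conv_def distrib_left tlift_on_add)
  then show ?case using s add
    by (intro bexI[of _ "s + s'"]) (simp_all add: evB_add part_add complex_vector.subspace_add)
qed

lemma DhatB1_rep:
  assumes "\<upsilon> \<in> Ahat G" "\<omega> \<in> Ahat G"
  shows "coset_rep (DhatB1 G \<upsilon> \<omega>) \<in> AA G" "evB (coset_rep (DhatB1 G \<upsilon> \<omega>)) = one_coprod (part \<upsilon>) (part \<omega>)"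
proof -
  obtain t where t: "t \<in> AA G" "evB t = one_coprod (part \<upsilon>) (part \<omega>)"
    using one_coprod_exists[OF assms] by blast
  then show "coset_rep (DhatB1 G \<upsilon> \<omega>) \<in> AA G" "evB (coset_rep (DhatB1 G \<upsilon> \<omega>)) = one_coprod (part \<upsilon>) (part \<omega>)"
    by (simp_all add: DhatB1_eq[OF assms t] B.coset_rep)
qed

text \<open>Multiplying \<open>\<Delta>'(\<upsilon>)(1 \<otimes> \<omega>)\<close> by \<open>\<alpha> \<otimes> 1\<close> gives \<open>\<Delta>'(\<upsilon>)(\<alpha> \<otimes> \<omega>)\<close>; on functions this is associativity
  of the convolution.\<close>

lemma one_coprod_conv:
  assumes "clinear F" "clinear K" "clinear N"
  shows "((\<lambda>m. one_coprod F K (m, l)) \<star> N) k = coprod_op F (\<lambda>(k, l). (act_map (K l) \<star> N) k) (k, l)"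
proof -
  have "clinear (\<lambda>m. F (m * a))" for a by (intro lin clinear_comp[OF assms(1)])
  then show ?thesis
    by (simp add: one_coprod_def coprod_op_def conv_sum_left conv_assoc lin assms)
qed

lemma evB_right_mult:
  assumes r: "r \<in> AA G" and \<alpha>: "\<alpha> \<in> Ahat G"
  shows "tlift_on (Ahat G) (Ahat G) (\<lambda>\<kappa> \<nu>. Amult G \<kappa> \<alpha> \<otimes> \<nu>) r \<in> AA G \<and>
    evB (tlift_on (Ahat G) (Ahat G) (\<lambda>\<kappa> \<nu>. Amult G \<kappa> \<alpha> \<otimes> \<nu>) r) (k, l) = ((\<lambda>m. evB r (m, l)) \<star> part \<alpha>) k"
proof -
  let ?m = "tlift_on (Ahat G) (Ahat G) (\<lambda>\<kappa> \<nu>. Amult G \<kappa> \<alpha> \<otimes> \<nu>)"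
  have bil: "clinear_on (Ahat G) (\<lambda>\<kappa>. Amult G \<kappa> \<alpha> \<otimes> \<nu>)" "clinear_on (Ahat G) (\<lambda>\<nu>. Amult G \<kappa> \<alpha> \<otimes> \<nu>)" for \<kappa> \<nu>
    by (rule clinear_onI; simp add: Amult_add Amult_scale \<alpha> tensor_op_add_left tensor_op_scaleC_left
        tensor_op_add_right tensor_op_scaleC_right)+
  have m: "clinear_on (AA G) ?m" by (intro tlift_on_linear subspace_Ahat bil)
  show ?thesis
    using r subspace_Ahat
  proof (induction r rule: tsub_induct)
    case zero
    show ?case
      by (simp add: clinear_on_zero[OF m] clinear_on_zero[OF evB_linear] complex_vector.subspace_0 conv_def)
  next
    case (tensor \<beta> \<gamma>)
    then have "?m (\<beta> \<otimes> \<gamma>) = Amult G \<beta> \<alpha> \<otimes> \<gamma>" by (intro tlift_on_tensor subspace_Ahat bil)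
    then show ?case
      using tensor \<alpha> by (simp add: evB_tensor part_Amult conv_assoc lin part_linear)
  next
    case (add s t)
    then show ?case
      by (simp add: clinear_on_add[OF m] clinear_on_add[OF evB_linear] complex_vector.subspace_add conv_def
          distrib_left tlift_on_add)
  qed
qed

lemma DhatB_realizes:
  assumes "\<upsilon> \<in> Ahat G"
  shows "B.realizes (DhatB G \<upsilon>) (coprod_op (part \<upsilon>))"
  unfolding DhatB_def
proof (rule B.comultiplication_realizes[OF assms])
  fix \<alpha> \<beta> assume \<alpha>: "\<alpha> \<in> Ahat G" and \<beta>: "\<beta> \<in> Ahat G"
  note r = DhatB1_rep[OF assms \<beta>]
  show "tlift_on (Ahat G) (Ahat G) (\<lambda>\<kappa> \<nu>. Amult G \<kappa> \<alpha> \<otimes> \<nu>) (coset_rep (DhatB1 G \<upsilon> \<beta>)) \<in> AA G"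
    using evB_right_mult[OF r(1) \<alpha>] by blast
  have "evB (\<alpha> \<otimes> \<beta>) = (\<lambda>(k, l). (act_map (part \<beta> l) \<star> part \<alpha>) k)"
    by (auto simp: evB_tensor \<alpha> \<beta>)
  then show "evB (tlift_on (Ahat G) (Ahat G) (\<lambda>\<kappa> \<nu>. Amult G \<kappa> \<alpha> \<otimes> \<nu>) (coset_rep (DhatB1 G \<upsilon> \<beta>)))
      = coprod_op (part \<upsilon>) (evB (\<alpha> \<otimes> \<beta>))"
    using evB_right_mult[OF r(1) \<alpha>] by (auto simp: r(2) one_coprod_conv part_linear assms \<alpha> \<beta>)
qed

lemma DhatB_ext_realizes:
  assumes "\<delta> \<in> Ahat G"
  shows "B.realizes (DhatB_ext G (ofAhat G \<delta>)) (coprod_op (part \<delta>))"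
  unfolding DhatB_ext_def
  by (rule B.extension_realizes[OF DhatB_realizes assms]) (simp_all add: ofAhat_def part_Amult assms)

section \<open>The dual of H inside the dual algebra\<close>

text \<open>The copy of the functionals on \<open>H\<close> in the convolution algebra.\<close>

abbreviation sc :: "('h \<Rightarrow> complex) \<Rightarrow> 'h \<Rightarrow> 'c" where "sc d \<equiv> \<lambda>k. d k *\<^sub>C 1"

lemma conv_sc_left: "(sc d \<star> F) k = sw k (\<lambda>a b. cw (F b) (\<lambda>u v. d (v * a) *\<^sub>C u))"
  by (simp add: conv_def mult_scaleC_right)

lemma conv_sc_right:
  assumes "clinear F"
  shows "(F \<star> sc d) k = sw k (\<lambda>a b. d b *\<^sub>C F a)"
proof -
  have "clinear (\<lambda>x. cw x (\<lambda>c e. c * F (e * a)))" for a by (intro lin clinear_comp[OF assms])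
  from clinear_scaleC[OF this] show ?thesis
    by (simp add: conv_def cw_one lin clinear_comp[OF assms])
qed

lemma conv_sc_sc: "clinear d \<Longrightarrow> sc d \<star> sc e = sc (\<lambda>k. sw k (\<lambda>a b. d a * e b))"
  by (rule ext, subst conv_sc_right)
    (simp_all add: lin tlift_on_push[where g = "\<lambda>c. c *\<^sub>C _"] scaleC_scaleC mult.commute)

text \<open>The core of the morphism property. The right-hand side contains the values
  \<open>d(X\<^sub>1 Y\<^sub>1) d1(X\<^sub>2) d2(Y\<^sub>2)\<close> of \<open>\<Delta>(d)(d1 \<otimes> d2)\<close>; the left-hand side is the operator of \<open>1 # d\<close>
  applied to \<open>\<pi>(d1)\<alpha> \<otimes> \<pi>(d2)\<beta>\<close>, where \<open>\<pi>(d) = 1 # d\<close>. The second leg contributes an element \<open>y\<close> of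
  \<open>C\<close> that stands to the right of \<open>d\<close>; the exchange \<open>d \<star> y = y\<^sub>0 \<star> d(_ y\<^sub>1)\<close> moves it to the left,
  and this produces the argument \<open>Y\<^sub>1\<close> of \<open>d\<close>.\<close>

lemma coprod_op_sc:
  assumes d: "clinear d" and d1: "clinear d1" and d2: "clinear d2" and K: "clinear K" and N: "clinear N"
  shows "coprod_op (sc d) (\<lambda>(k, l). (act_map ((sc d2 \<star> N) l) \<star> (sc d1 \<star> K)) k) (k, l)
    = sw l (\<lambda>a b. cw (N b) (\<lambda>c w. sw k (\<lambda>p x. sw x (\<lambda>q r. cw (K r) (\<lambda>u v.
        sw (v * q) (\<lambda>X1 X2. sw (w * a) (\<lambda>Y1 Y2. d (X1 * Y1) * d1 X2 * d2 Y2)) *\<^sub>C ((p \<rhd> c) * u))))))"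
proof -
  note cl = clinear_comp[OF d] clinear_comp[OF d1] clinear_comp[OF d2] clinear_comp[OF K] clinear_comp[OF N]
  have l: "clinear (sc d)" "clinear (sc d1)" "clinear (sc d2)" "\<And>y. clinear (\<lambda>m. sc d (m * y))" by (intro lin cl)+
  \<comment> \<open>the value once the element \<open>c\<close> of \<open>C\<close> stands to the left of \<open>d\<close>, with \<open>d\<close> translated by \<open>y\<close>\<close>
  define Z where "Z c y = (act_map c \<star> ((\<lambda>m. sc d (m * y)) \<star> (sc d1 \<star> K))) k" for c y
  have Z: "clinear (\<lambda>x. Z (f x) y)" "clinear (\<lambda>x. Z c (g x))" if "clinear f" "clinear g" for f :: "'c \<Rightarrow> 'c" and g :: "'h \<Rightarrow> 'h" and c y
    unfolding Z_def conv_def act_map_def by (intro lin cl that)+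
  have Zc: "clinear (\<lambda>c. Z c y)" for y by (rule Z(1)) (rule clinear_ident clinear_zero)+
  have Zy: "clinear (\<lambda>y. Z c (f y))" if "clinear f" for c and f :: "'h \<Rightarrow> 'h" by (rule Z(2)) (rule clinear_ident that)+
  have "coprod_op (sc d) (\<lambda>(k, l). (act_map ((sc d2 \<star> N) l) \<star> (sc d1 \<star> K)) k) (k, l)
      = sw l (\<lambda>a b. cw ((sc d2 \<star> N) b) (\<lambda>c w. Z c (w * a)))"
    unfolding coprod_op_def Z_def
    by (simp add: conv_act_map_exchange[OF l(1) conv_linear[OF l(2) K], symmetric])
  also have "\<dots> = sw l (\<lambda>a b. sw b (\<lambda>b1 b2. cw (N b2) (\<lambda>c' w'. d2 (w' * b1) *\<^sub>C cw c' (\<lambda>c w. Z c (w * a)))))"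
  proof -
    have cw_lin: "clinear (\<lambda>x. cw x (\<lambda>c w. Z c (w * a)))" for a by (intro lin Zc Zy)
    show ?thesis by (simp add: conv_sc_left tlift_on_push[OF cw_lin] clinear_scaleC[OF cw_lin])
  qed
  also have "\<dots> = sw l (\<lambda>x b2. sw x (\<lambda>a b1. cw (N b2) (\<lambda>c' w'. d2 (w' * b1) *\<^sub>C cw c' (\<lambda>c w. Z c (w * a)))))"
    by (rule sw_assoc[symmetric]; intro lin cl Zc Zy)
  also have "\<dots> = sw l (\<lambda>x b2. sw x (\<lambda>a b1. cw (N b2) (\<lambda>c' w'. cw c' (\<lambda>c w. d2 (w' * b1) *\<^sub>C Z c (w * a)))))"
    by (simp add: tlift_on_scale)
  also have "\<dots> = sw l (\<lambda>x b2. sw x (\<lambda>a b1. cw (N b2) (\<lambda>c y. sw y (\<lambda>w w'. d2 (w' * b1) *\<^sub>C Z c (w * a)))))"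
    by (subst cw_coassoc) (intro lin cl Zc Zy clinear_ident refl)+
  also have "\<dots> = sw l (\<lambda>x b2. cw (N b2) (\<lambda>c y. sw (y * x) (\<lambda>Y1 Y2. d2 Y2 *\<^sub>C Z c Y1)))"
  proof (rule tlift_on_same)
    fix x b2
    have "sw x (\<lambda>a b1. cw (N b2) (\<lambda>c y. sw y (\<lambda>w w'. d2 (w' * b1) *\<^sub>C Z c (w * a))))
        = cw (N b2) (\<lambda>c y. sw y (\<lambda>w w'. sw x (\<lambda>a b1. d2 (w' * b1) *\<^sub>C Z c (w * a))))"
      by (simp add: tlift_on_swap[of _ _ _ _ _ _ "Delta G x"])
    also have "\<dots> = cw (N b2) (\<lambda>c y. sw (y * x) (\<lambda>Y1 Y2. d2 Y2 *\<^sub>C Z c Y1))"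
      by (subst sw_mult) (intro lin cl Zy clinear_ident refl)+
    finally show "sw x (\<lambda>a b1. cw (N b2) (\<lambda>c y. sw y (\<lambda>w w'. d2 (w' * b1) *\<^sub>C Z c (w * a)))) = \<dots>" .
  qed
  also have "\<dots> = sw l (\<lambda>a b. cw (N b) (\<lambda>c w. sw k (\<lambda>p x. sw x (\<lambda>q r. cw (K r) (\<lambda>u v.
        sw (v * q) (\<lambda>X1 X2. sw (w * a) (\<lambda>Y1 Y2. d (X1 * Y1) * d1 X2 * d2 Y2)) *\<^sub>C ((p \<rhd> c) * u))))))"
  proof (rule tlift_on_same, rule tlift_on_same)
    fix a b c w
    have Z_eq: "Z c Y = sw k (\<lambda>p x. sw x (\<lambda>q r. cw (K r) (\<lambda>u v.
        sw (v * q) (\<lambda>X1 X2. d (X1 * Y) * d1 X2) *\<^sub>C ((p \<rhd> c) * u))))" for Y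
    proof -
      have "(\<lambda>m. sc d (m * Y)) \<star> (sc d1 \<star> K) = sc (\<lambda>m. sw m (\<lambda>X1 X2. d (X1 * Y) * d1 X2)) \<star> K"
        by (simp only: conv_assoc[OF l(4) l(2) K, symmetric], subst conv_sc_sc) (intro lin cl refl)+
      then show ?thesis
        by (simp add: Z_def act_map_conv conv_sc_left tlift_on_push[where g = "\<lambda>x. (_ \<rhd> _) * x"] lin mult_scaleC_right)
    qed
    show "sw (w * a) (\<lambda>Y1 Y2. d2 Y2 *\<^sub>C Z c Y1) = sw k (\<lambda>p x. sw x (\<lambda>q r. cw (K r) (\<lambda>u v.
        sw (v * q) (\<lambda>X1 X2. sw (w * a) (\<lambda>Y1 Y2. d (X1 * Y1) * d1 X2 * d2 Y2)) *\<^sub>C ((p \<rhd> c) * u))))"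
      by (simp add: Z_eq tlift_on_scale[symmetric] scaleC_scaleC
          tlift_on_swap[of _ _ _ _ _ _ "Delta G (w * a)"] tlift_on_push[where g = "\<lambda>c. c *\<^sub>C _"] lin ac_simps)
  qed
  finally show ?thesis .
qed

text \<open>The same expansion for \<open>\<pi>(e)\<alpha> \<otimes> \<pi>(e')\<beta>\<close>, to be summed over the legs of \<open>\<Delta>(d)(d1 \<otimes> d2)\<close>.\<close>

lemma act_map_sc_conv:
  "(act_map ((sc e' \<star> N) l) \<star> (sc e \<star> K)) k
    = sw l (\<lambda>a b. cw (N b) (\<lambda>c w. sw k (\<lambda>p x. sw x (\<lambda>q r. cw (K r) (\<lambda>u v.
        (e (v * q) * e' (w * a)) *\<^sub>C ((p \<rhd> c) * u))))))"
proof -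
  have "act_map ((sc e' \<star> N) l) = (\<lambda>m. sw l (\<lambda>a b. cw (N b) (\<lambda>c w. e' (w * a) *\<^sub>C act_map c m)))"
    by (rule ext) (simp add: act_map_def conv_sc_left tlift_on_push[where g = "\<lambda>x. _ \<rhd> x"] lin
        clinear_scaleC[OF cbilinearD(1)[OF act_bilinear]])
  moreover have "((\<lambda>m. s *\<^sub>C F m) \<star> L) k = s *\<^sub>C (F \<star> L) k" for s F L
    by (simp add: conv_def mult_scaleC_right tlift_on_scale)
  ultimately have "(act_map ((sc e' \<star> N) l) \<star> (sc e \<star> K)) k
      = sw l (\<lambda>a b. cw (N b) (\<lambda>c w. e' (w * a) *\<^sub>C (act_map c \<star> (sc e \<star> K)) k))"
    by (simp add: conv_sum_left)
  also have "\<dots> = sw l (\<lambda>a b. cw (N b) (\<lambda>c w. sw k (\<lambda>p x. sw x (\<lambda>q r. cw (K r) (\<lambda>u v.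
        (e (v * q) * e' (w * a)) *\<^sub>C ((p \<rhd> c) * u))))))"
    by (simp add: act_map_conv conv_sc_left tlift_on_push[where g = "\<lambda>x. (_ \<rhd> _) * x"] lin
        mult_scaleC_right tlift_on_scale[symmetric] scaleC_scaleC mult.commute)
  finally show ?thesis .
qed

lemma pairH_push:
  assumes "t \<in> tsub (Hhat G) (Hhat G)"
  shows "tlift_on (Hhat G) (Hhat G) (\<lambda>e e'. (dapp e h * dapp e' k) *\<^sub>C v) t = pairH t h k *\<^sub>C v"
proof -
  have "tlift_on (Hhat G) (Hhat G) (\<lambda>e e'. (dapp e h * dapp e' k) *\<^sub>C v) t = tlift (\<lambda>e e'. (dapp e h * dapp e' k) *\<^sub>C v) t"
    by (rule tlift_on_eq_tlift[OF subspace_Hhat assms]) ((intro lin)+, simp)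
  then show ?thesis
    by (simp add: pairH_def tlift_on_push[where g = "\<lambda>c. c *\<^sub>C v"] lin)
qed

text \<open>Strong left invariance in both legs exhibits \<open>\<Delta>(d)(d' \<otimes> d'')\<close> as an element of the tensor
  square.\<close>

lemma DH_left_spec:
  assumes "d \<in> Hhat G" "d' \<in> Hhat G" "d'' \<in> Hhat G"
  shows "DH_left G d d' d'' \<in> tsub (Hhat G) (Hhat G)"
    "pairH (DH_left G d d' d'') h k = sw h (\<lambda>h1 h2. sw k (\<lambda>k1 k2. dapp d (h1 * k1) * dapp d' h2 * dapp d'' k2))"
proof -
  obtain g a b where d: "d = dotH G g" "d' = dotH G a" "d'' = dotH G b" using assms by (metis HhatE)
  let ?t = "sw a (\<lambda>a1 a2. sw b (\<lambda>b1 b2. \<phi> (S' a1 * S' b1 * g) *\<^sub>C (dotH G a2 \<otimes> dotH G b2)))"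
  have t: "?t \<in> tsub (Hhat G) (Hhat G)"
    by (intro tlift_in_subspace complex_vector.subspace_scale tensor_in_tsub) simp_all
  have pair: "pairH ?t h k = sw h (\<lambda>h1 h2. sw k (\<lambda>k1 k2. dapp d (h1 * k1) * dapp d' h2 * dapp d'' k2))" for h k
  proof -
    have "sw h (\<lambda>h1 h2. sw k (\<lambda>k1 k2. dapp d (h1 * k1) * dapp d' h2 * dapp d'' k2))
        = sw h (\<lambda>h1 h2. \<phi> (h2 * a) *\<^sub>C sw k (\<lambda>k1 k2. \<phi> (k2 * b) *\<^sub>C \<phi> (h1 * k1 * g)))"
      by (simp add: d tlift_on_scale[symmetric]) (simp add: scaleC_complex_def ac_simps)
    also have "\<dots> = sw h (\<lambda>h1 h2. \<phi> (h2 * a) *\<^sub>C sw b (\<lambda>b1 b2. \<phi> (k * b2) *\<^sub>C \<phi> (h1 * S' b1 * g)))"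
      by (subst strong_left_invariance') (intro lin refl)+
    also have "\<dots> = sw a (\<lambda>a1 a2. \<phi> (h * a2) *\<^sub>C sw b (\<lambda>b1 b2. \<phi> (k * b2) *\<^sub>C \<phi> (S' a1 * S' b1 * g)))"
      by (rule strong_left_invariance') (intro lin)
    also have "\<dots> = pairH ?t h k"
      by (simp add: tlift_on_push[OF pairH_linear] clinear_scaleC[OF pairH_linear] tlift_on_scale[symmetric])
        (simp add: scaleC_complex_def ac_simps)
    finally show ?thesis ..
  qed
  have eq: "DH_left G d d' d'' = ?t"
    unfolding DH_left_def by (rule the_equality) (auto simp: t pair intro!: pairH_ext)
  show "DH_left G d d' d'' \<in> tsub (Hhat G) (Hhat G)"
    "pairH (DH_left G d d' d'') h k = sw h (\<lambda>h1 h2. sw k (\<lambda>k1 k2. dapp d (h1 * k1) * dapp d' h2 * dapp d'' k2))"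
    unfolding eq by (rule t, rule pair)
qed

text \<open>The same with strong right invariance.\<close>

lemma DH_right_spec:
  assumes "d \<in> Hhat G" "d' \<in> Hhat G" "d'' \<in> Hhat G"
  shows "DH_right G d' d'' d \<in> tsub (Hhat G) (Hhat G)"
    "pairH (DH_right G d' d'' d) h k = sw h (\<lambda>h1 h2. sw k (\<lambda>k1 k2. dapp d' h1 * dapp d'' k1 * dapp d (h2 * k2)))"
proof -
  obtain g a b where d: "d = dotH G g" "d' = dotH G a" "d'' = dotH G b" using assms by (metis HhatE)
  let ?t = "sw a (\<lambda>a1 a2. sw b (\<lambda>b1 b2. \<phi> (S a2 * S b2 * g) *\<^sub>C (dotH G a1 \<otimes> dotH G b1)))"
  have t: "?t \<in> tsub (Hhat G) (Hhat G)"
    by (intro tlift_in_subspace complex_vector.subspace_scale tensor_in_tsub) simp_all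
  have pair: "pairH ?t h k = sw h (\<lambda>h1 h2. sw k (\<lambda>k1 k2. dapp d' h1 * dapp d'' k1 * dapp d (h2 * k2)))" for h k
  proof -
    have "sw h (\<lambda>h1 h2. sw k (\<lambda>k1 k2. dapp d' h1 * dapp d'' k1 * dapp d (h2 * k2)))
        = sw h (\<lambda>h1 h2. \<phi> (h1 * a) *\<^sub>C sw k (\<lambda>k1 k2. \<phi> (k1 * b) *\<^sub>C \<phi> (h2 * k2 * g)))"
      by (simp add: d tlift_on_scale[symmetric]) (simp add: scaleC_complex_def ac_simps)
    also have "\<dots> = sw h (\<lambda>h1 h2. \<phi> (h1 * a) *\<^sub>C sw b (\<lambda>b1 b2. \<phi> (k * b1) *\<^sub>C \<phi> (h2 * S b2 * g)))"
      by (subst strong_right_invariance) (intro lin refl)+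
    also have "\<dots> = sw a (\<lambda>a1 a2. \<phi> (h * a1) *\<^sub>C sw b (\<lambda>b1 b2. \<phi> (k * b1) *\<^sub>C \<phi> (S a2 * S b2 * g)))"
      by (rule strong_right_invariance) (intro lin)
    also have "\<dots> = pairH ?t h k"
      by (simp add: tlift_on_push[OF pairH_linear] clinear_scaleC[OF pairH_linear] tlift_on_scale[symmetric])
        (simp add: scaleC_complex_def ac_simps)
    finally show ?thesis ..
  qed
  have eq: "DH_right G d' d'' d = ?t"
    unfolding DH_right_def by (rule the_equality) (auto simp: t pair intro!: pairH_ext)
  show "DH_right G d' d'' d \<in> tsub (Hhat G) (Hhat G)"
    "pairH (DH_right G d' d'' d) h k = sw h (\<lambda>h1 h2. sw k (\<lambda>k1 k2. dapp d' h1 * dapp d'' k1 * dapp d (h2 * k2)))"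
    unfolding eq by (rule t, rule pair)
qed

lemma DhatB_ext_formula:
  assumes d: "d \<in> Hhat G" "d' \<in> Hhat G" "d'' \<in> Hhat G" and \<alpha>: "\<alpha> \<in> Ahat G" and \<beta>: "\<beta> \<in> Ahat G"
  shows "DhatB_ext G (ofAhat G (1 \<boxtimes> d)) (coset (relB G) (Amult G (1 \<boxtimes> d') \<alpha> \<otimes> Amult G (1 \<boxtimes> d'') \<beta>))
    = coset (relB G) (tlift_on (Hhat G) (Hhat G)
        (\<lambda>e e'. Amult G (1 \<boxtimes> e) \<alpha> \<otimes> Amult G (1 \<boxtimes> e') \<beta>) (DH_left G d d' d''))"
proof (rule B.realizes_eq[OF DhatB_ext_realizes])
  note D = DH_left_spec[OF d]
  let ?t = "tlift_on (Hhat G) (Hhat G) (\<lambda>e e'. Amult G (1 \<boxtimes> e) \<alpha> \<otimes> Amult G (1 \<boxtimes> e') \<beta>) (DH_left G d d' d'')"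
  show "1 \<boxtimes> d \<in> Ahat G" using d by simp
  show "Amult G (1 \<boxtimes> d') \<alpha> \<otimes> Amult G (1 \<boxtimes> d'') \<beta> \<in> AA G" using d \<alpha> \<beta> by simp
  show "?t \<in> AA G" by (rule tlift_on_in_subspace[OF subspace_tsub subspace_Hhat D(1)]) (simp add: \<alpha> \<beta>)
  show "evB ?t = coprod_op (part (1 \<boxtimes> d)) (evB (Amult G (1 \<boxtimes> d') \<alpha> \<otimes> Amult G (1 \<boxtimes> d'') \<beta>))"
  proof (rule ext, clarify)
    fix k l
    have ev: "evB (Amult G (1 \<boxtimes> e) \<alpha> \<otimes> Amult G (1 \<boxtimes> e') \<beta>) (k, l)
        = (act_map ((sc (dapp e') \<star> part \<beta>) l) \<star> (sc (dapp e) \<star> part \<alpha>)) k" if "e \<in> Hhat G" "e' \<in> Hhat G" for e e' k l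
      using that \<alpha> \<beta> by (simp add: evB_tensor part_Amult)
    have "evB ?t (k, l) = tlift_on (Hhat G) (Hhat G)
        (\<lambda>e e'. (act_map ((sc (dapp e') \<star> part \<beta>) l) \<star> (sc (dapp e) \<star> part \<alpha>)) k) (DH_left G d d' d'')"
      by (subst tlift_on_push_on[OF evB_linear subspace_tsub subspace_Hhat D(1)])
        (simp_all add: \<alpha> \<beta> ev cong: tlift_on_cong[OF subspace_Hhat D(1)])
    also have "\<dots> = sw l (\<lambda>a b. cw (part \<beta> b) (\<lambda>c w. sw k (\<lambda>p x. sw x (\<lambda>q r. cw (part \<alpha> r) (\<lambda>u v.
        pairH (DH_left G d d' d'') (v * q) (w * a) *\<^sub>C ((p \<rhd> c) * u))))))"
      by (simp add: act_map_sc_conv tlift_on_swap[of _ _ _ _ _ _ "DH_left G d d' d''"]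
          pairH_push[OF D(1)])
    also have "\<dots> = coprod_op (sc (dapp d))
        (\<lambda>(k, l). (act_map ((sc (dapp d'') \<star> part \<beta>) l) \<star> (sc (dapp d') \<star> part \<alpha>)) k) (k, l)"
      by (subst coprod_op_sc) (simp_all add: part_linear \<alpha> \<beta> clinear_dapp D(2))
    also have "\<dots> = coprod_op (part (1 \<boxtimes> d)) (evB (Amult G (1 \<boxtimes> d') \<alpha> \<otimes> Amult G (1 \<boxtimes> d'') \<beta>)) (k, l)"
    proof -
      have "evB (Amult G (1 \<boxtimes> d') \<alpha> \<otimes> Amult G (1 \<boxtimes> d'') \<beta>)
          = (\<lambda>(k, l). (act_map ((sc (dapp d'') \<star> part \<beta>) l) \<star> (sc (dapp d') \<star> part \<alpha>)) k)"
        using ev[OF d(2,3)] by auto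
      then show ?thesis by simp
    qed
    finally show "evB ?t (k, l) = coprod_op (part (1 \<boxtimes> d)) (evB (Amult G (1 \<boxtimes> d') \<alpha> \<otimes> Amult G (1 \<boxtimes> d'') \<beta>)) (k, l)" .
  qed
qed

subsection \<open>The dual of H acts non-degenerately by multipliers\<close>

lemma dapp_Hmult: "dapp (Hmult G d e) k = sw k (\<lambda>a b. dapp d a * dapp e b)"
  unfolding Hmult_def by (subst dapp_Dual) (intro lin refl)+

lemma Hmult_in_Hhat:
  assumes "d \<in> Hhat G" "e \<in> Hhat G"
  shows "Hmult G d e \<in> Hhat G"
proof -
  obtain g h where d: "d = dotH G g" "e = dotH G h" using assms by (metis HhatE)
  have "Hmult G d e = sw h (\<lambda>p q. \<phi> (S' p * g) *\<^sub>C dotH G q)"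
  proof (rule dual_eqI)
    fix k
    have "dapp (Hmult G d e) k = sw k (\<lambda>a b. \<phi> (b * h) *\<^sub>C \<phi> (a * g))"
      by (simp add: dapp_Hmult d scaleC_complex_def mult.commute)
    also have "\<dots> = sw h (\<lambda>p q. \<phi> (k * q) *\<^sub>C \<phi> (S' p * g))"
      by (rule strong_left_invariance') (intro lin)
    also have "\<dots> = dapp (sw h (\<lambda>p q. \<phi> (S' p * g) *\<^sub>C dotH G q)) k"
      by (simp add: tlift_on_push[where g = "\<lambda>x. dapp x k"] lin scaleC_dual.rep_eq)
        (simp add: scaleC_complex_def mult.commute)
    finally show "dapp (Hmult G d e) k = \<dots>" .
  qed
  also have "\<dots> \<in> Hhat G"
    by (intro tlift_in_subspace complex_vector.subspace_scale) simp_all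
  finally show ?thesis .
qed

lemma one_Hmult:
  assumes "d \<in> Hhat G" "e \<in> Hhat G"
  shows "1 \<boxtimes> Hmult G d e = Amult G (1 \<boxtimes> d) (1 \<boxtimes> e)"
proof (rule part_inject)
  show "part (1 \<boxtimes> Hmult G d e) = part (Amult G (1 \<boxtimes> d) (1 \<boxtimes> e))"
    using assms by (simp add: part_Amult conv_sc_sc clinear_dapp dapp_Hmult)
qed (use assms Hmult_in_Hhat in simp_all)

lemma ofAhat_in_MAhat:
  assumes "\<delta> \<in> Ahat G"
  shows "ofAhat G \<delta> \<in> MAhat G"
  using assms unfolding MAhat_def ofAhat_def
  by (auto intro!: clinear_onI simp: Amult_add Amult_scale Amult_assoc complex_vector.subspace_add
      complex_vector.subspace_scale)

lemma dual_H_multiplier_hom: "multiplier_hom G (\<lambda>d. ofAhat G (1 \<boxtimes> d))"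
  unfolding multiplier_hom_def
proof (intro conjI ballI)
  show "(\<lambda>d. ofAhat G (1 \<boxtimes> d)) ` Hhat G \<subseteq> MAhat G" by (intro image_subsetI ofAhat_in_MAhat) simp
  fix \<alpha> assume \<alpha>: "\<alpha> \<in> Ahat G"
  have l: "1 \<boxtimes> (d + e) = 1 \<boxtimes> d + 1 \<boxtimes> e" "1 \<boxtimes> (c *\<^sub>C d) = c *\<^sub>C (1 \<boxtimes> d)" for c d e
    by (simp_all add: clinear_add[OF one_mu_tensor_linear] clinear_scaleC[OF one_mu_tensor_linear])
  show "clinear_on (Hhat G) (\<lambda>d. mleft (ofAhat G (1 \<boxtimes> d)) \<alpha>)"
    "clinear_on (Hhat G) (\<lambda>d. mright \<alpha> (ofAhat G (1 \<boxtimes> d)))"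
    by (rule clinear_onI; simp add: ofAhat_def \<alpha> l Amult_add Amult_scale)+
  fix d e assume "d \<in> Hhat G" "e \<in> Hhat G"
  then show "mleft (ofAhat G (1 \<boxtimes> Hmult G d e)) \<alpha> = mleft (ofAhat G (1 \<boxtimes> d)) (mleft (ofAhat G (1 \<boxtimes> e)) \<alpha>)"
    "mright \<alpha> (ofAhat G (1 \<boxtimes> Hmult G d e)) = mright (mright \<alpha> (ofAhat G (1 \<boxtimes> d))) (ofAhat G (1 \<boxtimes> e))"
    by (simp_all add: ofAhat_def \<alpha> one_Hmult Amult_assoc)
qed

text \<open>The twist in the product formula \<open>Amult_gen\<close> is undone by choosing \<open>g = h\<^sub>1 S(y\<^sub>1)\<close>.\<close>

lemma left_span: "cspan {mleft (ofAhat G (1 \<boxtimes> d)) \<alpha> | d \<alpha>. d \<in> Hhat G \<and> \<alpha> \<in> Ahat G} = Ahat G" (is "cspan ?E = _")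
proof
  show "cspan ?E \<subseteq> Ahat G"
    by (intro complex_vector.span_minimal subspace_Ahat) (auto simp: ofAhat_def)
  have sub: "complex_vector.subspace (cspan ?E)" by (rule complex_vector.subspace_span)
  have E: "Amult G (1 \<boxtimes> dotH G g) (y \<boxtimes> dotH G h) \<in> cspan ?E" for g y h
  proof (rule complex_vector.span_base)
    have "Amult G (1 \<boxtimes> dotH G g) (y \<boxtimes> dotH G h) = mleft (ofAhat G (1 \<boxtimes> dotH G g)) (y \<boxtimes> dotH G h)"
      by (simp add: ofAhat_def)
    then show "Amult G (1 \<boxtimes> dotH G g) (y \<boxtimes> dotH G h) \<in> ?E"
      using dotH_in_Hhat mu_tensor_in_Ahat by blast
  qed
  have expand: "y \<boxtimes> dotH G h = cw y (\<lambda>y0 y1. sw h (\<lambda>h1 h2. Amult G (1 \<boxtimes> dotH G (h1 * S y1)) (y0 \<boxtimes> dotH G h2)))" for y h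
  proof -
    have "cw y (\<lambda>y0 y1. sw h (\<lambda>h1 h2. Amult G (1 \<boxtimes> dotH G (h1 * S y1)) (y0 \<boxtimes> dotH G h2)))
        = cw y (\<lambda>y0 y1. sw h (\<lambda>h1 x. sw x (\<lambda>p q. cw y0 (\<lambda>c d. (\<phi> (d * (S' p * h1) * S y1) *\<^sub>C c) \<boxtimes> dotH G q))))"
      by (simp add: Amult_gen mult.assoc)
    also have "\<dots> = cw y (\<lambda>y0 y1. sw h (\<lambda>x q. sw x (\<lambda>h1 p. cw y0 (\<lambda>c d. (\<phi> (d * (S' p * h1) * S y1) *\<^sub>C c) \<boxtimes> dotH G q))))"
      by (subst sw_assoc[of _ h]) (intro lin refl)+
    also have "\<dots> = cw y (\<lambda>y0 y1. cw y0 (\<lambda>c d. (\<phi> (d * S y1) *\<^sub>C c) \<boxtimes> dotH G h))"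
      by (simp add: sw_antipode_inv(2)[where F = "\<lambda>x. cw _ (\<lambda>c d. (\<phi> (d * x * _) *\<^sub>C c) \<boxtimes> _)"] lin
          sw_counit(1)[where F = "\<lambda>x. cw _ (\<lambda>c d. (\<phi> (d * _) *\<^sub>C c) \<boxtimes> dotH G x)"])
    also have "\<dots> = cw y (\<lambda>c x. sw x (\<lambda>d y1. (\<phi> (d * S y1) *\<^sub>C c) \<boxtimes> dotH G h))"
      by (rule cw_coassoc; intro lin)
    also have "\<dots> = cw y (\<lambda>c x. \<epsilon> x *\<^sub>C (c \<boxtimes> dotH G h))"
      by (simp add: sw_antipode(2)[where F = "\<lambda>x. (\<phi> x *\<^sub>C _) \<boxtimes> _"] lin scaleC_one)
    also have "\<dots> = y \<boxtimes> dotH G h"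
      by (rule cw_counit) (intro lin)
    finally show ?thesis ..
  qed
  show "Ahat G \<subseteq> cspan ?E"
  proof
    fix \<alpha> assume "\<alpha> \<in> Ahat G"
    then show "\<alpha> \<in> cspan ?E"
    proof (induction \<alpha> rule: Ahat_induct)
      case (gen y h)
      show ?case by (subst expand) (intro tlift_in_subspace sub E)
    qed (rule complex_vector.subspace_add[OF sub])
  qed
qed

text \<open>The twist is undone by taking the two legs of \<open>h\<close>.\<close>

lemma right_span: "cspan {mright \<alpha> (ofAhat G (1 \<boxtimes> d)) | d \<alpha>. d \<in> Hhat G \<and> \<alpha> \<in> Ahat G} = Ahat G" (is "cspan ?E = _")
proof
  show "cspan ?E \<subseteq> Ahat G"
    by (intro complex_vector.span_minimal subspace_Ahat) (auto simp: ofAhat_def)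
  have sub: "complex_vector.subspace (cspan ?E)" by (rule complex_vector.subspace_span)
  have E: "Amult G (y \<boxtimes> dotH G h) (1 \<boxtimes> dotH G g) \<in> cspan ?E" for g y h
  proof (rule complex_vector.span_base)
    have "Amult G (y \<boxtimes> dotH G h) (1 \<boxtimes> dotH G g) = mright (y \<boxtimes> dotH G h) (ofAhat G (1 \<boxtimes> dotH G g))"
      by (simp add: ofAhat_def)
    then show "Amult G (y \<boxtimes> dotH G h) (1 \<boxtimes> dotH G g) \<in> ?E"
      using dotH_in_Hhat mu_tensor_in_Ahat by blast
  qed
  have expand: "y \<boxtimes> dotH G h = sw h (\<lambda>h1 h2. Amult G (y \<boxtimes> dotH G h1) (1 \<boxtimes> dotH G h2))" for y h
  proof -
    have "sw h (\<lambda>h1 h2. Amult G (y \<boxtimes> dotH G h1) (1 \<boxtimes> dotH G h2))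
        = sw h (\<lambda>h1 x. sw x (\<lambda>p q. (\<phi> (S' p * h1) *\<^sub>C y) \<boxtimes> dotH G q))"
      by (simp add: Amult_gen cw_one lin)
    also have "\<dots> = sw h (\<lambda>x q. sw x (\<lambda>h1 p. (\<phi> (S' p * h1) *\<^sub>C y) \<boxtimes> dotH G q))"
      by (rule sw_assoc[symmetric]; intro lin)
    also have "\<dots> = y \<boxtimes> dotH G h"
      by (simp add: sw_antipode_inv(2)[where F = "\<lambda>x. (\<phi> x *\<^sub>C _) \<boxtimes> _"] lin scaleC_one
          sw_counit(1)[where F = "\<lambda>x. _ \<boxtimes> dotH G x"])
    finally show ?thesis ..
  qed
  show "Ahat G \<subseteq> cspan ?E"
  proof
    fix \<alpha> assume "\<alpha> \<in> Ahat G"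
    then show "\<alpha> \<in> cspan ?E"
    proof (induction \<alpha> rule: Ahat_induct)
      case (gen y h)
      show ?case by (subst expand) (intro tlift_in_subspace sub E)
    qed (rule complex_vector.subspace_add[OF sub])
  qed
qed

section \<open>An anti-automorphism exchanging the two base algebras\<close>

text \<open>The anti-automorphism of \<open>A\<close> that restricts to \<open>t\<^sub>C\<close> on \<open>C\<close>, to \<open>t\<^sub>B\<close> on \<open>B\<close> and to the
  inverse antipode on \<open>H\<close>. It exchanges the two base algebras.\<close>

definition theta :: "('c, 'h) tensor \<Rightarrow> ('c, 'h) tensor" (\<open>\<theta>\<close>) where
  "\<theta> = tlift (\<lambda>z k. ofH (S' k) \<odot> tC G z)"

lemma theta_linear: "clinear \<theta>"
  unfolding theta_def by (intro clinear_tlift lin)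

lemmas theta_lin [lin] = clinear_comp[OF theta_linear]

lemma theta_tensor: "\<theta> (z \<otimes> k) = ofH (S' k) \<odot> tC G z"
  unfolding theta_def by (simp add: tlift_tensor lin)

lemma theta_ofC: "\<theta> (ofC z) = tC G z" and theta_ofH: "\<theta> (ofH k) = ofH (S' k)"
  by (simp_all add: theta_tensor tC_one)

text \<open>The commutation relation of \<open>B\<close> and \<open>H\<close>, solved for the other order.\<close>

lemma tC_ofH_S': "tC G y \<odot> ofH (S' h) = sw h (\<lambda>a b. ofH (S' b) \<odot> tC G (a \<rhd> y))"
proof -
  have "sw h (\<lambda>a b. ofH (S' b) \<odot> tC G (a \<rhd> y)) = sw h (\<lambda>a b. sw b (\<lambda>p q. tC G ((S' p * a) \<rhd> y) \<odot> ofH (S' q)))"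
    by (simp add: ofH_tC sw_S' lin act_mult)
  also have "\<dots> = sw h (\<lambda>x q. sw x (\<lambda>a p. tC G ((S' p * a) \<rhd> y) \<odot> ofH (S' q)))"
    by (rule sw_assoc[symmetric]; intro lin)
  also have "\<dots> = tC G y \<odot> ofH (S' h)"
    by (simp add: sw_antipode_inv(2)[where F = "\<lambda>x. tC G (x \<rhd> y) \<odot> _"] lin
        sw_counit(1)[where F = "\<lambda>x. _ \<odot> ofH (S' x)"])
  finally show ?thesis ..
qed

lemma theta_mult: "\<theta> (a \<odot> b) = \<theta> b \<odot> \<theta> a"
proof (rule tensor_ext[where t = a and f = "\<lambda>a. \<theta> (a \<odot> b)"])
  fix y h
  show "\<theta> ((y \<otimes> h) \<odot> b) = \<theta> b \<odot> \<theta> (y \<otimes> h)"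
  proof (rule tensor_ext[where t = b and f = "\<lambda>b. \<theta> ((y \<otimes> h) \<odot> b)"])
    fix y' h'
    have "\<theta> ((y \<otimes> h) \<odot> (y' \<otimes> h')) = sw h (\<lambda>a b. ofH (S' (b * h')) \<odot> tC G (y * (a \<rhd> y')))"
      by (simp add: amult_tensor tlift_on_push[OF theta_linear] theta_tensor)
    also have "\<dots> = sw h (\<lambda>a b. ofH (S' h') \<odot> ((ofH (S' b) \<odot> tC G (a \<rhd> y')) \<odot> tC G y))"
      by (simp only: S'_mult ofH_mult[symmetric] tC_mult[symmetric] amult_assoc)
    also have "\<dots> = ofH (S' h') \<odot> ((tC G y' \<odot> ofH (S' h)) \<odot> tC G y)"
      unfolding tC_ofH_S' by (simp add: tlift_on_push[where g = "\<lambda>x. ofH (S' h') \<odot> (x \<odot> tC G y)"] lin)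
    also have "\<dots> = \<theta> (y' \<otimes> h') \<odot> \<theta> (y \<otimes> h)"
      by (simp only: theta_tensor amult_assoc)
    finally show "\<theta> ((y \<otimes> h) \<odot> (y' \<otimes> h')) = \<theta> (y' \<otimes> h') \<odot> \<theta> (y \<otimes> h)" .
  qed (intro lin)+
qed (intro lin)+

text \<open>The inverse antipode cancels the second leg of \<open>t\<^sub>C(w)\<close>, which leaves its action on the first.\<close>

lemma theta_tC: "\<theta> (tC G w) = ofC (\<tau> w)"
proof -
  have "\<theta> (tC G w) = cw w (\<lambda>a b. cw a (\<lambda>c d. ofH (S' b) \<odot> (c \<otimes> d)))"
    unfolding tC_def by (simp add: tlift_on_push[OF theta_linear] theta_tensor)
      (simp add: tC_def tlift_on_push[where g = "\<lambda>x. _ \<odot> x"] lin)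
  also have "\<dots> = cw w (\<lambda>a b. cw a (\<lambda>c d. sw b (\<lambda>b1 b2. (S' b2 \<rhd> c) \<otimes> S' b1 * d)))"
    by (simp add: amult_tensor sw_S' lin)
  also have "\<dots> = cw w (\<lambda>c x. sw x (\<lambda>d b. sw b (\<lambda>b1 b2. (S' b2 \<rhd> c) \<otimes> S' b1 * d)))"
    by (rule cw_coassoc; intro lin)
  also have "\<dots> = cw w (\<lambda>c x. sw x (\<lambda>y b2. sw y (\<lambda>d b1. (S' b2 \<rhd> c) \<otimes> S' b1 * d)))"
    by (subst sw_assoc) (intro lin refl)+
  also have "\<dots> = cw w (\<lambda>c x. (S' x \<rhd> c) \<otimes> 1)"
    by (simp add: sw_antipode_inv(2)[where F = "\<lambda>x. _ \<otimes> x"] lin sw_counit(1)[where F = "\<lambda>x. (S' x \<rhd> _) \<otimes> _"])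
  also have "\<dots> = ofC (\<tau> w)"
    unfolding base_modular_def by (simp add: tlift_on_push[where g = "\<lambda>x. x \<otimes> 1"] lin)
  finally show ?thesis .
qed

text \<open>A right inverse of \<open>\<theta>\<close>, chosen so that \<open>h y\<close> is sent to \<open>t\<^sub>C(\<rho>(y)) S(h)\<close>.\<close>

definition theta_inv :: "('c, 'h) tensor \<Rightarrow> ('c, 'h) tensor" where
  "theta_inv = tlift (\<lambda>z k. sw k (\<lambda>a b. tC G (\<rho> (S' a \<rhd> z)) \<odot> ofH (S b)))"

lemma theta_inv_linear: "clinear theta_inv"
  unfolding theta_inv_def by (intro clinear_tlift lin)

lemmas theta_inv_lin [lin] = clinear_comp[OF theta_inv_linear]

lemma theta_theta_inv [simp]: "\<theta> (theta_inv a) = a"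
proof (rule tensor_ext[where t = a and g = "\<lambda>a. a"])
  show "\<theta> (theta_inv (z \<otimes> k)) = z \<otimes> k" for z k
    by (subst (2) tensor_eq_HC)
      (simp add: theta_inv_def tlift_tensor lin tlift_on_push[OF theta_linear] theta_mult theta_tC theta_ofH)
qed (intro lin)+

lemma theta_inv_HC: "theta_inv (ofH h \<odot> ofC y) = tC G (\<rho> y) \<odot> ofH (S h)"
proof -
  have "theta_inv (ofH h \<odot> ofC y) = sw h (\<lambda>p q. sw q (\<lambda>a b. tC G (\<rho> ((S' a * p) \<rhd> y)) \<odot> ofH (S b)))"
    by (simp only: ofH_ofC tlift_on_push[OF theta_inv_linear])
      (simp add: theta_inv_def tlift_tensor lin act_mult)
  also have "\<dots> = sw h (\<lambda>x b. sw x (\<lambda>p a. tC G (\<rho> ((S' a * p) \<rhd> y)) \<odot> ofH (S b)))"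
    by (rule sw_assoc[symmetric]; intro lin)
  also have "\<dots> = tC G (\<rho> y) \<odot> ofH (S h)"
    by (simp add: sw_antipode_inv(2)[where F = "\<lambda>x. tC G (\<rho> (x \<rhd> y)) \<odot> _"] lin
        sw_counit(1)[where F = "\<lambda>x. _ \<odot> ofH (S x)"])
  finally show ?thesis .
qed

subsection \<open>The transposed map on the dual\<close>

definition tstar :: "('c, 'h) tensor dual \<Rightarrow> ('c, 'h) tensor dual" where
  "tstar \<alpha> = Dual (\<lambda>a. dapp \<alpha> (\<theta> a))"

lemma dapp_tstar [simp]: "dapp (tstar \<alpha>) a = dapp \<alpha> (\<theta> a)"
  unfolding tstar_def by (subst dapp_Dual) (intro lin refl)+

lemma tstar_linear: "clinear tstar"
  by (rule clinearI; rule dual_eqI) (simp_all add: plus_dual.rep_eq scaleC_dual.rep_eq)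

lemmas tstar_lin [lin] = clinear_comp[OF tstar_linear]

lemma tstar_inj: "tstar \<alpha> = tstar \<beta> \<Longrightarrow> \<alpha> = \<beta>"
  by (rule dual_eqI) (metis dapp_tstar theta_theta_inv)

text \<open>The counterpart of \<open>mu_act_left\<close> for the coaction: apply invariance to \<open>v w\<^sub>0\<close>, with
  \<open>S\<^sup>-\<^sup>1(w\<^sub>1)\<close> inserted.\<close>

lemma mu_coact_shift:
  assumes "clinear F"
  shows "cw v (\<lambda>c d. \<mu> (c * w) *\<^sub>C F d) = cw w (\<lambda>p q. \<mu> (v * p) *\<^sub>C F (S' q))"
proof -
  note F = assms clinear_comp[OF assms]
  have "cw w (\<lambda>p q. \<mu> (v * p) *\<^sub>C F (S' q)) = cw w (\<lambda>p q. cw (v * p) (\<lambda>a b. \<mu> a *\<^sub>C F (S' q * b)))"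
    by (simp add: mu_coact[where F = "\<lambda>x. F (_ * x)"] lin F)
  also have "\<dots> = cw w (\<lambda>p q. cw p (\<lambda>p0 p1. cw v (\<lambda>c d. \<mu> (c * p0) *\<^sub>C F (S' q * p1 * d))))"
    by (simp add: cw_mult lin F tlift_on_swap[of _ _ _ _ _ _ "coact G v"] mult.assoc)
  also have "\<dots> = cw w (\<lambda>p0 x. sw x (\<lambda>p1 q. cw v (\<lambda>c d. \<mu> (c * p0) *\<^sub>C F (S' q * p1 * d))))"
    by (rule cw_coassoc; intro lin F)
  also have "\<dots> = cw w (\<lambda>p0 x. \<epsilon> x *\<^sub>C cw v (\<lambda>c d. \<mu> (c * p0) *\<^sub>C F d))"
    by (simp add: sw_antipode_inv(2)[where F = "\<lambda>x. cw v (\<lambda>c d. \<mu> (c * _) *\<^sub>C F (x * d))"] lin F)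
  also have "\<dots> = cw v (\<lambda>c d. \<mu> (c * w) *\<^sub>C F d)"
    by (rule cw_counit) (intro lin)
  finally show ?thesis ..
qed

text \<open>The transpose reverses a generator: \<open>t\<^sub>C(y) # u\<close> becomes the product of \<open>u \<circ> S\<^sup>-\<^sup>1\<close> with
  \<open>y \<in> C\<close> on its right. Invariance moves the action and the coaction across \<open>\<mu>\<close>.\<close>

lemma tstar_gen: "represents (tstar (y \<boxtimes> dotH G h)) (sc (\<lambda>m. \<phi> (S' m * h)) \<star> act_map y)"
  unfolding represents_def
proof (intro conjI allI)
  show "clinear (sc (\<lambda>m. \<phi> (S' m * h)) \<star> act_map y)" by (intro conv_linear lin)
  fix v k
  have "\<theta> (v \<otimes> k) = cw v (\<lambda>c d. sw k (\<lambda>k1 k2. (S' k2 \<rhd> c) \<otimes> S' k1 * d))"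
    unfolding theta_tensor tC_def by (simp add: tlift_on_push[where g = "\<lambda>x. _ \<odot> x"] lin amult_tensor sw_S')
  then have "dapp (tstar (y \<boxtimes> dotH G h)) (v \<otimes> k)
      = cw v (\<lambda>c d. sw k (\<lambda>k1 k2. \<mu> (c * (k2 \<rhd> y)) *\<^sub>C \<phi> (S' k1 * d * h)))"
    by (simp add: tlift_on_push[OF clinear_dapp] mu_act_left) (simp add: scaleC_complex_def)
  also have "\<dots> = sw k (\<lambda>k1 k2. cw v (\<lambda>c d. \<mu> (c * (k2 \<rhd> y)) *\<^sub>C \<phi> (S' k1 * d * h)))"
    by (rule tlift_on_swap)
  also have "\<dots> = sw k (\<lambda>k1 k2. cw (k2 \<rhd> y) (\<lambda>p q. \<mu> (v * p) *\<^sub>C \<phi> (S' k1 * S' q * h)))"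
    by (subst mu_coact_shift) (intro lin refl)+
  also have "\<dots> = \<mu> (v * (sc (\<lambda>m. \<phi> (S' m * h)) \<star> act_map y) k)"
    by (simp add: conv_sc_left tlift_on_push[where g = "\<lambda>x. \<mu> (v * x)"] lin S'_mult mult_scaleC_right
        clinear_scaleC[OF mu_linear] act_map_def)
      (simp add: scaleC_complex_def mult.commute)
  finally show "dapp (tstar (y \<boxtimes> dotH G h)) (v \<otimes> k) = \<mu> (v * (sc (\<lambda>m. \<phi> (S' m * h)) \<star> act_map y) k)" .
qed

text \<open>The functional \<open>1 \<boxtimes> \<phi>\<^sub>g\<close> multiplied by \<open>y\<close> from the right in the convolution algebra,
  expressed by generators.\<close>

definition right_gen :: "'c \<Rightarrow> 'h \<Rightarrow> ('c, 'h) tensor dual" where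
  "right_gen y g = cw y (\<lambda>c d. sw (d * g) (\<lambda>m1 m2. (S' m1 \<rhd> c) \<boxtimes> dotH G m2))"

lemma right_gen_in_Ahat [simp]: "right_gen y g \<in> Ahat G"
  unfolding right_gen_def by (intro tlift_in_subspace) simp_all

lemma right_gen_represents: "represents (right_gen y g) (sc (\<lambda>m. \<phi> (m * g)) \<star> act_map y)"
proof -
  have "(sc (\<lambda>m. \<phi> (m * g)) \<star> act_map y) k
      = cw y (\<lambda>c d. sw (d * g) (\<lambda>m1 m2. dapp (dotH G m2) k *\<^sub>C (S' m1 \<rhd> c)))" for k
  proof -
    have "(sc (\<lambda>m. \<phi> (m * g)) \<star> act_map y) k = cw y (\<lambda>c d. sw k (\<lambda>p q. \<phi> (q * (d * g)) *\<^sub>C (p \<rhd> c)))"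
      by (simp add: conv_act_map lin mult_scaleC_right mult.assoc) (rule tlift_on_swap)
    then show ?thesis by (simp add: strong_left_invariance'[where F = "\<lambda>x. x \<rhd> _"] lin)
  qed
  then have "sc (\<lambda>m. \<phi> (m * g)) \<star> act_map y
      = (\<lambda>k. cw y (\<lambda>c d. sw (d * g) (\<lambda>m1 m2. dapp (dotH G m2) k *\<^sub>C (S' m1 \<rhd> c))))"
    by (rule ext)
  then show ?thesis
    unfolding right_gen_def by (simp only:) (intro represents_sum represents_mu_tensor)
qed

text \<open>The modular automorphism absorbs the inverse antipode, so that the transposed generators are
  again of the form \<open>right_gen\<close>.\<close>

lemma phi_S'_left: "\<phi> (S' m * h) = \<phi> (m * modular (S h))"
proof -
  have "\<phi> (S' m * h) = \<phi> (S' (S h * m))" by (simp only: S'_mult S'_S)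
  also have "\<dots> = \<phi> (S h * m)" by (rule phi_S')
  also have "\<dots> = \<phi> (m * modular (S h))" by (rule phi_modular)
  finally show ?thesis .
qed

lemma phi_S'_modular: "\<phi> (S' m * modular (S' g)) = \<phi> (m * g)"
proof -
  have "\<phi> (m * g) = \<phi> (S' (m * g))" by simp
  also have "\<dots> = \<phi> (S' g * S' m)" by (simp only: S'_mult)
  also have "\<dots> = \<phi> (S' m * modular (S' g))" by (rule phi_modular)
  finally show ?thesis ..
qed

lemma tstar_mu_tensor: "tstar (y \<boxtimes> dotH G h) = right_gen y (modular (S h))"
  using tstar_gen[of y h] right_gen_represents[of y "modular (S h)"]
  by (intro represents_inject) (simp_all add: phi_S'_left)

lemma right_gen_eq_tstar: "right_gen y g = tstar (y \<boxtimes> dotH G (modular (S' g)))"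
  using tstar_gen[of y "modular (S' g)"] right_gen_represents[of y g]
  by (intro represents_inject) (simp_all add: phi_S'_modular)

lemma tstar_in_Ahat [simp]: "\<alpha> \<in> Ahat G \<Longrightarrow> tstar \<alpha> \<in> Ahat G"
proof (induction \<alpha> rule: Ahat_induct)
  case (gen y h)
  show ?case by (simp add: tstar_mu_tensor)
next
  case (add \<alpha> \<beta>)
  then show ?case by (simp add: clinear_add[OF tstar_linear] complex_vector.subspace_add)
qed

text \<open>Conversely, every generator is a sum of functionals \<open>right_gen\<close>: the factor \<open>S(u\<^sub>1)\<close> removes
  the coaction, and invariance of \<open>\<phi>\<close> on \<open>k h\<close> removes the action.\<close>

lemma mu_tensor_eq_right_gen:
  "y \<boxtimes> dotH G h = sw h (\<lambda>h1 h2. cw (h1 \<rhd> y) (\<lambda>u0 u1. right_gen u0 (S u1 * h2)))"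
proof (rule represents_inject)
  show "represents (y \<boxtimes> dotH G h) (\<lambda>k. \<phi> (k * h) *\<^sub>C y)"
    using represents_mu_tensor[of y "dotH G h"] by simp
  have "sw h (\<lambda>h1 h2. cw (h1 \<rhd> y) (\<lambda>u0 u1. (sc (\<lambda>m. \<phi> (m * (S u1 * h2))) \<star> act_map u0) k)) = \<phi> (k * h) *\<^sub>C y" for k
  proof -
    have "sw h (\<lambda>h1 h2. cw (h1 \<rhd> y) (\<lambda>u0 u1. (sc (\<lambda>m. \<phi> (m * (S u1 * h2))) \<star> act_map u0) k))
        = sw h (\<lambda>h1 h2. cw (h1 \<rhd> y) (\<lambda>u0 u1. cw u0 (\<lambda>c d. sw k (\<lambda>p q. \<phi> (q * (d * S u1) * h2) *\<^sub>C (p \<rhd> c)))))"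
      by (simp add: conv_act_map lin mult_scaleC_right mult.assoc tlift_on_swap[of _ _ _ _ _ _ "Delta G k"])
    also have "\<dots> = sw h (\<lambda>h1 h2. cw (h1 \<rhd> y) (\<lambda>c x. sw x (\<lambda>d u1. sw k (\<lambda>p q. \<phi> (q * (d * S u1) * h2) *\<^sub>C (p \<rhd> c)))))"
      by (subst cw_coassoc) (intro lin refl)+
    also have "\<dots> = sw h (\<lambda>h1 h2. sw k (\<lambda>p q. \<phi> (q * h2) *\<^sub>C (p \<rhd> h1 \<rhd> y)))"
      by (simp add: sw_antipode(2)[where F = "\<lambda>x. sw k (\<lambda>p q. \<phi> (q * x * _) *\<^sub>C (p \<rhd> _))"] lin
          cw_counit[where F = "\<lambda>c. sw k (\<lambda>p q. \<phi> (q * _) *\<^sub>C (p \<rhd> c))"])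
    also have "\<dots> = sw k (\<lambda>p q. sw h (\<lambda>h1 h2. \<phi> (q * h2) *\<^sub>C ((p * h1) \<rhd> y)))"
      by (subst tlift_on_swap) (simp add: act_mult)
    also have "\<dots> = sw (k * h) (\<lambda>a b. \<phi> b *\<^sub>C (a \<rhd> y))"
      by (subst sw_mult) (intro lin refl)+
    also have "\<dots> = \<phi> (k * h) *\<^sub>C y"
      by (simp add: sw_integral(1)[where F = "\<lambda>a. a \<rhd> y"] lin)
    finally show ?thesis .
  qed
  then show "represents (sw h (\<lambda>h1 h2. cw (h1 \<rhd> y) (\<lambda>u0 u1. right_gen u0 (S u1 * h2)))) (\<lambda>k. \<phi> (k * h) *\<^sub>C y)"
    using represents_sum[OF represents_sum[OF right_gen_represents], of UNIV UNIV "\<lambda>h1 h2. UNIV" "\<lambda>h1 h2. UNIV"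
        "\<lambda>h1 h2 u0 u1. u0" "\<lambda>h1 h2 u0 u1. S u1 * h2" "\<lambda>h1 h2. coact G (h1 \<rhd> y)" "Delta G h"]
    by simp
qed

lemma tstar_surj:
  assumes "\<beta> \<in> Ahat G" shows "\<exists>\<alpha>\<in>Ahat G. tstar \<alpha> = \<beta>"
proof -
  have sub: "complex_vector.subspace (tstar ` Ahat G)"
    by (rule linear_subspace_image[OF tstar_linear subspace_Ahat])
  have "\<beta> \<in> tstar ` Ahat G" using assms
  proof (induction \<beta> rule: Ahat_induct)
    case (gen y h)
    have "right_gen u g \<in> tstar ` Ahat G" for u g by (simp add: right_gen_eq_tstar)
    then show ?case by (subst mu_tensor_eq_right_gen) (intro tlift_in_subspace sub)
  qed (rule complex_vector.subspace_add[OF sub])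
  then show ?thesis by blast
qed

text \<open>The exchange relation between \<open>C\<close> and functionals on \<open>H\<close>, solved for the other order.\<close>

lemma act_map_sc_exchange:
  "(act_map y \<star> sc (\<lambda>m. \<phi> (S' m * g))) k = cw y (\<lambda>c d. (sc (\<lambda>m. \<phi> (d * S' m * g)) \<star> act_map c) k)"
proof -
  have "cw y (\<lambda>c d. (sc (\<lambda>m. \<phi> (d * S' m * g)) \<star> act_map c) k)
      = cw y (\<lambda>c d. cw c (\<lambda>z w. sw k (\<lambda>a b. \<phi> (d * S' w * S' b * g) *\<^sub>C (a \<rhd> z))))"
    by (simp add: conv_act_map lin mult_scaleC_right mult.assoc S'_mult tlift_on_swap[of _ _ _ _ _ _ "Delta G k"])
  also have "\<dots> = cw y (\<lambda>z x. sw x (\<lambda>w d. sw k (\<lambda>a b. \<phi> (d * S' w * S' b * g) *\<^sub>C (a \<rhd> z))))"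
    by (rule cw_coassoc; intro lin)
  also have "\<dots> = sw k (\<lambda>a b. \<phi> (S' b * g) *\<^sub>C (a \<rhd> y))"
    by (simp add: sw_antipode_inv(1)[where F = "\<lambda>x. sw k (\<lambda>a b. \<phi> (x * S' b * g) *\<^sub>C (a \<rhd> _))"] lin
        cw_counit[where F = "\<lambda>z. sw k (\<lambda>a b. \<phi> (S' b * g) *\<^sub>C (a \<rhd> z))"])
  also have "\<dots> = (act_map y \<star> sc (\<lambda>m. \<phi> (S' m * g))) k"
    by (simp add: act_map_conv mult_scaleC_right)
  finally show ?thesis ..
qed

text \<open>On generators both sides are products of two functionals on \<open>H\<close> and two elements of \<open>C\<close>. The
  exchange relation brings the functionals to the left, where strong invariance computes their
  product as in \<open>Amult_gen\<close>.\<close>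

lemma tstar_Amult:
  assumes "\<alpha> \<in> Ahat G" "\<beta> \<in> Ahat G"
  shows "tstar (Amult G \<alpha> \<beta>) = Amult G (tstar \<beta>) (tstar \<alpha>)"
  using assms(1)
proof (induction \<alpha> rule: Ahat_induct)
  case (gen x g)
  show ?case using assms(2)
  proof (induction \<beta> rule: Ahat_induct)
    case (gen y h)
    let ?f = "\<lambda>m. \<phi> (S' m * h)" and ?e = "\<lambda>d m. \<phi> (d * S' m * g)"
    have lf: "clinear (sc ?f)" and le: "clinear (sc (?e d))" for d by (intro lin)+
    have "(sc ?f \<star> act_map y) \<star> (sc (\<lambda>m. \<phi> (S' m * g)) \<star> act_map x)
        = sc ?f \<star> ((act_map y \<star> sc (\<lambda>m. \<phi> (S' m * g))) \<star> act_map x)"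
      by (simp add: conv_assoc lin conv_linear)
    also have "act_map y \<star> sc (\<lambda>m. \<phi> (S' m * g)) = (\<lambda>k. cw y (\<lambda>c d. (sc (?e d) \<star> act_map c) k))"
      by (rule ext) (rule act_map_sc_exchange)
    also have "sc ?f \<star> ((\<lambda>k. cw y (\<lambda>c d. (sc (?e d) \<star> act_map c) k)) \<star> act_map x)
        = (\<lambda>k. cw y (\<lambda>c d. ((sc ?f \<star> sc (?e d)) \<star> act_map (c * x)) k))"
    proof
      fix k
      have "(\<lambda>k. cw y (\<lambda>c d. (sc (?e d) \<star> act_map c) k)) \<star> act_map x
          = (\<lambda>k. cw y (\<lambda>c d. (sc (?e d) \<star> act_map (c * x)) k))"
        by (rule ext) (simp add: conv_sum_left conv_assoc le lin act_map_mult)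
      then show "(sc ?f \<star> ((\<lambda>k. cw y (\<lambda>c d. (sc (?e d) \<star> act_map c) k)) \<star> act_map x)) k
          = cw y (\<lambda>c d. ((sc ?f \<star> sc (?e d)) \<star> act_map (c * x)) k)"
        by (simp add: conv_sum_right lf conv_assoc le lin)
    qed
    also have "\<dots> = (\<lambda>k. sw h (\<lambda>p q. cw y (\<lambda>c d. \<phi> (d * S' p * g) *\<^sub>C (sc (\<lambda>m. \<phi> (S' m * q)) \<star> act_map (c * x)) k)))"
    proof
      fix k
      have *: "sc ?f \<star> sc (?e d) = sc (\<lambda>m. sw h (\<lambda>p q. \<phi> (d * S' p * g) * \<phi> (S' m * q)))" for d
      proof -
        have "sw m (\<lambda>a b. \<phi> (S' a * h) * \<phi> (d * S' b * g)) = sw h (\<lambda>p q. \<phi> (d * S' p * g) * \<phi> (S' m * q))" for m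
        proof -
          have "sw m (\<lambda>a b. \<phi> (S' a * h) * \<phi> (d * S' b * g)) = sw (S' m) (\<lambda>a b. \<phi> (b * h) *\<^sub>C \<phi> (d * a * g))"
            by (subst sw_S') (intro lin | simp add: scaleC_complex_def)+
          also have "\<dots> = sw h (\<lambda>p q. \<phi> (S' m * q) *\<^sub>C \<phi> (d * S' p * g))"
            by (rule strong_left_invariance') (intro lin)
          finally show ?thesis by (simp add: scaleC_complex_def mult.commute)
        qed
        then show ?thesis by (subst conv_sc_sc) (intro lin | simp)+
      qed
      have "(sc (\<lambda>m. sw h (\<lambda>p q. \<phi> (d * S' p * g) * \<phi> (S' m * q))) \<star> act_map z) k
          = sw h (\<lambda>p q. \<phi> (d * S' p * g) *\<^sub>C (sc (\<lambda>m. \<phi> (S' m * q)) \<star> act_map z) k)" for d z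
      proof -
        have "sc (\<lambda>m. sw h (\<lambda>p q. \<phi> (d * S' p * g) * \<phi> (S' m * q)))
            = (\<lambda>m. sw h (\<lambda>p q. \<phi> (d * S' p * g) *\<^sub>C sc (\<lambda>m. \<phi> (S' m * q)) m))"
          by (rule ext) (simp add: tlift_on_push[where g = "\<lambda>c. c *\<^sub>C _"] lin scaleC_scaleC)
        moreover have "((\<lambda>m. s *\<^sub>C F m) \<star> L) k = s *\<^sub>C (F \<star> L) k" for s F L
          by (simp add: conv_def mult_scaleC_right tlift_on_scale)
        ultimately show ?thesis by (simp only: conv_sum_left)
      qed
      then show "cw y (\<lambda>c d. ((sc ?f \<star> sc (?e d)) \<star> act_map (c * x)) k)
          = sw h (\<lambda>p q. cw y (\<lambda>c d. \<phi> (d * S' p * g) *\<^sub>C (sc (\<lambda>m. \<phi> (S' m * q)) \<star> act_map (c * x)) k))"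
        by (simp add: *) (rule tlift_on_swap)
    qed
    finally have part_eq: "(sc ?f \<star> act_map y) \<star> (sc (\<lambda>m. \<phi> (S' m * g)) \<star> act_map x) = \<dots>" .
    have "represents (sw h (\<lambda>p q. cw y (\<lambda>c d. \<phi> (d * S' p * g) *\<^sub>C tstar ((c * x) \<boxtimes> dotH G q))))
        (\<lambda>k. sw h (\<lambda>p q. cw y (\<lambda>c d. \<phi> (d * S' p * g) *\<^sub>C (sc (\<lambda>m. \<phi> (S' m * q)) \<star> act_map (c * x)) k)))"
      by (intro represents_sum represents_scale tstar_gen)
    moreover have "tstar (Amult G (x \<boxtimes> dotH G g) (y \<boxtimes> dotH G h))
        = sw h (\<lambda>p q. cw y (\<lambda>c d. \<phi> (d * S' p * g) *\<^sub>C tstar ((c * x) \<boxtimes> dotH G q)))"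
      by (simp add: Amult_gen tlift_on_push[OF tstar_linear] clinear_scaleC[OF tstar_linear]
          clinear_scaleC[OF mu_tensor_lin(1)[OF clinear_ident]])
    ultimately show ?case
      using represents_Amult[OF tstar_gen[of y h] tstar_gen[of x g]]
      by (intro represents_inject) (simp_all add: part_eq)
  next
    case (add \<beta> \<gamma>)
    then show ?case by (simp add: Amult_add clinear_add[OF tstar_linear])
  qed
next
  case (add \<alpha> \<gamma>)
  then show ?case using assms(2) by (simp add: Amult_add clinear_add[OF tstar_linear])
qed

section \<open>The right comultiplication of the dual\<close>

text \<open>Since \<open>\<theta>\<close> is anti-multiplicative, the transpose turns right multiplication by \<open>C\<close> into left
  multiplication by \<open>B\<close>.\<close>

lemma embC_right:
  assumes "\<alpha> \<in> Ahat G"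
  shows "tstar (mright \<alpha> (embC G y)) = mleft (embB G (tC G (\<rho> y))) (tstar \<alpha>)" "mright \<alpha> (embC G y) \<in> Ahat G"
proof -
  have "clinear (\<lambda>a. dapp \<alpha> (a \<odot> tC G y))" "clinear (\<lambda>a. dapp (tstar \<alpha>) (ofC y \<odot> a))" by (intro lin)+
  then show *: "tstar (mright \<alpha> (embC G y)) = mleft (embB G (tC G (\<rho> y))) (tstar \<alpha>)"
    using assms by (intro dual_eqI) (simp add: embC_def embB_def dapp_Dual theta_mult theta_ofC)
  obtain \<beta> where "\<beta> \<in> Ahat G" "tstar \<beta> = mleft (embB G (tC G (\<rho> y))) (tstar \<alpha>)"
    using tstar_surj[OF embB_left_in_Ahat[OF tstar_in_Ahat[OF assms]]] by blast
  then show "mright \<alpha> (embC G y) \<in> Ahat G" using * tstar_inj by metis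
qed

lemma embB_right:
  assumes "\<alpha> \<in> Ahat G"
  shows "tstar (mright \<alpha> (embB G (tC G y))) = mleft (embC G y) (tstar \<alpha>)" "mright \<alpha> (embB G (tC G y)) \<in> Ahat G"
proof -
  have "clinear (\<lambda>a. dapp \<alpha> (tC G y \<odot> a))" "clinear (\<lambda>a. dapp (tstar \<alpha>) (a \<odot> ofC y))" by (intro lin)+
  then show *: "tstar (mright \<alpha> (embB G (tC G y))) = mleft (embC G y) (tstar \<alpha>)"
    using assms by (intro dual_eqI) (simp add: embC_def embB_def dapp_Dual theta_mult theta_ofC)
  obtain \<beta> where "\<beta> \<in> Ahat G" "tstar \<beta> = mleft (embC G y) (tstar \<alpha>)"
    using tstar_surj[OF embC_left_in_Ahat[OF tstar_in_Ahat[OF assms]]] by blast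
  then show "mright \<alpha> (embB G (tC G y)) \<in> Ahat G" using * tstar_inj by metis
qed

text \<open>The transpose on both legs, combined with the flip: as the transpose is anti-multiplicative,
  the flip turns tensors balanced over \<open>C\<close> into tensors balanced over \<open>B\<close>.\<close>

definition flip_star :: "(('c, 'h) tensor dual, ('c, 'h) tensor dual) tensor \<Rightarrow>
    (('c, 'h) tensor dual, ('c, 'h) tensor dual) tensor" where
  "flip_star = tlift (\<lambda>\<alpha> \<beta>. tstar \<beta> \<otimes> tstar \<alpha>)"

lemma flip_star_linear: "clinear flip_star"
  unfolding flip_star_def by (intro clinear_tlift lin)

lemma flip_star_tensor [simp]: "flip_star (\<alpha> \<otimes> \<beta>) = tstar \<beta> \<otimes> tstar \<alpha>"
  unfolding flip_star_def by (simp add: tlift_tensor lin)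

lemma flip_star_inj: "flip_star s = flip_star t \<Longrightarrow> s = t"
proof -
  \<comment> \<open>the transpose of \<open>theta_inv\<close>, a left inverse of \<open>tstar\<close>\<close>
  define u where "u \<alpha> = Dual (\<lambda>a. dapp \<alpha> (theta_inv a))" for \<alpha> :: "('c, 'h) tensor dual"
  have dapp_u: "dapp (u \<alpha>) a = dapp \<alpha> (theta_inv a)" for \<alpha> a
    unfolding u_def by (subst dapp_Dual) (intro lin refl)+
  have u: "clinear u"
    by (rule clinearI; rule dual_eqI) (simp_all add: dapp_u plus_dual.rep_eq scaleC_dual.rep_eq)
  have u_tstar: "u (tstar \<alpha>) = \<alpha>" for \<alpha>
    by (rule dual_eqI) (simp add: dapp_u)
  let ?g = "tlift (\<lambda>\<alpha> \<beta>. u \<beta> \<otimes> u \<alpha>)"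
  have g: "clinear ?g" by (intro clinear_tlift lin clinear_comp[OF u])
  have "?g (flip_star t) = t" for t
  proof (rule tensor_ext[where t = t and g = "\<lambda>t. t"])
    show "clinear (\<lambda>t. ?g (flip_star t))" by (rule clinear_comp[OF g flip_star_linear])
    show "?g (flip_star (\<alpha> \<otimes> \<beta>)) = \<alpha> \<otimes> \<beta>" for \<alpha> \<beta>
      by (simp add: tlift_tensor lin clinear_comp[OF u] u_tstar)
  qed (intro lin)
  then show "flip_star s = flip_star t \<Longrightarrow> s = t" by metis
qed

lemma flip_star_AA: "t \<in> AA G \<Longrightarrow> flip_star t \<in> AA G"
proof -
  assume "t \<in> AA G"
  then show ?thesis using subspace_Ahat
    by (induction t rule: tsub_induct)
      (simp_all add: clinear_0[OF flip_star_linear] clinear_add[OF flip_star_linear]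
        complex_vector.subspace_0 complex_vector.subspace_add)
qed

lemma flip_star_surj: "s \<in> AA G \<Longrightarrow> \<exists>t\<in>AA G. flip_star t = s"
proof -
  assume s: "s \<in> AA G"
  have sub: "complex_vector.subspace (flip_star ` AA G)"
    by (rule linear_subspace_image[OF flip_star_linear subspace_tsub])
  have "s \<in> flip_star ` AA G" using s subspace_Ahat
  proof (induction s rule: tsub_induct)
    case zero
    show ?case by (rule complex_vector.subspace_0[OF sub])
  next
    case (tensor \<alpha> \<beta>)
    obtain \<alpha>' \<beta>' where "\<alpha>' \<in> Ahat G" "tstar \<alpha>' = \<alpha>" "\<beta>' \<in> Ahat G" "tstar \<beta>' = \<beta>"
      using tensor tstar_surj by metis
    then have "\<alpha> \<otimes> \<beta> = flip_star (\<beta>' \<otimes> \<alpha>')" "\<beta>' \<otimes> \<alpha>' \<in> AA G" by simp_all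
    then show ?case by blast
  next
    case (add s t)
    then show ?case by (intro complex_vector.subspace_add[OF sub])
  qed
  then show ?thesis by blast
qed

lemma flip_star_rel_gen:
  assumes "\<alpha> \<in> Ahat G" "\<beta> \<in> Ahat G"
  shows "flip_star (mright \<alpha> (embC G y) \<otimes> \<beta> - \<alpha> \<otimes> mright \<beta> (embB G (tB_inv G y)))
    = - (mleft (embC G (\<rho> y)) (tstar \<beta>) \<otimes> tstar \<alpha> - tstar \<beta> \<otimes> mleft (embB G (tC G (\<rho> y))) (tstar \<alpha>))"
  by (simp add: clinear_minus[OF flip_star_linear] embC_right embB_right assms)

lemma flip_star_relC: "flip_star ` relC G = relB G"
proof
  let ?EC = "{mright u (embC G d) \<otimes> v - u \<otimes> mright v (embB G (tB_inv G d)) |u v d. u \<in> Ahat G \<and> v \<in> Ahat G \<and> d \<in> UNIV}"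
  let ?EB = "{mleft (embC G (tC_inv G d)) u \<otimes> v - u \<otimes> mleft (embB G d) v |u v d. u \<in> Ahat G \<and> v \<in> Ahat G \<and> d \<in> Balg G}"
  have relC: "relC G = cspan ?EC" by (simp only: relC_def balancing_def)
  have relB: "relB G = cspan ?EB" by (simp only: relB_def balancing_def)
  have gen: "mleft (embC G y) \<beta> \<otimes> \<alpha> - \<beta> \<otimes> mleft (embB G (tC G y)) \<alpha> \<in> relB G" if "\<alpha> \<in> Ahat G" "\<beta> \<in> Ahat G" for \<alpha> \<beta> y
  proof -
    have "mleft (embC G (tC_inv G (tC G y))) \<beta> \<otimes> \<alpha> - \<beta> \<otimes> mleft (embB G (tC G y)) \<alpha> \<in> ?EB"
      using that tC_in_Balg by blast
    then show ?thesis unfolding relB by (simp add: complex_vector.span_base)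
  qed
  have subB: "complex_vector.subspace {t. flip_star t \<in> relB G}"
    unfolding complex_vector.subspace_def
    by (simp add: clinear_0[OF flip_star_linear] clinear_add[OF flip_star_linear] clinear_scaleC[OF flip_star_linear]
        complex_vector.subspace_0[OF subspace_relB] complex_vector.subspace_add[OF subspace_relB]
        complex_vector.subspace_scale[OF subspace_relB])
  have "?EC \<subseteq> {t. flip_star t \<in> relB G}"
    by (clarify, subst flip_star_rel_gen, assumption, assumption)
      (intro complex_vector.subspace_neg[OF subspace_relB] gen tstar_in_Ahat)
  then show "flip_star ` relC G \<subseteq> relB G"
    unfolding relC using complex_vector.span_minimal[OF _ subB] by blast
  have subC: "complex_vector.subspace (flip_star ` relC G)"
    unfolding relC by (intro linear_subspace_image[OF flip_star_linear] complex_vector.subspace_span)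
  have "?EB \<subseteq> flip_star ` relC G"
  proof clarify
    fix u v d assume u: "u \<in> Ahat G" and v: "v \<in> Ahat G" and d: "d \<in> Balg G"
    obtain y where y: "d = tC G y" using d by (rule BalgE)
    obtain \<alpha> \<beta> where \<alpha>: "\<alpha> \<in> Ahat G" "tstar \<alpha> = v" and \<beta>: "\<beta> \<in> Ahat G" "tstar \<beta> = u"
      using u v tstar_surj by metis
    let ?r = "mright \<alpha> (embC G (\<tau> y)) \<otimes> \<beta> - \<alpha> \<otimes> mright \<beta> (embB G (tB_inv G (\<tau> y)))"
    have "?r \<in> relC G" unfolding relC by (rule complex_vector.span_base) (use \<alpha> \<beta> in blast)
    then have "flip_star ?r \<in> flip_star ` relC G" by blast
    then have "- flip_star ?r \<in> flip_star ` relC G" by (rule complex_vector.subspace_neg[OF subC])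
    moreover have "- flip_star ?r = mleft (embC G (tC_inv G d)) u \<otimes> v - u \<otimes> mleft (embB G d) v"
      by (subst flip_star_rel_gen[OF \<alpha>(1) \<beta>(1)]) (simp add: \<alpha>(2) \<beta>(2) y)
    ultimately show "mleft (embC G (tC_inv G d)) u \<otimes> v - u \<otimes> mleft (embB G d) v \<in> flip_star ` relC G"
      by simp
  qed
  then show "relB G \<subseteq> flip_star ` relC G"
    unfolding relB by (rule complex_vector.span_minimal[OF _ subC])
qed

text \<open>The model of the tensor product balanced over \<open>C\<close> is transported along \<open>flip_star\<close> from the
  one balanced over \<open>B\<close>. The representing map is \<open>rpart\<close>, the one of the transposed functional.\<close>

definition evC :: "(('c, 'h) tensor dual, ('c, 'h) tensor dual) tensor \<Rightarrow> 'h \<times> 'h \<Rightarrow> 'c" where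
  "evC t = evB (flip_star t)"

definition rpart :: "('c, 'h) tensor dual \<Rightarrow> 'h \<Rightarrow> 'c" where
  "rpart \<alpha> = part (tstar \<alpha>)"

lemma rpart_linear: "\<alpha> \<in> Ahat G \<Longrightarrow> clinear (rpart \<alpha>)"
  by (simp add: rpart_def part_linear)

lemma rpart_Amult: "\<alpha> \<in> Ahat G \<Longrightarrow> \<beta> \<in> Ahat G \<Longrightarrow> rpart (Amult G \<alpha> \<beta>) = rpart \<beta> \<star> rpart \<alpha>"
  by (simp add: rpart_def tstar_Amult part_Amult)

lemma evC_tensor: "\<alpha> \<in> Ahat G \<Longrightarrow> \<beta> \<in> Ahat G \<Longrightarrow> evC (\<alpha> \<otimes> \<beta>) (k, l) = (act_map (rpart \<alpha> l) \<star> rpart \<beta>) k"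
  by (simp add: evC_def rpart_def evB_tensor)

lemma evC_model: "dual_comultiplication G (relC G) evC rpart"
proof (intro dual_comultiplication.intro[OF yd_setting_axioms] evaluated_quotient.intro
    dual_comultiplication_axioms.intro)
  show "complex_vector.subspace (AA G)" by simp
  show relC_AA: "relC G \<subseteq> AA G"
  proof
    fix t assume "t \<in> relC G"
    then have "flip_star t \<in> AA G" using flip_star_relC relB_subset by blast
    then show "t \<in> AA G" using flip_star_surj flip_star_inj by metis
  qed
  show "clinear_on (AA G) (\<lambda>t. evC t i)" for i
    unfolding evC_def
    by (rule clinear_onI) (simp_all add: clinear_add[OF flip_star_linear] clinear_scaleC[OF flip_star_linear]
        clinear_on_add[OF evB_linear] clinear_on_scale[OF evB_linear] flip_star_AA)
  show "t \<in> relC G" if "t \<in> AA G" "\<And>i. evC t i = 0" for t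
  proof -
    have "flip_star t \<in> relB G" using that by (intro evB_kernel flip_star_AA) (simp_all add: evC_def)
    then show ?thesis unfolding flip_star_relC[symmetric] using flip_star_inj by blast
  qed
  show "evC t i = 0" if "t \<in> relC G" for t i
    using that flip_star_relC relB_subset unfolding evC_def by blast
  show "clinear (rpart \<upsilon>)" if "\<upsilon> \<in> Ahat G" for \<upsilon> using that by (rule rpart_linear)
  show "clinear (\<lambda>m. evC t (m, b))" if "t \<in> AA G" for t b
    using evB_bilinear'[OF flip_star_AA[OF that]] by (simp add: evC_def)
  show "clinear (\<lambda>b. evC t (m, b))" if "t \<in> AA G" for t m
    using evB_bilinear'[OF flip_star_AA[OF that]] by (simp add: evC_def)
  show "\<exists>s\<in>AA G. evC s = coprod_op (rpart \<upsilon>) (evC t)" if "\<upsilon> \<in> Ahat G" "t \<in> AA G" for \<upsilon> t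
    using evB_coprod_exists[OF tstar_in_Ahat[OF that(1)] flip_star_AA[OF that(2)]] flip_star_surj
    unfolding evC_def rpart_def by metis
  let ?EC = "{s \<in> AA G. \<exists>\<omega>\<in>Ahat G. \<exists>t\<in>AA G. evC s = coprod_op (rpart \<omega>) (evC t)}"
  let ?EB = "{s \<in> AA G. \<exists>\<omega>\<in>Ahat G. \<exists>t\<in>AA G. evB s = coprod_op (part \<omega>) (evB t)}"
  have "?EB \<subseteq> flip_star ` ?EC"
  proof clarify
    fix s \<omega> t assume s: "s \<in> AA G" and \<omega>: "\<omega> \<in> Ahat G" and t: "t \<in> AA G" and eq: "evB s = coprod_op (part \<omega>) (evB t)"
    obtain s' where s': "s' \<in> AA G" "flip_star s' = s" using flip_star_surj[OF s] by blast
    obtain t' where t': "t' \<in> AA G" "flip_star t' = t" using flip_star_surj[OF t] by blast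
    obtain \<omega>' where \<omega>': "\<omega>' \<in> Ahat G" "tstar \<omega>' = \<omega>" using tstar_surj[OF \<omega>] by blast
    have "evC s' = coprod_op (rpart \<omega>') (evC t')"
      using eq by (simp add: evC_def rpart_def s' t' \<omega>')
    then have "s' \<in> ?EC" using s' t' \<omega>' by blast
    then show "s \<in> flip_star ` ?EC" using s'(2) by blast
  qed
  moreover have "complex_vector.subspace (flip_star ` cspan ?EC)"
    by (intro linear_subspace_image[OF flip_star_linear] complex_vector.subspace_span)
  moreover have "flip_star ` ?EC \<subseteq> flip_star ` cspan ?EC"
    by (intro image_mono complex_vector.span_superset)
  ultimately have span: "cspan ?EB \<subseteq> flip_star ` cspan ?EC"
    by (intro complex_vector.span_minimal) auto
  show "AA G \<subseteq> cspan ?EC"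
  proof
    fix t assume "t \<in> AA G"
    then have "flip_star t \<in> flip_star ` cspan ?EC" using span evB_coprod_span flip_star_AA by blast
    then show "t \<in> cspan ?EC" using flip_star_inj by blast
  qed
qed

interpretation C: dual_comultiplication G "relC G" evC rpart
  by (rule evC_model)

subsection \<open>The partial integrals with values in B\<close>

text \<open>The transpose turns the \<open>C\<close>-valued partial integrals into partial integrals over \<open>B\<close>.\<close>

lemma left_C_part_theta:
  assumes "\<upsilon> \<in> Ahat G"
  shows "\<mu> (v * left_C_part G (tstar \<upsilon>) a) = dapp \<upsilon> (\<theta> a \<odot> tC G v)"
proof -
  have r: "represents (tstar \<upsilon>) (rpart \<upsilon>)" unfolding rpart_def by (intro Ahat_represents tstar_in_Ahat assms)
  have "dapp (tstar \<upsilon>) (ofC v \<odot> a) = \<mu> (v * left_C_part G (tstar \<upsilon>) a)"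
  proof (rule tensor_ext[where t = a])
    show "dapp (tstar \<upsilon>) (ofC v \<odot> (z \<otimes> k)) = \<mu> (v * left_C_part G (tstar \<upsilon>) (z \<otimes> k))" for z k
      by (simp add: left_C_part_tensor[OF r] amult_ofC_left represents_dapp[OF r] mult.assoc del: dapp_tstar)
  qed (intro lin clinear_comp[OF left_C_part_linear[OF r]])+
  then show ?thesis by (simp add: theta_mult theta_ofC)
qed

text \<open>Since \<open>t\<^sub>C\<close> reverses products, \<open>B\<close>-linearity on the left puts \<open>c\<close> to the right of the value,
  whereas representing maps have their value on the right. The modular automorphisms \<open>\<rho>\<close> and \<open>\<tau>\<close>
  move the factors around cyclically.\<close>

lemma left_B_part_exists:
  assumes "\<omega> \<in> Ahat G"
  shows "\<exists>g. clinear g \<and> (\<forall>b c. \<mu> (g b * c) = dapp \<omega> (tC G c \<odot> b))"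
proof -
  have r: "represents (tstar \<omega>) (rpart \<omega>)" unfolding rpart_def by (intro Ahat_represents tstar_in_Ahat assms)
  note F = clinear_comp[OF rpart_linear[OF assms]]
  \<comment> \<open>the solution of \<open>\<mu>(g(z # k) c) = \<kappa>((z # k) c)\<close> for the transposed functional \<open>\<kappa>\<close>\<close>
  define g where "g = tlift (\<lambda>z k. \<tau> (sw k (\<lambda>a b. S a \<rhd> (rpart \<omega> b * \<rho> z))))"
  have g: "clinear g" unfolding g_def by (intro clinear_tlift lin F)
  have "\<mu> (g b' * c) = dapp (tstar \<omega>) (b' \<odot> ofC c)" for b' c
  proof (rule tensor_ext[where t = b'])
    fix z k
    have "dapp (tstar \<omega>) ((z \<otimes> k) \<odot> ofC c) = sw k (\<lambda>a b. \<mu> (z * ((a \<rhd> c) * rpart \<omega> b)))"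
      by (simp add: amult_ofC_right tlift_on_push[OF clinear_dapp] represents_dapp[OF r] mult.assoc del: dapp_tstar)
    also have "\<dots> = sw k (\<lambda>a b. \<mu> (c * (S a \<rhd> (rpart \<omega> b * \<rho> z))))"
    proof (rule tlift_on_same)
      show "\<mu> (z * ((a \<rhd> c) * rpart \<omega> b)) = \<mu> (c * (S a \<rhd> (rpart \<omega> b * \<rho> z)))" for a b
        using mu_rho[of "(a \<rhd> c) * rpart \<omega> b" z] by (simp add: mult.assoc mu_act_left)
    qed
    also have "\<dots> = \<mu> (g (z \<otimes> k) * c)"
      by (simp add: g_def tlift_tensor lin F mu_tau tlift_on_push[where g = "\<lambda>x. \<mu> (c * x)"])
    finally show "\<mu> (g (z \<otimes> k) * c) = dapp (tstar \<omega>) ((z \<otimes> k) \<odot> ofC c)" ..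
  qed (intro lin clinear_comp[OF g])+
  then have "\<mu> (g (theta_inv b) * c) = dapp \<omega> (tC G c \<odot> b)" for b c
    by (simp add: theta_mult theta_ofC)
  moreover have "clinear (\<lambda>b. g (theta_inv b))" by (rule clinear_comp[OF g theta_inv_linear])
  ultimately show ?thesis by blast
qed

lemma left_B_part_eq:
  assumes g: "clinear g" "\<And>b c. \<mu> (g b * c) = dapp \<omega> (tC G c \<odot> b)"
  shows "left_B_part G \<omega> = (\<lambda>b. tC G (g b))"
  unfolding left_B_part_def
proof (rule the_equality)
  have "g (tC G c \<odot> a) = g a * c" for c a
    by (rule mu_separates_left) (simp add: g(2) amult_assoc[symmetric] tC_mult mult.assoc)
  then have "tC G (g (x \<odot> a)) = x \<odot> tC G (g a)" if "x \<in> Balg G" for x a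
    using that by (auto elim!: BalgE simp: tC_mult)
  moreover have "\<mu> (g a) = dapp \<omega> a" for a using g(2)[of a 1] by (simp add: tC_one)
  moreover have "clinear (\<lambda>b. tC G (g b))" by (rule clinear_comp[OF tC_linear g(1)])
  ultimately show "clinear (\<lambda>b. tC G (g b)) \<and> range (\<lambda>b. tC G (g b)) \<subseteq> Balg G \<and>
      (\<forall>x\<in>Balg G. \<forall>a. tC G (g (x \<odot> a)) = x \<odot> tC G (g a)) \<and> (\<forall>a. muB G (tC G (g a)) = dapp \<omega> a)"
    by auto
  fix f
  assume f: "clinear f \<and> range f \<subseteq> Balg G \<and> (\<forall>x\<in>Balg G. \<forall>a. f (x \<odot> a) = x \<odot> f a) \<and> (\<forall>a. muB G (f a) = dapp \<omega> a)"
  show "f = (\<lambda>b. tC G (g b))"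
  proof
    fix b
    obtain y where y: "f b = tC G y" using f by (metis BalgE rangeI subsetD)
    have "y = g b"
    proof (rule mu_separates_left)
      fix c
      have "\<mu> (y * c) = muB G (f (tC G c \<odot> b))" using f by (simp add: y tC_mult)
      also have "\<dots> = dapp \<omega> (tC G c \<odot> b)" using f by blast
      finally show "\<mu> (y * c) = \<mu> (g b * c)" by (simp only: g(2))
    qed
    then show "f b = tC G (g b)" by (simp add: y)
  qed
qed

lemma right_B_part_eq:
  assumes "\<upsilon> \<in> Ahat G"
  shows "right_B_part G \<upsilon> = (\<lambda>a. tC G (left_C_part G (tstar \<upsilon>) (theta_inv a)))"
  unfolding right_B_part_def
proof (rule the_equality)
  let ?g = "\<lambda>a. left_C_part G (tstar \<upsilon>) (theta_inv a)"
  have r: "represents (tstar \<upsilon>) (rpart \<upsilon>)" unfolding rpart_def by (intro Ahat_represents tstar_in_Ahat assms)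
  have g: "\<mu> (c * ?g a) = dapp \<upsilon> (a \<odot> tC G c)" for a c
    by (simp add: left_C_part_theta[OF assms])
  have g_lin: "clinear ?g" by (rule clinear_comp[OF left_C_part_linear[OF r] theta_inv_linear])
  have "?g (a \<odot> tC G c) = c * ?g a" for c a
    by (rule mu_separates_right) (simp add: g amult_assoc tC_mult mult.assoc[symmetric])
  then have "tC G (?g (a \<odot> x)) = tC G (?g a) \<odot> x" if "x \<in> Balg G" for x a
    using that by (auto elim!: BalgE simp: tC_mult)
  moreover have "\<mu> (?g a) = dapp \<upsilon> a" for a using g[of 1 a] by (simp add: tC_one)
  moreover have "clinear (\<lambda>b. tC G (?g b))" by (rule clinear_comp[OF tC_linear g_lin])
  ultimately show "clinear (\<lambda>b. tC G (?g b)) \<and> range (\<lambda>b. tC G (?g b)) \<subseteq> Balg G \<and>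
      (\<forall>x\<in>Balg G. \<forall>a. tC G (?g (a \<odot> x)) = tC G (?g a) \<odot> x) \<and> (\<forall>a. muB G (tC G (?g a)) = dapp \<upsilon> a)"
    by auto
  fix f
  assume f: "clinear f \<and> range f \<subseteq> Balg G \<and> (\<forall>x\<in>Balg G. \<forall>a. f (a \<odot> x) = f a \<odot> x) \<and> (\<forall>a. muB G (f a) = dapp \<upsilon> a)"
  show "f = (\<lambda>b. tC G (?g b))"
  proof
    fix b
    obtain y where y: "f b = tC G y" using f by (metis BalgE rangeI subsetD)
    have "y = ?g b"
    proof (rule mu_separates_right)
      fix c
      have "\<mu> (c * y) = muB G (f (b \<odot> tC G c))" using f by (simp add: y tC_mult)
      also have "\<dots> = dapp \<upsilon> (b \<odot> tC G c)" using f by blast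
      finally show "\<mu> (c * y) = \<mu> (c * ?g b)" by (simp only: g)
    qed
    then show "f b = tC G (?g b)" by (simp add: y)
  qed
qed

text \<open>The right comultiplication is prescribed on products \<open>h y\<close>. A bilinear map with these values
  is obtained by rewriting \<open>z # k\<close> as in \<open>tensor_eq_HC\<close>.\<close>

lemma DeltaB_bilinear: "cbilinear (DeltaB G)"
  and DeltaB_HC: "DeltaB G (a \<otimes> a') (ofH h \<odot> ofC y) = sw h (\<lambda>p q. (a \<odot> ofH p) \<odot> ofC y \<otimes> a' \<odot> ofH q)"
proof -
  define D where "D t = tlift (\<lambda>z k. sw k (\<lambda>k1 x. sw x (\<lambda>k2 k3. tlift (\<lambda>a a'.
      (a \<odot> ofH k2) \<odot> ofC (S' k1 \<rhd> z) \<otimes> a' \<odot> ofH k3) t)))" for t :: "(('c, 'h) tensor, ('c, 'h) tensor) tensor"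
  have D: "cbilinear D"
    unfolding D_def by (intro lin)
  have D_HC: "D (a \<otimes> a') (ofH h \<odot> ofC y) = sw h (\<lambda>p q. (a \<odot> ofH p) \<odot> ofC y \<otimes> a' \<odot> ofH q)" for a a' h y
  proof -
    have "D (a \<otimes> a') (ofH h \<odot> ofC y)
        = sw h (\<lambda>p q. sw q (\<lambda>k1 x. sw x (\<lambda>k2 k3. (a \<odot> ofH k2) \<odot> ofC ((S' k1 * p) \<rhd> y) \<otimes> a' \<odot> ofH k3)))"
      by (simp only: ofH_ofC tlift_on_push[OF cbilinearD(1)[OF D]])
        (simp add: D_def tlift_tensor lin act_mult)
    also have "\<dots> = sw h (\<lambda>u x. sw u (\<lambda>p k1. sw x (\<lambda>k2 k3. (a \<odot> ofH k2) \<odot> ofC ((S' k1 * p) \<rhd> y) \<otimes> a' \<odot> ofH k3)))"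
      by (rule sw_assoc[symmetric]; intro lin)
    also have "\<dots> = sw h (\<lambda>p q. (a \<odot> ofH p) \<odot> ofC y \<otimes> a' \<odot> ofH q)"
      by (simp add: sw_antipode_inv(2)[where F = "\<lambda>x. sw _ (\<lambda>k2 k3. (_ \<odot> ofH k2) \<odot> ofC (x \<rhd> y) \<otimes> _ \<odot> ofH k3)"] lin
          sw_counit(1)[where F = "\<lambda>x. sw x (\<lambda>k2 k3. (_ \<odot> ofH k2) \<odot> ofC y \<otimes> _ \<odot> ofH k3)"])
    finally show ?thesis .
  qed
  have "DeltaB G = D"
    unfolding DeltaB_def
  proof (rule the_equality)
    show "cbilinear D \<and> (\<forall>a a' h y. D (a \<otimes> a') (ofH h \<odot> ofC y)
        = sw h (\<lambda>p q. (a \<odot> ofH p) \<odot> ofC y \<otimes> a' \<odot> ofH q))"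
      using D D_HC by blast
    fix E assume E: "cbilinear E \<and> (\<forall>a a' h y. E (a \<otimes> a') (ofH h \<odot> ofC y)
        = sw h (\<lambda>p q. (a \<odot> ofH p) \<odot> ofC y \<otimes> a' \<odot> ofH q))"
    have E': "cbilinear E" using E by blast
    have "E t b = D t b" for t b
    proof (rule tensor_ext[where t = t, OF cbilinearD(2)[OF E'] cbilinearD(2)[OF D]])
      show "E (a \<otimes> a') b = D (a \<otimes> a') b" for a a'
        by (rule tensor_ext_HC[OF cbilinearD(1)[OF E'] cbilinearD(1)[OF D]]) (use E D_HC in simp)
    qed
    then show "E = D" by (intro ext)
  qed
  then show "cbilinear (DeltaB G)"
    "DeltaB G (a \<otimes> a') (ofH h \<odot> ofC y) = sw h (\<lambda>p q. (a \<odot> ofH p) \<odot> ofC y \<otimes> a' \<odot> ofH q)"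
    by (simp_all add: D D_HC)
qed

text \<open>On \<open>h y\<close> both sides become \<open>h\<^sub>2 \<tau>(w\<^sub>0 F(w\<^sub>1 S(h\<^sub>1)))\<close> with \<open>w = \<rho>(y)\<close> and \<open>F = rpart \<upsilon>\<close>: the
  element \<open>h y\<close> is the image of \<open>t\<^sub>C(w) S(h)\<close> under \<open>\<theta>\<close>, and the antipode exchanges the legs of \<open>h\<close>.\<close>

lemma rconv_eq:
  assumes "\<upsilon> \<in> Ahat G"
  shows "rconv G a \<upsilon> = \<theta> (lconv G (tstar \<upsilon>) (theta_inv a))"
proof -
  have r: "represents (tstar \<upsilon>) (rpart \<upsilon>)" unfolding rpart_def by (intro Ahat_represents tstar_in_Ahat assms)
  note F = clinear_comp[OF rpart_linear[OF assms]]
  note l = clinear_comp[OF left_C_part_linear[OF r]]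
  have R: "cbilinear (\<lambda>b b'. b' \<odot> ofC (tB G (right_B_part G \<upsilon> b)))"
    unfolding right_B_part_eq[OF assms] tB_tC by (intro lin l)
  show ?thesis
  proof (rule tensor_ext_HC[where a = a])
    show "clinear (\<lambda>a. rconv G a \<upsilon>)"
      unfolding rconv_def by (intro clinear_tlift_arg R cbilinearD(1)[OF DeltaB_bilinear])
    show "clinear (\<lambda>a. \<theta> (lconv G (tstar \<upsilon>) (theta_inv a)))"
      by (intro lin clinear_comp[OF lconv_linear[OF r]])
    fix h y
    define w where "w = \<rho> y"
    have lC: "left_C_part G (tstar \<upsilon>) (tC G w \<odot> ofH m) = cw w (\<lambda>z v. z * rpart \<upsilon> (v * m))" for m
      by (simp add: tC_ofH tlift_on_push[OF left_C_part_linear[OF r]] left_C_part_tensor[OF r])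
    have "rconv G (ofH h \<odot> ofC y) \<upsilon>
        = sw h (\<lambda>p q. ofH q \<odot> ofC (\<tau> (left_C_part G (tstar \<upsilon>) (theta_inv (ofH p \<odot> ofC y)))))"
      unfolding rconv_def DeltaB_HC
      by (subst tlift_on_push[OF clinear_tlift[OF R]], subst tlift_tensor[OF R])
        (simp only: right_B_part_eq[OF assms] tB_tC amult_one_left)
    also have "\<dots> = sw h (\<lambda>p q. ofH q \<odot> ofC (\<tau> (cw w (\<lambda>z v. z * rpart \<upsilon> (v * S p)))))"
      by (simp only: theta_inv_HC w_def[symmetric] lC)
    finally have lhs: "rconv G (ofH h \<odot> ofC y) \<upsilon> = \<dots>" .
    have "lconv G (tstar \<upsilon>) (tC G w \<odot> ofH k)
        = cw w (\<lambda>z v. sw k (\<lambda>k1 k2. tC G (rpart \<upsilon> (v * k2)) \<odot> (tC G z \<odot> ofH k1)))" for k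
    proof -
      have "lconv G (tstar \<upsilon>) (tC G w \<odot> ofH k)
          = cw w (\<lambda>z x. sw (x * k) (\<lambda>a b. tC G (rpart \<upsilon> b) \<odot> (z \<otimes> a)))"
        by (simp add: tC_ofH tlift_on_push[OF lconv_linear[OF r]] lconv_tensor[OF r])
      also have "\<dots> = cw w (\<lambda>z x. sw x (\<lambda>u v. sw k (\<lambda>k1 k2. tC G (rpart \<upsilon> (v * k2)) \<odot> (z \<otimes> u * k1))))"
        by (subst sw_mult) (intro lin F refl)+
      also have "\<dots> = cw w (\<lambda>z v. cw z (\<lambda>c u. sw k (\<lambda>k1 k2. tC G (rpart \<upsilon> (v * k2)) \<odot> (c \<otimes> u * k1))))"
        by (rule cw_coassoc[symmetric]; intro lin F)
      also have "\<dots> = cw w (\<lambda>z v. sw k (\<lambda>k1 k2. tC G (rpart \<upsilon> (v * k2)) \<odot> (tC G z \<odot> ofH k1)))"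
        by (simp add: tC_ofH tlift_on_push[where g = "\<lambda>x. _ \<odot> x"] lin)
          (simp add: tlift_on_swap[of _ _ _ _ _ _ "Delta G k"])
      finally show ?thesis .
    qed
    then have "\<theta> (lconv G (tstar \<upsilon>) (theta_inv (ofH h \<odot> ofC y)))
        = cw w (\<lambda>z v. sw h (\<lambda>p q. \<theta> (tC G (rpart \<upsilon> (v * S p)) \<odot> (tC G z \<odot> ofH (S q)))))"
      by (simp add: theta_inv_HC w_def[symmetric] tlift_on_push[OF theta_linear] sw_S lin F)
    also have "\<dots> = cw w (\<lambda>z v. sw h (\<lambda>p q. ofH q \<odot> ofC (\<tau> (z * rpart \<upsilon> (v * S p)))))"
      by (simp add: theta_mult theta_tC theta_ofH amult_assoc ofC_mult tau_mult)
    also have "\<dots> = sw h (\<lambda>p q. ofH q \<odot> ofC (\<tau> (cw w (\<lambda>z v. z * rpart \<upsilon> (v * S p)))))"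
      by (subst tlift_on_swap) (simp add: tlift_on_push[where g = "\<lambda>x. _ \<odot> ofC (\<tau> x)"] lin)
    finally show "rconv G (ofH h \<odot> ofC y) \<upsilon> = \<theta> (lconv G (tstar \<upsilon>) (theta_inv (ofH h \<odot> ofC y)))"
      by (simp add: lhs)
  qed
qed

abbreviation pairing :: "(('c, 'h) tensor dual, ('c, 'h) tensor dual) tensor \<Rightarrow>
    ('c, 'h) tensor \<Rightarrow> ('c, 'h) tensor \<Rightarrow> complex" where
  "pairing t a b \<equiv> tlift_on (Ahat G) (Ahat G) (\<lambda>\<alpha> \<beta>. dapp \<alpha> (a \<odot> ofC (left_C_part G \<beta> b))) t"

text \<open>On an elementary tensor both sides are \<open>\<mu>\<close> of the product of the two partial integrals.\<close>

lemma pairing_flip_star: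
  assumes t: "t \<in> AA G"
  shows "tlift_on (Ahat G) (Ahat G) (\<lambda>\<upsilon> \<omega>. dapp \<upsilon> (a \<odot> left_B_part G \<omega> b)) t
    = pairing (flip_star t) (theta_inv b) (theta_inv a)"
proof -
  let ?q = "tlift_on (Ahat G) (Ahat G)
      (\<lambda>\<upsilon> \<omega>. dapp (tstar \<omega>) (theta_inv b \<odot> ofC (left_C_part G (tstar \<upsilon>) (theta_inv a))))"
  have "dapp \<upsilon> (a \<odot> left_B_part G \<omega> b)
      = dapp (tstar \<omega>) (theta_inv b \<odot> ofC (left_C_part G (tstar \<upsilon>) (theta_inv a)))"
    if v: "\<upsilon> \<in> Ahat G" "\<omega> \<in> Ahat G" for \<upsilon> \<omega>
  proof -
    obtain g where g: "clinear g" "\<And>b c. \<mu> (g b * c) = dapp \<omega> (tC G c \<odot> b)"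
      using left_B_part_exists[OF v(2)] by blast
    have "dapp \<upsilon> (a \<odot> left_B_part G \<omega> b) = \<mu> (g b * left_C_part G (tstar \<upsilon>) (theta_inv a))"
      by (simp add: left_B_part_eq[OF g] left_C_part_theta[OF v(1)])
    then show ?thesis by (simp add: g(2) theta_mult theta_ofC)
  qed
  then have "tlift_on (Ahat G) (Ahat G) (\<lambda>\<upsilon> \<omega>. dapp \<upsilon> (a \<odot> left_B_part G \<omega> b)) t = ?q t"
    by (rule tlift_on_cong[OF subspace_Ahat t])
  also have "?q t = pairing (flip_star t) (theta_inv b) (theta_inv a)"
  proof -
    have bil: "clinear_on (Ahat G) (\<lambda>\<upsilon>. dapp (tstar \<omega>) (theta_inv b \<odot> ofC (left_C_part G (tstar \<upsilon>) (theta_inv a))))"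
      "clinear_on (Ahat G) (\<lambda>\<omega>. dapp (tstar \<omega>) (theta_inv b \<odot> ofC (left_C_part G (tstar \<upsilon>) (theta_inv a))))" for \<upsilon> \<omega>
      by (rule clinear_onI; simp only: clinear_add[OF tstar_linear] clinear_scaleC[OF tstar_linear] tstar_in_Ahat
          clinear_on_add[OF pairB_bilinear(2)] clinear_on_scale[OF pairB_bilinear(2)]
          clinear_on_add[OF pairB_bilinear(1)] clinear_on_scale[OF pairB_bilinear(1)])+
    have q: "clinear_on (AA G) ?q" by (intro tlift_on_linear subspace_Ahat bil)
    have p: "clinear_on (AA G) (\<lambda>t. pairing t (theta_inv b) (theta_inv a))"
      by (intro tlift_on_linear subspace_Ahat pairB_bilinear)
    show ?thesis using t subspace_Ahat
    proof (induction t rule: tsub_induct)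
      case zero
      show ?case by (simp only: clinear_on_zero[OF q subspace_tsub] clinear_0[OF flip_star_linear] clinear_on_zero[OF p subspace_tsub])
    next
      case (tensor \<alpha> \<beta>)
      have "?q (\<alpha> \<otimes> \<beta>) = dapp (tstar \<beta>) (theta_inv b \<odot> ofC (left_C_part G (tstar \<alpha>) (theta_inv a)))"
        by (rule tlift_on_tensor[OF subspace_Ahat subspace_Ahat bil tensor])
      also have "\<dots> = pairing (tstar \<beta> \<otimes> tstar \<alpha>) (theta_inv b) (theta_inv a)"
        by (rule tlift_on_tensor[symmetric, OF subspace_Ahat subspace_Ahat pairB_bilinear tstar_in_Ahat tstar_in_Ahat])
          (rule tensor)+
      finally show ?case by simp
    next
      case (add s t)
      then show ?case
        by (simp only: clinear_on_add[OF q] clinear_add[OF flip_star_linear] clinear_on_add[OF p] flip_star_AA)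
    qed
  qed
  finally show ?thesis .
qed

text \<open>By construction \<open>theta_inv\<close> is a right inverse of \<open>\<theta>\<close> only; the pairing factors through \<open>\<theta>\<close>,
  so that it cannot distinguish the composite in the other order from the identity.\<close>

lemma pairing_theta_inv:
  assumes "t \<in> AA G"
  shows "pairing t (theta_inv (\<theta> a)) (theta_inv (\<theta> b)) = pairing t a b"
proof (rule tlift_on_cong[OF subspace_Ahat assms])
  fix \<alpha> \<beta> assume \<alpha>: "\<alpha> \<in> Ahat G" and \<beta>: "\<beta> \<in> Ahat G"
  obtain \<upsilon> where \<upsilon>: "\<upsilon> \<in> Ahat G" "tstar \<upsilon> = \<beta>" using tstar_surj[OF \<beta>] by blast
  obtain \<omega> where \<omega>: "\<omega> \<in> Ahat G" "tstar \<omega> = \<alpha>" using tstar_surj[OF \<alpha>] by blast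
  have "left_C_part G \<beta> (theta_inv (\<theta> b)) = left_C_part G \<beta> b"
    by (rule mu_separates_right) (simp add: \<upsilon>(2)[symmetric] left_C_part_theta[OF \<upsilon>(1)])
  then show "dapp \<alpha> (theta_inv (\<theta> a) \<odot> ofC (left_C_part G \<beta> (theta_inv (\<theta> b)))) = dapp \<alpha> (a \<odot> ofC (left_C_part G \<beta> b))"
    by (simp add: \<omega>(2)[symmetric] theta_mult)
qed

lemma DhatC1_eq:
  assumes v: "\<upsilon> \<in> Ahat G" "\<omega> \<in> Ahat G" and t: "t \<in> AA G" and ev: "evC t = one_coprod (rpart \<omega>) (rpart \<upsilon>)"
  shows "DhatC1 G \<upsilon> \<omega> = coset (relC G) t"
  unfolding DhatC1_def
proof (rule the_equality)
  note rep = C.coset_rep[OF t]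
  have value_t: "pairC G (coset (relC G) t) a b = dapp \<omega> (rconv G a \<upsilon> \<odot> b)" for a b
  proof -
    have "pairC G (coset (relC G) t) a b
        = pairing (flip_star (coset_rep (coset (relC G) t))) (theta_inv b) (theta_inv a)"
      unfolding pairC_def by (rule pairing_flip_star[OF rep(1)])
    also have "\<dots> = dapp (tstar \<omega>) (theta_inv b \<odot> lconv G (tstar \<upsilon>) (theta_inv a))"
      by (rule pairing_value) (simp_all add: v flip_star_AA rep(1) evC_def[symmetric] rep(2) ev rpart_def)
    finally show ?thesis by (simp add: theta_mult rconv_eq[OF v(1)])
  qed
  then show "coset (relC G) t \<in> quot (AA G) (relC G) \<and>
      (\<forall>a b. pairC G (coset (relC G) t) a b = dapp \<omega> (rconv G a \<upsilon> \<odot> b))"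
    using t by (simp add: quot_def)
  fix X
  assume X: "X \<in> quot (AA G) (relC G) \<and> (\<forall>a b. pairC G X a b = dapp \<omega> (rconv G a \<upsilon> \<odot> b))"
  then obtain s where s: "s \<in> AA G" "X = coset (relC G) s" by (auto simp: quot_def)
  note rep_s = C.coset_rep[OF s(1)]
  have "evB (flip_star (coset_rep (coset (relC G) s))) = evB (flip_star (coset_rep (coset (relC G) t)))"
  proof (rule pairing_separates)
    fix a b
    have "pairC G (coset (relC G) s) (\<theta> b) (\<theta> a) = pairC G (coset (relC G) t) (\<theta> b) (\<theta> a)"
      using X by (simp add: s(2) value_t)
    then show "pairing (flip_star (coset_rep (coset (relC G) s))) a b = pairing (flip_star (coset_rep (coset (relC G) t))) a b"
      unfolding pairC_def by (simp only: pairing_flip_star rep(1) rep_s(1) pairing_theta_inv flip_star_AA)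
  qed (simp_all add: flip_star_AA rep(1) rep_s(1))
  then have "evC s = evC t" by (simp add: evC_def[symmetric] rep(2) rep_s(2))
  then show "X = coset (relC G) t"
    using s t by (simp add: C.coset_eq_iff_ev)
qed

lemma DhatC1_rep:
  assumes "\<upsilon> \<in> Ahat G" "\<omega> \<in> Ahat G"
  shows "coset_rep (DhatC1 G \<upsilon> \<omega>) \<in> AA G" "evC (coset_rep (DhatC1 G \<upsilon> \<omega>)) = one_coprod (rpart \<omega>) (rpart \<upsilon>)"
proof -
  obtain s where s: "s \<in> AA G" "evB s = one_coprod (part (tstar \<omega>)) (part (tstar \<upsilon>))"
    using one_coprod_exists[OF tstar_in_Ahat tstar_in_Ahat] assms by blast
  obtain t where "t \<in> AA G" "flip_star t = s" using flip_star_surj[OF s(1)] by blast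
  then have t: "t \<in> AA G" "evC t = one_coprod (rpart \<omega>) (rpart \<upsilon>)"
    using s by (simp_all add: evC_def rpart_def)
  then show "coset_rep (DhatC1 G \<upsilon> \<omega>) \<in> AA G" "evC (coset_rep (DhatC1 G \<upsilon> \<omega>)) = one_coprod (rpart \<omega>) (rpart \<upsilon>)"
    by (simp_all add: DhatC1_eq[OF assms t] C.coset_rep)
qed

lemma flip_star_left_mult:
  assumes r: "r \<in> AA G" and \<beta>: "\<beta> \<in> Ahat G"
  shows "tlift_on (Ahat G) (Ahat G) (\<lambda>\<kappa> \<nu>. \<kappa> \<otimes> Amult G \<beta> \<nu>) r \<in> AA G \<and>
    flip_star (tlift_on (Ahat G) (Ahat G) (\<lambda>\<kappa> \<nu>. \<kappa> \<otimes> Amult G \<beta> \<nu>) r)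
      = tlift_on (Ahat G) (Ahat G) (\<lambda>\<kappa> \<nu>. Amult G \<kappa> (tstar \<beta>) \<otimes> \<nu>) (flip_star r)"
proof -
  let ?m = "tlift_on (Ahat G) (Ahat G) (\<lambda>\<kappa> \<nu>. \<kappa> \<otimes> Amult G \<beta> \<nu>)"
  let ?n = "tlift_on (Ahat G) (Ahat G) (\<lambda>\<kappa> \<nu>. Amult G \<kappa> (tstar \<beta>) \<otimes> \<nu>)"
  have bil: "clinear_on (Ahat G) (\<lambda>\<kappa>. \<kappa> \<otimes> Amult G \<beta> \<nu>)" "clinear_on (Ahat G) (\<lambda>\<nu>. \<kappa> \<otimes> Amult G \<beta> \<nu>)"
    "clinear_on (Ahat G) (\<lambda>\<kappa>. Amult G \<kappa> (tstar \<beta>) \<otimes> \<nu>)" "clinear_on (Ahat G) (\<lambda>\<nu>. Amult G \<kappa> (tstar \<beta>) \<otimes> \<nu>)" for \<kappa> \<nu>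
    by (rule clinear_onI; simp add: Amult_add Amult_scale \<beta> tensor_op_add_left tensor_op_scaleC_left
        tensor_op_add_right tensor_op_scaleC_right)+
  have m: "clinear_on (AA G) ?m" and n: "clinear_on (AA G) ?n" by (intro tlift_on_linear subspace_Ahat bil)+
  show ?thesis
    using r subspace_Ahat
  proof (induction r rule: tsub_induct)
    case zero
    show ?case
      by (simp add: clinear_on_zero[OF m] clinear_on_zero[OF n] complex_vector.subspace_0 clinear_0[OF flip_star_linear])
  next
    case (tensor \<alpha> \<gamma>)
    have "?m (\<alpha> \<otimes> \<gamma>) = \<alpha> \<otimes> Amult G \<beta> \<gamma>"
      by (rule tlift_on_tensor[OF subspace_Ahat subspace_Ahat bil(1,2) tensor])
    moreover have "?n (tstar \<gamma> \<otimes> tstar \<alpha>) = Amult G (tstar \<gamma>) (tstar \<beta>) \<otimes> tstar \<alpha>"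
      by (rule tlift_on_tensor[OF subspace_Ahat subspace_Ahat bil(3,4) tstar_in_Ahat tstar_in_Ahat]) (rule tensor)+
    ultimately show ?case
      using tensor \<beta> by (simp add: tstar_Amult)
  next
    case (add s t)
    then show ?case
      by (simp add: clinear_on_add[OF m] clinear_on_add[OF n] clinear_add[OF flip_star_linear] flip_star_AA
          complex_vector.subspace_add)
  qed
qed

lemma DhatC_realizes:
  assumes "\<omega> \<in> Ahat G"
  shows "C.realizes (DhatC G \<omega>) (coprod_op (rpart \<omega>))"
  unfolding DhatC_def
proof (rule C.comultiplication_realizes[OF assms])
  fix \<alpha> \<beta> assume \<alpha>: "\<alpha> \<in> Ahat G" and \<beta>: "\<beta> \<in> Ahat G"
  note r = DhatC1_rep[OF \<alpha> assms]
  note m = flip_star_left_mult[OF r(1) \<beta>]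
  show "tlift_on (Ahat G) (Ahat G) (\<lambda>\<kappa> \<nu>. \<kappa> \<otimes> Amult G \<beta> \<nu>) (coset_rep (DhatC1 G \<alpha> \<omega>)) \<in> AA G"
    using m by blast
  have "evC (\<alpha> \<otimes> \<beta>) = (\<lambda>(k, l). (act_map (rpart \<alpha> l) \<star> rpart \<beta>) k)"
    by (auto simp: evC_tensor \<alpha> \<beta>)
  moreover have "evC (tlift_on (Ahat G) (Ahat G) (\<lambda>\<kappa> \<nu>. \<kappa> \<otimes> Amult G \<beta> \<nu>) (coset_rep (DhatC1 G \<alpha> \<omega>))) (k, l)
      = ((\<lambda>m. one_coprod (rpart \<omega>) (rpart \<alpha>) (m, l)) \<star> rpart \<beta>) k" for k l
    using evB_right_mult[OF flip_star_AA[OF r(1)] tstar_in_Ahat[OF \<beta>]] conjunct2[OF m] r(2)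
    by (simp add: evC_def rpart_def)
  ultimately show "evC (tlift_on (Ahat G) (Ahat G) (\<lambda>\<kappa> \<nu>. \<kappa> \<otimes> Amult G \<beta> \<nu>) (coset_rep (DhatC1 G \<alpha> \<omega>)))
      = coprod_op (rpart \<omega>) (evC (\<alpha> \<otimes> \<beta>))"
    by (auto simp: one_coprod_conv rpart_linear assms \<alpha> \<beta>)
qed

lemma DhatC_ext_realizes:
  assumes "\<delta> \<in> Ahat G"
  shows "C.realizes (DhatC_ext G (ofAhat G \<delta>)) (coprod_op (rpart \<delta>))"
  unfolding DhatC_ext_def
  by (rule C.extension_realizes[OF DhatC_realizes assms]) (simp_all add: ofAhat_def rpart_Amult assms)

text \<open>On the dual of \<open>H\<close> the transpose is composition with the inverse antipode.\<close>

lemma rpart_one_tensor: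
  assumes "d \<in> Hhat G" shows "rpart (1 \<boxtimes> d) = sc (\<lambda>m. dapp d (S' m))"
proof -
  obtain h where d: "d = dotH G h" using assms by (rule HhatE)
  have "sc (\<lambda>m. \<phi> (S' m * h)) \<star> act_map 1 = sc (\<lambda>m. \<phi> (S' m * h))"
  proof
    fix k
    have "(sc (\<lambda>m. \<phi> (S' m * h)) \<star> act_map 1) k = sw k (\<lambda>a b. \<epsilon> a *\<^sub>C sc (\<lambda>m. \<phi> (S' m * h)) b)"
      by (subst conv_act_map, intro lin)
        (simp add: cw_one lin mult_scaleC_right scaleC_scaleC mult.commute)
    also have "\<dots> = sc (\<lambda>m. \<phi> (S' m * h)) k"
      by (rule sw_counit) (intro lin)
    finally show "(sc (\<lambda>m. \<phi> (S' m * h)) \<star> act_map 1) k = sc (\<lambda>m. \<phi> (S' m * h)) k" .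
  qed
  then show ?thesis
    using part_eq[OF tstar_gen[of 1 h]] by (simp add: rpart_def d)
qed

text \<open>The transposed situation is again \<open>coprod_op_sc\<close>. The inverse antipode reverses the order of
  factors and legs, and hence turns \<open>\<Delta>(d)(d' \<otimes> d'')\<close> into \<open>(d' \<otimes> d'')\<Delta>(d)\<close> with the two legs
  exchanged.\<close>

lemma DhatC_ext_formula:
  assumes d: "d \<in> Hhat G" "d' \<in> Hhat G" "d'' \<in> Hhat G" and \<alpha>: "\<alpha> \<in> Ahat G" and \<beta>: "\<beta> \<in> Ahat G"
  shows "DhatC_ext G (ofAhat G (1 \<boxtimes> d)) (coset (relC G) (Amult G \<alpha> (1 \<boxtimes> d') \<otimes> Amult G \<beta> (1 \<boxtimes> d'')))
    = coset (relC G) (tlift_on (Hhat G) (Hhat G)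
        (\<lambda>e e'. Amult G \<alpha> (1 \<boxtimes> e) \<otimes> Amult G \<beta> (1 \<boxtimes> e')) (DH_right G d' d'' d))"
proof (rule C.realizes_eq[OF DhatC_ext_realizes])
  note D = DH_right_spec[OF d]
  let ?t = "tlift_on (Hhat G) (Hhat G) (\<lambda>e e'. Amult G \<alpha> (1 \<boxtimes> e) \<otimes> Amult G \<beta> (1 \<boxtimes> e')) (DH_right G d' d'' d)"
  let ?s = "\<lambda>e m. dapp e (S' m)"
  show "1 \<boxtimes> d \<in> Ahat G" using d by simp
  show "Amult G \<alpha> (1 \<boxtimes> d') \<otimes> Amult G \<beta> (1 \<boxtimes> d'') \<in> AA G" using d \<alpha> \<beta> by simp
  show t: "?t \<in> AA G" by (rule tlift_on_in_subspace[OF subspace_tsub subspace_Hhat D(1)]) (simp add: \<alpha> \<beta>)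
  show "evC ?t = coprod_op (rpart (1 \<boxtimes> d)) (evC (Amult G \<alpha> (1 \<boxtimes> d') \<otimes> Amult G \<beta> (1 \<boxtimes> d'')))"
  proof (rule ext, clarify)
    fix k l
    have ev: "evC (Amult G \<alpha> (1 \<boxtimes> e) \<otimes> Amult G \<beta> (1 \<boxtimes> e')) (k, l)
        = (act_map ((sc (?s e) \<star> rpart \<alpha>) l) \<star> (sc (?s e') \<star> rpart \<beta>)) k" if "e \<in> Hhat G" "e' \<in> Hhat G" for e e' k l
      using that \<alpha> \<beta> by (simp add: evC_tensor rpart_Amult rpart_one_tensor)
    have "evC ?t (k, l) = tlift_on (Hhat G) (Hhat G) (\<lambda>e e'. evC (Amult G \<alpha> (1 \<boxtimes> e) \<otimes> Amult G \<beta> (1 \<boxtimes> e')) (k, l)) (DH_right G d' d'' d)"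
      by (rule tlift_on_push_on[OF C.ev_lin subspace_tsub subspace_Hhat D(1)]) (simp add: \<alpha> \<beta>)
    also have "\<dots> = tlift_on (Hhat G) (Hhat G)
        (\<lambda>e e'. (act_map ((sc (?s e) \<star> rpart \<alpha>) l) \<star> (sc (?s e') \<star> rpart \<beta>)) k) (DH_right G d' d'' d)"
      by (rule tlift_on_cong[OF subspace_Hhat D(1)]) (rule ev)
    also have "\<dots> = sw l (\<lambda>a b. cw (rpart \<alpha> b) (\<lambda>c w. sw k (\<lambda>p x. sw x (\<lambda>q r. cw (rpart \<beta> r) (\<lambda>u v.
        pairH (DH_right G d' d'' d) (S' (w * a)) (S' (v * q)) *\<^sub>C ((p \<rhd> c) * u))))))"
      by (simp add: act_map_sc_conv tlift_on_swap[of _ _ _ _ _ _ "DH_right G d' d'' d"]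
          pairH_push[OF D(1), symmetric] mult.commute)
    also have "\<dots> = sw l (\<lambda>a b. cw (rpart \<alpha> b) (\<lambda>c w. sw k (\<lambda>p x. sw x (\<lambda>q r. cw (rpart \<beta> r) (\<lambda>u v.
        sw (v * q) (\<lambda>X1 X2. sw (w * a) (\<lambda>Y1 Y2. ?s d (X1 * Y1) * ?s d'' X2 * ?s d' Y2)) *\<^sub>C ((p \<rhd> c) * u))))))"
    proof -
      have "pairH (DH_right G d' d'' d) (S' Y) (S' X) = sw X (\<lambda>X1 X2. sw Y (\<lambda>Y1 Y2. ?s d (X1 * Y1) * ?s d'' X2 * ?s d' Y2))" for X Y
      proof -
        have "pairH (DH_right G d' d'' d) (S' Y) (S' X)
            = sw Y (\<lambda>Y1 Y2. sw X (\<lambda>X1 X2. dapp d' (S' Y2) * dapp d'' (S' X2) * dapp d (S' Y1 * S' X1)))"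
          unfolding D(2) by (subst sw_S'; intro lin | simp add: sw_S' lin)+
        also have "\<dots> = sw X (\<lambda>X1 X2. sw Y (\<lambda>Y1 Y2. dapp d' (S' Y2) * dapp d'' (S' X2) * dapp d (S' Y1 * S' X1)))"
          by (rule tlift_on_swap)
        finally show ?thesis by (simp add: S'_mult ac_simps)
      qed
      then show ?thesis by simp
    qed
    also have "\<dots> = coprod_op (sc (?s d))
        (\<lambda>(k, l). (act_map ((sc (?s d') \<star> rpart \<alpha>) l) \<star> (sc (?s d'') \<star> rpart \<beta>)) k) (k, l)"
      by (rule coprod_op_sc[symmetric]) (intro lin rpart_linear \<alpha> \<beta>)+
    also have "\<dots> = coprod_op (rpart (1 \<boxtimes> d)) (evC (Amult G \<alpha> (1 \<boxtimes> d') \<otimes> Amult G \<beta> (1 \<boxtimes> d''))) (k, l)"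
    proof -
      have "evC (Amult G \<alpha> (1 \<boxtimes> d') \<otimes> Amult G \<beta> (1 \<boxtimes> d''))
          = (\<lambda>(k, l). (act_map ((sc (?s d') \<star> rpart \<alpha>) l) \<star> (sc (?s d'') \<star> rpart \<beta>)) k)"
        using ev[OF d(2,3)] by auto
      then show ?thesis by (simp add: rpart_one_tensor[OF d(1)])
    qed
    finally show "evC ?t (k, l) = coprod_op (rpart (1 \<boxtimes> d)) (evC (Amult G \<alpha> (1 \<boxtimes> d') \<otimes> Amult G \<beta> (1 \<boxtimes> d''))) (k, l)" .
  qed
qed

section \<open>The structure of the dual\<close>

lemma hopf_morphism_dual_H:
  assumes \<pi>: "\<And>d. d \<in> Hhat G \<Longrightarrow> \<pi> d = ofAhat G (1 \<boxtimes> d)"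
  shows "hopf_morphism G \<pi>"
  unfolding hopf_morphism_def
proof (intro conjI ballI)
  show "multiplier_hom G \<pi>"
    using dual_H_multiplier_hom unfolding multiplier_hom_def
    by (simp add: \<pi> Hmult_in_Hhat clinear_on_def complex_vector.subspace_add complex_vector.subspace_scale
        image_subset_iff)
  have "{mleft (\<pi> d) \<alpha> |d \<alpha>. d \<in> Hhat G \<and> \<alpha> \<in> Ahat G} = {mleft (ofAhat G (1 \<boxtimes> d)) \<alpha> |d \<alpha>. d \<in> Hhat G \<and> \<alpha> \<in> Ahat G}"
    by (intro Collect_cong ex_cong1) (auto simp: \<pi>)
  then show "cspan {mleft (\<pi> d) \<alpha> |d \<alpha>. d \<in> Hhat G \<and> \<alpha> \<in> Ahat G} = Ahat G"
    by (simp only: left_span)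
  have "{mright \<alpha> (\<pi> d) |d \<alpha>. d \<in> Hhat G \<and> \<alpha> \<in> Ahat G} = {mright \<alpha> (ofAhat G (1 \<boxtimes> d)) |d \<alpha>. d \<in> Hhat G \<and> \<alpha> \<in> Ahat G}"
    by (intro Collect_cong ex_cong1) (auto simp: \<pi>)
  then show "cspan {mright \<alpha> (\<pi> d) |d \<alpha>. d \<in> Hhat G \<and> \<alpha> \<in> Ahat G} = Ahat G"
    by (simp only: right_span)
  fix d d' d'' \<alpha> \<beta>
  assume d: "d \<in> Hhat G" "d' \<in> Hhat G" "d'' \<in> Hhat G" and \<alpha>: "\<alpha> \<in> Ahat G" and \<beta>: "\<beta> \<in> Ahat G"
  have l: "mleft (\<pi> e) \<gamma> = Amult G (1 \<boxtimes> e) \<gamma>" "mright \<gamma> (\<pi> e) = Amult G \<gamma> (1 \<boxtimes> e)" if "e \<in> Hhat G" "\<gamma> \<in> Ahat G" for e \<gamma>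
    using that by (simp_all add: \<pi> ofAhat_def)
  have "tlift_on (Hhat G) (Hhat G) (\<lambda>e e'. mleft (\<pi> e) \<alpha> \<otimes> mleft (\<pi> e') \<beta>) (DH_left G d d' d'')
      = tlift_on (Hhat G) (Hhat G) (\<lambda>e e'. Amult G (1 \<boxtimes> e) \<alpha> \<otimes> Amult G (1 \<boxtimes> e') \<beta>) (DH_left G d d' d'')"
    by (rule tlift_on_cong[OF subspace_Hhat DH_left_spec(1)[OF d]]) (simp add: l \<alpha> \<beta>)
  then show "DhatB_ext G (\<pi> d) (coset (relB G) (mleft (\<pi> d') \<alpha> \<otimes> mleft (\<pi> d'') \<beta>)) =
      coset (relB G) (tlift_on (Hhat G) (Hhat G) (\<lambda>e e'. mleft (\<pi> e) \<alpha> \<otimes> mleft (\<pi> e') \<beta>) (DH_left G d d' d''))"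
    using DhatB_ext_formula[OF d \<alpha> \<beta>] by (simp add: l d \<alpha> \<beta> \<pi>[OF d(1)])
  have "tlift_on (Hhat G) (Hhat G) (\<lambda>e e'. mright \<alpha> (\<pi> e) \<otimes> mright \<beta> (\<pi> e')) (DH_right G d' d'' d)
      = tlift_on (Hhat G) (Hhat G) (\<lambda>e e'. Amult G \<alpha> (1 \<boxtimes> e) \<otimes> Amult G \<beta> (1 \<boxtimes> e')) (DH_right G d' d'' d)"
    by (rule tlift_on_cong[OF subspace_Hhat DH_right_spec(1)[OF d]]) (simp add: l \<alpha> \<beta>)
  then show "DhatC_ext G (\<pi> d) (coset (relC G) (mright \<alpha> (\<pi> d') \<otimes> mright \<beta> (\<pi> d''))) =
      coset (relC G) (tlift_on (Hhat G) (Hhat G) (\<lambda>e e'. mright \<alpha> (\<pi> e) \<otimes> mright \<beta> (\<pi> e')) (DH_right G d' d'' d))"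
    using DhatC_ext_formula[OF d \<alpha> \<beta>] by (simp add: l d \<alpha> \<beta> \<pi>[OF d(1)])
qed

definition to_smash :: "('c, 'h) tensor dual \<Rightarrow> (('c, 'h) tensor, 'h dual) tensor" where
  "to_smash = inv_into (smash G) of_smash"

lemma to_smash_of_smash: "s \<in> smash G \<Longrightarrow> to_smash (of_smash s) = s"
  unfolding to_smash_def by (rule inv_into_f_f[OF of_smash_inj])

lemma of_smash_to_smash: "\<alpha> \<in> Ahat G \<Longrightarrow> of_smash (to_smash \<alpha>) = \<alpha>"
  and to_smash_in_smash: "\<alpha> \<in> Ahat G \<Longrightarrow> to_smash \<alpha> \<in> smash G"
  unfolding to_smash_def using of_smash_bij
  by (auto simp: bij_betw_def intro: f_inv_into_f inv_into_into)

lemma to_smash_bij: "bij_betw to_smash (Ahat G) (smash G)"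
  unfolding to_smash_def by (rule bij_betw_inv_into[OF of_smash_bij])

lemma inv_to_smash: "s \<in> smash G \<Longrightarrow> inv_into (Ahat G) to_smash s = of_smash s"
  by (rule inv_into_f_eq[OF bij_betw_imp_inj_on[OF to_smash_bij] of_smash_in_Ahat to_smash_of_smash])

lemma smash_tensor: "x \<in> Balg G \<Longrightarrow> u \<in> Hhat G \<Longrightarrow> x \<otimes> u \<in> smash G"
  unfolding smash_def by (rule tensor_in_tsub)

lemma to_smash_iso: "algebra_iso_Ahat_smash G to_smash"
  unfolding algebra_iso_Ahat_smash_def
proof (intro conjI ballI)
  show "bij_betw to_smash (Ahat G) (smash G)" by (rule to_smash_bij)
  have sub: "complex_vector.subspace (smash G)" unfolding smash_def by simp
  show "clinear_on (Ahat G) to_smash"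
  proof (rule clinear_onI)
    fix u v assume u: "u \<in> Ahat G" and v: "v \<in> Ahat G"
    have "to_smash u + to_smash v \<in> smash G"
      by (intro complex_vector.subspace_add[OF sub] to_smash_in_smash u v)
    from to_smash_of_smash[OF this] show "to_smash (u + v) = to_smash u + to_smash v"
      by (simp add: clinear_add[OF of_smash_linear] of_smash_to_smash u v)
  next
    fix c v assume v: "v \<in> Ahat G"
    have "c *\<^sub>C to_smash v \<in> smash G"
      by (intro complex_vector.subspace_scale[OF sub] to_smash_in_smash v)
    from to_smash_of_smash[OF this] show "to_smash (c *\<^sub>C v) = c *\<^sub>C to_smash v"
      by (simp add: clinear_scaleC[OF of_smash_linear] of_smash_to_smash v)
  qed
  fix u v assume u: "u \<in> Ahat G" and v: "v \<in> Ahat G"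
  note s = to_smash_in_smash[OF u] to_smash_in_smash[OF v]
  show "to_smash (Amult G u v) = smash_mult G (to_smash u) (to_smash v)"
    using to_smash_of_smash[OF smash_mult_in_smash[OF s]]
    by (simp add: of_smash_mult[OF s] of_smash_to_smash u v)
qed

lemma embC_left_smash:
  assumes "x \<in> Balg G" "u \<in> Hhat G"
  shows "tlift (\<lambda>z w. amult G x (tC G z) \<otimes> w) (coactM G y u) \<in> smash G"
    "of_smash (tlift (\<lambda>z w. amult G x (tC G z) \<otimes> w) (coactM G y u)) = mleft (embC G y) (of_smash (x \<otimes> u))"
proof -
  obtain c h where x: "x = tC G c" and u: "u = dotH G h" using assms by (metis BalgE HhatE)
  have *: "tlift (\<lambda>z w. amult G x (tC G z) \<otimes> w) (coactM G y u) = sw h (\<lambda>p q. tC G ((S' p \<rhd> y) * c) \<otimes> dotH G q)"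
    by (simp add: u x coactM_dotH tlift_on_push[OF clinear_tlift] tlift_tensor lin tC_mult)
  show "tlift (\<lambda>z w. amult G x (tC G z) \<otimes> w) (coactM G y u) \<in> smash G"
    unfolding * by (intro tlift_in_subspace) (simp_all add: smash_tensor, simp add: smash_def)
  show "of_smash (tlift (\<lambda>z w. amult G x (tC G z) \<otimes> w) (coactM G y u)) = mleft (embC G y) (of_smash (x \<otimes> u))"
    unfolding * by (simp add: tlift_on_push[OF of_smash_linear] x u embC_left_mu_tensor)
qed

end

theorem proposition5p4p1:
  fixes G :: "('h::complex_algebra_1, 'c::complex_algebra_1) yd_data"
  assumes "regular_hopf_algebra (Delta G) (eps G) (antip G)"
    and "normalized_integral (Delta G) (phiH G)"
    and "braided_commutative_yd_algebra G"
    and "clinear (muC G)" and "faithful_functional (muC G)" and "muC G 1 = 1"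
    and "invariant_functional G"
  shows "\<exists>\<Theta>. algebra_iso_Ahat_smash G \<Theta> \<and>
    (\<forall>h y. \<Theta> (dotA G (amult G (ofH h) (ofC y)) (phiA G)) = tC G y \<otimes> dotH G h) \<and>
    (let \<Theta>' = inv_into (Ahat G) \<Theta> in
      (\<forall>x\<in>Balg G. \<forall>x'\<in>Balg G. \<forall>\<upsilon>\<in>Hhat G.
         mleft (embB G x) (\<Theta>' (x' \<otimes> \<upsilon>)) = \<Theta>' (amult G x x' \<otimes> \<upsilon>)) \<and>
      (\<forall>y. \<forall>x\<in>Balg G. \<forall>\<upsilon>\<in>Hhat G.
         mleft (embC G y) (\<Theta>' (x \<otimes> \<upsilon>)) =
           \<Theta>' (tlift (\<lambda>z w. amult G x (tC G z) \<otimes> w) (coactM G y \<upsilon>))) \<and>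
      hopf_morphism G (\<lambda>\<upsilon>. ofAhat G (\<Theta>' (aone \<otimes> \<upsilon>))) \<and>
      (\<forall>z. \<forall>\<upsilon>\<in>Hhat G.
         counitAhat (\<Theta>' (tC G z \<otimes> \<upsilon>)) = muC G z * counitHhat \<upsilon> \<and>
         psiAhat G (\<Theta>' (tC G z \<otimes> \<upsilon>)) = muC G z * psiHhat G \<upsilon>))"
proof -
  interpret yd_setting G
    by (rule yd_setting.intro) (rule assms)+
  have aone_B: "aone \<in> Balg G" using tC_in_Balg[of 1] by (simp only: tC_one)
  show ?thesis
    unfolding Let_def
  proof (intro exI[of _ to_smash] conjI allI ballI)
    show "algebra_iso_Ahat_smash G to_smash" by (rule to_smash_iso)
    show "to_smash (dotA G (amult G (ofH h) (ofC y)) (phiA G)) = tC G y \<otimes> dotH G h" for h y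
      using to_smash_of_smash[OF smash_tensor[OF tC_in_Balg[of y] dotH_in_Hhat[of h]]] by (simp add: dotA_HC)
    show "mleft (embB G x) (inv_into (Ahat G) to_smash (x' \<otimes> \<upsilon>)) = inv_into (Ahat G) to_smash (amult G x x' \<otimes> \<upsilon>)"
      if x: "x \<in> Balg G" "x' \<in> Balg G" and u: "\<upsilon> \<in> Hhat G" for x x' \<upsilon>
    proof -
      obtain y y' where y: "x = tC G y" "x' = tC G y'" using x by (metis BalgE)
      show ?thesis using u by (simp add: y tC_mult inv_to_smash smash_tensor embB_left_mu_tensor)
    qed
    show "mleft (embC G y) (inv_into (Ahat G) to_smash (x \<otimes> \<upsilon>)) =
        inv_into (Ahat G) to_smash (tlift (\<lambda>z w. amult G x (tC G z) \<otimes> w) (coactM G y \<upsilon>))"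
      if "x \<in> Balg G" "\<upsilon> \<in> Hhat G" for x y \<upsilon>
      using that by (simp only: inv_to_smash smash_tensor embC_left_smash)
    show "hopf_morphism G (\<lambda>\<upsilon>. ofAhat G (inv_into (Ahat G) to_smash (aone \<otimes> \<upsilon>)))"
      by (rule hopf_morphism_dual_H) (simp add: inv_to_smash smash_tensor aone_B scaleC_one)
    show "counitAhat (inv_into (Ahat G) to_smash (tC G z \<otimes> \<upsilon>)) = muC G z * counitHhat \<upsilon>"
      if "\<upsilon> \<in> Hhat G" for z \<upsilon>
      using that by (simp add: inv_to_smash smash_tensor counitAhat_mu_tensor)
    show "psiAhat G (inv_into (Ahat G) to_smash (tC G z \<otimes> \<upsilon>)) = muC G z * psiHhat G \<upsilon>"
      if "\<upsilon> \<in> Hhat G" for z \<upsilon>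
      using that by (auto elim!: HhatE simp: inv_to_smash smash_tensor psiAhat_mu_tensor)
  qed
qed

end
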